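(* Let $k$ be a field of characteristic different from $2$, let $H$ be a quasi-Hopf algebra over $k$ with bijective antipode, and let $A$ be a quasi-Hopf algebra with a projection onto $H$, i.e. with quasi-Hopf algebra morphisms $i:H\to A$ and $\pi:A\to H$ such that $\pi i=\mathrm{id}_H$. Assume that $A$ is a free right $H$-module (via $i$) of rank $2$. Then $A$ is isomorphic as a quasi-Hopf algebra either to $H_g$ or to $H(\theta)_{\sigma,v}$ for some couple $(\sigma,v)$, where: (1) $H_g$ is the unital $k$-algebra generated by $g$ and $H$ with relations $g^2=1$ and $gh=hg$ for all $h\in H$; $H$ is a quasi-Hopf subalgebra of $H_g$, and $\Delta(g)=g\otimes g$, $\varepsilon(g)=1$, $S(g)=g$ complete the quasi-Hopf algebra structure (that is, $H_g$ is the tensor product of the quasi-Hopf algebras $k[C_2]$, the group Hopf algebra with trivial reassociator, and $H$); (2) $(\sigma,v)$ consists of an algebra morphism $\sigma:H\to k$ and an element $v\in H$ with $\sigma(v)=-1$, $\varepsilon(v)=1$, $\Delta(v)=\sigma(y^1x^3X^2)\,x^1X^1vy^2\otimes x^2vX^3y^3$, and $\sigma(h_2)h_1v=\sigma(h_1)vh_2$ for all $h\in H$; $H(\theta)_{\sigma,v}$ is the unital $k$-algebra generated by $\theta$ and $H$ with relations $\theta^2=0$ and $h\theta=\sigma(h_1)\theta h_2$ for all $h\in H$; its quasi-Hopf algebra structure is such that $H$ is a quasi-Hopf subalgebra and $$\Delta(\theta)=\sigma(X^2x^1)\,X^1vx^2\otimes\theta X^3x^3+\sigma(x^1)\,\theta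 x^2\otimes x^3,$$ $$S(\theta)=-\sigma(X^2x^1_2)\,S(X^1x^1_1v)\,\alpha\,\theta\,X^3x^2\beta S(x^3).$$
   Context: A quasi-bialgebra is $(H,\Delta,\varepsilon,\Phi)$ with $H$ a unital associative $k$-algebra, $\Phi\in H^{\otimes 3}$ invertible (the reassociator), $\Delta:H\to H\otimes H$ and $\varepsilon:H\to k$ algebra maps such that $(\mathrm{id}\otimes\Delta)\Delta(h)=\Phi\,(\Delta\otimes\mathrm{id})(\Delta(h))\,\Phi^{-1}$, $(\mathrm{id}\otimes\varepsilon)\Delta(h)=h=(\varepsilon\otimes\mathrm{id})\Delta(h)$, $(\mathrm{id}\otimes\varepsilon\otimes\mathrm{id})(\Phi)=1\otimes1$ and $(1\otimes\Phi)(\mathrm{id}\otimes\Delta\otimes\mathrm{id})(\Phi)(\Phi\otimes1)=(\mathrm{id}\otimes\mathrm{id}\otimes\Delta)(\Phi)(\Delta\otimes\mathrm{id}\otimes\mathrm{id})(\Phi)$. Write $\Delta(h)=h_1\otimes h_2$, $\Phi=X^1\otimes X^2\otimes X^3$, $\Phi^{-1}=x^1\otimes x^2\otimes x^3=y^1\otimes y^2\otimes y^3$ (summation understood; different letters denote independent copies; $x^1_1\otimes x^1_2=\Delta(x^1)$). $H$ is a quasi-Hopf algebra if there are an algebra anti-morphism $S:H\to H$ (antipode) and $\alpha,\beta\in H$ with $S(h_1)\alpha h_2=\varepsilon(h)\alpha$, $h_1\beta S(h_2)=\varepsilon(h)\beta$, $X^1\beta S(X^2)\alpha X^3=1$, $S(x^1)\alpha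 x^2\beta S(x^3)=1$. A quasi-Hopf algebra morphism is an algebra map compatible with comultiplications, counits and antipodes and sending reassociator to reassociator and $\alpha,\beta$ to the corresponding elements. In $H_g$ and $H(\theta)_{\sigma,v}$ the reassociator and the elements $\alpha,\beta$ are those of $H$, and $\varepsilon(\theta)=0$. *)

theory Defs
  imports "HOL-Algebra.QuotRing" "HOL-Algebra.Module"
begin

section \<open>Algebras over a field, monoid algebras and quotient algebras\<close>

text \<open>
  The locale \<^locale>\<open>algebra\<close> of HOL-Algebra is restricted to commutative algebras.
  Here an algebra is unital and associative, but not necessarily commutative.
\<close>

locale unital_algebra = field k + module k A + A?: ring A
  for k (structure) and A (structure) +
  assumes smult_mult_left:
      "\<lbrakk>r \<in> carrier k; x \<in> carrier A; y \<in> carrier A\<rbrakk> \<Longrightarrow>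
        (r \<odot>\<^bsub>A\<^esub> x) \<otimes>\<^bsub>A\<^esub> y = r \<odot>\<^bsub>A\<^esub> (x \<otimes>\<^bsub>A\<^esub> y)"
    and smult_mult_right:
      "\<lbrakk>r \<in> carrier k; x \<in> carrier A; y \<in> carrier A\<rbrakk> \<Longrightarrow>
        x \<otimes>\<^bsub>A\<^esub> (r \<odot>\<^bsub>A\<^esub> y) = r \<odot>\<^bsub>A\<^esub> (x \<otimes>\<^bsub>A\<^esub> y)"

definition alg_hom ::
  "('k, 'm) ring_scheme \<Rightarrow> ('k, 'a, 'x) module_scheme \<Rightarrow> ('k, 'b, 'y) module_scheme \<Rightarrow> ('a \<Rightarrow> 'b) set"
  where "alg_hom k A B =
    {f \<in> ring_hom A B. \<forall>r\<in>carrier k. \<forall>x\<in>carrier A. f (r \<odot>\<^bsub>A\<^esub> x) = r \<odot>\<^bsub>B\<^esub> f x}"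

definition alg_char :: "('k, 'm) ring_scheme \<Rightarrow> ('k, 'a, 'x) module_scheme \<Rightarrow> ('a \<Rightarrow> 'k) set"
  where "alg_char k A =
    {f \<in> ring_hom A k. \<forall>r\<in>carrier k. \<forall>x\<in>carrier A. f (r \<odot>\<^bsub>A\<^esub> x) = r \<otimes>\<^bsub>k\<^esub> f x}"

text \<open>The monoid algebra \<open>k[M]\<close>: finitely supported functions with the convolution product.\<close>

definition supp :: "('k, 'm) ring_scheme \<Rightarrow> ('w \<Rightarrow> 'k) \<Rightarrow> 'w set"
  where "supp k p = {w. p w \<noteq> \<zero>\<^bsub>k\<^esub>}"

definition mon_alg ::
  "('k, 'm) ring_scheme \<Rightarrow> ('w, 'n) monoid_scheme \<Rightarrow> ('k, 'w \<Rightarrow> 'k) module"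
  where "mon_alg k M = \<lparr>
    carrier = {p. finite (supp k p) \<and> supp k p \<subseteq> carrier M \<and> range p \<subseteq> carrier k},
    mult = (\<lambda>p q w. \<Oplus>\<^bsub>k\<^esub>u\<in>supp k p. \<Oplus>\<^bsub>k\<^esub>v\<in>supp k q.
      if u \<otimes>\<^bsub>M\<^esub> v = w then p u \<otimes>\<^bsub>k\<^esub> q v else \<zero>\<^bsub>k\<^esub>),
    one = (\<lambda>w. if w = \<one>\<^bsub>M\<^esub> then \<one>\<^bsub>k\<^esub> else \<zero>\<^bsub>k\<^esub>),
    zero = (\<lambda>w. \<zero>\<^bsub>k\<^esub>),
    add = (\<lambda>p q w. p w \<oplus>\<^bsub>k\<^esub> q w),
    smult = (\<lambda>r p w. r \<otimes>\<^bsub>k\<^esub> p w)\<rparr>"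

definition basis :: "('k, 'm) ring_scheme \<Rightarrow> 'w \<Rightarrow> 'w \<Rightarrow> 'k"
  where "basis k u = (\<lambda>w. if w = u then \<one>\<^bsub>k\<^esub> else \<zero>\<^bsub>k\<^esub>)"

definition quot_alg :: "('k, 'a, 'x) module_scheme \<Rightarrow> 'a set \<Rightarrow> ('k, 'a set) module"
  where "quot_alg F I = ring.extend (F Quot I)
    (module.fields (\<lambda>r X. \<Union>x\<in>X. I +>\<^bsub>F\<^esub> (r \<odot>\<^bsub>F\<^esub> x)))"


section \<open>Tensor powers of an algebra\<close>

text \<open>
  Pure tensors in \<open>A\<close> to the power \<open>n\<close> are indexed by lists of length \<open>n\<close>. These lists form a
  monoid under componentwise multiplication, and the tensor power, with its usual algebra
  structure, is the monoid algebra modulo the relations of multilinearity. The ideal generated by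
  these relations is just their linear span, because multiplying a relation by a basis element
  gives another relation of the same kind.
\<close>

definition list_monoid :: "('k, 'a, 'x) module_scheme \<Rightarrow> nat \<Rightarrow> 'a list monoid"
  where "list_monoid A n = \<lparr>
    carrier = {w. length w = n \<and> set w \<subseteq> carrier A},
    mult = (\<lambda>u v. map2 (\<lambda>a b. a \<otimes>\<^bsub>A\<^esub> b) u v),
    one = replicate n \<one>\<^bsub>A\<^esub>\<rparr>"

definition formal_tensors ::
  "('k, 'm) ring_scheme \<Rightarrow> ('k, 'a, 'x) module_scheme \<Rightarrow> nat \<Rightarrow> ('k, 'a list \<Rightarrow> 'k) module"
  where "formal_tensors k A n = mon_alg k (list_monoid A n)"

definition multilinear_rels ::
  "('k, 'm) ring_scheme \<Rightarrow> ('k, 'a, 'x) module_scheme \<Rightarrow> nat \<Rightarrow> ('a list \<Rightarrow> 'k) set"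
  where "multilinear_rels k A n = (let F = formal_tensors k A n in
    {basis k (us @ (a \<oplus>\<^bsub>A\<^esub> b) # vs)
        \<ominus>\<^bsub>F\<^esub> (basis k (us @ a # vs) \<oplus>\<^bsub>F\<^esub> basis k (us @ b # vs)) | us a b vs.
      a \<in> carrier A \<and> b \<in> carrier A \<and> set us \<subseteq> carrier A \<and> set vs \<subseteq> carrier A
      \<and> length us + length vs + 1 = n} \<union>
    {basis k (us @ (r \<odot>\<^bsub>A\<^esub> a) # vs) \<ominus>\<^bsub>F\<^esub> r \<odot>\<^bsub>F\<^esub> basis k (us @ a # vs) | us r a vs.
      r \<in> carrier k \<and> a \<in> carrier A \<and> set us \<subseteq> carrier A \<and> set vs \<subseteq> carrier A
      \<and> length us + length vs + 1 = n})"

definition tensor_ideal ::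
  "('k, 'm) ring_scheme \<Rightarrow> ('k, 'a, 'x) module_scheme \<Rightarrow> nat \<Rightarrow> ('a list \<Rightarrow> 'k) set"
  where "tensor_ideal k A n = Idl\<^bsub>formal_tensors k A n\<^esub> (multilinear_rels k A n)"

definition tpow ::
  "('k, 'm) ring_scheme \<Rightarrow> ('k, 'a, 'x) module_scheme \<Rightarrow> nat \<Rightarrow> ('k, ('a list \<Rightarrow> 'k) set) module"
  where "tpow k A n = quot_alg (formal_tensors k A n) (tensor_ideal k A n)"

text \<open>\<open>tens k A [a\<^sub>1, \<dots>, a\<^sub>n]\<close> is the pure tensor with factors \<open>a\<^sub>1, \<dots>, a\<^sub>n\<close>.\<close>

definition tens ::
  "('k, 'm) ring_scheme \<Rightarrow> ('k, 'a, 'x) module_scheme \<Rightarrow> 'a list \<Rightarrow> ('a list \<Rightarrow> 'k) set"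
  where "tens k A u =
    tensor_ideal k A (length u) +>\<^bsub>formal_tensors k A (length u)\<^esub> basis k u"

text \<open>
  The value at a tensor \<open>t\<close> of the linear map into \<open>V\<close> induced by a multilinear map \<open>f\<close>, computed
  on some representative of \<open>t\<close>. For multilinear \<open>f\<close> it does not depend on the representative.
\<close>

definition tlift ::
  "('k, 'm) ring_scheme \<Rightarrow> ('k, 'v, 'y) module_scheme \<Rightarrow> ('a list \<Rightarrow> 'k) set \<Rightarrow> ('a list \<Rightarrow> 'v) \<Rightarrow> 'v"
  where "tlift k V t f =
    (let p = (SOME p. p \<in> t) in \<Oplus>\<^bsub>V\<^esub>w\<in>supp k p. p w \<odot>\<^bsub>V\<^esub> f w)"

text \<open>
  Sweedler notation: for \<open>t = \<Sum> a \<otimes> b\<close>, \<open>sw2 k V t (\<lambda>a b. f a b)\<close> is the element \<open>\<Sum> f a b\<close> of \<open>V\<close>;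
  similarly \<open>sw3\<close> for three tensor factors.
\<close>

definition sw2 ::
  "('k, 'm) ring_scheme \<Rightarrow> ('k, 'v, 'y) module_scheme \<Rightarrow> ('a list \<Rightarrow> 'k) set \<Rightarrow> ('a \<Rightarrow> 'a \<Rightarrow> 'v) \<Rightarrow> 'v"
  where "sw2 k V t f = tlift k V t (\<lambda>w. f (w ! 0) (w ! 1))"

definition sw3 ::
  "('k, 'm) ring_scheme \<Rightarrow> ('k, 'v, 'y) module_scheme \<Rightarrow> ('a list \<Rightarrow> 'k) set
    \<Rightarrow> ('a \<Rightarrow> 'a \<Rightarrow> 'a \<Rightarrow> 'v) \<Rightarrow> 'v"
  where "sw3 k V t f = tlift k V t (\<lambda>w. f (w ! 0) (w ! 1) (w ! 2))"

text \<open>The map \<open>f \<otimes> \<dots> \<otimes> f\<close> (\<open>n\<close> factors), for \<open>f\<close> linear with values in \<open>B\<close>.\<close>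

definition tmap ::
  "('k, 'm) ring_scheme \<Rightarrow> ('k, 'b, 'y) module_scheme \<Rightarrow> nat \<Rightarrow> ('a \<Rightarrow> 'b)
    \<Rightarrow> ('a list \<Rightarrow> 'k) set \<Rightarrow> ('b list \<Rightarrow> 'k) set"
  where "tmap k B n f t = tlift k (tpow k B n) t (\<lambda>w. tens k B (map f w))"


section \<open>Quasi-bialgebras and quasi-Hopf algebras\<close>

record ('k, 'a) quasi_hopf = "('k, 'a) module" +
  comult :: "'a \<Rightarrow> ('a list \<Rightarrow> 'k) set" (\<open>\<Delta>\<index>\<close>)
  counit :: "'a \<Rightarrow> 'k" (\<open>\<epsilon>\<index>\<close>)
  reassoc :: "('a list \<Rightarrow> 'k) set" (\<open>\<Phi>\<index>\<close>)
  antipode :: "'a \<Rightarrow> 'a" (\<open>\<S>\<index>\<close>)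
  alpha :: "'a" (\<open>\<alpha>\<index>\<close>)
  beta :: "'a" (\<open>\<beta>\<index>\<close>)

definition reassoc_inv ::
  "('k, 'm) ring_scheme \<Rightarrow> ('k, 'a, 'x) quasi_hopf_scheme \<Rightarrow> ('a list \<Rightarrow> 'k) set"
  where "reassoc_inv k H = inv\<^bsub>tpow k H 3\<^esub> \<Phi>\<^bsub>H\<^esub>"

locale quasi_bialgebra = unital_algebra k H
  for k (structure) and H :: "('k, 'a, 'x) quasi_hopf_scheme" (structure) +
  assumes comult_hom: "\<Delta>\<^bsub>H\<^esub> \<in> alg_hom k H (tpow k H 2)"
    and counit_hom: "\<epsilon>\<^bsub>H\<^esub> \<in> alg_char k H"
    and reassoc_unit: "\<Phi>\<^bsub>H\<^esub> \<in> Units (tpow k H 3)"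
    and quasi_coassoc: "h \<in> carrier H \<Longrightarrow>
      sw2 k (tpow k H 3) (\<Delta>\<^bsub>H\<^esub> h) (\<lambda>a b.
        sw2 k (tpow k H 3) (\<Delta>\<^bsub>H\<^esub> b) (\<lambda>b1 b2. tens k H [a, b1, b2]))
      = \<Phi>\<^bsub>H\<^esub>
        \<otimes>\<^bsub>tpow k H 3\<^esub> sw2 k (tpow k H 3) (\<Delta>\<^bsub>H\<^esub> h) (\<lambda>a b.
          sw2 k (tpow k H 3) (\<Delta>\<^bsub>H\<^esub> a) (\<lambda>a1 a2. tens k H [a1, a2, b]))
        \<otimes>\<^bsub>tpow k H 3\<^esub> reassoc_inv k H"
    and counit_right: "h \<in> carrier H \<Longrightarrow> sw2 k H (\<Delta>\<^bsub>H\<^esub> h) (\<lambda>a b. \<epsilon>\<^bsub>H\<^esub> b \<odot>\<^bsub>H\<^esub> a) = h"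
    and counit_left: "h \<in> carrier H \<Longrightarrow> sw2 k H (\<Delta>\<^bsub>H\<^esub> h) (\<lambda>a b. \<epsilon>\<^bsub>H\<^esub> a \<odot>\<^bsub>H\<^esub> b) = h"
    and counit_reassoc:
      "sw3 k (tpow k H 2) \<Phi>\<^bsub>H\<^esub> (\<lambda>X1 X2 X3. \<epsilon>\<^bsub>H\<^esub> X2 \<odot>\<^bsub>tpow k H 2\<^esub> tens k H [X1, X3])
      = tens k H [\<one>\<^bsub>H\<^esub>, \<one>\<^bsub>H\<^esub>]"
    and pentagon:
      "sw3 k (tpow k H 4) \<Phi>\<^bsub>H\<^esub> (\<lambda>X1 X2 X3. tens k H [\<one>\<^bsub>H\<^esub>, X1, X2, X3])
        \<otimes>\<^bsub>tpow k H 4\<^esub> sw3 k (tpow k H 4) \<Phi>\<^bsub>H\<^esub> (\<lambda>X1 X2 X3.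
          sw2 k (tpow k H 4) (\<Delta>\<^bsub>H\<^esub> X2) (\<lambda>a b. tens k H [X1, a, b, X3]))
        \<otimes>\<^bsub>tpow k H 4\<^esub> sw3 k (tpow k H 4) \<Phi>\<^bsub>H\<^esub> (\<lambda>X1 X2 X3. tens k H [X1, X2, X3, \<one>\<^bsub>H\<^esub>])
      = sw3 k (tpow k H 4) \<Phi>\<^bsub>H\<^esub> (\<lambda>X1 X2 X3.
          sw2 k (tpow k H 4) (\<Delta>\<^bsub>H\<^esub> X3) (\<lambda>a b. tens k H [X1, X2, a, b]))
        \<otimes>\<^bsub>tpow k H 4\<^esub> sw3 k (tpow k H 4) \<Phi>\<^bsub>H\<^esub> (\<lambda>X1 X2 X3.
          sw2 k (tpow k H 4) (\<Delta>\<^bsub>H\<^esub> X1) (\<lambda>a b. tens k H [a, b, X2, X3]))"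

locale quasi_hopf_algebra = quasi_bialgebra +
  assumes antipode_closed: "\<S>\<^bsub>H\<^esub> \<in> carrier H \<rightarrow> carrier H"
    and antipode_add: "\<lbrakk>x \<in> carrier H; y \<in> carrier H\<rbrakk> \<Longrightarrow> \<S>\<^bsub>H\<^esub> (x \<oplus>\<^bsub>H\<^esub> y) = \<S>\<^bsub>H\<^esub> x \<oplus>\<^bsub>H\<^esub> \<S>\<^bsub>H\<^esub> y"
    and antipode_smult: "\<lbrakk>r \<in> carrier k; x \<in> carrier H\<rbrakk> \<Longrightarrow> \<S>\<^bsub>H\<^esub> (r \<odot>\<^bsub>H\<^esub> x) = r \<odot>\<^bsub>H\<^esub> \<S>\<^bsub>H\<^esub> x"
    and antipode_mult: "\<lbrakk>x \<in> carrier H; y \<in> carrier H\<rbrakk> \<Longrightarrow> \<S>\<^bsub>H\<^esub> (x \<otimes>\<^bsub>H\<^esub> y) = \<S>\<^bsub>H\<^esub> y \<otimes>\<^bsub>H\<^esub> \<S>\<^bsub>H\<^esub> x"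
    and antipode_one: "\<S>\<^bsub>H\<^esub> \<one>\<^bsub>H\<^esub> = \<one>\<^bsub>H\<^esub>"
    and alpha_closed: "\<alpha>\<^bsub>H\<^esub> \<in> carrier H"
    and beta_closed: "\<beta>\<^bsub>H\<^esub> \<in> carrier H"
    and antipode_alpha: "h \<in> carrier H \<Longrightarrow>
      sw2 k H (\<Delta>\<^bsub>H\<^esub> h) (\<lambda>h1 h2. \<S>\<^bsub>H\<^esub> h1 \<otimes>\<^bsub>H\<^esub> \<alpha>\<^bsub>H\<^esub> \<otimes>\<^bsub>H\<^esub> h2) = \<epsilon>\<^bsub>H\<^esub> h \<odot>\<^bsub>H\<^esub> \<alpha>\<^bsub>H\<^esub>"
    and antipode_beta: "h \<in> carrier H \<Longrightarrow>
      sw2 k H (\<Delta>\<^bsub>H\<^esub> h) (\<lambda>h1 h2. h1 \<otimes>\<^bsub>H\<^esub> \<beta>\<^bsub>H\<^esub> \<otimes>\<^bsub>H\<^esub> \<S>\<^bsub>H\<^esub> h2) = \<epsilon>\<^bsub>H\<^esub> h \<odot>\<^bsub>H\<^esub> \<beta>\<^bsub>H\<^esub>"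
    and antipode_reassoc:
      "sw3 k H \<Phi>\<^bsub>H\<^esub> (\<lambda>X1 X2 X3.
        X1 \<otimes>\<^bsub>H\<^esub> \<beta>\<^bsub>H\<^esub> \<otimes>\<^bsub>H\<^esub> \<S>\<^bsub>H\<^esub> X2 \<otimes>\<^bsub>H\<^esub> \<alpha>\<^bsub>H\<^esub> \<otimes>\<^bsub>H\<^esub> X3) = \<one>\<^bsub>H\<^esub>"
    and antipode_reassoc_inv:
      "sw3 k H (reassoc_inv k H) (\<lambda>x1 x2 x3.
        \<S>\<^bsub>H\<^esub> x1 \<otimes>\<^bsub>H\<^esub> \<alpha>\<^bsub>H\<^esub> \<otimes>\<^bsub>H\<^esub> x2 \<otimes>\<^bsub>H\<^esub> \<beta>\<^bsub>H\<^esub> \<otimes>\<^bsub>H\<^esub> \<S>\<^bsub>H\<^esub> x3) = \<one>\<^bsub>H\<^esub>"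

definition quasi_hopf_morphism ::
  "('k, 'm) ring_scheme \<Rightarrow> ('k, 'a, 'x) quasi_hopf_scheme \<Rightarrow> ('k, 'b, 'y) quasi_hopf_scheme
    \<Rightarrow> ('a \<Rightarrow> 'b) \<Rightarrow> bool"
  where "quasi_hopf_morphism k H A f \<longleftrightarrow>
    f \<in> alg_hom k H A \<and>
    (\<forall>h\<in>carrier H. \<Delta>\<^bsub>A\<^esub> (f h) = tmap k A 2 f (\<Delta>\<^bsub>H\<^esub> h)) \<and>
    (\<forall>h\<in>carrier H. \<epsilon>\<^bsub>A\<^esub> (f h) = \<epsilon>\<^bsub>H\<^esub> h) \<and>
    (\<forall>h\<in>carrier H. \<S>\<^bsub>A\<^esub> (f h) = f (\<S>\<^bsub>H\<^esub> h)) \<and>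
    tmap k A 3 f \<Phi>\<^bsub>H\<^esub> = \<Phi>\<^bsub>A\<^esub> \<and>
    f \<alpha>\<^bsub>H\<^esub> = \<alpha>\<^bsub>A\<^esub> \<and> f \<beta>\<^bsub>H\<^esub> = \<beta>\<^bsub>A\<^esub>"

definition quasi_hopf_isomorphic ::
  "('k, 'm) ring_scheme \<Rightarrow> ('k, 'a, 'x) quasi_hopf_scheme \<Rightarrow> ('k, 'b, 'y) quasi_hopf_scheme \<Rightarrow> bool"
  where "quasi_hopf_isomorphic k A B \<longleftrightarrow>
    (\<exists>f. quasi_hopf_morphism k A B f \<and> bij_betw f (carrier A) (carrier B))"

text \<open>\<open>A\<close> is free of rank \<open>n\<close> as a right \<open>H\<close>-module under \<open>a \<cdot> h = a (i h)\<close>.\<close>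

definition free_right_module ::
  "('h, 'x) ring_scheme \<Rightarrow> ('a, 'y) ring_scheme \<Rightarrow> ('h \<Rightarrow> 'a) \<Rightarrow> nat \<Rightarrow> bool"
  where "free_right_module H A i n \<longleftrightarrow>
    (\<exists>E\<subseteq>carrier A. finite E \<and> card E = n \<and>
      (\<forall>a\<in>carrier A. \<exists>!c. c \<in> E \<rightarrow>\<^sub>E carrier H \<and> a = (\<Oplus>\<^bsub>A\<^esub>e\<in>E. e \<otimes>\<^bsub>A\<^esub> i (c e))))"


section \<open>Adjoining one generator to an algebra, with relations\<close>

text \<open>
  Words are over the alphabet consisting of the letters \<open>Some h\<close>, for \<open>h\<close> in \<open>H\<close>, and the new
  generator \<open>None\<close>. Imposing the relations that hold in \<open>H\<close> gives the algebra generated freely by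
  \<open>H\<close> and one further element, in which the additional relations are then stated.
\<close>

definition word_monoid :: "('k, 'h, 'x) module_scheme \<Rightarrow> 'h option list monoid"
  where "word_monoid H = \<lparr>
    carrier = lists (insert None (Some ` carrier H)), mult = (@), one = []\<rparr>"

definition base_rels ::
  "('k, 'm) ring_scheme \<Rightarrow> ('k, 'h, 'x) module_scheme \<Rightarrow> ('h option list \<Rightarrow> 'k) set"
  where "base_rels k H = (let F = mon_alg k (word_monoid H) in
    {basis k [Some (x \<oplus>\<^bsub>H\<^esub> y)] \<ominus>\<^bsub>F\<^esub> (basis k [Some x] \<oplus>\<^bsub>F\<^esub> basis k [Some y]) | x y.
      x \<in> carrier H \<and> y \<in> carrier H} \<union>
    {basis k [Some (r \<odot>\<^bsub>H\<^esub> x)] \<ominus>\<^bsub>F\<^esub> r \<odot>\<^bsub>F\<^esub> basis k [Some x] | r x.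
      r \<in> carrier k \<and> x \<in> carrier H} \<union>
    {basis k [Some (x \<otimes>\<^bsub>H\<^esub> y)] \<ominus>\<^bsub>F\<^esub> basis k [Some x, Some y] | x y.
      x \<in> carrier H \<and> y \<in> carrier H} \<union>
    {basis k [Some \<one>\<^bsub>H\<^esub>] \<ominus>\<^bsub>F\<^esub> basis k []})"

definition base_ideal ::
  "('k, 'm) ring_scheme \<Rightarrow> ('k, 'h, 'x) module_scheme \<Rightarrow> ('h option list \<Rightarrow> 'k) set"
  where "base_ideal k H = Idl\<^bsub>mon_alg k (word_monoid H)\<^esub> (base_rels k H)"

definition adjoin ::
  "('k, 'm) ring_scheme \<Rightarrow> ('k, 'h, 'x) module_scheme \<Rightarrow> ('k, ('h option list \<Rightarrow> 'k) set) module"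
  where "adjoin k H = quot_alg (mon_alg k (word_monoid H)) (base_ideal k H)"

definition adjoin_emb ::
  "('k, 'm) ring_scheme \<Rightarrow> ('k, 'h, 'x) module_scheme \<Rightarrow> 'h \<Rightarrow> ('h option list \<Rightarrow> 'k) set"
  where "adjoin_emb k H h = base_ideal k H +>\<^bsub>mon_alg k (word_monoid H)\<^esub> basis k [Some h]"

definition adjoin_gen ::
  "('k, 'm) ring_scheme \<Rightarrow> ('k, 'h, 'x) module_scheme \<Rightarrow> ('h option list \<Rightarrow> 'k) set"
  where "adjoin_gen k H = base_ideal k H +>\<^bsub>mon_alg k (word_monoid H)\<^esub> basis k [None]"

definition presented ::
  "('k, 'm) ring_scheme \<Rightarrow> ('k, 'h, 'x) module_scheme \<Rightarrow> ('h option list \<Rightarrow> 'k) set set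
    \<Rightarrow> ('k, ('h option list \<Rightarrow> 'k) set set) module"
  where "presented k H rels = quot_alg (adjoin k H) (Idl\<^bsub>adjoin k H\<^esub> rels)"

definition presented_emb ::
  "('k, 'm) ring_scheme \<Rightarrow> ('k, 'h, 'x) module_scheme \<Rightarrow> ('h option list \<Rightarrow> 'k) set set
    \<Rightarrow> 'h \<Rightarrow> ('h option list \<Rightarrow> 'k) set set"
  where "presented_emb k H rels h = Idl\<^bsub>adjoin k H\<^esub> rels +>\<^bsub>adjoin k H\<^esub> adjoin_emb k H h"

definition presented_gen ::
  "('k, 'm) ring_scheme \<Rightarrow> ('k, 'h, 'x) module_scheme \<Rightarrow> ('h option list \<Rightarrow> 'k) set set
    \<Rightarrow> ('h option list \<Rightarrow> 'k) set set"
  where "presented_gen k H rels = Idl\<^bsub>adjoin k H\<^esub> rels +>\<^bsub>adjoin k H\<^esub> adjoin_gen k H"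

definition quasi_hopf_extension ::
  "('k, 'm) ring_scheme \<Rightarrow> ('k, 'h, 'x) quasi_hopf_scheme \<Rightarrow> ('h option list \<Rightarrow> 'k) set set
    \<Rightarrow> ('k, ('h option list \<Rightarrow> 'k) set set) quasi_hopf \<Rightarrow> bool"
  where "quasi_hopf_extension k H rels Q \<longleftrightarrow>
    module.truncate Q = presented k H rels \<and>
    quasi_hopf_algebra k Q \<and>
    quasi_hopf_morphism k H Q (presented_emb k H rels) \<and>
    inj_on (presented_emb k H rels) (carrier H)"


section \<open>The quasi-Hopf algebras \<open>H\<^sub>g\<close> and \<open>H(\<theta>)\<close>\<close>

text \<open>
  Since \<open>H\<close> and the new generator generate the presented algebra, there is at most one
  quasi-Hopf structure as described by each of the two predicates \<open>is_H_g\<close> and \<open>is_H_theta\<close>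
  (up to values outside the carrier).
\<close>

definition g_rels ::
  "('k, 'm) ring_scheme \<Rightarrow> ('k, 'h, 'x) module_scheme \<Rightarrow> ('h option list \<Rightarrow> 'k) set set"
  where "g_rels k H = (let P = adjoin k H; j = adjoin_emb k H; g = adjoin_gen k H in
    {g \<otimes>\<^bsub>P\<^esub> g \<ominus>\<^bsub>P\<^esub> \<one>\<^bsub>P\<^esub>} \<union>
    {g \<otimes>\<^bsub>P\<^esub> j h \<ominus>\<^bsub>P\<^esub> j h \<otimes>\<^bsub>P\<^esub> g | h. h \<in> carrier H})"

definition is_H_g ::
  "('k, 'm) ring_scheme \<Rightarrow> ('k, 'h, 'x) quasi_hopf_scheme
    \<Rightarrow> ('k, ('h option list \<Rightarrow> 'k) set set) quasi_hopf \<Rightarrow> bool"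
  where "is_H_g k H Q \<longleftrightarrow> quasi_hopf_extension k H (g_rels k H) Q \<and>
    (let g = presented_gen k H (g_rels k H) in
      \<Delta>\<^bsub>Q\<^esub> g = tens k Q [g, g] \<and> \<epsilon>\<^bsub>Q\<^esub> g = \<one>\<^bsub>k\<^esub> \<and> \<S>\<^bsub>Q\<^esub> g = g)"

definition couple ::
  "('k, 'm) ring_scheme \<Rightarrow> ('k, 'h, 'x) quasi_hopf_scheme \<Rightarrow> ('h \<Rightarrow> 'k) \<Rightarrow> 'h \<Rightarrow> bool"
  where "couple k H \<sigma> v \<longleftrightarrow>
    \<sigma> \<in> alg_char k H \<and> v \<in> carrier H \<and> \<sigma> v = \<ominus>\<^bsub>k\<^esub> \<one>\<^bsub>k\<^esub> \<and> \<epsilon>\<^bsub>H\<^esub> v = \<one>\<^bsub>k\<^esub> \<and>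
    \<Delta>\<^bsub>H\<^esub> v =
      sw3 k (tpow k H 2) \<Phi>\<^bsub>H\<^esub> (\<lambda>X1 X2 X3.
      sw3 k (tpow k H 2) (reassoc_inv k H) (\<lambda>x1 x2 x3.
      sw3 k (tpow k H 2) (reassoc_inv k H) (\<lambda>y1 y2 y3.
        \<sigma> (y1 \<otimes>\<^bsub>H\<^esub> x3 \<otimes>\<^bsub>H\<^esub> X2) \<odot>\<^bsub>tpow k H 2\<^esub>
          tens k H [x1 \<otimes>\<^bsub>H\<^esub> X1 \<otimes>\<^bsub>H\<^esub> v \<otimes>\<^bsub>H\<^esub> y2, x2 \<otimes>\<^bsub>H\<^esub> v \<otimes>\<^bsub>H\<^esub> X3 \<otimes>\<^bsub>H\<^esub> y3]))) \<and>
    (\<forall>h\<in>carrier H.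
      sw2 k H (\<Delta>\<^bsub>H\<^esub> h) (\<lambda>h1 h2. \<sigma> h2 \<odot>\<^bsub>H\<^esub> (h1 \<otimes>\<^bsub>H\<^esub> v)) =
      sw2 k H (\<Delta>\<^bsub>H\<^esub> h) (\<lambda>h1 h2. \<sigma> h1 \<odot>\<^bsub>H\<^esub> (v \<otimes>\<^bsub>H\<^esub> h2)))"

definition theta_rels ::
  "('k, 'm) ring_scheme \<Rightarrow> ('k, 'h, 'x) quasi_hopf_scheme \<Rightarrow> ('h \<Rightarrow> 'k)
    \<Rightarrow> ('h option list \<Rightarrow> 'k) set set"
  where "theta_rels k H \<sigma> = (let P = adjoin k H; j = adjoin_emb k H; \<theta> = adjoin_gen k H in
    {\<theta> \<otimes>\<^bsub>P\<^esub> \<theta>} \<union>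
    {j h \<otimes>\<^bsub>P\<^esub> \<theta> \<ominus>\<^bsub>P\<^esub> sw2 k P (\<Delta>\<^bsub>H\<^esub> h) (\<lambda>h1 h2. \<sigma> h1 \<odot>\<^bsub>P\<^esub> (\<theta> \<otimes>\<^bsub>P\<^esub> j h2)) | h.
      h \<in> carrier H})"

definition is_H_theta ::
  "('k, 'm) ring_scheme \<Rightarrow> ('k, 'h, 'x) quasi_hopf_scheme \<Rightarrow> ('h \<Rightarrow> 'k) \<Rightarrow> 'h
    \<Rightarrow> ('k, ('h option list \<Rightarrow> 'k) set set) quasi_hopf \<Rightarrow> bool"
  where "is_H_theta k H \<sigma> v Q \<longleftrightarrow> quasi_hopf_extension k H (theta_rels k H \<sigma>) Q \<and>
    (let j = presented_emb k H (theta_rels k H \<sigma>);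
         \<theta> = presented_gen k H (theta_rels k H \<sigma>);
         T = tpow k Q 2
     in
      \<Delta>\<^bsub>Q\<^esub> \<theta> =
        sw3 k T \<Phi>\<^bsub>H\<^esub> (\<lambda>X1 X2 X3. sw3 k T (reassoc_inv k H) (\<lambda>x1 x2 x3.
          \<sigma> (X2 \<otimes>\<^bsub>H\<^esub> x1) \<odot>\<^bsub>T\<^esub>
            tens k Q [j (X1 \<otimes>\<^bsub>H\<^esub> v \<otimes>\<^bsub>H\<^esub> x2), \<theta> \<otimes>\<^bsub>Q\<^esub> j (X3 \<otimes>\<^bsub>H\<^esub> x3)]))
        \<oplus>\<^bsub>T\<^esub> sw3 k T (reassoc_inv k H) (\<lambda>x1 x2 x3.
          \<sigma> x1 \<odot>\<^bsub>T\<^esub> tens k Q [\<theta> \<otimes>\<^bsub>Q\<^esub> j x2, j x3]) \<and>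
      \<epsilon>\<^bsub>Q\<^esub> \<theta> = \<zero>\<^bsub>k\<^esub> \<and>
      \<S>\<^bsub>Q\<^esub> \<theta> =
        \<ominus>\<^bsub>Q\<^esub> sw3 k Q \<Phi>\<^bsub>H\<^esub> (\<lambda>X1 X2 X3. sw3 k Q (reassoc_inv k H) (\<lambda>x1 x2 x3.
          sw2 k Q (\<Delta>\<^bsub>H\<^esub> x1) (\<lambda>x11 x12.
            \<sigma> (X2 \<otimes>\<^bsub>H\<^esub> x12) \<odot>\<^bsub>Q\<^esub>
              (j (\<S>\<^bsub>H\<^esub> (X1 \<otimes>\<^bsub>H\<^esub> x11 \<otimes>\<^bsub>H\<^esub> v) \<otimes>\<^bsub>H\<^esub> \<alpha>\<^bsub>H\<^esub>) \<otimes>\<^bsub>Q\<^esub> \<theta> \<otimes>\<^bsub>Q\<^esub>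
                j (X3 \<otimes>\<^bsub>H\<^esub> x2 \<otimes>\<^bsub>H\<^esub> \<beta>\<^bsub>H\<^esub> \<otimes>\<^bsub>H\<^esub> \<S>\<^bsub>H\<^esub> x3))))))"

end

theory Submission
  imports Defs
begin

text \<open>
  The formula \<open>E(m) = X\<^sup>1 m\<^sub>1 \<beta> S(X\<^sup>2 \<pi>(m\<^sub>2)) \<alpha> X\<^sup>3\<close> projects \<open>A\<close> onto its coinvariants over \<open>H\<close>
  (\<open>coinv\<close>; the embedding \<open>i\<close> is left out here), it satisfies \<open>E(m h) = E(m) \<epsilon>(h)\<close>, and each
  element is recovered as \<open>m = E(m\<^sub>1) \<pi>(m\<^sub>2)\<close>. If \<open>A\<close> is free of rank two, the values of \<open>E\<close> span a
  plane through \<open>1\<close>, so \<open>E(m) = \<epsilon>(m) 1 + \<phi>(m) \<theta>\<close> for a functional \<open>\<phi>\<close> and some \<open>\<theta>\<close> killed by \<open>\<pi>\<close>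
  (\<open>rank_two_generator\<close>). Hence \<open>A = H \<oplus> \<theta> H\<close>, with coordinates \<open>\<pi>(m)\<close> and \<open>\<kappa>(m) = \<phi>(m\<^sub>1) \<pi>(m\<^sub>2)\<close>.

  All of the structure of \<open>A\<close> can be read off from scalar functions. From
  \<open>\<phi>(a b) = \<phi>(a) \<epsilon>(b) + \<chi>(a) \<phi>(b)\<close>, where \<open>\<chi>(a) = \<phi>(a \<theta>)\<close>, it follows that \<open>\<chi>\<close> is a character. Put
  \<open>\<sigma> = \<chi> i\<close>, \<open>v = \<pi>(\<theta>\<^sub>1) \<phi>(\<theta>\<^sub>2)\<close>, \<open>c = \<chi>(\<theta>)\<close>, and let \<open>d\<close> be the value at \<open>\<theta>\<close> of the convolution square
  \<open>\<phi> * \<phi>\<close>. Then \<open>h \<theta> = \<sigma>(h\<^sub>1) \<theta> h\<^sub>2\<close>, and decomposing both legs gives the coproduct of \<open>\<theta>\<close>. The square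
  \<open>\<phi> * \<phi>\<close> inherits the invariance of \<open>\<phi>\<close> and vanishes at \<open>1\<close>, so it equals \<open>d \<phi>\<close>; its value at
  \<open>\<theta> \<theta>\<close> yields the relation \<open>\<phi> * \<chi> + \<chi> * \<phi> + d (\<chi> * \<chi>) = d c\<close> at \<open>\<theta>\<close> (\<open>quadratic_relation\<close>).

  The dichotomy rests on a fact about quasi-Hopf algebras: a character that is idempotent for
  convolution is the counit (\<open>idempotent_char\<close>), because its composite with the antipode is a
  convolution inverse. The character \<open>\<sigma>\<close> is idempotent as soon as \<open>c\<close> or \<open>d\<close> is not zero.

  If \<open>c = 0\<close>, then \<open>\<chi> = \<sigma> \<pi>\<close> and the quadratic relation says \<open>1 + \<sigma>(v) = 0\<close>. Were \<open>d\<close> nonzero,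
  \<open>\<sigma>\<close> would be the counit and \<open>\<sigma>(v) = 1\<close>; so \<open>d = 0\<close>, as the characteristic is not \<open>2\<close>. Then \<open>\<theta>\<close>
  has square zero and the coproduct and antipode prescribed in \<open>H(\<theta>)\<close>.

  If \<open>c \<noteq> 0\<close>, then \<open>\<sigma> = \<epsilon>\<close> and the quadratic relation says \<open>(1 + c d) (2 + c d) = 0\<close>. If \<open>1 + c d\<close> were
  \<open>0\<close>, the character \<open>\<chi>\<close> would be idempotent, although it differs from the counit at \<open>\<theta>\<close>; so
  \<open>c d = -2\<close>, which is not zero. The element \<open>v\<close> is a central group-like idempotent, hence \<open>1\<close>, and
  \<open>\<gamma> = 1 + d \<theta>\<close> is group-like, commutes with \<open>H\<close> and has square \<open>1\<close>. As \<open>d \<noteq> 0\<close>, also \<open>A = H \<oplus> \<gamma> H\<close>,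
  which is \<open>H\<^sub>g\<close>.

  In both cases \<open>A\<close> satisfies the relations of the presented algebra, which is spanned by \<open>H\<close> and the
  generator times \<open>H\<close>; directness of the sum in \<open>A\<close> makes the two algebras isomorphic
  (\<open>presented_iso\<close>). The quasi-Hopf structure of \<open>A\<close> is then carried over to the presented algebra.

  Equations between tensors are stated after application of an arbitrary multilinear map \<open>f\<close> with
  values in an arbitrary module \<open>V\<close>. In this form they can be used inside larger Sweedler expressions.
\<close>

section \<open>Linear maps\<close>

text \<open>
  With this notation \<open>\<otimes>\<^sub>A\<close> abbreviates the product \<open>\<otimes>\<^bsub>A\<^esub>\<close>, and similarly for the other operations.
\<close>

syntax "_index" :: "logic \<Rightarrow> index" ("\<^sub>_" [1000] 1000)

definition lin ::
  "('k, 'm) ring_scheme \<Rightarrow> ('k, 'a, 'x) module_scheme \<Rightarrow> ('k, 'b, 'y) module_scheme \<Rightarrow> ('a \<Rightarrow> 'b) set"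
  where "lin k V W = {f \<in> carrier V \<rightarrow> carrier W.
    (\<forall>x\<in>carrier V. \<forall>y\<in>carrier V. f (x \<oplus>\<^sub>V y) = f x \<oplus>\<^sub>W f y) \<and>
    (\<forall>r\<in>carrier k. \<forall>x\<in>carrier V. f (r \<odot>\<^sub>V x) = r \<odot>\<^sub>W f x)}"

text \<open>
  The ground field as an algebra, so that functionals and characters are linear maps into it and
  are covered by the results on Sweedler expressions with values in a module.
\<close>

definition scalars :: "('k, 'm) ring_scheme \<Rightarrow> ('k, 'k) module"
  where "scalars k = \<lparr>carrier = carrier k, mult = mult k, one = one k, zero = zero k, add = add k,
    smult = mult k\<rparr>"

text \<open>
  The value at \<open>p\<close> of the linear extension of \<open>f\<close> from the basis to the monoid algebra.
\<close>

definition lincomb ::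
  "('k, 'm) ring_scheme \<Rightarrow> ('k, 'v, 'y) module_scheme \<Rightarrow> ('w \<Rightarrow> 'k) \<Rightarrow> ('w \<Rightarrow> 'v) \<Rightarrow> 'v"
  where "lincomb k V p f = (\<Oplus>\<^bsub>V\<^esub>w\<in>supp k p. p w \<odot>\<^sub>V f w)"

lemma lin_closed: "\<lbrakk>f \<in> lin k V W; x \<in> carrier V\<rbrakk> \<Longrightarrow> f x \<in> carrier W"
  by (auto simp: lin_def)

lemma lin_add: "\<lbrakk>f \<in> lin k V W; x \<in> carrier V; y \<in> carrier V\<rbrakk> \<Longrightarrow> f (x \<oplus>\<^sub>V y) = f x \<oplus>\<^sub>W f y"
  by (auto simp: lin_def)

lemma lin_smult: "\<lbrakk>f \<in> lin k V W; r \<in> carrier k; x \<in> carrier V\<rbrakk> \<Longrightarrow> f (r \<odot>\<^sub>V x) = r \<odot>\<^sub>W f x"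
  by (auto simp: lin_def)

lemma linI:
  assumes "\<And>x. x \<in> carrier V \<Longrightarrow> f x \<in> carrier W"
    and "\<And>x y. \<lbrakk>x \<in> carrier V; y \<in> carrier V\<rbrakk> \<Longrightarrow> f (x \<oplus>\<^sub>V y) = f x \<oplus>\<^sub>W f y"
    and "\<And>r x. \<lbrakk>r \<in> carrier k; x \<in> carrier V\<rbrakk> \<Longrightarrow> f (r \<odot>\<^sub>V x) = r \<odot>\<^sub>W f x"
  shows "f \<in> lin k V W"
  using assms by (auto simp: lin_def)

lemma alg_hom_lin: "f \<in> alg_hom k A B \<Longrightarrow> f \<in> lin k A B"
  by (auto simp: alg_hom_def lin_def ring_hom_def)

lemma alg_char_lin: "f \<in> alg_char k A \<Longrightarrow> f \<in> lin k A (scalars k)"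
  by (auto simp: alg_char_def lin_def ring_hom_def scalars_def)

lemma alg_homD:
  assumes "f \<in> alg_hom k A B"
  shows "x \<in> carrier A \<Longrightarrow> f x \<in> carrier B"
    and "\<lbrakk>x \<in> carrier A; y \<in> carrier A\<rbrakk> \<Longrightarrow> f (x \<oplus>\<^sub>A y) = f x \<oplus>\<^sub>B f y"
    and "\<lbrakk>r \<in> carrier k; x \<in> carrier A\<rbrakk> \<Longrightarrow> f (r \<odot>\<^sub>A x) = r \<odot>\<^sub>B f x"
    and "\<lbrakk>x \<in> carrier A; y \<in> carrier A\<rbrakk> \<Longrightarrow> f (x \<otimes>\<^sub>A y) = f x \<otimes>\<^sub>B f y"
    and "f \<one>\<^sub>A = \<one>\<^sub>B"
  using assms by (auto simp: alg_hom_def ring_hom_def)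

lemma alg_homI:
  assumes "\<And>x. x \<in> carrier A \<Longrightarrow> f x \<in> carrier B"
    "\<And>x y. \<lbrakk>x \<in> carrier A; y \<in> carrier A\<rbrakk> \<Longrightarrow> f (x \<oplus>\<^sub>A y) = f x \<oplus>\<^sub>B f y"
    "\<And>r x. \<lbrakk>r \<in> carrier k; x \<in> carrier A\<rbrakk> \<Longrightarrow> f (r \<odot>\<^sub>A x) = r \<odot>\<^sub>B f x"
    "\<And>x y. \<lbrakk>x \<in> carrier A; y \<in> carrier A\<rbrakk> \<Longrightarrow> f (x \<otimes>\<^sub>A y) = f x \<otimes>\<^sub>B f y"
    "f \<one>\<^sub>A = \<one>\<^sub>B"
  shows "f \<in> alg_hom k A B"
  using assms by (auto simp: alg_hom_def intro!: ring_hom_memI)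

lemma lin_id: "(\<lambda>x. x) \<in> lin k V V"
  by (auto simp: lin_def)

lemma lin_comp: "\<lbrakk>g \<in> lin k V W; f \<in> lin k U V\<rbrakk> \<Longrightarrow> (\<lambda>x. g (f x)) \<in> lin k U W"
  by (auto simp: lin_def Pi_iff)

lemma lin_zero:
  assumes "module k V" "module k W" "f \<in> lin k V W"
  shows "f \<zero>\<^sub>V = \<zero>\<^sub>W"
proof -
  interpret V: module k V by fact
  interpret W: module k W by fact
  have "f (\<zero>\<^sub>k \<odot>\<^sub>V \<zero>\<^sub>V) = \<zero>\<^sub>k \<odot>\<^sub>W f \<zero>\<^sub>V"
    by (rule lin_smult[OF assms(3)]) auto
  then show ?thesis using lin_closed[OF assms(3), of "\<zero>\<^sub>V"] by simp
qed

lemma lin_minus: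
  assumes "module k V" "module k W" "f \<in> lin k V W" "x \<in> carrier V" "y \<in> carrier V"
  shows "f (x \<ominus>\<^sub>V y) = f x \<ominus>\<^sub>W f y"
proof -
  interpret V: module k V by fact
  interpret W: module k W by fact
  have "f (\<ominus>\<^sub>V y) = \<ominus>\<^sub>W f y"
  proof -
    have "f (\<ominus>\<^sub>V y) \<oplus>\<^sub>W f y = \<zero>\<^sub>W"
      using lin_add[OF assms(3), of "\<ominus>\<^sub>V y" y] lin_zero[OF assms(1-3)] assms(5) V.l_neg by simp
    then show ?thesis using lin_closed[OF assms(3)] assms(5)
      by (simp add: W.minus_equality)
  qed
  then show ?thesis using assms lin_closed[OF assms(3)]
    by (simp add: a_minus_def lin_add[OF assms(3)])
qed

lemma lin_finsum:
  assumes "module k V" "module k W" "f \<in> lin k V W" "g \<in> I \<rightarrow> carrier V"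
  shows "f (\<Oplus>\<^bsub>V\<^esub>i\<in>I. g i) = (\<Oplus>\<^bsub>W\<^esub>i\<in>I. f (g i))"
proof -
  interpret V: module k V by fact
  interpret W: module k W by fact
  show ?thesis
  proof (cases "finite I")
    case False
    then show ?thesis using lin_zero[OF assms(1-3)] by (simp add: V.add.finprod_infinite W.add.finprod_infinite)
  next
    case True
    then show ?thesis using assms(4)
    proof (induction I)
      case empty
      then show ?case using lin_zero[OF assms(1-3)] by simp
    next
      case (insert x F)
      then have "(\<lambda>i. f (g i)) \<in> F \<rightarrow> carrier W" "f (g x) \<in> carrier W" "g \<in> F \<rightarrow> carrier V" "g x \<in> carrier V"
        using lin_closed[OF assms(3)] by auto
      then show ?case using insert
        by (simp add: V.finsum_insert W.finsum_insert lin_add[OF assms(3)] V.finsum_closed)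
    qed
  qed
qed

lemma (in field) scalars_unital_algebra: "unital_algebra R (scalars R)"
proof -
  have ag: "abelian_group (scalars R)"
    by (rule abelian_groupI) (auto simp: scalars_def a_ac intro: l_neg)
  have "module R (scalars R)"
    by (rule moduleI) (use ag in \<open>auto simp: scalars_def m_ac l_distr r_distr is_cring\<close>)
  moreover have "ring (scalars R)"
  proof (rule ringI[OF ag])
    show "monoid (scalars R)" by (rule monoidI) (auto simp: scalars_def m_assoc)
  qed (auto simp: scalars_def l_distr r_distr)
  moreover have "unital_algebra_axioms R (scalars R)"
    by unfold_locales (auto simp: scalars_def m_ac)
  ultimately show ?thesis
    by (intro unital_algebra.intro field_axioms)
qed

section \<open>Monoid algebras\<close>

locale monoid_algebra = field k + M: monoid M
  for k (structure) and M (structure)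
begin

abbreviation "F \<equiv> mon_alg k M"

lemma mem_F: "p \<in> carrier F \<longleftrightarrow> finite (supp k p) \<and> supp k p \<subseteq> carrier M \<and> (\<forall>w. p w \<in> carrier k)"
  by (auto simp: mon_alg_def)

lemma add_F: "p \<oplus>\<^sub>F q = (\<lambda>w. p w \<oplus>\<^sub>k q w)"
  and zero_F: "\<zero>\<^sub>F = (\<lambda>w. \<zero>\<^sub>k)"
  and smult_F: "r \<odot>\<^sub>F p = (\<lambda>w. r \<otimes>\<^sub>k p w)"
  and one_F: "\<one>\<^sub>F = basis k \<one>\<^sub>M"
  by (simp_all add: mon_alg_def basis_def)

lemma basis_mem: "u \<in> carrier M \<Longrightarrow> basis k u \<in> carrier F"
  by (auto simp: mem_F supp_def basis_def)

lemma supp_basis: "supp k (basis k u) = {u}"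
  by (auto simp: supp_def basis_def)

lemma abelian_group_F: "abelian_group F"
proof (rule abelian_groupI)
  fix p q assume p: "p \<in> carrier F" and q: "q \<in> carrier F"
  have "supp k (\<lambda>w. p w \<oplus>\<^sub>k q w) \<subseteq> supp k p \<union> supp k q"
    using p q by (auto simp: supp_def)
  from this finite_subset[OF this] show "p \<oplus>\<^sub>F q \<in> carrier F"
    using p q by (auto simp: mem_F add_F)
  show "p \<oplus>\<^sub>F q = q \<oplus>\<^sub>F p"
    using p q by (auto simp: mem_F add_F a_ac)
next
  fix p assume p: "p \<in> carrier F"
  have "supp k (\<lambda>w. \<ominus>\<^sub>k p w) = supp k p" using p by (auto simp: supp_def mem_F)
  then have "(\<lambda>w. \<ominus>\<^sub>k p w) \<in> carrier F" using p by (auto simp: mem_F)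
  moreover have "(\<lambda>w. \<ominus>\<^sub>k p w) \<oplus>\<^sub>F p = \<zero>\<^sub>F" using p by (auto simp: mem_F add_F zero_F l_neg)
  ultimately show "\<exists>y\<in>carrier F. y \<oplus>\<^sub>F p = \<zero>\<^sub>F" by blast
qed (simp_all add: mem_F add_F zero_F a_assoc supp_def)

lemma module_F: "module k F"
proof (rule moduleI[OF is_cring abelian_group_F])
  fix r p assume "r \<in> carrier k" and p: "p \<in> carrier F"
  moreover from this have s: "supp k (\<lambda>w. r \<otimes>\<^sub>k p w) \<subseteq> supp k p" by (auto simp: supp_def)
  ultimately show "r \<odot>\<^sub>F p \<in> carrier F"
    using finite_subset[OF s] by (auto simp: mem_F smult_F)
qed (simp_all add: mem_F add_F smult_F m_assoc l_distr r_distr)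

sublocale F: module k F by (rule module_F)

lemma mon_alg_induct [consumes 1, case_names zero basis add]:
  assumes p: "p \<in> carrier F"
    and P0: "P \<zero>\<^sub>F"
    and P1: "\<And>w r. \<lbrakk>w \<in> carrier M; r \<in> carrier k\<rbrakk> \<Longrightarrow> P (r \<odot>\<^sub>F basis k w)"
    and P2: "\<And>p q. \<lbrakk>p \<in> carrier F; q \<in> carrier F; P p; P q\<rbrakk> \<Longrightarrow> P (p \<oplus>\<^sub>F q)"
  shows "P p"
proof -
  have "\<forall>p\<in>carrier F. supp k p \<subseteq> S \<longrightarrow> P p" if "finite S" for S
    using that
  proof (induction S)
    case empty
    have "p = \<zero>\<^sub>F" if "supp k p \<subseteq> {}" for p using that by (auto simp: supp_def zero_F)
    then show ?case using P0 by blast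
  next
    case (insert x S)
    show ?case
    proof (intro ballI impI)
      fix p assume p: "p \<in> carrier F" and s: "supp k p \<subseteq> insert x S"
      show "P p"
      proof (cases "p x = \<zero>\<^sub>k")
      case True
      then have "supp k p \<subseteq> S" using s by (auto simp: supp_def)
      then show ?thesis using insert p by blast
      next
      case False
      define q where "q = p(x := \<zero>\<^sub>k)"
      have x: "x \<in> carrier M" "p x \<in> carrier k" using p False by (auto simp: mem_F supp_def)
      have sq: "supp k q \<subseteq> supp k p - {x}" by (auto simp: supp_def q_def)
      from this finite_subset[OF this] have q: "q \<in> carrier F" using p by (auto simp: mem_F q_def)
      have "supp k q \<subseteq> S" using s sq by blast
      then have "P q" using insert q by blast
      moreover have "P (p x \<odot>\<^sub>F basis k x)" using P1 x by blast
      moreover have "p = p x \<odot>\<^sub>F basis k x \<oplus>\<^sub>F q"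
       using p by (auto simp: add_F smult_F basis_def q_def mem_F)
      ultimately show ?thesis using P2 q x basis_mem
       by (metis F.smult_closed)
      qed
    qed
  qed
  then show ?thesis using p by (auto simp: mem_F)
qed

context
  fixes V :: "('a, 'v, 'y) module_scheme"
  assumes V: "module k V"
begin

interpretation V: module k V by (rule V)

lemma lincomb_superset:
  assumes "p \<in> carrier F" "finite S" "supp k p \<subseteq> S" "\<And>w. w \<in> S \<Longrightarrow> f w \<in> carrier V"
  shows "lincomb k V p f = (\<Oplus>\<^bsub>V\<^esub>w\<in>S. p w \<odot>\<^sub>V f w)"
  unfolding lincomb_def
proof (rule V.add.finprod_mono_neutral_cong_left)
  show "\<And>i. i \<in> S - supp k p \<Longrightarrow> p i \<odot>\<^sub>V f i = \<zero>\<^sub>V"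
    using assms by (auto simp: supp_def)
qed (use assms in \<open>auto simp: mem_F\<close>)

lemma lincomb_closed:
  assumes "p \<in> carrier F" "\<And>w. w \<in> carrier M \<Longrightarrow> f w \<in> carrier V"
  shows "lincomb k V p f \<in> carrier V"
  unfolding lincomb_def using assms by (intro V.finsum_closed) (auto simp: mem_F)

lemma lincomb_cong:
  assumes "p \<in> carrier F" "\<And>w. w \<in> carrier M \<Longrightarrow> f w = g w"
    "\<And>w. w \<in> carrier M \<Longrightarrow> g w \<in> carrier V"
  shows "lincomb k V p f = lincomb k V p g"
  unfolding lincomb_def using assms by (intro V.finsum_cong') (auto simp: mem_F subset_iff)

lemma lincomb_lin:
  assumes f: "\<And>w. w \<in> carrier M \<Longrightarrow> f w \<in> carrier V"
  shows "(\<lambda>p. lincomb k V p f) \<in> lin k F V"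
proof (rule linI)
  fix p q assume p: "p \<in> carrier F" and q: "q \<in> carrier F"
  let ?S = "supp k p \<union> supp k q"
  have S: "finite ?S" "?S \<subseteq> carrier M" using p q by (auto simp: mem_F)
  then have fS: "\<And>w. w \<in> ?S \<Longrightarrow> f w \<in> carrier V" using f by blast
  have "supp k (p \<oplus>\<^sub>F q) \<subseteq> ?S" using p q by (auto simp: supp_def add_F)
  then have "lincomb k V (p \<oplus>\<^sub>F q) f = (\<Oplus>\<^bsub>V\<^esub>w\<in>?S. (p \<oplus>\<^sub>F q) w \<odot>\<^sub>V f w)"
    using p q S fS by (intro lincomb_superset) auto
  also have "\<dots> = (\<Oplus>\<^bsub>V\<^esub>w\<in>?S. p w \<odot>\<^sub>V f w \<oplus>\<^sub>V q w \<odot>\<^sub>V f w)"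
    using p q fS by (intro V.finsum_cong') (auto simp: add_F mem_F V.smult_l_distr)
  also have "\<dots> = (\<Oplus>\<^bsub>V\<^esub>w\<in>?S. p w \<odot>\<^sub>V f w) \<oplus>\<^sub>V (\<Oplus>\<^bsub>V\<^esub>w\<in>?S. q w \<odot>\<^sub>V f w)"
    using p q fS by (intro V.finsum_addf) (auto simp: mem_F)
  also have "\<dots> = lincomb k V p f \<oplus>\<^sub>V lincomb k V q f"
    using lincomb_superset[OF p, of ?S f] lincomb_superset[OF q, of ?S f] S fS by simp
  finally show "lincomb k V (p \<oplus>\<^sub>F q) f = lincomb k V p f \<oplus>\<^sub>V lincomb k V q f" .
next
  fix r p assume r: "r \<in> carrier k" and p: "p \<in> carrier F"
  let ?S = "supp k p"
  have S: "finite ?S" "?S \<subseteq> carrier M" using p by (auto simp: mem_F)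
  then have fS: "\<And>w. w \<in> ?S \<Longrightarrow> f w \<in> carrier V" using f by blast
  have "supp k (r \<odot>\<^sub>F p) \<subseteq> ?S" using p r by (auto simp: supp_def smult_F)
  then have "lincomb k V (r \<odot>\<^sub>F p) f = (\<Oplus>\<^bsub>V\<^esub>w\<in>?S. (r \<odot>\<^sub>F p) w \<odot>\<^sub>V f w)"
    using p r S fS by (intro lincomb_superset) auto
  also have "\<dots> = (\<Oplus>\<^bsub>V\<^esub>w\<in>?S. r \<odot>\<^sub>V (p w \<odot>\<^sub>V f w))"
    using p r fS by (intro V.finsum_cong') (auto simp: smult_F mem_F V.smult_assoc1)
  also have "\<dots> = r \<odot>\<^sub>V lincomb k V p f"
    unfolding lincomb_def using p r fS S by (intro V.finsum_smult_ldistr[symmetric]) (auto simp: mem_F)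
  finally show "lincomb k V (r \<odot>\<^sub>F p) f = r \<odot>\<^sub>V lincomb k V p f" .
qed (use f lincomb_closed in blast)

lemma lincomb_basis:
  assumes "u \<in> carrier M" "f u \<in> carrier V"
  shows "lincomb k V (basis k u) f = f u"
  unfolding lincomb_def supp_basis using assms by (simp add: V.finsum_insert basis_def)

lemma lincomb_fun_lin:
  assumes "p \<in> carrier F" "\<And>w. w \<in> carrier M \<Longrightarrow> (\<lambda>x. f x w) \<in> lin k U V"
  shows "(\<lambda>x. lincomb k V p (f x)) \<in> lin k U V"
proof (rule linI)
  fix x assume x: "x \<in> carrier U"
  show "lincomb k V p (f x) \<in> carrier V"
    using lincomb_closed[OF assms(1)] lin_closed[OF assms(2) x] by blast
next
  fix x y assume x: "x \<in> carrier U" and y: "y \<in> carrier U"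
  note c = lin_closed[OF assms(2) x] lin_closed[OF assms(2) y]
  have S: "finite (supp k p)" "\<And>w. w \<in> supp k p \<Longrightarrow> w \<in> carrier M" "\<And>w. p w \<in> carrier k"
    using assms(1) by (auto simp: mem_F)
  have "lincomb k V p (f (x \<oplus>\<^sub>U y)) = (\<Oplus>\<^bsub>V\<^esub>w\<in>supp k p. p w \<odot>\<^sub>V f x w \<oplus>\<^sub>V p w \<odot>\<^sub>V f y w)"
    unfolding lincomb_def using S c
    by (intro V.finsum_cong') (auto simp: lin_add[OF assms(2) x y] V.smult_r_distr)
  also have "\<dots> = lincomb k V p (f x) \<oplus>\<^sub>V lincomb k V p (f y)"
    unfolding lincomb_def using S c by (intro V.finsum_addf) auto
  finally show "lincomb k V p (f (x \<oplus>\<^sub>U y)) = lincomb k V p (f x) \<oplus>\<^sub>V lincomb k V p (f y)" .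
next
  fix r x assume r: "r \<in> carrier k" and x: "x \<in> carrier U"
  note c = lin_closed[OF assms(2) x]
  have S: "finite (supp k p)" "\<And>w. w \<in> supp k p \<Longrightarrow> w \<in> carrier M" "\<And>w. p w \<in> carrier k"
    using assms(1) by (auto simp: mem_F)
  have "lincomb k V p (f (r \<odot>\<^sub>U x)) = (\<Oplus>\<^bsub>V\<^esub>w\<in>supp k p. r \<odot>\<^sub>V (p w \<odot>\<^sub>V f x w))"
    unfolding lincomb_def using S c r
    by (intro V.finsum_cong') (auto simp: lin_smult[OF assms(2) r x] V.smult_assoc1[symmetric] m_comm)
  also have "\<dots> = r \<odot>\<^sub>V lincomb k V p (f x)"
    unfolding lincomb_def using S c r by (intro V.finsum_smult_ldistr[symmetric]) auto
  finally show "lincomb k V p (f (r \<odot>\<^sub>U x)) = r \<odot>\<^sub>V lincomb k V p (f x)" .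
qed

lemma lin_eq_lincomb:
  assumes g: "g \<in> lin k F V" and p: "p \<in> carrier F"
  shows "g p = lincomb k V p (\<lambda>w. g (basis k w))"
proof -
  have c: "\<And>w. w \<in> carrier M \<Longrightarrow> g (basis k w) \<in> carrier V"
    using lin_closed[OF g basis_mem] .
  have L: "(\<lambda>p. lincomb k V p (\<lambda>w. g (basis k w))) \<in> lin k F V"
    by (rule lincomb_lin) (rule c)
  from p show ?thesis
  proof (induction p rule: mon_alg_induct)
    case zero
    then show ?case using lin_zero[OF module_F V g] lin_zero[OF module_F V L] by simp
  next
    case (basis w r)
    then show ?case using lin_smult[OF g, of r "basis k w"] lin_smult[OF L, of r "basis k w"]
      by (simp add: lincomb_basis c basis_mem)
  next
    case (add p q)
    then show ?case using lin_add[OF g] lin_add[OF L] by simp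
  qed
qed

end

lemma lin_lincomb:
  assumes "module k V" "module k W" "g \<in> lin k V W" "p \<in> carrier F"
    "\<And>w. w \<in> carrier M \<Longrightarrow> f w \<in> carrier V"
  shows "g (lincomb k V p f) = lincomb k W p (\<lambda>w. g (f w))"
proof -
  interpret V: module k V by fact
  interpret W: module k W by fact
  have S: "\<And>w. w \<in> supp k p \<Longrightarrow> w \<in> carrier M" "\<And>w. p w \<in> carrier k"
    using assms(4) by (auto simp: mem_F)
  have "g (lincomb k V p f) = (\<Oplus>\<^bsub>W\<^esub>w\<in>supp k p. g (p w \<odot>\<^sub>V f w))"
    unfolding lincomb_def by (rule lin_finsum[OF assms(1-3)]) (use S assms(5) in auto)
  also have "\<dots> = lincomb k W p (\<lambda>w. g (f w))"
    unfolding lincomb_def using S assms(5) lin_closed[OF assms(3)]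
    by (intro W.finsum_cong') (auto simp: lin_smult[OF assms(3)])
  finally show ?thesis .
qed

text \<open>
  The product as an iterated linear extension: its bilinearity and associativity then follow from
  general facts on linear extensions, without manipulation of double sums.
\<close>

lemma mult_F: "(p \<otimes>\<^sub>F q) w = lincomb k (scalars k) p (\<lambda>u. lincomb k (scalars k) q (\<lambda>v. basis k w (u \<otimes>\<^sub>M v)))"
  if "p \<in> carrier F" "q \<in> carrier F"
proof -
  interpret K: unital_algebra k "scalars k" by (rule scalars_unital_algebra)
  have S: "\<And>w. p w \<in> carrier k" "\<And>w. q w \<in> carrier k" "finite (supp k q)" using that by (auto simp: mem_F)
  have fs: "finsum (scalars k) = finsum k"
    by (intro ext) (simp add: finsum_def finprod_def scalars_def)
  have "(p \<otimes>\<^sub>F q) w = (\<Oplus>\<^bsub>k\<^esub>u\<in>supp k p. \<Oplus>\<^bsub>k\<^esub>v\<in>supp k q. p u \<otimes>\<^sub>k (q v \<otimes>\<^sub>k basis k w (u \<otimes>\<^sub>M v)))"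
    using S by (auto simp: mon_alg_def basis_def intro!: finsum_cong' finsum_closed)
  also have "\<dots> = (\<Oplus>\<^bsub>k\<^esub>u\<in>supp k p. p u \<otimes>\<^sub>k (\<Oplus>\<^bsub>k\<^esub>v\<in>supp k q. q v \<otimes>\<^sub>k basis k w (u \<otimes>\<^sub>M v)))"
    using S by (intro finsum_cong') (auto simp: finsum_rdistr basis_def intro!: finsum_closed)
  also have "\<dots> = lincomb k (scalars k) p (\<lambda>u. lincomb k (scalars k) q (\<lambda>v. basis k w (u \<otimes>\<^sub>M v)))"
    unfolding lincomb_def fs by (simp add: scalars_def)
  finally show ?thesis .
qed

end

context monoid_algebra
begin

lemma mult_F_closed:
  assumes p: "p \<in> carrier F" and q: "q \<in> carrier F"
  shows "p \<otimes>\<^sub>F q \<in> carrier F"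
proof -
  interpret K: unital_algebra k "scalars k" by (rule scalars_unital_algebra)
  let ?S = "(\<lambda>(u, v). u \<otimes>\<^sub>M v) ` (supp k p \<times> supp k q)"
  have pq: "finite (supp k p)" "finite (supp k q)" "supp k p \<subseteq> carrier M" "supp k q \<subseteq> carrier M"
    "\<And>w. p w \<in> carrier k" "\<And>w. q w \<in> carrier k" using p q by (auto simp: mem_F)
  have "(p \<otimes>\<^sub>F q) w \<in> carrier k" for w
  proof -
    have "(p \<otimes>\<^sub>F q) w \<in> carrier (scalars k)"
      unfolding mult_F[OF p q] using p q
      by (intro lincomb_closed K.module_axioms) (auto simp: scalars_def basis_def)
    then show ?thesis by (simp add: scalars_def)
  qed
  moreover have "(p \<otimes>\<^sub>F q) w = \<zero>\<^sub>k" if "w \<notin> ?S" for w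
  proof -
    have "(\<Oplus>\<^bsub>k\<^esub>v\<in>supp k q. if u \<otimes>\<^sub>M v = w then p u \<otimes>\<^sub>k q v else \<zero>\<^sub>k) = \<zero>\<^sub>k" if "u \<in> supp k p" for u
    proof -
      have "(\<Oplus>\<^bsub>k\<^esub>v\<in>supp k q. if u \<otimes>\<^sub>M v = w then p u \<otimes>\<^sub>k q v else \<zero>\<^sub>k) = (\<Oplus>\<^bsub>k\<^esub>v\<in>supp k q. \<zero>\<^sub>k)"
        using \<open>w \<notin> ?S\<close> that by (intro finsum_cong') auto
      then show ?thesis by simp
    qed
    then have "(\<Oplus>\<^bsub>k\<^esub>u\<in>supp k p. \<Oplus>\<^bsub>k\<^esub>v\<in>supp k q. if u \<otimes>\<^sub>M v = w then p u \<otimes>\<^sub>k q v else \<zero>\<^sub>k)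
      = (\<Oplus>\<^bsub>k\<^esub>u\<in>supp k p. \<zero>\<^sub>k)"
      by (intro finsum_cong') auto
    then show ?thesis by (simp add: mon_alg_def)
  qed
  then have s: "supp k (p \<otimes>\<^sub>F q) \<subseteq> ?S" unfolding supp_def[of k "p \<otimes>\<^sub>F q"] by blast
  moreover have "finite (supp k (p \<otimes>\<^sub>F q))" using finite_subset[OF s] pq by blast
  moreover have "?S \<subseteq> carrier M" using pq by auto
  ultimately show ?thesis unfolding mem_F by blast
qed

lemma mult_F_lin_left:
  assumes q: "q \<in> carrier F"
  shows "(\<lambda>p. p \<otimes>\<^sub>F q) \<in> lin k F F"
proof -
  interpret K: unital_algebra k "scalars k" by (rule scalars_unital_algebra)
  have L: "(\<lambda>p. lincomb k (scalars k) p (\<lambda>u. lincomb k (scalars k) q (\<lambda>v. basis k w (u \<otimes>\<^sub>M v))))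
      \<in> lin k F (scalars k)" for w
    by (intro lincomb_lin K.module_axioms lincomb_closed q) (auto simp: scalars_def basis_def)
  show ?thesis
  proof (rule linI)
    fix x y assume "x \<in> carrier F" "y \<in> carrier F"
    then show "(x \<oplus>\<^sub>F y) \<otimes>\<^sub>F q = x \<otimes>\<^sub>F q \<oplus>\<^sub>F y \<otimes>\<^sub>F q"
      by (intro ext) (simp add: add_F[of "x \<otimes>\<^sub>F q"] mult_F q lin_add[OF L], simp add: scalars_def)
  next
    fix r x assume "r \<in> carrier k" "x \<in> carrier F"
    then show "(r \<odot>\<^sub>F x) \<otimes>\<^sub>F q = r \<odot>\<^sub>F (x \<otimes>\<^sub>F q)"
      by (intro ext) (simp add: smult_F[of r "x \<otimes>\<^sub>F q"] mult_F q lin_smult[OF L], simp add: scalars_def)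
  qed (simp add: mult_F_closed q)
qed

lemma mult_F_lin_right:
  assumes p: "p \<in> carrier F"
  shows "(\<lambda>q. p \<otimes>\<^sub>F q) \<in> lin k F F"
proof -
  interpret K: unital_algebra k "scalars k" by (rule scalars_unital_algebra)
  have L: "(\<lambda>q. lincomb k (scalars k) p (\<lambda>u. lincomb k (scalars k) q (\<lambda>v. basis k w (u \<otimes>\<^sub>M v))))
      \<in> lin k F (scalars k)" for w
    by (intro lincomb_fun_lin lincomb_lin K.module_axioms p) (auto simp: scalars_def basis_def)
  show ?thesis
  proof (rule linI)
    fix x y assume "x \<in> carrier F" "y \<in> carrier F"
    then show "p \<otimes>\<^sub>F (x \<oplus>\<^sub>F y) = p \<otimes>\<^sub>F x \<oplus>\<^sub>F p \<otimes>\<^sub>F y"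
      by (intro ext) (simp add: add_F[of "p \<otimes>\<^sub>F x"] mult_F p lin_add[OF L], simp add: scalars_def)
  next
    fix r x assume "r \<in> carrier k" "x \<in> carrier F"
    then show "p \<otimes>\<^sub>F (r \<odot>\<^sub>F x) = r \<odot>\<^sub>F (p \<otimes>\<^sub>F x)"
      by (intro ext) (simp add: smult_F[of r "p \<otimes>\<^sub>F x"] mult_F p lin_smult[OF L], simp add: scalars_def)
  qed (simp add: mult_F_closed p)
qed

lemma basis_mult:
  assumes "u \<in> carrier M" "v \<in> carrier M"
  shows "basis k u \<otimes>\<^sub>F basis k v = basis k (u \<otimes>\<^sub>M v)"
proof -
  interpret K: unital_algebra k "scalars k" by (rule scalars_unital_algebra)
  have c: "\<And>u w. basis k w u \<in> carrier (scalars k)" by (auto simp: scalars_def basis_def)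
  have "(basis k u \<otimes>\<^sub>F basis k v) w = basis k w (u \<otimes>\<^sub>M v)" for w
    using assms by (simp add: mult_F basis_mem lincomb_basis[OF K.module_axioms] c)
  then show ?thesis by (auto simp: basis_def)
qed

text \<open>
  Used in one variable at a time, this reduces the algebra laws of the monoid algebra to its basis,
  where they are laws of the monoid.
\<close>

lemma lin_eqI:
  assumes "module k V" "f \<in> lin k F V" "g \<in> lin k F V" "p \<in> carrier F"
    "\<And>w. w \<in> carrier M \<Longrightarrow> f (basis k w) = g (basis k w)"
  shows "f p = g p"
proof -
  have "lincomb k V p (\<lambda>w. f (basis k w)) = lincomb k V p (\<lambda>w. g (basis k w))"
    using assms lin_closed[OF assms(3) basis_mem] by (intro lincomb_cong) auto
  then show ?thesis using assms by (simp add: lin_eq_lincomb[symmetric])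
qed

lemma unital_algebra_F: "unital_algebra k F"
proof -
  note linear = mult_F_lin_left mult_F_lin_right mult_F_closed lin_comp[OF mult_F_lin_left]
    lin_comp[OF mult_F_lin_right]
  have "x \<otimes>\<^sub>F y \<otimes>\<^sub>F z = x \<otimes>\<^sub>F (y \<otimes>\<^sub>F z)"
    if xyz: "x \<in> carrier F" "y \<in> carrier F" "z \<in> carrier F" for x y z
  proof (rule lin_eqI[OF module_F _ _ xyz(1)])
    fix u assume u: "u \<in> carrier M"
    show "basis k u \<otimes>\<^sub>F y \<otimes>\<^sub>F z = basis k u \<otimes>\<^sub>F (y \<otimes>\<^sub>F z)"
    proof (rule lin_eqI[OF module_F _ _ xyz(2)])
      fix v assume v: "v \<in> carrier M"
      show "basis k u \<otimes>\<^sub>F basis k v \<otimes>\<^sub>F z = basis k u \<otimes>\<^sub>F (basis k v \<otimes>\<^sub>F z)"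
        by (rule lin_eqI[OF module_F _ _ xyz(3)])
      (use u v in \<open>simp_all add: basis_mult basis_mem linear M.m_assoc\<close>)
    qed (use u xyz in \<open>simp_all add: basis_mem linear\<close>)
  qed (use xyz in \<open>simp_all add: linear\<close>)
  moreover have "\<one>\<^sub>F \<otimes>\<^sub>F x = x" "x \<otimes>\<^sub>F \<one>\<^sub>F = x" if x: "x \<in> carrier F" for x
    by (rule lin_eqI[OF module_F _ _ x], simp_all add: one_F basis_mem basis_mult linear lin_id)+
  ultimately have "monoid F"
    by (intro monoidI) (auto simp: mult_F_closed one_F basis_mem)
  then have "ring F"
    by (intro ringI abelian_group_F) (auto simp: lin_add[OF mult_F_lin_left] lin_add[OF mult_F_lin_right])
  moreover have "unital_algebra_axioms k F"
    by unfold_locales (auto simp: lin_smult[OF mult_F_lin_left] lin_smult[OF mult_F_lin_right])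
  ultimately show ?thesis
    by (intro unital_algebra.intro field_axioms module_F)
qed

lemma lincomb_mult:
  assumes V: "module k V" and p: "p \<in> carrier F" and q: "q \<in> carrier F"
    and f: "\<And>w. w \<in> carrier M \<Longrightarrow> f w \<in> carrier V"
  shows "lincomb k V (p \<otimes>\<^sub>F q) f = lincomb k V p (\<lambda>u. lincomb k V q (\<lambda>v. f (u \<otimes>\<^sub>M v)))"
proof -
  have L: "(\<lambda>p. lincomb k V p f) \<in> lin k F V" by (rule lincomb_lin[OF V]) (rule f)
  have "lincomb k V (p \<otimes>\<^sub>F q) f = lincomb k V p (\<lambda>u. lincomb k V (basis k u \<otimes>\<^sub>F q) f)"
    by (rule lin_eq_lincomb[OF V lin_comp[OF L mult_F_lin_left[OF q]] p])
  also have "\<dots> = lincomb k V p (\<lambda>u. lincomb k V q (\<lambda>v. f (u \<otimes>\<^sub>M v)))"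
  proof (rule lincomb_cong[OF V p])
    fix u assume u: "u \<in> carrier M"
    have "lincomb k V (basis k u \<otimes>\<^sub>F q) f = lincomb k V q (\<lambda>v. lincomb k V (basis k u \<otimes>\<^sub>F basis k v) f)"
      by (rule lin_eq_lincomb[OF V lin_comp[OF L mult_F_lin_right[OF basis_mem[OF u]]] q])
    also have "\<dots> = lincomb k V q (\<lambda>v. f (u \<otimes>\<^sub>M v))"
      by (rule lincomb_cong[OF V q]) (use u f in \<open>simp_all add: basis_mult lincomb_basis[OF V]\<close>)
    finally show "lincomb k V (basis k u \<otimes>\<^sub>F q) f = lincomb k V q (\<lambda>v. f (u \<otimes>\<^sub>M v))" .
    show "lincomb k V q (\<lambda>v. f (u \<otimes>\<^sub>M v)) \<in> carrier V"
      by (rule lincomb_closed[OF V q]) (use u f in simp)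
  qed
  finally show ?thesis .
qed

end

section \<open>Quotient algebras\<close>

lemma unital_algebra_image:
  assumes A: "unital_algebra k A"
    and car: "carrier Q = h ` carrier A"
    and add: "\<And>x y. \<lbrakk>x \<in> carrier A; y \<in> carrier A\<rbrakk> \<Longrightarrow> h x \<oplus>\<^sub>Q h y = h (x \<oplus>\<^sub>A y)"
    and mult: "\<And>x y. \<lbrakk>x \<in> carrier A; y \<in> carrier A\<rbrakk> \<Longrightarrow> h x \<otimes>\<^sub>Q h y = h (x \<otimes>\<^sub>A y)"
    and one: "\<one>\<^sub>Q = h \<one>\<^sub>A" and zero: "\<zero>\<^sub>Q = h \<zero>\<^sub>A"
    and smult: "\<And>r x. \<lbrakk>r \<in> carrier k; x \<in> carrier A\<rbrakk> \<Longrightarrow> r \<odot>\<^sub>Q h x = h (r \<odot>\<^sub>A x)"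
  shows "unital_algebra k Q"
proof -
  interpret A: unital_algebra k A by fact
  have ag: "abelian_group Q"
  proof (rule abelian_groupI)
    fix x assume "x \<in> carrier Q"
    then obtain a where a: "a \<in> carrier A" "x = h a" by (auto simp: car)
    then have "h (\<ominus>\<^sub>A a) \<oplus>\<^sub>Q x = \<zero>\<^sub>Q" by (simp add: add zero A.l_neg)
    then show "\<exists>y\<in>carrier Q. y \<oplus>\<^sub>Q x = \<zero>\<^sub>Q" using a by (auto simp: car)
  qed (auto simp: car add zero A.a_ac)
  have "monoid Q" by (rule monoidI) (auto simp: car mult one A.m_assoc)
  then have "ring Q" by (intro ringI ag) (auto simp: car mult add A.l_distr A.r_distr)
  moreover have "module k Q"
    by (rule moduleI) (use ag in \<open>auto simp: car add smult A.smult_l_distr A.smult_r_distr A.smult_assoc1 A.is_cring\<close>)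
  moreover have "unital_algebra_axioms k Q"
    by unfold_locales (auto simp: car smult mult A.smult_mult_left A.smult_mult_right)
  ultimately show ?thesis
    by (intro unital_algebra.intro A.field_axioms)
qed

lemma quot_alg_sel:
  "carrier (quot_alg A I) = a_rcosets\<^bsub>A\<^esub> I"
  "X \<oplus>\<^bsub>quot_alg A I\<^esub> Y = X <+>\<^bsub>A\<^esub> Y"
  "X \<otimes>\<^bsub>quot_alg A I\<^esub> Y = rcoset_mult A I X Y"
  "\<one>\<^bsub>quot_alg A I\<^esub> = I +>\<^bsub>A\<^esub> \<one>\<^sub>A"
  "\<zero>\<^bsub>quot_alg A I\<^esub> = I"
  "r \<odot>\<^bsub>quot_alg A I\<^esub> X = (\<Union>x\<in>X. I +>\<^bsub>A\<^esub> (r \<odot>\<^sub>A x))"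
  by (simp_all add: quot_alg_def ring.extend_def module.fields_def FactRing_def)

text \<open>
  Evaluation at an arbitrary representative of a coset, which is also how \<open>tlift\<close> is defined. It is
  the induced map on the quotient if \<open>g\<close> vanishes on the ideal (\<open>induced_coset\<close>).
\<close>

definition induced :: "('a \<Rightarrow> 'b) \<Rightarrow> 'a set \<Rightarrow> 'b"
  where "induced g X = g (SOME x. x \<in> X)"

context unital_algebra
begin

lemma ideal_smult:
  assumes "ideal I A" "r \<in> carrier k" "x \<in> I"
  shows "r \<odot>\<^sub>A x \<in> I"
proof -
  interpret I: ideal I A by fact
  have "r \<odot>\<^sub>A x = (r \<odot>\<^sub>A \<one>\<^sub>A) \<otimes>\<^sub>A x" using assms I.a_Hcarr by (simp add: smult_mult_left)
  then show ?thesis using I.I_l_closed[of x "r \<odot>\<^sub>A \<one>\<^sub>A"] assms by simp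
qed

lemma quot_facts:
  assumes I: "ideal I A"
  shows quot_unital_algebra: "unital_algebra k (quot_alg A I)"
    and coset_alg_hom: "(\<lambda>x. I +>\<^bsub>A\<^esub> x) \<in> alg_hom k A (quot_alg A I)"
    and coset_surj: "carrier (quot_alg A I) = (\<lambda>x. I +>\<^bsub>A\<^esub> x) ` carrier A"
proof -
  interpret I: ideal I A by fact
  show car: "carrier (quot_alg A I) = (\<lambda>x. I +>\<^bsub>A\<^esub> x) ` carrier A"
    by (auto simp: quot_alg_sel A_RCOSETS_def')
  have add: "(I +>\<^bsub>A\<^esub> x) \<oplus>\<^bsub>quot_alg A I\<^esub> (I +>\<^bsub>A\<^esub> y) = I +>\<^bsub>A\<^esub> (x \<oplus>\<^sub>A y)" if "x \<in> carrier A" "y \<in> carrier A" for x y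
    using that by (simp add: quot_alg_sel I.a_rcos_sum)
  have mult: "(I +>\<^bsub>A\<^esub> x) \<otimes>\<^bsub>quot_alg A I\<^esub> (I +>\<^bsub>A\<^esub> y) = I +>\<^bsub>A\<^esub> (x \<otimes>\<^sub>A y)" if "x \<in> carrier A" "y \<in> carrier A" for x y
    using that by (simp add: quot_alg_sel I.rcoset_mult_add)
  have smult: "r \<odot>\<^bsub>quot_alg A I\<^esub> (I +>\<^bsub>A\<^esub> x) = I +>\<^bsub>A\<^esub> (r \<odot>\<^sub>A x)" if "r \<in> carrier k" "x \<in> carrier A" for r x
  proof -
    have "I +>\<^bsub>A\<^esub> (r \<odot>\<^sub>A y) = I +>\<^bsub>A\<^esub> (r \<odot>\<^sub>A x)" if "y \<in> I +>\<^bsub>A\<^esub> x" for y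
    proof -
      from that obtain i where i: "i \<in> I" "y = i \<oplus>\<^sub>A x" by (auto simp: a_r_coset_def')
      then have "r \<odot>\<^sub>A y = r \<odot>\<^sub>A i \<oplus>\<^sub>A r \<odot>\<^sub>A x"
        using \<open>r \<in> carrier k\<close> \<open>x \<in> carrier A\<close> I.a_Hcarr by (simp add: smult_r_distr)
      moreover have "r \<odot>\<^sub>A i \<in> I" using ideal_smult[OF I] i \<open>r \<in> carrier k\<close> by blast
      ultimately have "r \<odot>\<^sub>A y \<in> I +>\<^bsub>A\<^esub> (r \<odot>\<^sub>A x)" by (auto simp: a_r_coset_def')
      then show ?thesis
        using I.a_repr_independence' \<open>r \<in> carrier k\<close> \<open>x \<in> carrier A\<close> by (metis smult_closed)
    qed
    moreover have "I +>\<^bsub>A\<^esub> x \<noteq> {}" using that I.a_rcos_self by blast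
    ultimately show ?thesis unfolding quot_alg_sel by (intro SUP_eq_const)
  qed
  have one: "\<one>\<^bsub>quot_alg A I\<^esub> = I +>\<^bsub>A\<^esub> \<one>\<^sub>A" and zero: "\<zero>\<^bsub>quot_alg A I\<^esub> = I +>\<^bsub>A\<^esub> \<zero>\<^sub>A"
    using I.a_subset by (simp_all add: quot_alg_sel)
  show "unital_algebra k (quot_alg A I)"
    by (rule unital_algebra_image[OF unital_algebra_axioms car add mult one zero smult])
  show "(\<lambda>x. I +>\<^bsub>A\<^esub> x) \<in> alg_hom k A (quot_alg A I)"
    using car by (auto simp: alg_hom_def add mult one smult intro!: ring_hom_memI)
qed

lemma coset_eq_iff:
  assumes "ideal I A" "x \<in> carrier A" "y \<in> carrier A"
  shows "I +>\<^bsub>A\<^esub> x = I +>\<^bsub>A\<^esub> y \<longleftrightarrow> x \<ominus>\<^sub>A y \<in> I"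
proof -
  interpret I: ideal I A by fact
  show ?thesis using assms I.a_rcos_module_minus[OF ring_axioms] I.a_repr_independence' I.a_rcos_self
    by metis
qed

lemma induced_coset:
  assumes I: "ideal I A" and V: "module k V" and g: "g \<in> lin k A V"
    and g0: "\<And>x. x \<in> I \<Longrightarrow> g x = \<zero>\<^sub>V" and x: "x \<in> carrier A"
  shows "induced g (I +>\<^bsub>A\<^esub> x) = g x"
proof -
  interpret I: ideal I A by fact
  interpret V: module k V by fact
  have "x \<in> I +>\<^bsub>A\<^esub> x" using x by (rule I.a_rcos_self)
  then have "(SOME y. y \<in> I +>\<^bsub>A\<^esub> x) \<in> I +>\<^bsub>A\<^esub> x" by (rule someI)
  then obtain i where i: "i \<in> I" "(SOME y. y \<in> I +>\<^bsub>A\<^esub> x) = i \<oplus>\<^sub>A x" by (auto simp: a_r_coset_def')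
  then show ?thesis
    using x lin_closed[OF g x] by (simp add: induced_def lin_add[OF g I.a_Hcarr] g0)
qed

lemma induced_lin:
  assumes I: "ideal I A" and V: "module k V" and g: "g \<in> lin k A V"
    and g0: "\<And>x. x \<in> I \<Longrightarrow> g x = \<zero>\<^sub>V"
  shows "induced g \<in> lin k (quot_alg A I) V"
proof -
  note h = coset_alg_hom[OF I]
  note c = induced_coset[OF I V g g0]
  note hl = alg_hom_lin[OF h]
  show ?thesis
    by (rule linI) (auto simp: coset_surj[OF I] c lin_closed[OF g] lin_add[OF g] lin_smult[OF g]
      simp flip: lin_add[OF hl] lin_smult[OF hl])
qed

lemma induced_alg_hom:
  assumes I: "ideal I A" and B: "unital_algebra k B" and g: "g \<in> alg_hom k A B"
    and g0: "\<And>x. x \<in> I \<Longrightarrow> g x = \<zero>\<^sub>B"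
  shows "induced g \<in> alg_hom k (quot_alg A I) B"
proof -
  interpret B: unital_algebra k B by fact
  note h = coset_alg_hom[OF I]
  have hr: "(\<lambda>x. I +>\<^bsub>A\<^esub> x) \<in> ring_hom A (quot_alg A I)" and gr: "g \<in> ring_hom A B"
    using h g by (auto simp: alg_hom_def)
  note c = induced_coset[OF I B.module_axioms alg_hom_lin[OF g] g0]
  note l = induced_lin[OF I B.module_axioms alg_hom_lin[OF g] g0]
  have "induced g (X \<otimes>\<^bsub>quot_alg A I\<^esub> Y) = induced g X \<otimes>\<^sub>B induced g Y"
    if "X \<in> carrier (quot_alg A I)" "Y \<in> carrier (quot_alg A I)" for X Y
    using that by (auto simp: coset_surj[OF I] c ring_hom_mult[OF gr] simp flip: ring_hom_mult[OF hr])
  moreover have "induced g \<one>\<^bsub>quot_alg A I\<^esub> = \<one>\<^sub>B"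
    using c[of "\<one>\<^sub>A"] by (simp add: quot_alg_sel ring_hom_one[OF gr])
  ultimately show ?thesis using l
    by (auto simp: alg_hom_def lin_def intro!: ring_hom_memI)
qed

end

section \<open>Tensor powers and Sweedler notation\<close>

definition multilin ::
  "('k, 'm) ring_scheme \<Rightarrow> ('k, 'a, 'x) module_scheme \<Rightarrow> ('k, 'v, 'y) module_scheme \<Rightarrow> nat
    \<Rightarrow> ('a list \<Rightarrow> 'v) \<Rightarrow> bool"
  where "multilin k A V n f \<longleftrightarrow>
    (\<forall>w. length w = n \<and> set w \<subseteq> carrier A \<longrightarrow> f w \<in> carrier V) \<and>
    (\<forall>us vs. length us + length vs + 1 = n \<and> set us \<subseteq> carrier A \<and> set vs \<subseteq> carrier A \<longrightarrow>
      (\<lambda>a. f (us @ a # vs)) \<in> lin k A V)"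

lemma multilinD:
  assumes "multilin k A V n f"
  shows "\<lbrakk>length w = n; set w \<subseteq> carrier A\<rbrakk> \<Longrightarrow> f w \<in> carrier V"
    and "\<lbrakk>length us + length vs + 1 = n; set us \<subseteq> carrier A; set vs \<subseteq> carrier A\<rbrakk> \<Longrightarrow>
      (\<lambda>a. f (us @ a # vs)) \<in> lin k A V"
  using assms by (auto simp: multilin_def)

lemma tlift_eq_lincomb: "tlift k V t f = lincomb k V (SOME p. p \<in> t) f"
  by (simp add: tlift_def lincomb_def Let_def)

lemma tlift_eq_induced: "tlift k V t f = induced (\<lambda>p. lincomb k V p f) t"
  by (simp add: tlift_eq_lincomb induced_def)

context unital_algebra
begin

abbreviation "FT n \<equiv> formal_tensors k A n"
abbreviation "TI n \<equiv> tensor_ideal k A n"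

lemma list_monoid_sel:
  "carrier (list_monoid A n) = {w. length w = n \<and> set w \<subseteq> carrier A}"
  "u \<otimes>\<^bsub>list_monoid A n\<^esub> v = map2 (mult A) u v"
  "\<one>\<^bsub>list_monoid A n\<^esub> = replicate n \<one>\<^sub>A"
  by (simp_all add: list_monoid_def)

lemma map2_mult_closed:
  "\<lbrakk>set u \<subseteq> carrier A; set v \<subseteq> carrier A\<rbrakk> \<Longrightarrow> set (map2 (mult A) u v) \<subseteq> carrier A"
  by (clarsimp simp: subset_iff) (blast intro: A.m_closed dest: set_zip_leftD set_zip_rightD)

lemma monoid_list_monoid: "monoid (list_monoid A n)"
proof (rule monoidI)
  fix x y z assume "x \<in> carrier (list_monoid A n)" "y \<in> carrier (list_monoid A n)" "z \<in> carrier (list_monoid A n)"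
  then show "x \<otimes>\<^bsub>list_monoid A n\<^esub> y \<otimes>\<^bsub>list_monoid A n\<^esub> z = x \<otimes>\<^bsub>list_monoid A n\<^esub> (y \<otimes>\<^bsub>list_monoid A n\<^esub> z)"
    by (intro nth_equalityI) (auto simp: list_monoid_sel subset_iff A.m_assoc)
next
  fix x assume x: "x \<in> carrier (list_monoid A n)"
  then show "\<one>\<^bsub>list_monoid A n\<^esub> \<otimes>\<^bsub>list_monoid A n\<^esub> x = x"
    by (intro nth_equalityI) (auto simp: list_monoid_sel subset_iff)
  show "x \<otimes>\<^bsub>list_monoid A n\<^esub> \<one>\<^bsub>list_monoid A n\<^esub> = x"
    using x by (intro nth_equalityI) (auto simp: list_monoid_sel subset_iff)
qed (simp_all add: list_monoid_sel map2_mult_closed[simplified] set_replicate_conv_if)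

lemma monoid_algebra_lists: "monoid_algebra k (list_monoid A n)"
  by (intro monoid_algebra.intro field_axioms monoid_list_monoid)

lemma formal_tensors_algebra: "unital_algebra k (FT n)"
  unfolding formal_tensors_def by (rule monoid_algebra.unital_algebra_F[OF monoid_algebra_lists])

lemma multilin_mult:
  assumes f: "multilin k A V n f" and u: "length u = n" "set u \<subseteq> carrier A"
  shows "multilin k A V n (\<lambda>w. f (map2 (mult A) u w))"
    and "multilin k A V n (\<lambda>w. f (map2 (mult A) w u))"
proof -
  have l: "(\<lambda>a. c \<otimes>\<^sub>A a) \<in> lin k A A" "(\<lambda>a. a \<otimes>\<^sub>A c) \<in> lin k A A" if "c \<in> carrier A" for c
    using that by (auto intro!: linI simp: A.l_distr A.r_distr smult_mult_left smult_mult_right)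
  have u_split: "\<exists>u1 b u2. u = u1 @ b # u2 \<and> length u1 = m \<and> set u1 \<subseteq> carrier A \<and> b \<in> carrier A \<and> set u2 \<subseteq> carrier A"
    if "m < n" for m
  proof -
    have "u = take m u @ u ! m # drop (Suc m) u" using that u id_take_nth_drop[of m u] by simp
    then show ?thesis
      using that u by (intro exI[of _ "take m u"] exI[of _ "u ! m"] exI[of _ "drop (Suc m) u"])
      (auto dest!: in_set_takeD in_set_dropD)
  qed
  show "multilin k A V n (\<lambda>w. f (map2 (mult A) u w))"
    unfolding multilin_def
  proof (intro conjI allI impI)
    fix us vs assume h: "length us + length vs + 1 = n \<and> set us \<subseteq> carrier A \<and> set vs \<subseteq> carrier A"
    then obtain u1 b u2 where *: "u = u1 @ b # u2" "length u1 = length us" "set u1 \<subseteq> carrier A" "b \<in> carrier A" "set u2 \<subseteq> carrier A"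
      using u_split[of "length us"] by auto
    have "(\<lambda>a. f (map2 (mult A) u1 us @ a # map2 (mult A) u2 vs)) \<in> lin k A V"
      using h * u by (intro multilinD(2)[OF f] map2_mult_closed) auto
    from lin_comp[OF this l(1)[OF *(4)]]
    show "(\<lambda>a. f (map2 (mult A) u (us @ a # vs))) \<in> lin k A V"
      using * by simp
  qed (simp add: u multilinD(1)[OF f] map2_mult_closed[simplified])
  show "multilin k A V n (\<lambda>w. f (map2 (mult A) w u))"
    unfolding multilin_def
  proof (intro conjI allI impI)
    fix us vs assume h: "length us + length vs + 1 = n \<and> set us \<subseteq> carrier A \<and> set vs \<subseteq> carrier A"
    then obtain u1 b u2 where *: "u = u1 @ b # u2" "length u1 = length us" "set u1 \<subseteq> carrier A" "b \<in> carrier A" "set u2 \<subseteq> carrier A"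
      using u_split[of "length us"] by auto
    have "(\<lambda>a. f (map2 (mult A) us u1 @ a # map2 (mult A) vs u2)) \<in> lin k A V"
      using h * u by (intro multilinD(2)[OF f] map2_mult_closed) auto
    from lin_comp[OF this l(2)[OF *(4)]]
    show "(\<lambda>a. f (map2 (mult A) (us @ a # vs) u)) \<in> lin k A V"
      using * by simp
  qed (simp add: u multilinD(1)[OF f] map2_mult_closed[simplified])
qed

lemma multilinear_rels_cases [consumes 1, case_names add smult]:
  assumes "p \<in> multilinear_rels k A n"
  obtains us a b vs where "p = basis k (us @ (a \<oplus>\<^sub>A b) # vs)
      \<ominus>\<^bsub>FT n\<^esub> (basis k (us @ a # vs) \<oplus>\<^bsub>FT n\<^esub> basis k (us @ b # vs))"
      "a \<in> carrier A" "b \<in> carrier A" "set us \<subseteq> carrier A" "set vs \<subseteq> carrier A" "length us + length vs + 1 = n"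
  | us r a vs where "p = basis k (us @ (r \<odot>\<^sub>A a) # vs)
      \<ominus>\<^bsub>FT n\<^esub> r \<odot>\<^bsub>FT n\<^esub> basis k (us @ a # vs)"
      "r \<in> carrier k" "a \<in> carrier A" "set us \<subseteq> carrier A" "set vs \<subseteq> carrier A" "length us + length vs + 1 = n"
  using assms unfolding multilinear_rels_def Let_def by blast

lemma multilinear_rels_closed: "multilinear_rels k A n \<subseteq> carrier (FT n)"
proof
  interpret MA: monoid_algebra k "list_monoid A n" by (rule monoid_algebra_lists)
  interpret FT: unital_algebra k "mon_alg k (list_monoid A n)" by (rule MA.unital_algebra_F)
  have b: "basis k w \<in> carrier MA.F" if "length w = n" "set w \<subseteq> carrier A" for w
    using that by (simp add: MA.basis_mem list_monoid_sel)
  fix p assume "p \<in> multilinear_rels k A n"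
  then show "p \<in> carrier (FT n)"
    by (cases rule: multilinear_rels_cases) (simp_all add: formal_tensors_def b)
qed

lemma tensor_ideal_ideal: "ideal (TI n) (FT n)"
proof -
  interpret FT: unital_algebra k "FT n" by (rule formal_tensors_algebra)
  show ?thesis unfolding tensor_ideal_def
    by (rule FT.genideal_ideal[OF multilinear_rels_closed])
qed

text \<open>
  The elements on which all multilinear maps vanish contain the relations of multilinearity and form
  an ideal, because a multilinear map composed with multiplication by a fixed word is multilinear
  again. This makes \<open>tlift\<close> independent of the representative.
\<close>

lemma lincomb_tensor_ideal:
  assumes V: "module k V" and f: "multilin k A V n f" and p: "p \<in> TI n"
  shows "lincomb k V p f = \<zero>\<^sub>V"
proof -
  interpret MA: monoid_algebra k "list_monoid A n" by (rule monoid_algebra_lists)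
  interpret FT: unital_algebra k "mon_alg k (list_monoid A n)" by (rule MA.unital_algebra_F)
  interpret V: module k V by (rule V)
  define J where "J = {p \<in> carrier MA.F. \<forall>f. multilin k A V n f \<longrightarrow> lincomb k V p f = \<zero>\<^sub>V}"
  have cl: "\<And>f w. \<lbrakk>multilin k A V n f; w \<in> carrier (list_monoid A n)\<rbrakk> \<Longrightarrow> f w \<in> carrier V"
    by (auto simp: list_monoid_sel multilinD(1))
  have L: "(\<lambda>p. lincomb k V p f) \<in> lin k MA.F V" if "multilin k A V n f" for f
    by (rule MA.lincomb_lin[OF V]) (rule cl[OF that])
  have J: "ideal J MA.F"
  proof (rule idealI)
    show "subgroup J (add_monoid MA.F)"
    proof (rule group.subgroupI[OF abelian_group.a_group[OF MA.abelian_group_F]])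
      show "J \<noteq> {}"
        using lin_zero[OF MA.module_F V L] by (auto simp: J_def intro!: exI[of _ "\<zero>\<^bsub>MA.F\<^esub>"])
    next
      fix a assume a: "a \<in> J"
      then have "\<zero>\<^bsub>MA.F\<^esub> \<ominus>\<^bsub>MA.F\<^esub> a \<in> J"
        using lin_minus[OF MA.module_F V L, of _ "\<zero>\<^bsub>MA.F\<^esub>" a] lin_zero[OF MA.module_F V L]
        by (auto simp: J_def a_minus_def)
      then show "inv\<^bsub>add_monoid MA.F\<^esub> a \<in> J"
        using a by (simp add: J_def a_minus_def flip: a_inv_def)
    next
      fix a b assume "a \<in> J" "b \<in> J"
      then show "a \<otimes>\<^bsub>add_monoid MA.F\<^esub> b \<in> J" by (auto simp: J_def lin_add[OF L])
    qed (auto simp: J_def)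
  next
    fix a x assume a: "a \<in> J" and x: "x \<in> carrier MA.F"
    have "lincomb k V (x \<otimes>\<^bsub>MA.F\<^esub> a) f = \<zero>\<^sub>V" if f: "multilin k A V n f" for f
    proof -
      have "lincomb k V (x \<otimes>\<^bsub>MA.F\<^esub> a) f
      = lincomb k V x (\<lambda>u. lincomb k V a (\<lambda>v. f (u \<otimes>\<^bsub>list_monoid A n\<^esub> v)))"
        using a x cl[OF f] by (intro MA.lincomb_mult V) (auto simp: J_def)
      also have "\<dots> = lincomb k V x (\<lambda>u. \<zero>\<^sub>V)"
        using a x multilin_mult(1)[OF f] by (intro MA.lincomb_cong V) (auto simp: J_def list_monoid_sel)
      also have "\<dots> = \<zero>\<^sub>V"
        using x unfolding lincomb_def MA.mem_F by (simp cong: V.finsum_cong)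
      finally show ?thesis .
    qed
    then show "x \<otimes>\<^bsub>MA.F\<^esub> a \<in> J" using a x by (auto simp: J_def)
    have "lincomb k V (a \<otimes>\<^bsub>MA.F\<^esub> x) f = \<zero>\<^sub>V" if f: "multilin k A V n f" for f
    proof -
      have "lincomb k V (a \<otimes>\<^bsub>MA.F\<^esub> x) f
      = lincomb k V a (\<lambda>u. lincomb k V x (\<lambda>v. f (u \<otimes>\<^bsub>list_monoid A n\<^esub> v)))"
        using a x cl[OF f] by (intro MA.lincomb_mult V) (auto simp: J_def)
      moreover have "multilin k A V n (\<lambda>u. lincomb k V x (\<lambda>v. f (u \<otimes>\<^bsub>list_monoid A n\<^esub> v)))"
      unfolding multilin_def list_monoid_sel
      proof (intro conjI allI impI)
      fix w assume w: "length w = n \<and> set w \<subseteq> carrier A"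
      show "lincomb k V x (\<lambda>v. f (map2 (mult A) w v)) \<in> carrier V"
       using w multilinD(1)[OF multilin_mult(1)[OF f]]
       by (intro MA.lincomb_closed V x) (auto simp: list_monoid_sel)
      next
      fix us vs assume us: "length us + length vs + 1 = n \<and> set us \<subseteq> carrier A \<and> set vs \<subseteq> carrier A"
      show "(\<lambda>a. lincomb k V x (\<lambda>v. f (map2 (mult A) (us @ a # vs) v))) \<in> lin k A V"
       using us multilinD(2)[OF multilin_mult(2)[OF f]]
       by (intro MA.lincomb_fun_lin V x) (auto simp: list_monoid_sel)
      qed
      ultimately show ?thesis using a by (auto simp: J_def)
    qed
    then show "a \<otimes>\<^bsub>MA.F\<^esub> x \<in> J" using a x by (auto simp: J_def)
  qed (rule FT.ring_axioms)
  have "multilinear_rels k A n \<subseteq> J"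
  proof -
    have "lincomb k V p f = \<zero>\<^sub>V" if p: "p \<in> multilinear_rels k A n" and f: "multilin k A V n f" for p f
    proof -
      note L = L[OF f]
      have z: "x \<ominus>\<^sub>V x = \<zero>\<^sub>V" if "x \<in> carrier V" for x
        using that by (simp add: a_minus_def V.r_neg)
      have b: "lincomb k V (basis k w) f = f w" "basis k w \<in> carrier MA.F" "f w \<in> carrier V"
      if "length w = n" "set w \<subseteq> carrier A" for w
        using that MA.basis_mem[of w] cl[OF f, of w] MA.lincomb_basis[OF V, of w f] by (simp_all add: list_monoid_sel)
      from p[unfolded formal_tensors_def] show ?thesis
      proof (cases rule: multilinear_rels_cases)
      case (add us a b vs)
      have "(\<lambda>a. f (us @ a # vs)) \<in> lin k A V" using add by (intro multilinD(2)[OF f])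
      from lin_add[OF this, of a b] show ?thesis
       using add by (simp add: formal_tensors_def lin_minus[OF MA.module_F V L] lin_add[OF L] b z)
      next
      case (smult us r a vs)
      have "(\<lambda>a. f (us @ a # vs)) \<in> lin k A V" using smult by (intro multilinD(2)[OF f])
      from lin_smult[OF this, of r a] show ?thesis
       using smult by (simp add: formal_tensors_def lin_minus[OF MA.module_F V L] lin_smult[OF L] b z)
      qed
    qed
    then show ?thesis using multilinear_rels_closed by (auto simp: J_def formal_tensors_def)
  qed
  then have "TI n \<subseteq> J"
    unfolding tensor_ideal_def formal_tensors_def by (intro FT.genideal_minimal J)
  then show ?thesis using p f by (auto simp: J_def)
qed

lemma tpow_algebra: "unital_algebra k (tpow k A n)"
  unfolding tpow_def by (rule unital_algebra.quot_unital_algebra[OF formal_tensors_algebra tensor_ideal_ideal])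

lemma tpow_module: "module k (tpow k A n)"
  using tpow_algebra by (simp add: unital_algebra_def)

lemma tpow_rep:
  assumes "t \<in> carrier (tpow k A n)"
  shows "(SOME p. p \<in> t) \<in> carrier (FT n)"
proof -
  interpret I: ideal "TI n" "FT n" by (rule tensor_ideal_ideal)
  obtain p where p: "p \<in> carrier (FT n)" "t = TI n +>\<^bsub>FT n\<^esub> p"
    using assms unital_algebra.coset_surj[OF formal_tensors_algebra tensor_ideal_ideal] by (auto simp: tpow_def)
  then have "p \<in> t" using I.a_rcos_self by simp
  then have "(SOME p. p \<in> t) \<in> t" by (rule someI[of "\<lambda>p. p \<in> t"])
  then show ?thesis using p I.a_elemrcos_carrier by blast
qed

lemma tlift_coset:
  assumes "module k V" "multilin k A V n f" "p \<in> carrier (FT n)"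
  shows "tlift k V (TI n +>\<^bsub>FT n\<^esub> p) f = lincomb k V p f"
  unfolding tlift_eq_induced
proof (rule unital_algebra.induced_coset[OF formal_tensors_algebra tensor_ideal_ideal assms(1)])
  show "(\<lambda>p. lincomb k V p f) \<in> lin k (FT n) V"
    unfolding formal_tensors_def using assms multilinD(1)[OF assms(2)]
    by (intro monoid_algebra.lincomb_lin[OF monoid_algebra_lists]) (auto simp: list_monoid_sel)
qed (use assms lincomb_tensor_ideal in auto)

lemma tlift_arg_lin:
  assumes "module k V" "multilin k A V n f"
  shows "(\<lambda>t. tlift k V t f) \<in> lin k (tpow k A n) V"
  unfolding tlift_eq_induced tpow_def
proof (rule unital_algebra.induced_lin[OF formal_tensors_algebra tensor_ideal_ideal assms(1)])
  show "(\<lambda>p. lincomb k V p f) \<in> lin k (FT n) V"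
    unfolding formal_tensors_def using assms multilinD(1)[OF assms(2)]
    by (intro monoid_algebra.lincomb_lin[OF monoid_algebra_lists]) (auto simp: list_monoid_sel)
qed (use assms lincomb_tensor_ideal in auto)

lemma tens_closed:
  assumes "length w = n" "set w \<subseteq> carrier A"
  shows "tens k A w \<in> carrier (tpow k A n)"
  using assms unital_algebra.coset_surj[OF formal_tensors_algebra tensor_ideal_ideal]
    monoid_algebra.basis_mem[OF monoid_algebra_lists]
  by (auto simp: tens_def tpow_def formal_tensors_def list_monoid_sel)

lemma tlift_tens:
  assumes "module k V" "multilin k A V n f" "length w = n" "set w \<subseteq> carrier A"
  shows "tlift k V (tens k A w) f = f w"
proof -
  have w: "w \<in> carrier (list_monoid A n)" using assms by (simp add: list_monoid_sel)
  have "tlift k V (tens k A w) f = lincomb k V (basis k w) f"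
    unfolding tens_def \<open>length w = n\<close> using monoid_algebra.basis_mem[OF monoid_algebra_lists w] assms
    by (intro tlift_coset) (simp_all add: formal_tensors_def)
  then show ?thesis
    using assms monoid_algebra.lincomb_basis[OF monoid_algebra_lists assms(1) w] multilinD(1)[OF assms(2)] by simp
qed

lemma tens_mult:
  assumes "length u = n" "set u \<subseteq> carrier A" "length v = n" "set v \<subseteq> carrier A"
  shows "tens k A u \<otimes>\<^bsub>tpow k A n\<^esub> tens k A v = tens k A (map2 (mult A) u v)"
proof -
  interpret MA: monoid_algebra k "list_monoid A n" by (rule monoid_algebra_lists)
  have h: "(\<lambda>x. TI n +>\<^bsub>FT n\<^esub> x) \<in> ring_hom (FT n) (tpow k A n)"
    using unital_algebra.coset_alg_hom[OF formal_tensors_algebra tensor_ideal_ideal]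
    by (auto simp: alg_hom_def tpow_def)
  have uv: "u \<in> carrier (list_monoid A n)" "v \<in> carrier (list_monoid A n)"
    using assms by (simp_all add: list_monoid_sel)
  have "basis k u \<in> carrier MA.F" "basis k v \<in> carrier MA.F"
    "basis k u \<otimes>\<^bsub>MA.F\<^esub> basis k v = basis k (map2 (mult A) u v)"
    using MA.basis_mem[OF uv(1)] MA.basis_mem[OF uv(2)] MA.basis_mult[OF uv] by (simp_all add: list_monoid_sel)
  then show ?thesis
    using ring_hom_mult[OF h, of "basis k u" "basis k v"] assms by (simp add: tens_def formal_tensors_def)
qed

lemma tens_one: "tens k A (replicate n \<one>\<^sub>A) = \<one>\<^bsub>tpow k A n\<^esub>"
proof -
  interpret MA: monoid_algebra k "list_monoid A n" by (rule monoid_algebra_lists)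
  show ?thesis
    using MA.one_F by (simp add: tens_def tpow_def quot_alg_sel formal_tensors_def list_monoid_sel)
qed

lemma multilin_tens: "multilin k A (tpow k A n) n (tens k A)"
  unfolding multilin_def
proof (intro conjI allI impI)
  interpret MA: monoid_algebra k "list_monoid A n" by (rule monoid_algebra_lists)
  interpret FT: unital_algebra k "FT n" by (rule formal_tensors_algebra)
  interpret I: ideal "TI n" "FT n" by (rule tensor_ideal_ideal)
  fix us vs assume us: "length us + length vs + 1 = n \<and> set us \<subseteq> carrier A \<and> set vs \<subseteq> carrier A"
  have h: "(\<lambda>x. TI n +>\<^bsub>FT n\<^esub> x) \<in> lin k (FT n) (tpow k A n)"
    unfolding tpow_def by (rule alg_hom_lin[OF unital_algebra.coset_alg_hom[OF formal_tensors_algebra tensor_ideal_ideal]])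
  have b: "basis k (us @ a # vs) \<in> carrier (FT n)" if "a \<in> carrier A" for a
    unfolding formal_tensors_def using us that by (intro MA.basis_mem) (auto simp: list_monoid_sel)
  have r: "multilinear_rels k A n \<subseteq> TI n"
    unfolding tensor_ideal_def by (rule FT.genideal_self[OF multilinear_rels_closed])
  have eq: "length us + length vs + 1 = n" using us by simp
  have t: "tens k A (us @ a # vs) = TI n +>\<^bsub>FT n\<^esub> basis k (us @ a # vs)" for a
    using eq by (simp add: tens_def)
  show "(\<lambda>a. tens k A (us @ a # vs)) \<in> lin k A (tpow k A n)"
  proof (rule linI)
    fix x y assume xy: "x \<in> carrier A" "y \<in> carrier A"
    have "basis k (us @ (x \<oplus>\<^sub>A y) # vs) \<ominus>\<^bsub>FT n\<^esub>
      (basis k (us @ x # vs) \<oplus>\<^bsub>FT n\<^esub> basis k (us @ y # vs)) \<in> TI n"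
      using us xy by (intro subsetD[OF r]) (unfold multilinear_rels_def Let_def, blast)
    then show "tens k A (us @ (x \<oplus>\<^sub>A y) # vs)
      = tens k A (us @ x # vs) \<oplus>\<^bsub>tpow k A n\<^esub> tens k A (us @ y # vs)"
      using xy b by (simp add: t FT.coset_eq_iff[OF I.ideal_axioms] flip: lin_add[OF h])
  next
    fix r x assume rx: "r \<in> carrier k" "x \<in> carrier A"
    have "basis k (us @ (r \<odot>\<^sub>A x) # vs) \<ominus>\<^bsub>FT n\<^esub>
      r \<odot>\<^bsub>FT n\<^esub> basis k (us @ x # vs) \<in> TI n"
      using us rx by (intro subsetD[OF r]) (unfold multilinear_rels_def Let_def, blast)
    then show "tens k A (us @ (r \<odot>\<^sub>A x) # vs) = r \<odot>\<^bsub>tpow k A n\<^esub> tens k A (us @ x # vs)"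
      using rx b by (simp add: t FT.coset_eq_iff[OF I.ideal_axioms] flip: lin_smult[OF h])
  qed (use us in \<open>auto intro!: tens_closed\<close>)
qed (use tens_closed in auto)

lemma lin_eq_tlift:
  assumes V: "module k V" and g: "g \<in> lin k (tpow k A n) V" and t: "t \<in> carrier (tpow k A n)"
  shows "g t = tlift k V t (\<lambda>w. g (tens k A w))"
proof -
  interpret MA: monoid_algebra k "list_monoid A n" by (rule monoid_algebra_lists)
  interpret V: module k V by (rule V)
  obtain p where p: "p \<in> carrier (FT n)" "t = TI n +>\<^bsub>FT n\<^esub> p"
    using t unital_algebra.coset_surj[OF formal_tensors_algebra tensor_ideal_ideal] by (auto simp: tpow_def)
  have h: "(\<lambda>x. TI n +>\<^bsub>FT n\<^esub> x) \<in> lin k (FT n) (tpow k A n)"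
    unfolding tpow_def by (rule alg_hom_lin[OF unital_algebra.coset_alg_hom[OF formal_tensors_algebra tensor_ideal_ideal]])
  have gm: "multilin k A V n (\<lambda>w. g (tens k A w))"
    unfolding multilin_def using multilinD[OF multilin_tens] lin_closed[OF g] by (auto intro!: lin_comp[OF g])
  have "g t = lincomb k V p (\<lambda>w. g (TI n +>\<^bsub>FT n\<^esub> basis k w))"
    unfolding p(2) using MA.lin_eq_lincomb[OF V lin_comp[OF g h, unfolded formal_tensors_def]] p(1)
    by (simp add: formal_tensors_def)
  also have "\<dots> = lincomb k V p (\<lambda>w. g (tens k A w))"
    using p(1) multilinD(1)[OF gm] by (intro MA.lincomb_cong[OF V]) (auto simp: formal_tensors_def tens_def list_monoid_sel)
  also have "\<dots> = tlift k V t (\<lambda>w. g (tens k A w))"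
    unfolding p(2) by (rule tlift_coset[symmetric, OF V gm p(1)])
  finally show ?thesis .
qed

lemma tlift_closed:
  assumes "module k V" "t \<in> carrier (tpow k A n)"
    "\<And>w. \<lbrakk>length w = n; set w \<subseteq> carrier A\<rbrakk> \<Longrightarrow> f w \<in> carrier V"
  shows "tlift k V t f \<in> carrier V"
  unfolding tlift_eq_lincomb using tpow_rep[OF assms(2)] assms
  by (intro monoid_algebra.lincomb_closed[OF monoid_algebra_lists]) (auto simp: formal_tensors_def list_monoid_sel)

lemma tlift_cong:
  assumes "module k V" "t \<in> carrier (tpow k A n)"
    "\<And>w. \<lbrakk>length w = n; set w \<subseteq> carrier A\<rbrakk> \<Longrightarrow> f w = g w"
    "\<And>w. \<lbrakk>length w = n; set w \<subseteq> carrier A\<rbrakk> \<Longrightarrow> g w \<in> carrier V"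
  shows "tlift k V t f = tlift k V t g"
  unfolding tlift_eq_lincomb using tpow_rep[OF assms(2)] assms
  by (intro monoid_algebra.lincomb_cong[OF monoid_algebra_lists]) (auto simp: formal_tensors_def list_monoid_sel)

lemma lin_tlift:
  assumes "module k V" "module k W" "g \<in> lin k V W" "t \<in> carrier (tpow k A n)"
    "\<And>w. \<lbrakk>length w = n; set w \<subseteq> carrier A\<rbrakk> \<Longrightarrow> f w \<in> carrier V"
  shows "g (tlift k V t f) = tlift k W t (\<lambda>w. g (f w))"
  unfolding tlift_eq_lincomb using tpow_rep[OF assms(4)] assms
  by (intro monoid_algebra.lin_lincomb[OF monoid_algebra_lists]) (auto simp: formal_tensors_def list_monoid_sel)

lemma tlift_fun_lin:
  assumes "module k V" "t \<in> carrier (tpow k A n)"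
    "\<And>w. \<lbrakk>length w = n; set w \<subseteq> carrier A\<rbrakk> \<Longrightarrow> (\<lambda>x. f x w) \<in> lin k U V"
  shows "(\<lambda>x. tlift k V t (f x)) \<in> lin k U V"
  unfolding tlift_eq_lincomb using tpow_rep[OF assms(2)] assms
  by (intro monoid_algebra.lincomb_fun_lin[OF monoid_algebra_lists]) (auto simp: formal_tensors_def list_monoid_sel)

lemma tlift_swap:
  assumes B: "unital_algebra k B" and V: "module k V"
    and t: "t \<in> carrier (tpow k A n)" and s: "s \<in> carrier (tpow k B m)"
    and f: "\<And>u w. \<lbrakk>length u = n; set u \<subseteq> carrier A; length w = m; set w \<subseteq> carrier B\<rbrakk> \<Longrightarrow> f u w \<in> carrier V"
  shows "tlift k V t (\<lambda>u. tlift k V s (\<lambda>w. f u w)) = tlift k V s (\<lambda>w. tlift k V t (\<lambda>u. f u w))"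
proof -
  interpret MA: monoid_algebra k "list_monoid A n" by (rule monoid_algebra_lists)
  interpret B: unital_algebra k B by (rule B)
  interpret MB: monoid_algebra k "list_monoid B m" by (rule B.monoid_algebra_lists)
  let ?p = "SOME p. p \<in> t" and ?q = "SOME p. p \<in> s"
  have p: "?p \<in> carrier MA.F" and q: "?q \<in> carrier MB.F"
    using tpow_rep[OF t] B.tpow_rep[OF s] by (simp_all add: formal_tensors_def)
  have f': "f u w \<in> carrier V" if "u \<in> carrier (list_monoid A n)" "w \<in> carrier (list_monoid B m)" for u w
    using that f by (auto simp: list_monoid_sel B.list_monoid_sel)
  have L: "(\<lambda>p. lincomb k V ?q (\<lambda>w. lincomb k V p (\<lambda>u. f u w))) \<in> lin k MA.F V"
    by (intro MB.lincomb_fun_lin[OF V q] MA.lincomb_lin[OF V] f')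
  have "lincomb k V ?q (\<lambda>w. lincomb k V ?p (\<lambda>u. f u w))
    = lincomb k V ?p (\<lambda>u. lincomb k V ?q (\<lambda>w. lincomb k V (basis k u) (\<lambda>u. f u w)))"
    by (rule MA.lin_eq_lincomb[OF V L p])
  also have "\<dots> = lincomb k V ?p (\<lambda>u. lincomb k V ?q (\<lambda>w. f u w))"
    using f' by (intro MA.lincomb_cong[OF V p] MB.lincomb_cong[OF V q] MB.lincomb_closed[OF V q])
      (simp_all add: MA.lincomb_basis[OF V])
  finally show ?thesis unfolding tlift_eq_lincomb by simp
qed

lemma tlift_mult:
  assumes V: "module k V" and f: "multilin k A V n f"
    and t: "t \<in> carrier (tpow k A n)" and s: "s \<in> carrier (tpow k A n)"
  shows "tlift k V (t \<otimes>\<^bsub>tpow k A n\<^esub> s) f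
    = tlift k V t (\<lambda>u. tlift k V s (\<lambda>w. f (map2 (mult A) u w)))"
proof -
  interpret T: unital_algebra k "tpow k A n" by (rule tpow_algebra)
  have l: "(\<lambda>a. c \<otimes>\<^bsub>tpow k A n\<^esub> a) \<in> lin k (tpow k A n) (tpow k A n)" "(\<lambda>a. a \<otimes>\<^bsub>tpow k A n\<^esub> c) \<in> lin k (tpow k A n) (tpow k A n)"
    if "c \<in> carrier (tpow k A n)" for c
    using that by (auto intro!: linI simp: T.l_distr T.r_distr T.smult_mult_left T.smult_mult_right)
  note L = tlift_arg_lin[OF V f]
  have "tlift k V (t \<otimes>\<^bsub>tpow k A n\<^esub> s) f = tlift k V t (\<lambda>u. tlift k V (tens k A u \<otimes>\<^bsub>tpow k A n\<^esub> s) f)"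
    by (rule lin_eq_tlift[OF V lin_comp[OF L l(2)[OF s]] t])
  also have "\<dots> = tlift k V t (\<lambda>u. tlift k V s (\<lambda>w. f (map2 (mult A) u w)))"
  proof (rule tlift_cong[OF V t])
    fix u assume u: "length u = n" "set u \<subseteq> carrier A"
    have c: "f (map2 (mult A) u w) \<in> carrier V" if "length w = n" "set w \<subseteq> carrier A" for w
      by (rule multilinD(1)[OF multilin_mult(1)[OF f u] that])
    have "tlift k V (tens k A u \<otimes>\<^bsub>tpow k A n\<^esub> s) f
      = tlift k V s (\<lambda>w. tlift k V (tens k A u \<otimes>\<^bsub>tpow k A n\<^esub> tens k A w) f)"
      by (rule lin_eq_tlift[OF V lin_comp[OF L l(1)[OF tens_closed[OF u]]] s])
    also have "\<dots> = tlift k V s (\<lambda>w. f (map2 (mult A) u w))"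
      using u c map2_mult_closed by (intro tlift_cong[OF V s]) (simp_all add: tens_mult tlift_tens[OF V f])
    finally show "tlift k V (tens k A u \<otimes>\<^bsub>tpow k A n\<^esub> s) f
      = tlift k V s (\<lambda>w. f (map2 (mult A) u w))" .
    show "tlift k V s (\<lambda>w. f (map2 (mult A) u w)) \<in> carrier V"
      by (rule tlift_closed[OF V s c])
  qed
  finally show ?thesis .
qed

text \<open>
  The tensor power is multiplied componentwise, so a multilinear map that is multiplicative on pure
  tensors induces an algebra map. The counit applied to one leg and the maps that occur in the
  pentagon are of this kind.
\<close>

lemma tlift_alg_hom:
  assumes B: "unital_algebra k B" and f: "multilin k A B n f"
    and m: "\<And>u w. \<lbrakk>length u = n; set u \<subseteq> carrier A; length w = n; set w \<subseteq> carrier A\<rbrakk> \<Longrightarrow>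
      f (map2 (mult A) u w) = f u \<otimes>\<^sub>B f w"
    and one: "f (replicate n \<one>\<^sub>A) = \<one>\<^sub>B"
  shows "(\<lambda>t. tlift k B t f) \<in> alg_hom k (tpow k A n) B"
proof -
  interpret B: unital_algebra k B by (rule B)
  note V = B.module_axioms and fc = multilinD(1)[OF f]
  note L = tlift_arg_lin[OF V f] and c = tlift_closed[OF V _ fc]
  have ml: "(\<lambda>x. r \<otimes>\<^sub>B x) \<in> lin k B B" "(\<lambda>x. x \<otimes>\<^sub>B r) \<in> lin k B B" if "r \<in> carrier B" for r
    using that by (auto intro!: linI simp: B.l_distr B.r_distr B.smult_mult_left B.smult_mult_right)
  have "tlift k B (t \<otimes>\<^bsub>tpow k A n\<^esub> s) f = tlift k B t f \<otimes>\<^sub>B tlift k B s f"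
    if t: "t \<in> carrier (tpow k A n)" and s: "s \<in> carrier (tpow k A n)" for t s
  proof -
    have "tlift k B (t \<otimes>\<^bsub>tpow k A n\<^esub> s) f = tlift k B t (\<lambda>u. f u \<otimes>\<^sub>B tlift k B s f)"
      unfolding tlift_mult[OF V f t s]
    proof (rule tlift_cong[OF V t])
      fix u assume u: "length u = n" "set u \<subseteq> carrier A"
      have "tlift k B s (\<lambda>w. f (map2 (mult A) u w)) = tlift k B s (\<lambda>w. f u \<otimes>\<^sub>B f w)"
        using u by (intro tlift_cong[OF V s]) (simp_all add: m fc)
      then show "tlift k B s (\<lambda>w. f (map2 (mult A) u w)) = f u \<otimes>\<^sub>B tlift k B s f"
        using lin_tlift[OF V V ml(1)[OF fc[OF u]] s fc] by simp
      show "f u \<otimes>\<^sub>B tlift k B s f \<in> carrier B" using u s by (simp add: fc c)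
    qed
    also have "\<dots> = tlift k B t f \<otimes>\<^sub>B tlift k B s f"
      by (rule lin_tlift[OF V V ml(2)[OF c[OF s]] t fc, symmetric])
    finally show ?thesis .
  qed
  moreover have "tlift k B \<one>\<^bsub>tpow k A n\<^esub> f = \<one>\<^sub>B"
    unfolding tens_one[symmetric] one[symmetric] by (rule tlift_tens[OF V f]) auto
  ultimately show ?thesis by (intro alg_homI) (simp_all add: c lin_add[OF L] lin_smult[OF L])
qed

end

section \<open>Multilinear maps in Sweedler notation\<close>

lemma foldSetD_comp_cong:
  assumes "(B, y) \<in> foldSetD D (op \<circ> h) e" "\<And>a. a \<in> B \<Longrightarrow> h a = h' a"
  shows "(B, y) \<in> foldSetD D (op \<circ> h') e"
  using assms
proof (induction rule: foldSetD.induct)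
  case (insertI x A y)
  then have "(insert x A, (op \<circ> h') x y) \<in> foldSetD D (op \<circ> h') e"
    by (intro foldSetD.insertI) auto
  then show ?case using insertI by (simp add: comp_def)
qed (rule foldSetD.emptyI)

text \<open>
  A sum depends only on the values of the summands on the index set, even if some of these lie
  outside the carrier. Congruence rules for Sweedler expressions can therefore be stated without
  closure conditions, which makes them usable by the simplifier.
\<close>

lemma finsum_cong_closed_free:
  assumes "\<And>i. i \<in> I \<Longrightarrow> f i = g i"
  shows "finsum V f I = finsum V g I"
proof -
  have "(I, y) \<in> foldSetD (carrier V) (add V \<circ> f) e \<longleftrightarrow> (I, y) \<in> foldSetD (carrier V) (add V \<circ> g) e" for y e
    using foldSetD_comp_cong[of I y _ "add V" f e g] foldSetD_comp_cong[of I y _ "add V" g e f] assms by auto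
  then show ?thesis by (simp add: finsum_def finprod_def foldD_def)
qed

definition bilin ::
  "('k, 'm) ring_scheme \<Rightarrow> ('k, 'a, 'x) module_scheme \<Rightarrow> ('k, 'v, 'y) module_scheme
    \<Rightarrow> ('a \<Rightarrow> 'a \<Rightarrow> 'v) \<Rightarrow> bool"
  where "bilin k A V f \<longleftrightarrow>
    (\<forall>a\<in>carrier A. (\<lambda>x. f x a) \<in> lin k A V \<and> (\<lambda>x. f a x) \<in> lin k A V)"

definition trilin ::
  "('k, 'm) ring_scheme \<Rightarrow> ('k, 'a, 'x) module_scheme \<Rightarrow> ('k, 'v, 'y) module_scheme
    \<Rightarrow> ('a \<Rightarrow> 'a \<Rightarrow> 'a \<Rightarrow> 'v) \<Rightarrow> bool"
  where "trilin k A V f \<longleftrightarrow> (\<forall>a\<in>carrier A. \<forall>b\<in>carrier A.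
    (\<lambda>x. f x a b) \<in> lin k A V \<and> (\<lambda>x. f a x b) \<in> lin k A V \<and> (\<lambda>x. f a b x) \<in> lin k A V)"

definition quadlin ::
  "('k, 'm) ring_scheme \<Rightarrow> ('k, 'a, 'x) module_scheme \<Rightarrow> ('k, 'v, 'y) module_scheme
    \<Rightarrow> ('a \<Rightarrow> 'a \<Rightarrow> 'a \<Rightarrow> 'a \<Rightarrow> 'v) \<Rightarrow> bool"
  where "quadlin k A V f \<longleftrightarrow> (\<forall>a\<in>carrier A. \<forall>b\<in>carrier A. \<forall>c\<in>carrier A.
    (\<lambda>x. f x a b c) \<in> lin k A V \<and> (\<lambda>x. f a x b c) \<in> lin k A V \<and>
    (\<lambda>x. f a b x c) \<in> lin k A V \<and> (\<lambda>x. f a b c x) \<in> lin k A V)"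

definition sw4 ::
  "('k, 'm) ring_scheme \<Rightarrow> ('k, 'v, 'y) module_scheme \<Rightarrow> ('a list \<Rightarrow> 'k) set
    \<Rightarrow> ('a \<Rightarrow> 'a \<Rightarrow> 'a \<Rightarrow> 'a \<Rightarrow> 'v) \<Rightarrow> 'v"
  where "sw4 k V t f = tlift k V t (\<lambda>w. f (w ! 0) (w ! 1) (w ! 2) (w ! 3))"

lemma bilinI:
  assumes "\<And>a. a \<in> carrier A \<Longrightarrow> (\<lambda>x. f x a) \<in> lin k A V"
    and "\<And>a. a \<in> carrier A \<Longrightarrow> (\<lambda>x. f a x) \<in> lin k A V"
  shows "bilin k A V f"
  using assms by (auto simp: bilin_def)

lemma trilinI:
  assumes "\<And>a b. \<lbrakk>a \<in> carrier A; b \<in> carrier A\<rbrakk> \<Longrightarrow> (\<lambda>x. f x a b) \<in> lin k A V"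
    and "\<And>a b. \<lbrakk>a \<in> carrier A; b \<in> carrier A\<rbrakk> \<Longrightarrow> (\<lambda>x. f a x b) \<in> lin k A V"
    and "\<And>a b. \<lbrakk>a \<in> carrier A; b \<in> carrier A\<rbrakk> \<Longrightarrow> (\<lambda>x. f a b x) \<in> lin k A V"
  shows "trilin k A V f"
  using assms by (auto simp: trilin_def)

lemma quadlinI:
  assumes "\<And>a b c. \<lbrakk>a \<in> carrier A; b \<in> carrier A; c \<in> carrier A\<rbrakk> \<Longrightarrow> (\<lambda>x. f x a b c) \<in> lin k A V"
    and "\<And>a b c. \<lbrakk>a \<in> carrier A; b \<in> carrier A; c \<in> carrier A\<rbrakk> \<Longrightarrow> (\<lambda>x. f a x b c) \<in> lin k A V"
    and "\<And>a b c. \<lbrakk>a \<in> carrier A; b \<in> carrier A; c \<in> carrier A\<rbrakk> \<Longrightarrow> (\<lambda>x. f a b x c) \<in> lin k A V"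
    and "\<And>a b c. \<lbrakk>a \<in> carrier A; b \<in> carrier A; c \<in> carrier A\<rbrakk> \<Longrightarrow> (\<lambda>x. f a b c x) \<in> lin k A V"
  shows "quadlin k A V f"
  using assms by (auto simp: quadlin_def)

lemma bilin_lin:
  assumes "bilin k A V f"
  shows "\<lbrakk>g \<in> lin k U A; b \<in> carrier A\<rbrakk> \<Longrightarrow> (\<lambda>x. f (g x) b) \<in> lin k U V"
    and "\<lbrakk>g \<in> lin k U A; a \<in> carrier A\<rbrakk> \<Longrightarrow> (\<lambda>x. f a (g x)) \<in> lin k U V"
  using assms lin_comp[of "\<lambda>x. f x b" k A V g U] lin_comp[of "f a" k A V g U] by (auto simp: bilin_def)

lemma trilin_lin:
  assumes "trilin k A V f"
  shows "\<lbrakk>g \<in> lin k U A; b \<in> carrier A; c \<in> carrier A\<rbrakk> \<Longrightarrow> (\<lambda>x. f (g x) b c) \<in> lin k U V"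
    and "\<lbrakk>g \<in> lin k U A; a \<in> carrier A; c \<in> carrier A\<rbrakk> \<Longrightarrow> (\<lambda>x. f a (g x) c) \<in> lin k U V"
    and "\<lbrakk>g \<in> lin k U A; a \<in> carrier A; b \<in> carrier A\<rbrakk> \<Longrightarrow> (\<lambda>x. f a b (g x)) \<in> lin k U V"
  using assms lin_comp[of "\<lambda>x. f x b c" k A V g U] lin_comp[of "\<lambda>x. f a x c" k A V g U]
    lin_comp[of "f a b" k A V g U] by (auto simp: trilin_def)

lemma quadlin_lin:
  assumes "quadlin k A V f"
  shows "\<lbrakk>g \<in> lin k U A; b \<in> carrier A; c \<in> carrier A; d \<in> carrier A\<rbrakk> \<Longrightarrow> (\<lambda>x. f (g x) b c d) \<in> lin k U V"
    and "\<lbrakk>g \<in> lin k U A; a \<in> carrier A; c \<in> carrier A; d \<in> carrier A\<rbrakk> \<Longrightarrow> (\<lambda>x. f a (g x) c d) \<in> lin k U V"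
    and "\<lbrakk>g \<in> lin k U A; a \<in> carrier A; b \<in> carrier A; d \<in> carrier A\<rbrakk> \<Longrightarrow> (\<lambda>x. f a b (g x) d) \<in> lin k U V"
    and "\<lbrakk>g \<in> lin k U A; a \<in> carrier A; b \<in> carrier A; c \<in> carrier A\<rbrakk> \<Longrightarrow> (\<lambda>x. f a b c (g x)) \<in> lin k U V"
  using assms lin_comp[of "\<lambda>x. f x b c d" k A V g U] lin_comp[of "\<lambda>x. f a x c d" k A V g U]
    lin_comp[of "\<lambda>x. f a b x d" k A V g U] lin_comp[of "f a b c" k A V g U] by (auto simp: quadlin_def)

lemma bilin_closed: "\<lbrakk>bilin k A V f; a \<in> carrier A; b \<in> carrier A\<rbrakk> \<Longrightarrow> f a b \<in> carrier V"
  using lin_closed[of "f a" k A V b] by (auto simp: bilin_def)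

lemma trilin_closed:
  "\<lbrakk>trilin k A V f; a \<in> carrier A; b \<in> carrier A; c \<in> carrier A\<rbrakk> \<Longrightarrow> f a b c \<in> carrier V"
  using lin_closed[of "f a b" k A V c] by (auto simp: trilin_def)

lemma quadlin_closed:
  "\<lbrakk>quadlin k A V f; a \<in> carrier A; b \<in> carrier A; c \<in> carrier A; d \<in> carrier A\<rbrakk> \<Longrightarrow> f a b c d \<in> carrier V"
  using lin_closed[of "f a b c" k A V d] by (auto simp: quadlin_def)

lemma scalars_sel [simp]:
  "carrier (scalars k) = carrier k" "x \<oplus>\<^bsub>scalars k\<^esub> y = x \<oplus>\<^sub>k y" "x \<otimes>\<^bsub>scalars k\<^esub> y = x \<otimes>\<^sub>k y"
  "r \<odot>\<^bsub>scalars k\<^esub> x = r \<otimes>\<^sub>k x" "\<one>\<^bsub>scalars k\<^esub> = \<one>\<^sub>k" "\<zero>\<^bsub>scalars k\<^esub> = \<zero>\<^sub>k"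
  by (simp_all add: scalars_def)

lemma lin_smult_right:
  assumes "module k V" "r \<in> carrier k" "f \<in> lin k U V"
  shows "(\<lambda>x. r \<odot>\<^sub>V f x) \<in> lin k U V"
proof -
  interpret V: module k V by fact
  show ?thesis using assms lin_closed[OF assms(3)]
    by (intro linI) (simp_all add: lin_add[OF assms(3)] lin_smult[OF assms(3)] V.smult_r_distr V.R.m_comm
      flip: V.smult_assoc1)
qed

lemma lin_smult_left:
  assumes "module k V" "s \<in> lin k U (scalars k)" "c \<in> carrier V"
  shows "(\<lambda>x. s x \<odot>\<^sub>V c) \<in> lin k U V"
proof -
  interpret V: module k V by fact
  show ?thesis using assms lin_closed[OF assms(2)]
    by (intro linI) (simp_all add: lin_add[OF assms(2)] lin_smult[OF assms(2)] V.smult_l_distr V.smult_assoc1)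
qed

lemma lin_scalar_mult:
  assumes "field k" "s \<in> lin k U (scalars k)" "c \<in> carrier k"
  shows "(\<lambda>x. s x \<otimes>\<^sub>k c) \<in> lin k U (scalars k)" "(\<lambda>x. c \<otimes>\<^sub>k s x) \<in> lin k U (scalars k)"
proof -
  interpret k: field k by fact
  show "(\<lambda>x. s x \<otimes>\<^sub>k c) \<in> lin k U (scalars k)" "(\<lambda>x. c \<otimes>\<^sub>k s x) \<in> lin k U (scalars k)"
    using assms lin_closed[OF assms(2)]
    by (auto intro!: linI simp: lin_add[OF assms(2)] lin_smult[OF assms(2)] k.l_distr k.r_distr k.m_ac)
qed

lemma lin_mult:
  assumes "unital_algebra k B" "f \<in> lin k U B" "c \<in> carrier B"
  shows "(\<lambda>x. f x \<otimes>\<^sub>B c) \<in> lin k U B" "(\<lambda>x. c \<otimes>\<^sub>B f x) \<in> lin k U B"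
proof -
  interpret B: unital_algebra k B by fact
  show "(\<lambda>x. f x \<otimes>\<^sub>B c) \<in> lin k U B" "(\<lambda>x. c \<otimes>\<^sub>B f x) \<in> lin k U B"
    using assms lin_closed[OF assms(2)]
    by (auto intro!: linI simp: lin_add[OF assms(2)] lin_smult[OF assms(2)] B.A.l_distr B.A.r_distr
      B.smult_mult_left B.smult_mult_right)
qed

lemma lin_add_fun:
  assumes "module k V" "f \<in> lin k U V" "g \<in> lin k U V"
  shows "(\<lambda>x. f x \<oplus>\<^sub>V g x) \<in> lin k U V"
proof -
  interpret V: module k V by fact
  show ?thesis using assms lin_closed[OF assms(2)] lin_closed[OF assms(3)]
    by (intro linI) (simp_all add: lin_add[OF assms(2)] lin_add[OF assms(3)] lin_smult[OF assms(2)]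
      lin_smult[OF assms(3)] V.smult_r_distr V.a_ac)
qed

text \<open>
  These rules follow the structure of an expression, as do \<open>sw_lin_rules\<close> and their later
  extensions; used as introduction rules, they reduce every multilinearity condition to closure
  conditions.
\<close>

lemmas lin_rules = lin_id lin_smult_right lin_smult_left lin_mult lin_add_fun

context unital_algebra
begin

lemma length_cases:
  "length w = 2 \<longleftrightarrow> (\<exists>a b. w = [a, b])"
  "length w = 3 \<longleftrightarrow> (\<exists>a b c. w = [a, b, c])"
  "length w = 4 \<longleftrightarrow> (\<exists>a b c d. w = [a, b, c, d])"
  by (auto simp: length_Suc_conv eval_nat_numeral)

lemma split_cases:
  "length us + length vs + 1 = (2::nat) \<Longrightarrow>
    (us = [] \<and> (\<exists>a. vs = [a])) \<or> ((\<exists>a. us = [a]) \<and> vs = [])"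
  "length us + length vs + 1 = (3::nat) \<Longrightarrow>
    (us = [] \<and> (\<exists>a b. vs = [a, b])) \<or> ((\<exists>a. us = [a]) \<and> (\<exists>a. vs = [a])) \<or> ((\<exists>a b. us = [a, b]) \<and> vs = [])"
  "length us + length vs + 1 = (4::nat) \<Longrightarrow>
    (us = [] \<and> (\<exists>a b c. vs = [a, b, c])) \<or> ((\<exists>a. us = [a]) \<and> (\<exists>a b. vs = [a, b]))
    \<or> ((\<exists>a b. us = [a, b]) \<and> (\<exists>a. vs = [a])) \<or> ((\<exists>a b c. us = [a, b, c]) \<and> vs = [])"
proof -
  assume "length us + length vs + 1 = (2::nat)"
  then have "(length us = 0 \<and> length vs = Suc 0) \<or> (length us = Suc 0 \<and> length vs = 0)" by arith
  then show "(us = [] \<and> (\<exists>a. vs = [a])) \<or> ((\<exists>a. us = [a]) \<and> vs = [])"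
    by (auto simp: length_Suc_conv)
next
  assume "length us + length vs + 1 = (3::nat)"
  then have "(length us = 0 \<and> length vs = Suc (Suc 0)) \<or> (length us = Suc 0 \<and> length vs = Suc 0)
    \<or> (length us = Suc (Suc 0) \<and> length vs = 0)" by arith
  then show "(us = [] \<and> (\<exists>a b. vs = [a, b])) \<or> ((\<exists>a. us = [a]) \<and> (\<exists>a. vs = [a])) \<or> ((\<exists>a b. us = [a, b]) \<and> vs = [])"
    by (auto simp: length_Suc_conv)
next
  assume "length us + length vs + 1 = (4::nat)"
  then have "(length us = 0 \<and> length vs = Suc (Suc (Suc 0))) \<or> (length us = Suc 0 \<and> length vs = Suc (Suc 0))
    \<or> (length us = Suc (Suc 0) \<and> length vs = Suc 0) \<or> (length us = Suc (Suc (Suc 0)) \<and> length vs = 0)" by arith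
  then show "(us = [] \<and> (\<exists>a b c. vs = [a, b, c])) \<or> ((\<exists>a. us = [a]) \<and> (\<exists>a b. vs = [a, b]))
    \<or> ((\<exists>a b. us = [a, b]) \<and> (\<exists>a. vs = [a])) \<or> ((\<exists>a b c. us = [a, b, c]) \<and> vs = [])"
    by (auto simp: length_Suc_conv)
qed

lemma multilin2:
  assumes f: "bilin k A V f"
  shows "multilin k A V 2 (\<lambda>w. f (w ! 0) (w ! 1))"
  unfolding multilin_def
proof (intro conjI allI impI)
  fix w :: "'c list" assume w: "length w = 2 \<and> set w \<subseteq> carrier A"
  then show "f (w ! 0) (w ! 1) \<in> carrier V" by (intro bilin_closed[OF f]) (auto simp: subset_iff)
next
  fix us vs :: "'c list"
  assume h: "length us + length vs + 1 = 2 \<and> set us \<subseteq> carrier A \<and> set vs \<subseteq> carrier A"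
  show "(\<lambda>a. (\<lambda>w. f (w ! 0) (w ! 1)) (us @ a # vs)) \<in> lin k A V"
    using split_cases(1)[OF conjunct1[OF h]] h f
    by (elim disjE exE conjE) (simp_all add: bilin_def)
qed

lemma multilin3:
  assumes f: "trilin k A V f"
  shows "multilin k A V 3 (\<lambda>w. f (w ! 0) (w ! 1) (w ! 2))"
  unfolding multilin_def
proof (intro conjI allI impI)
  fix w :: "'c list" assume w: "length w = 3 \<and> set w \<subseteq> carrier A"
  then show "f (w ! 0) (w ! 1) (w ! 2) \<in> carrier V" by (intro trilin_closed[OF f]) (auto simp: subset_iff)
next
  fix us vs :: "'c list"
  assume h: "length us + length vs + 1 = 3 \<and> set us \<subseteq> carrier A \<and> set vs \<subseteq> carrier A"
  show "(\<lambda>a. (\<lambda>w. f (w ! 0) (w ! 1) (w ! 2)) (us @ a # vs)) \<in> lin k A V"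
    using split_cases(2)[OF conjunct1[OF h]] h f
    by (elim disjE exE conjE) (simp_all add: trilin_def)
qed

lemma multilin4:
  assumes f: "quadlin k A V f"
  shows "multilin k A V 4 (\<lambda>w. f (w ! 0) (w ! 1) (w ! 2) (w ! 3))"
  unfolding multilin_def
proof (intro conjI allI impI)
  fix w :: "'c list" assume w: "length w = 4 \<and> set w \<subseteq> carrier A"
  then show "f (w ! 0) (w ! 1) (w ! 2) (w ! 3) \<in> carrier V" by (intro quadlin_closed[OF f]) (auto simp: subset_iff)
next
  fix us vs :: "'c list"
  assume h: "length us + length vs + 1 = 4 \<and> set us \<subseteq> carrier A \<and> set vs \<subseteq> carrier A"
  show "(\<lambda>a. (\<lambda>w. f (w ! 0) (w ! 1) (w ! 2) (w ! 3)) (us @ a # vs)) \<in> lin k A V"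
    using split_cases(3)[OF conjunct1[OF h]] h f
    by (elim disjE exE conjE) (simp_all add: quadlin_def)
qed

end

context unital_algebra
begin

lemma tlift_cong_closed_free:
  assumes "t \<in> carrier (tpow k A n)"
    "\<And>w. \<lbrakk>length w = n; set w \<subseteq> carrier A\<rbrakk> \<Longrightarrow> f w = g w"
  shows "tlift k V t f = tlift k V t g"
proof -
  interpret MA: monoid_algebra k "list_monoid A n" by (rule monoid_algebra_lists)
  have "(SOME p. p \<in> t) \<in> carrier MA.F" using tpow_rep[OF assms(1)] by (simp add: formal_tensors_def)
  then show ?thesis
    unfolding tlift_eq_lincomb lincomb_def MA.mem_F
    by (intro finsum_cong_closed_free) (auto simp: assms(2) list_monoid_sel subset_iff)
qed

lemma sw2_closed:
  assumes "module k V" "t \<in> carrier (tpow k A 2)"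
    "\<And>a b. \<lbrakk>a \<in> carrier A; b \<in> carrier A\<rbrakk> \<Longrightarrow> f a b \<in> carrier V"
  shows "sw2 k V t f \<in> carrier V"
  unfolding sw2_def by (rule tlift_closed[OF assms(1,2)]) (auto intro!: assms(3) simp: subset_iff)

lemma sw2_cong:
  assumes "t \<in> carrier (tpow k A 2)"
    "\<And>a b. \<lbrakk>a \<in> carrier A; b \<in> carrier A\<rbrakk> \<Longrightarrow> f a b = g a b"
  shows "sw2 k V t f = sw2 k V t g"
  unfolding sw2_def by (rule tlift_cong_closed_free[OF assms(1)]) (auto intro!: assms(2) simp: subset_iff)

lemma lin_sw2:
  assumes "module k V" "module k W" "g \<in> lin k V W" "t \<in> carrier (tpow k A 2)"
    "\<And>a b. \<lbrakk>a \<in> carrier A; b \<in> carrier A\<rbrakk> \<Longrightarrow> f a b \<in> carrier V"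
  shows "g (sw2 k V t f) = sw2 k W t (\<lambda>a b. g (f a b))"
  unfolding sw2_def by (rule lin_tlift[OF assms(1-4)]) (auto intro!: assms(5) simp: subset_iff)

lemma sw2_fun_lin:
  assumes "module k V" "t \<in> carrier (tpow k A 2)"
    "\<And>a b. \<lbrakk>a \<in> carrier A; b \<in> carrier A\<rbrakk> \<Longrightarrow> (\<lambda>x. f x a b) \<in> lin k U V"
  shows "(\<lambda>x. sw2 k V t (f x)) \<in> lin k U V"
  unfolding sw2_def by (rule tlift_fun_lin[OF assms(1,2)]) (auto intro!: assms(3) simp: subset_iff)

lemma sw2_arg_lin:
  assumes "module k V" "bilin k A V f" "g \<in> lin k U (tpow k A 2)"
  shows "(\<lambda>x. sw2 k V (g x) f) \<in> lin k U V"
  unfolding sw2_def by (rule lin_comp[OF tlift_arg_lin[OF assms(1) multilin2[OF assms(2)]] assms(3)])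

lemma sw2_tens:
  assumes "module k V" "bilin k A V f" "a \<in> carrier A" "b \<in> carrier A"
  shows "sw2 k V (tens k A [a, b]) f = f a b"
  unfolding sw2_def using tlift_tens[OF assms(1) multilin2[OF assms(2)], of "[a, b]"] assms by simp

lemma lin_eq_sw2:
  assumes "module k V" "g \<in> lin k (tpow k A 2) V" "t \<in> carrier (tpow k A 2)"
  shows "g t = sw2 k V t (\<lambda>a b. g (tens k A [a, b]))"
proof -
  have "g t = tlift k V t (\<lambda>w. g (tens k A w))" by (rule lin_eq_tlift[OF assms])
  also have "\<dots> = sw2 k V t (\<lambda>a b. g (tens k A [a, b]))"
    unfolding sw2_def by (rule tlift_cong_closed_free[OF assms(3)]) (auto simp: length_cases)
  finally show ?thesis .
qed

lemma sw2_mult: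
  assumes "module k V" "bilin k A V f" "t \<in> carrier (tpow k A 2)" "s \<in> carrier (tpow k A 2)"
  shows "sw2 k V (t \<otimes>\<^bsub>tpow k A 2\<^esub> s) f
    = sw2 k V t (\<lambda>a b. sw2 k V s (\<lambda>a' b'. f (a\<otimes>\<^sub>A a') (b\<otimes>\<^sub>A b')))"
proof -
  note tlift_mult[OF assms(1) multilin2[OF assms(2)] assms(3,4)]
  also have "tlift k V t (\<lambda>u. tlift k V s (\<lambda>w. (\<lambda>w. f (w ! 0) (w ! 1)) (map2 (mult A) u w)))
    = tlift k V t (\<lambda>u. tlift k V s (\<lambda>w. f (u ! 0 \<otimes>\<^sub>A w ! 0) (u ! 1 \<otimes>\<^sub>A w ! 1)))"
    by (rule tlift_cong_closed_free[OF assms(3)], rule tlift_cong_closed_free[OF assms(4)]) simp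
  finally show ?thesis unfolding sw2_def .
qed

lemma sw2_one:
  assumes "module k V" "bilin k A V f"
  shows "sw2 k V \<one>\<^bsub>tpow k A 2\<^esub> f = f \<one>\<^sub>A \<one>\<^sub>A"
  using sw2_tens[OF assms, of "\<one>\<^sub>A" "\<one>\<^sub>A"] tens_one[of 2] by (simp add: eval_nat_numeral)

lemma sw3_closed:
  assumes "module k V" "t \<in> carrier (tpow k A 3)"
    "\<And>a b c. \<lbrakk>a \<in> carrier A; b \<in> carrier A; c \<in> carrier A\<rbrakk> \<Longrightarrow> f a b c \<in> carrier V"
  shows "sw3 k V t f \<in> carrier V"
  unfolding sw3_def by (rule tlift_closed[OF assms(1,2)]) (auto intro!: assms(3) simp: subset_iff)

lemma sw3_cong:
  assumes "t \<in> carrier (tpow k A 3)"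
    "\<And>a b c. \<lbrakk>a \<in> carrier A; b \<in> carrier A; c \<in> carrier A\<rbrakk> \<Longrightarrow> f a b c = g a b c"
  shows "sw3 k V t f = sw3 k V t g"
  unfolding sw3_def by (rule tlift_cong_closed_free[OF assms(1)]) (auto intro!: assms(2) simp: subset_iff)

lemma lin_sw3:
  assumes "module k V" "module k W" "g \<in> lin k V W" "t \<in> carrier (tpow k A 3)"
    "\<And>a b c. \<lbrakk>a \<in> carrier A; b \<in> carrier A; c \<in> carrier A\<rbrakk> \<Longrightarrow> f a b c \<in> carrier V"
  shows "g (sw3 k V t f) = sw3 k W t (\<lambda>a b c. g (f a b c))"
  unfolding sw3_def by (rule lin_tlift[OF assms(1-4)]) (auto intro!: assms(5) simp: subset_iff)

lemma sw3_fun_lin: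
  assumes "module k V" "t \<in> carrier (tpow k A 3)"
    "\<And>a b c. \<lbrakk>a \<in> carrier A; b \<in> carrier A; c \<in> carrier A\<rbrakk> \<Longrightarrow> (\<lambda>x. f x a b c) \<in> lin k U V"
  shows "(\<lambda>x. sw3 k V t (f x)) \<in> lin k U V"
  unfolding sw3_def by (rule tlift_fun_lin[OF assms(1,2)]) (auto intro!: assms(3) simp: subset_iff)

lemma sw3_arg_lin:
  assumes "module k V" "trilin k A V f" "g \<in> lin k U (tpow k A 3)"
  shows "(\<lambda>x. sw3 k V (g x) f) \<in> lin k U V"
  unfolding sw3_def by (rule lin_comp[OF tlift_arg_lin[OF assms(1) multilin3[OF assms(2)]] assms(3)])

lemma sw3_tens:
  assumes "module k V" "trilin k A V f" "a \<in> carrier A" "b \<in> carrier A" "c \<in> carrier A"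
  shows "sw3 k V (tens k A [a, b, c]) f = f a b c"
  unfolding sw3_def using tlift_tens[OF assms(1) multilin3[OF assms(2)], of "[a, b, c]"] assms by simp

lemma sw3_mult:
  assumes "module k V" "trilin k A V f" "t \<in> carrier (tpow k A 3)" "s \<in> carrier (tpow k A 3)"
  shows "sw3 k V (t \<otimes>\<^bsub>tpow k A 3\<^esub> s) f
    = sw3 k V t (\<lambda>a b c. sw3 k V s (\<lambda>a' b' c'. f (a\<otimes>\<^sub>A a') (b\<otimes>\<^sub>A b') (c\<otimes>\<^sub>A c')))"
proof -
  note tlift_mult[OF assms(1) multilin3[OF assms(2)] assms(3,4)]
  also have "tlift k V t (\<lambda>u. tlift k V s (\<lambda>w. (\<lambda>w. f (w ! 0) (w ! 1) (w ! 2)) (map2 (mult A) u w)))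
    = tlift k V t (\<lambda>u. tlift k V s (\<lambda>w. f (u ! 0 \<otimes>\<^sub>A w ! 0) (u ! 1 \<otimes>\<^sub>A w ! 1) (u ! 2 \<otimes>\<^sub>A w ! 2)))"
    by (rule tlift_cong_closed_free[OF assms(3)], rule tlift_cong_closed_free[OF assms(4)]) simp
  finally show ?thesis unfolding sw3_def .
qed

lemma sw3_one:
  assumes "module k V" "trilin k A V f"
  shows "sw3 k V \<one>\<^bsub>tpow k A 3\<^esub> f = f \<one>\<^sub>A \<one>\<^sub>A \<one>\<^sub>A"
  using sw3_tens[OF assms, of "\<one>\<^sub>A" "\<one>\<^sub>A" "\<one>\<^sub>A"] tens_one[of 3] by (simp add: eval_nat_numeral)

lemma sw4_cong:
  assumes "t \<in> carrier (tpow k A 4)"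
    "\<And>a b c d. \<lbrakk>a \<in> carrier A; b \<in> carrier A; c \<in> carrier A; d \<in> carrier A\<rbrakk> \<Longrightarrow> f a b c d = g a b c d"
  shows "sw4 k V t f = sw4 k V t g"
  unfolding sw4_def by (rule tlift_cong_closed_free[OF assms(1)]) (auto intro!: assms(2) simp: subset_iff)

lemma sw4_fun_lin:
  assumes "module k V" "t \<in> carrier (tpow k A 4)"
    "\<And>a b c d. \<lbrakk>a \<in> carrier A; b \<in> carrier A; c \<in> carrier A; d \<in> carrier A\<rbrakk> \<Longrightarrow> (\<lambda>x. f x a b c d) \<in> lin k U V"
  shows "(\<lambda>x. sw4 k V t (f x)) \<in> lin k U V"
  unfolding sw4_def by (rule tlift_fun_lin[OF assms(1,2)]) (auto intro!: assms(3) simp: subset_iff)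

lemma sw4_arg_lin:
  assumes "module k V" "quadlin k A V f" "g \<in> lin k U (tpow k A 4)"
  shows "(\<lambda>x. sw4 k V (g x) f) \<in> lin k U V"
  unfolding sw4_def by (rule lin_comp[OF tlift_arg_lin[OF assms(1) multilin4[OF assms(2)]] assms(3)])

lemma sw4_tens:
  assumes "module k V" "quadlin k A V f" "a \<in> carrier A" "b \<in> carrier A" "c \<in> carrier A" "d \<in> carrier A"
  shows "sw4 k V (tens k A [a, b, c, d]) f = f a b c d"
  unfolding sw4_def using tlift_tens[OF assms(1) multilin4[OF assms(2)], of "[a, b, c, d]"] assms by simp

lemma sw4_mult:
  assumes "module k V" "quadlin k A V f" "t \<in> carrier (tpow k A 4)" "s \<in> carrier (tpow k A 4)"
  shows "sw4 k V (t \<otimes>\<^bsub>tpow k A 4\<^esub> s) f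
    = sw4 k V t (\<lambda>a b c d. sw4 k V s (\<lambda>a' b' c' d'. f (a\<otimes>\<^sub>A a') (b\<otimes>\<^sub>A b') (c\<otimes>\<^sub>A c') (d\<otimes>\<^sub>A d')))"
proof -
  note tlift_mult[OF assms(1) multilin4[OF assms(2)] assms(3,4)]
  also have "tlift k V t (\<lambda>u. tlift k V s (\<lambda>w. (\<lambda>w. f (w ! 0) (w ! 1) (w ! 2) (w ! 3)) (map2 (mult A) u w)))
    = tlift k V t (\<lambda>u. tlift k V s (\<lambda>w. f (u ! 0 \<otimes>\<^sub>A w ! 0) (u ! 1 \<otimes>\<^sub>A w ! 1) (u ! 2 \<otimes>\<^sub>A w ! 2) (u ! 3 \<otimes>\<^sub>A w ! 3)))"
    by (rule tlift_cong_closed_free[OF assms(3)], rule tlift_cong_closed_free[OF assms(4)]) simp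
  finally show ?thesis unfolding sw4_def .
qed

lemma sw2_sw2_swap:
  assumes "unital_algebra k B" "module k V" "t \<in> carrier (tpow k A 2)" "s \<in> carrier (tpow k B 2)"
    "\<And>a b a' b'. \<lbrakk>a \<in> carrier A; b \<in> carrier A; a' \<in> carrier B; b' \<in> carrier B\<rbrakk> \<Longrightarrow> f a b a' b' \<in> carrier V"
  shows "sw2 k V t (\<lambda>a b. sw2 k V s (\<lambda>a' b'. f a b a' b'))
    = sw2 k V s (\<lambda>a' b'. sw2 k V t (\<lambda>a b. f a b a' b'))"
  unfolding sw2_def sw2_def
  by (rule tlift_swap[OF assms(1-4)]) (auto intro!: assms(5) simp: subset_iff)

lemma sw2_sw3_swap:
  assumes "unital_algebra k B" "module k V" "t \<in> carrier (tpow k A 2)" "s \<in> carrier (tpow k B 3)"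
    "\<And>a b a' b' c'. \<lbrakk>a \<in> carrier A; b \<in> carrier A; a' \<in> carrier B; b' \<in> carrier B; c' \<in> carrier B\<rbrakk> \<Longrightarrow> f a b a' b' c' \<in> carrier V"
  shows "sw2 k V t (\<lambda>a b. sw3 k V s (\<lambda>a' b' c'. f a b a' b' c'))
    = sw3 k V s (\<lambda>a' b' c'. sw2 k V t (\<lambda>a b. f a b a' b' c'))"
  unfolding sw2_def sw3_def
  by (rule tlift_swap[OF assms(1-4)]) (auto intro!: assms(5) simp: subset_iff)

lemma sw3_sw3_swap:
  assumes "unital_algebra k B" "module k V" "t \<in> carrier (tpow k A 3)" "s \<in> carrier (tpow k B 3)"
    "\<And>a b c a' b' c'. \<lbrakk>a \<in> carrier A; b \<in> carrier A; c \<in> carrier A; a' \<in> carrier B; b' \<in> carrier B; c' \<in> carrier B\<rbrakk> \<Longrightarrow> f a b c a' b' c' \<in> carrier V"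
  shows "sw3 k V t (\<lambda>a b c. sw3 k V s (\<lambda>a' b' c'. f a b c a' b' c'))
    = sw3 k V s (\<lambda>a' b' c'. sw3 k V t (\<lambda>a b c. f a b c a' b' c'))"
  unfolding sw3_def sw3_def
  by (rule tlift_swap[OF assms(1-4)]) (auto intro!: assms(5) simp: subset_iff)

lemma tens_lin2:
  assumes "g \<in> lin k U A" "b \<in> carrier A"
  shows "(\<lambda>x. tens k A [g x, b]) \<in> lin k U (tpow k A 2)" "(\<lambda>x. tens k A [b, g x]) \<in> lin k U (tpow k A 2)"
  using assms multilinD(2)[OF multilin_tens, of "[]" "[b]" 2] multilinD(2)[OF multilin_tens, of "[b]" "[]" 2]
  by (auto intro!: lin_comp[OF _ assms(1), of "\<lambda>a. tens k A [a, b]"] lin_comp[OF _ assms(1), of "\<lambda>a. tens k A [b, a]"])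

lemma tens_lin3:
  assumes "g \<in> lin k U A" "b \<in> carrier A" "c \<in> carrier A"
  shows "(\<lambda>x. tens k A [g x, b, c]) \<in> lin k U (tpow k A 3)"
    "(\<lambda>x. tens k A [b, g x, c]) \<in> lin k U (tpow k A 3)" "(\<lambda>x. tens k A [b, c, g x]) \<in> lin k U (tpow k A 3)"
  using assms multilinD(2)[OF multilin_tens, of "[]" "[b, c]" 3] multilinD(2)[OF multilin_tens, of "[b]" "[c]" 3]
    multilinD(2)[OF multilin_tens, of "[b, c]" "[]" 3]
  by (auto intro!: lin_comp[OF _ assms(1), of "\<lambda>a. tens k A [a, b, c]"] lin_comp[OF _ assms(1), of "\<lambda>a. tens k A [b, a, c]"]
     lin_comp[OF _ assms(1), of "\<lambda>a. tens k A [b, c, a]"])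

lemma tens_lin4:
  assumes "g \<in> lin k U A" "b \<in> carrier A" "c \<in> carrier A" "d \<in> carrier A"
  shows "(\<lambda>x. tens k A [g x, b, c, d]) \<in> lin k U (tpow k A 4)"
    "(\<lambda>x. tens k A [b, g x, c, d]) \<in> lin k U (tpow k A 4)"
    "(\<lambda>x. tens k A [b, c, g x, d]) \<in> lin k U (tpow k A 4)" "(\<lambda>x. tens k A [b, c, d, g x]) \<in> lin k U (tpow k A 4)"
  using assms multilinD(2)[OF multilin_tens, of "[]" "[b, c, d]" 4] multilinD(2)[OF multilin_tens, of "[b]" "[c, d]" 4]
    multilinD(2)[OF multilin_tens, of "[b, c]" "[d]" 4] multilinD(2)[OF multilin_tens, of "[b, c, d]" "[]" 4]
  by (auto intro!: lin_comp[OF _ assms(1), of "\<lambda>a. tens k A [a, b, c, d]"] lin_comp[OF _ assms(1), of "\<lambda>a. tens k A [b, a, c, d]"]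
     lin_comp[OF _ assms(1), of "\<lambda>a. tens k A [b, c, a, d]"] lin_comp[OF _ assms(1), of "\<lambda>a. tens k A [b, c, d, a]"])

lemmas sw_lin_rules = sw2_fun_lin sw3_fun_lin sw4_fun_lin sw2_arg_lin sw3_arg_lin sw4_arg_lin
  tens_lin2 tens_lin3 tens_lin4 lin_rules bilinI trilinI quadlinI

end

context unital_algebra
begin

text \<open>
  A Sweedler expression over a tensor that is itself given as a Sweedler expression can be
  flattened; here and below the factors of the inner tensor may come from another algebra.
\<close>

lemma sw2_sw2:
  assumes "unital_algebra k B" "module k V" "bilin k A V f" "t \<in> carrier (tpow k B 2)"
    "\<And>a b. \<lbrakk>a \<in> carrier B; b \<in> carrier B\<rbrakk> \<Longrightarrow> F a b \<in> carrier (tpow k A 2)"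
  shows "sw2 k V (sw2 k (tpow k A 2) t F) f = sw2 k V t (\<lambda>a b. sw2 k V (F a b) f)"
  by (rule unital_algebra.lin_sw2[OF assms(1) tpow_module assms(2) sw2_arg_lin[OF assms(2,3) lin_id] assms(4,5)])

lemma sw2_sw3:
  assumes "unital_algebra k B" "module k V" "bilin k A V f" "t \<in> carrier (tpow k B 3)"
    "\<And>a b c. \<lbrakk>a \<in> carrier B; b \<in> carrier B; c \<in> carrier B\<rbrakk> \<Longrightarrow> F a b c \<in> carrier (tpow k A 2)"
  shows "sw2 k V (sw3 k (tpow k A 2) t F) f = sw3 k V t (\<lambda>a b c. sw2 k V (F a b c) f)"
  by (rule unital_algebra.lin_sw3[OF assms(1) tpow_module assms(2) sw2_arg_lin[OF assms(2,3) lin_id] assms(4,5)])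

lemma sw3_sw2:
  assumes "unital_algebra k B" "module k V" "trilin k A V f" "t \<in> carrier (tpow k B 2)"
    "\<And>a b. \<lbrakk>a \<in> carrier B; b \<in> carrier B\<rbrakk> \<Longrightarrow> F a b \<in> carrier (tpow k A 3)"
  shows "sw3 k V (sw2 k (tpow k A 3) t F) f = sw2 k V t (\<lambda>a b. sw3 k V (F a b) f)"
  by (rule unital_algebra.lin_sw2[OF assms(1) tpow_module assms(2) sw3_arg_lin[OF assms(2,3) lin_id] assms(4,5)])

lemma sw3_sw3:
  assumes "unital_algebra k B" "module k V" "trilin k A V f" "t \<in> carrier (tpow k B 3)"
    "\<And>a b c. \<lbrakk>a \<in> carrier B; b \<in> carrier B; c \<in> carrier B\<rbrakk> \<Longrightarrow> F a b c \<in> carrier (tpow k A 3)"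
  shows "sw3 k V (sw3 k (tpow k A 3) t F) f = sw3 k V t (\<lambda>a b c. sw3 k V (F a b c) f)"
  by (rule unital_algebra.lin_sw3[OF assms(1) tpow_module assms(2) sw3_arg_lin[OF assms(2,3) lin_id] assms(4,5)])

lemma sw4_sw2:
  assumes "unital_algebra k B" "module k V" "quadlin k A V f" "t \<in> carrier (tpow k B 2)"
    "\<And>a b. \<lbrakk>a \<in> carrier B; b \<in> carrier B\<rbrakk> \<Longrightarrow> F a b \<in> carrier (tpow k A 4)"
  shows "sw4 k V (sw2 k (tpow k A 4) t F) f = sw2 k V t (\<lambda>a b. sw4 k V (F a b) f)"
  by (rule unital_algebra.lin_sw2[OF assms(1) tpow_module assms(2) sw4_arg_lin[OF assms(2,3) lin_id] assms(4,5)])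

lemma sw4_sw3:
  assumes "unital_algebra k B" "module k V" "quadlin k A V f" "t \<in> carrier (tpow k B 3)"
    "\<And>a b c. \<lbrakk>a \<in> carrier B; b \<in> carrier B; c \<in> carrier B\<rbrakk> \<Longrightarrow> F a b c \<in> carrier (tpow k A 4)"
  shows "sw4 k V (sw3 k (tpow k A 4) t F) f = sw3 k V t (\<lambda>a b c. sw4 k V (F a b c) f)"
  by (rule unital_algebra.lin_sw3[OF assms(1) tpow_module assms(2) sw4_arg_lin[OF assms(2,3) lin_id] assms(4,5)])

lemma sw3_alg_hom:
  assumes B: "unital_algebra k B" and f: "trilin k A B f"
    and m: "\<And>a b c a' b' c'. \<lbrakk>a \<in> carrier A; b \<in> carrier A; c \<in> carrier A; a' \<in> carrier A; b' \<in> carrier A; c' \<in> carrier A\<rbrakk> \<Longrightarrow>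
      f (a \<otimes>\<^sub>A a') (b \<otimes>\<^sub>A b') (c \<otimes>\<^sub>A c') = f a b c \<otimes>\<^sub>B f a' b' c'"
    and one: "f \<one>\<^sub>A \<one>\<^sub>A \<one>\<^sub>A = \<one>\<^sub>B"
  shows "(\<lambda>t. sw3 k B t f) \<in> alg_hom k (tpow k A 3) B"
  unfolding sw3_def using m one
  by (intro tlift_alg_hom[OF B multilin3[OF f]]) (auto simp: length_cases)

lemma sw4_alg_hom:
  assumes B: "unital_algebra k B" and f: "quadlin k A B f"
    and m: "\<And>a b c d a' b' c' d'. \<lbrakk>a \<in> carrier A; b \<in> carrier A; c \<in> carrier A; d \<in> carrier A;
      a' \<in> carrier A; b' \<in> carrier A; c' \<in> carrier A; d' \<in> carrier A\<rbrakk> \<Longrightarrow>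
      f (a \<otimes>\<^sub>A a') (b \<otimes>\<^sub>A b') (c \<otimes>\<^sub>A c') (d \<otimes>\<^sub>A d') = f a b c d \<otimes>\<^sub>B f a' b' c' d'"
    and one: "f \<one>\<^sub>A \<one>\<^sub>A \<one>\<^sub>A \<one>\<^sub>A = \<one>\<^sub>B"
  shows "(\<lambda>t. sw4 k B t f) \<in> alg_hom k (tpow k A 4) B"
  unfolding sw4_def using m one
  by (intro tlift_alg_hom[OF B multilin4[OF f]]) (auto simp: length_cases)

end

(* The operations of H and A are written with fixed symbols below, which replace the indexed ones. *)
no_notation comult ("\<Delta>\<index>") and counit ("\<epsilon>\<index>") and reassoc ("\<Phi>\<index>")
  and antipode ("\<S>\<index>") and alpha ("\<alpha>\<index>") and beta ("\<beta>\<index>")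

section \<open>Sweedler calculus in a quasi-bialgebra\<close>

context unital_algebra
begin

lemma scalars_module: "module k (scalars k)"
  using scalars_unital_algebra by (simp add: unital_algebra_def)

end

context quasi_bialgebra
begin

abbreviation mult_H (infixl "\<cdot>" 70) where "x \<cdot> y \<equiv> x \<otimes>\<^sub>H y"
abbreviation "\<Delta> \<equiv> comult H"
abbreviation "\<epsilon> \<equiv> counit H"
abbreviation "\<Phi> \<equiv> reassoc H"
abbreviation "\<phi>i \<equiv> reassoc_inv k H"
abbreviation "H2 \<equiv> tpow k H 2"
abbreviation "H3 \<equiv> tpow k H 3"
abbreviation "H4 \<equiv> tpow k H 4"

lemma comult_lin: "\<Delta> \<in> lin k H H2"
  by (rule alg_hom_lin[OF comult_hom])

lemma comult_closed: "h \<in> carrier H \<Longrightarrow> \<Delta> h \<in> carrier H2"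
  by (rule lin_closed[OF comult_lin])

lemma counit_lin: "\<epsilon> \<in> lin k H (scalars k)"
  by (rule alg_char_lin[OF counit_hom])

lemma counit_closed: "h \<in> carrier H \<Longrightarrow> \<epsilon> h \<in> carrier k"
  using lin_closed[OF counit_lin] by simp

lemma counit_mult: "\<lbrakk>a \<in> carrier H; b \<in> carrier H\<rbrakk> \<Longrightarrow> \<epsilon> (a \<cdot> b) = \<epsilon> a \<otimes> \<epsilon> b"
  and counit_one: "\<epsilon> \<one>\<^sub>H = \<one>"
  using counit_hom by (auto simp: alg_char_def ring_hom_def)

lemma reassoc_closed: "\<Phi> \<in> carrier H3"
  and reassoc_inv_closed: "\<phi>i \<in> carrier H3"
  and reassoc_mult_inv: "\<Phi> \<otimes>\<^sub>H3 \<phi>i = \<one>\<^sub>H3"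
  and reassoc_inv_mult: "\<phi>i \<otimes>\<^sub>H3 \<Phi> = \<one>\<^sub>H3"
proof -
  interpret T: unital_algebra k "H3" by (rule tpow_algebra)
  show "\<Phi> \<in> carrier H3" "\<phi>i \<in> carrier H3"
    "\<Phi> \<otimes>\<^sub>H3 \<phi>i = \<one>\<^sub>H3" "\<phi>i \<otimes>\<^sub>H3 \<Phi> = \<one>\<^sub>H3"
    using reassoc_unit T.A.Units_closed T.A.Units_inv_closed T.A.Units_r_inv T.A.Units_l_inv
    by (auto simp: reassoc_inv_def)
qed

lemmas qb_closed [simp] = comult_closed counit_closed reassoc_closed reassoc_inv_closed
  tpow_module tpow_algebra module_axioms unital_algebra_axioms scalars_module

lemmas qb_lin = sw_lin_rules lin_comp[OF comult_lin] lin_comp[OF counit_lin]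

lemmas sw_cong = sw2_cong sw3_cong sw4_cong

context
  fixes V :: "('k, 'v, 'y) module_scheme"
  assumes V: "module k V"
begin

interpretation V: module k V by (rule V)

lemma comult_mult_sw:
  assumes "bilin k H V f" "a \<in> carrier H" "b \<in> carrier H"
  shows "sw2 k V (\<Delta> (a \<cdot> b)) f
    = sw2 k V (\<Delta> a) (\<lambda>a1 a2. sw2 k V (\<Delta> b) (\<lambda>b1 b2. f (a1 \<cdot> b1) (a2 \<cdot> b2)))"
  using comult_hom assms comult_closed by (simp add: alg_hom_def ring_hom_def sw2_mult[OF V])

lemma comult_one_sw:
  assumes "bilin k H V f"
  shows "sw2 k V (\<Delta> \<one>\<^sub>H) f = f \<one>\<^sub>H \<one>\<^sub>H"
  using comult_hom sw2_one[OF V assms] by (simp add: alg_hom_def ring_hom_def)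

lemma counit_right_sw:
  assumes g: "g \<in> lin k H V" and h: "h \<in> carrier H"
  shows "sw2 k V (\<Delta> h) (\<lambda>a b. \<epsilon> b \<odot>\<^sub>V g a) = g h"
proof -
  have "g h = g (sw2 k H (\<Delta> h) (\<lambda>a b. \<epsilon> b \<odot>\<^sub>H a))" using counit_right[OF h] by simp
  also have "\<dots> = sw2 k V (\<Delta> h) (\<lambda>a b. g (\<epsilon> b \<odot>\<^sub>H a))"
    using h by (intro lin_sw2[OF module_axioms V g]) simp_all
  also have "\<dots> = sw2 k V (\<Delta> h) (\<lambda>a b. \<epsilon> b \<odot>\<^sub>V g a)"
    using h by (intro sw2_cong) (simp_all add: lin_smult[OF g])
  finally show ?thesis ..
qed

lemma counit_left_sw:
  assumes g: "g \<in> lin k H V" and h: "h \<in> carrier H"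
  shows "sw2 k V (\<Delta> h) (\<lambda>a b. \<epsilon> a \<odot>\<^sub>V g b) = g h"
proof -
  have "g h = g (sw2 k H (\<Delta> h) (\<lambda>a b. \<epsilon> a \<odot>\<^sub>H b))" using counit_left[OF h] by simp
  also have "\<dots> = sw2 k V (\<Delta> h) (\<lambda>a b. g (\<epsilon> a \<odot>\<^sub>H b))"
    using h by (intro lin_sw2[OF module_axioms V g]) simp_all
  also have "\<dots> = sw2 k V (\<Delta> h) (\<lambda>a b. \<epsilon> a \<odot>\<^sub>V g b)"
    using h by (intro sw2_cong) (simp_all add: lin_smult[OF g])
  finally show ?thesis ..
qed

lemma reassoc_inv_reassoc_sw:
  assumes "trilin k H V f"
  shows "sw3 k V \<phi>i (\<lambda>x1 x2 x3. sw3 k V \<Phi> (\<lambda>X1 X2 X3. f (x1 \<cdot> X1) (x2 \<cdot> X2) (x3 \<cdot> X3)))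
    = f \<one>\<^sub>H \<one>\<^sub>H \<one>\<^sub>H"
  using sw3_mult[OF V assms reassoc_inv_closed reassoc_closed] sw3_one[OF V assms]
  by (simp add: reassoc_inv_mult)

abbreviation "DL h \<equiv> sw2 k H3 (\<Delta> h) (\<lambda>a b.
    sw2 k H3 (\<Delta> a) (\<lambda>a1 a2. tens k H [a1, a2, b]))"

abbreviation "DR h \<equiv> sw2 k H3 (\<Delta> h) (\<lambda>a b.
    sw2 k H3 (\<Delta> b) (\<lambda>b1 b2. tens k H [a, b1, b2]))"

lemma DL_DR_closed:
  assumes "h \<in> carrier H"
  shows "DL h \<in> carrier H3" "DR h \<in> carrier H3"
  using assms by (auto intro!: sw2_closed tens_closed simp: qb_closed)

lemma DL_sw:
  assumes f: "trilin k H V f" and h: "h \<in> carrier H"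
  shows "sw3 k V (DL h) f = sw2 k V (\<Delta> h) (\<lambda>a b. sw2 k V (\<Delta> a) (\<lambda>a1 a2. f a1 a2 b))"
  using h by (simp add: sw3_sw2[OF unital_algebra_axioms V f] sw3_tens[OF V f] sw2_closed tens_closed cong: sw_cong)

lemma DR_sw:
  assumes f: "trilin k H V f" and h: "h \<in> carrier H"
  shows "sw3 k V (DR h) f = sw2 k V (\<Delta> h) (\<lambda>a b. sw2 k V (\<Delta> b) (\<lambda>b1 b2. f a b1 b2))"
  using h by (simp add: sw3_sw2[OF unital_algebra_axioms V f] sw3_tens[OF V f] sw2_closed tens_closed cong: sw_cong)

lemma trilin_sw3_right:
  assumes f: "trilin k H V f" and s: "s \<in> carrier H3"
  shows "trilin k H V (\<lambda>a b c. sw3 k V s (\<lambda>x y z. f (a \<cdot> x) (b \<cdot> y) (c \<cdot> z)))"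
  by (intro qb_lin trilin_lin[OF f] V s) simp_all

text \<open>
  The three forms of quasi-coassociativity differ in the side of the equation on which the
  reassociator stands: its conjugation can be moved to either bracketing, or split between the two.
\<close>

lemma coassoc_sw:
  assumes f: "trilin k H V f" and h: "h \<in> carrier H"
  shows "sw2 k V (\<Delta> h) (\<lambda>a b. sw2 k V (\<Delta> b) (\<lambda>b1 b2. f a b1 b2))
    = sw3 k V \<Phi> (\<lambda>X1 X2 X3. sw2 k V (\<Delta> h) (\<lambda>a b. sw2 k V (\<Delta> a) (\<lambda>a1 a2.
      sw3 k V \<phi>i (\<lambda>x1 x2 x3. f (X1 \<cdot> a1 \<cdot> x1) (X2 \<cdot> a2 \<cdot> x2) (X3 \<cdot> b \<cdot> x3)))))"
proof -
  interpret T: unital_algebra k "H3" by (rule tpow_algebra)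
  note fl = trilin_lin[OF f]
  have "sw2 k V (\<Delta> h) (\<lambda>a b. sw2 k V (\<Delta> b) (\<lambda>b1 b2. f a b1 b2)) = sw3 k V (DR h) f"
    by (simp add: DR_sw f h)
  also have "\<dots> = sw3 k V (\<Phi> \<otimes>\<^sub>H3 DL h \<otimes>\<^sub>H3 \<phi>i) f"
    using quasi_coassoc[OF h] by simp
  also have "\<dots> = sw3 k V \<Phi> (\<lambda>X1 X2 X3. sw3 k V (DL h) (\<lambda>a b c.
      sw3 k V \<phi>i (\<lambda>x1 x2 x3. f (X1 \<cdot> a \<cdot> x1) (X2 \<cdot> b \<cdot> x2) (X3 \<cdot> c \<cdot> x3))))"
    by (simp add: sw3_mult V f h DL_DR_closed trilin_sw3_right)
  also have "\<dots> = sw3 k V \<Phi> (\<lambda>X1 X2 X3. sw2 k V (\<Delta> h) (\<lambda>a b. sw2 k V (\<Delta> a) (\<lambda>a1 a2.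
      sw3 k V \<phi>i (\<lambda>x1 x2 x3. f (X1 \<cdot> a1 \<cdot> x1) (X2 \<cdot> a2 \<cdot> x2) (X3 \<cdot> b \<cdot> x3)))))"
    by (intro sw3_cong DL_sw qb_lin fl V h) simp_all
  finally show ?thesis .
qed

lemma coassoc_inv_sw:
  assumes f: "trilin k H V f" and h: "h \<in> carrier H"
  shows "sw2 k V (\<Delta> h) (\<lambda>a b. sw2 k V (\<Delta> a) (\<lambda>a1 a2. f a1 a2 b))
    = sw3 k V \<phi>i (\<lambda>x1 x2 x3. sw2 k V (\<Delta> h) (\<lambda>a b. sw2 k V (\<Delta> b) (\<lambda>b1 b2.
      sw3 k V \<Phi> (\<lambda>X1 X2 X3. f (x1 \<cdot> a \<cdot> X1) (x2 \<cdot> b1 \<cdot> X2) (x3 \<cdot> b2 \<cdot> X3)))))"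
proof -
  interpret T: unital_algebra k "H3" by (rule tpow_algebra)
  note fl = trilin_lin[OF f]
  note cl = DL_DR_closed[OF h] reassoc_closed reassoc_inv_closed
  have "\<phi>i \<otimes>\<^sub>H3 DR h \<otimes>\<^sub>H3 \<Phi>
    = (\<phi>i \<otimes>\<^sub>H3 \<Phi>) \<otimes>\<^sub>H3 DL h \<otimes>\<^sub>H3 (\<phi>i \<otimes>\<^sub>H3 \<Phi>)"
    unfolding quasi_coassoc[OF h] using cl by (simp add: T.A.m_assoc del: T.A.l_one T.A.r_one)
  then have DL: "DL h = \<phi>i \<otimes>\<^sub>H3 DR h \<otimes>\<^sub>H3 \<Phi>"
    using cl by (simp add: reassoc_inv_mult)
  have "sw2 k V (\<Delta> h) (\<lambda>a b. sw2 k V (\<Delta> a) (\<lambda>a1 a2. f a1 a2 b)) = sw3 k V (DL h) f"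
    by (simp add: DL_sw f h)
  also have "\<dots> = sw3 k V \<phi>i (\<lambda>X1 X2 X3. sw3 k V (DR h) (\<lambda>a b c.
      sw3 k V \<Phi> (\<lambda>x1 x2 x3. f (X1 \<cdot> a \<cdot> x1) (X2 \<cdot> b \<cdot> x2) (X3 \<cdot> c \<cdot> x3))))"
    unfolding DL by (simp add: sw3_mult V f h DL_DR_closed trilin_sw3_right)
  also have "\<dots> = sw3 k V \<phi>i (\<lambda>x1 x2 x3. sw2 k V (\<Delta> h) (\<lambda>a b. sw2 k V (\<Delta> b) (\<lambda>b1 b2.
      sw3 k V \<Phi> (\<lambda>X1 X2 X3. f (x1 \<cdot> a \<cdot> X1) (x2 \<cdot> b1 \<cdot> X2) (x3 \<cdot> b2 \<cdot> X3)))))"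
    by (intro sw3_cong DR_sw qb_lin fl V h) simp_all
  finally show ?thesis .
qed

lemma coassoc_mixed_sw:
  assumes f: "trilin k H V f" and h: "h \<in> carrier H"
  shows "sw3 k V \<Phi> (\<lambda>X1 X2 X3. sw2 k V (\<Delta> h) (\<lambda>a b. sw2 k V (\<Delta> a) (\<lambda>a1 a2.
      f (X1 \<cdot> a1) (X2 \<cdot> a2) (X3 \<cdot> b))))
    = sw2 k V (\<Delta> h) (\<lambda>a b. sw2 k V (\<Delta> b) (\<lambda>b1 b2.
      sw3 k V \<Phi> (\<lambda>X1 X2 X3. f (a \<cdot> X1) (b1 \<cdot> X2) (b2 \<cdot> X3))))"
proof -
  interpret T: unital_algebra k "H3" by (rule tpow_algebra)
  note fl = trilin_lin[OF f]
  note cl = DL_DR_closed[OF h] reassoc_closed reassoc_inv_closed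
  have eq: "\<Phi> \<otimes>\<^sub>H3 DL h = DR h \<otimes>\<^sub>H3 \<Phi>"
    unfolding quasi_coassoc[OF h] using cl by (simp add: T.A.m_assoc reassoc_inv_mult)
  have "sw3 k V (\<Phi> \<otimes>\<^sub>H3 DL h) f
    = sw3 k V \<Phi> (\<lambda>X1 X2 X3. sw2 k V (\<Delta> h) (\<lambda>a b. sw2 k V (\<Delta> a) (\<lambda>a1 a2.
      f (X1 \<cdot> a1) (X2 \<cdot> a2) (X3 \<cdot> b))))"
    unfolding sw3_mult[OF V f cl(3,1)]
    by (intro sw3_cong DL_sw qb_lin fl V h) simp_all
  moreover have "sw3 k V (DR h \<otimes>\<^sub>H3 \<Phi>) f
    = sw2 k V (\<Delta> h) (\<lambda>a b. sw2 k V (\<Delta> b) (\<lambda>b1 b2.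
      sw3 k V \<Phi> (\<lambda>X1 X2 X3. f (a \<cdot> X1) (b1 \<cdot> X2) (b2 \<cdot> X3))))"
    unfolding sw3_mult[OF V f cl(2,3)]
    by (rule DR_sw[OF trilin_sw3_right[OF f cl(3)] h])
  ultimately show ?thesis by (simp add: eq)
qed

end

end

section \<open>The counit and the reassociator\<close>

lemma (in module) smult_left_comm:
  "\<lbrakk>a \<in> carrier R; b \<in> carrier R; x \<in> carrier M\<rbrakk> \<Longrightarrow> a \<odot>\<^sub>M (b \<odot>\<^sub>M x) = b \<odot>\<^sub>M (a \<odot>\<^sub>M x)"
  by (simp add: R.m_comm flip: smult_assoc1)

context quasi_bialgebra
begin

lemma tens_ones:
  "tens k H [\<one>\<^sub>H, \<one>\<^sub>H] = \<one>\<^sub>H2"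
  "tens k H [\<one>\<^sub>H, \<one>\<^sub>H, \<one>\<^sub>H] = \<one>\<^sub>H3"
  "tens k H [\<one>\<^sub>H, \<one>\<^sub>H, \<one>\<^sub>H, \<one>\<^sub>H] = \<one>\<^sub>H4"
  using tens_one[of 2] tens_one[of 3] tens_one[of 4] by (simp_all add: eval_nat_numeral)

lemma counit_tens_mult:
  assumes "r \<in> carrier k" "s \<in> carrier k" "u \<in> carrier (tpow k H n)" "v \<in> carrier (tpow k H n)"
  shows "(r \<odot>\<^bsub>tpow k H n\<^esub> u) \<otimes>\<^bsub>tpow k H n\<^esub> (s \<odot>\<^bsub>tpow k H n\<^esub> v) = (r \<otimes> s) \<odot>\<^bsub>tpow k H n\<^esub> (u \<otimes>\<^bsub>tpow k H n\<^esub> v)"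
proof -
  interpret T: unital_algebra k "tpow k H n" by (rule tpow_algebra)
  show ?thesis using assms by (simp add: T.smult_mult_left T.smult_mult_right T.smult_assoc1 T.smult_left_comm)
qed

abbreviation "counit_at1 t \<equiv> sw3 k H2 t (\<lambda>a b c. \<epsilon> a \<odot>\<^sub>H2 tens k H [b, c])"
abbreviation "counit_at2 t \<equiv> sw3 k H2 t (\<lambda>a b c. \<epsilon> b \<odot>\<^sub>H2 tens k H [a, c])"
abbreviation "counit_at3 t \<equiv> sw3 k H2 t (\<lambda>a b c. \<epsilon> c \<odot>\<^sub>H2 tens k H [a, b])"

lemma counit_at_hom:
  "(\<lambda>t. counit_at1 t) \<in> alg_hom k H3 H2"
  "(\<lambda>t. counit_at2 t) \<in> alg_hom k H3 H2"
  "(\<lambda>t. counit_at3 t) \<in> alg_hom k H3 H2"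
proof -
  interpret T: unital_algebra k "H2" by (rule tpow_algebra)
  show "(\<lambda>t. counit_at1 t) \<in> alg_hom k H3 H2"
    "(\<lambda>t. counit_at2 t) \<in> alg_hom k H3 H2"
    "(\<lambda>t. counit_at3 t) \<in> alg_hom k H3 H2"
    by (rule sw3_alg_hom[OF tpow_algebra]; (intro qb_lin)?;
      simp add: tens_closed counit_mult counit_tens_mult tens_mult counit_one tens_ones)+
qed

text \<open>
  Every algebra map that trivialises the reassociator also trivialises its inverse. Applied to the
  counit on each of the legs, this gives the counit laws for \<open>\<Phi>\<^sup>-\<^sup>1\<close>.
\<close>

lemma reassoc_inv_trivial:
  assumes F: "F \<in> alg_hom k H3 B" and B: "unital_algebra k B" and e: "F \<Phi> = \<one>\<^sub>B"
  shows "F \<phi>i = \<one>\<^sub>B"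
proof -
  interpret B: unital_algebra k B by (rule B)
  have "F (\<Phi> \<otimes>\<^sub>H3 \<phi>i) = F \<phi>i"
    using alg_homD(1,4)[OF F] by (simp add: e)
  then show ?thesis by (simp add: reassoc_mult_inv alg_homD(5)[OF F])
qed

text \<open>
  The choice of the leg to which the counit is applied is left open by means of the functions
  \<open>x\<close>, \<open>y\<close> and \<open>z\<close>.
\<close>

lemma counit_leg_sw:
  assumes V: "module k V" and g: "bilin k H V g" and t: "t \<in> carrier H3"
    and c: "\<And>a b c. \<lbrakk>a \<in> carrier H; b \<in> carrier H; c \<in> carrier H\<rbrakk> \<Longrightarrow>
      x a b c \<in> carrier H \<and> y a b c \<in> carrier H \<and> z a b c \<in> carrier H"
    and e: "sw3 k H2 t (\<lambda>a b c. \<epsilon> (x a b c) \<odot>\<^sub>H2 tens k H [y a b c, z a b c]) = \<one>\<^sub>H2"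
  shows "sw3 k V t (\<lambda>a b c. \<epsilon> (x a b c) \<odot>\<^sub>V g (y a b c) (z a b c)) = g \<one>\<^sub>H \<one>\<^sub>H"
proof -
  note l = sw2_arg_lin[OF V g lin_id]
  have "g \<one>\<^sub>H \<one>\<^sub>H = sw2 k V (sw3 k H2 t (\<lambda>a b c. \<epsilon> (x a b c) \<odot>\<^sub>H2 tens k H [y a b c, z a b c])) g"
    by (simp add: e sw2_one[OF V g])
  also have "\<dots> = sw3 k V t (\<lambda>a b c. sw2 k V (\<epsilon> (x a b c) \<odot>\<^sub>H2 tens k H [y a b c, z a b c]) g)"
    using c by (intro sw2_sw3[OF unital_algebra_axioms V g t]) (simp add: tens_closed module.smult_closed[OF tpow_module])
  also have "\<dots> = sw3 k V t (\<lambda>a b c. \<epsilon> (x a b c) \<odot>\<^sub>V g (y a b c) (z a b c))"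
    using c by (intro sw3_cong t) (simp_all add: lin_smult[OF l] sw2_tens[OF V g] tens_closed)
  finally show ?thesis ..
qed

lemma counit_at1_sw:
  assumes "module k V" "bilin k H V g" "t \<in> carrier H3" "counit_at1 t = \<one>\<^sub>H2"
  shows "sw3 k V t (\<lambda>a b c. \<epsilon> a \<odot>\<^sub>V g b c) = g \<one>\<^sub>H \<one>\<^sub>H"
  by (rule counit_leg_sw[OF assms(1-3), where x = "\<lambda>a b c. a" and y = "\<lambda>a b c. b" and z = "\<lambda>a b c. c", OF _ assms(4)]) simp

lemma counit_at2_sw:
  assumes "module k V" "bilin k H V g" "t \<in> carrier H3" "counit_at2 t = \<one>\<^sub>H2"
  shows "sw3 k V t (\<lambda>a b c. \<epsilon> b \<odot>\<^sub>V g a c) = g \<one>\<^sub>H \<one>\<^sub>H"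
  by (rule counit_leg_sw[OF assms(1-3), where x = "\<lambda>a b c. b" and y = "\<lambda>a b c. a" and z = "\<lambda>a b c. c", OF _ assms(4)]) simp

lemma counit_at3_sw:
  assumes "module k V" "bilin k H V g" "t \<in> carrier H3" "counit_at3 t = \<one>\<^sub>H2"
  shows "sw3 k V t (\<lambda>a b c. \<epsilon> c \<odot>\<^sub>V g a b) = g \<one>\<^sub>H \<one>\<^sub>H"
  by (rule counit_leg_sw[OF assms(1-3), where x = "\<lambda>a b c. c" and y = "\<lambda>a b c. a" and z = "\<lambda>a b c. b", OF _ assms(4)]) simp

lemma counit_at2: "counit_at2 \<Phi> = \<one>\<^sub>H2"
  using counit_reassoc by (simp add: tens_ones)

text \<open>
  The five factors of the pentagon, as functions of the reassociator. Each of them is an algebra map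
  in this argument, so it sends \<open>\<Phi>\<^sup>-\<^sup>1\<close> to the inverse of the factor.
\<close>

abbreviation "pent1 t \<equiv> sw3 k H4 t (\<lambda>X1 X2 X3. tens k H [\<one>\<^sub>H, X1, X2, X3])"
abbreviation "pent4 t \<equiv> sw3 k H4 t (\<lambda>X1 X2 X3. tens k H [X1, X2, X3, \<one>\<^sub>H])"
abbreviation "pentM t \<equiv> sw3 k H4 t (\<lambda>X1 X2 X3.
  sw2 k H4 (\<Delta> X2) (\<lambda>a b. tens k H [X1, a, b, X3]))"
abbreviation "pentR t \<equiv> sw3 k H4 t (\<lambda>X1 X2 X3.
  sw2 k H4 (\<Delta> X3) (\<lambda>a b. tens k H [X1, X2, a, b]))"
abbreviation "pentL t \<equiv> sw3 k H4 t (\<lambda>X1 X2 X3.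
  sw2 k H4 (\<Delta> X1) (\<lambda>a b. tens k H [a, b, X2, X3]))"

lemma pent_closed:
  assumes "t \<in> carrier H3"
  shows "pent1 t \<in> carrier H4" "pent4 t \<in> carrier H4"
    "pentM t \<in> carrier H4" "pentR t \<in> carrier H4" "pentL t \<in> carrier H4"
  using assms by (simp_all add: sw3_closed sw2_closed tens_closed)

lemma pent_sw:
  assumes V: "module k V" and F: "quadlin k H V F" and t: "t \<in> carrier H3"
  shows "sw4 k V (pent1 t) F = sw3 k V t (\<lambda>X1 X2 X3. F \<one>\<^sub>H X1 X2 X3)"
    "sw4 k V (pent4 t) F = sw3 k V t (\<lambda>X1 X2 X3. F X1 X2 X3 \<one>\<^sub>H)"
    "sw4 k V (pentM t) F = sw3 k V t (\<lambda>X1 X2 X3. sw2 k V (\<Delta> X2) (\<lambda>a b. F X1 a b X3))"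
    "sw4 k V (pentR t) F = sw3 k V t (\<lambda>X1 X2 X3. sw2 k V (\<Delta> X3) (\<lambda>a b. F X1 X2 a b))"
    "sw4 k V (pentL t) F = sw3 k V t (\<lambda>X1 X2 X3. sw2 k V (\<Delta> X1) (\<lambda>a b. F a b X2 X3))"
  using t by (simp_all add: sw4_sw3[OF unital_algebra_axioms V F] sw4_sw2[OF unital_algebra_axioms V F]
    sw4_tens[OF V F] qb_closed sw2_closed tens_closed cong: sw_cong)

lemma pentagon': "pent1 \<Phi> \<otimes>\<^sub>H4 pentM \<Phi> \<otimes>\<^sub>H4 pent4 \<Phi>
    = pentR \<Phi> \<otimes>\<^sub>H4 pentL \<Phi>"
  by (rule pentagon)

text \<open>
  The axioms only trivialise the middle leg of the reassociator. Applying the counit to the second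
  factor of the pentagon turns it into \<open>U \<Phi> = \<Phi>\<close>, where \<open>U\<close> is \<open>1\<close> tensored with the value of the
  counit on the first leg; cancelling \<open>\<Phi>\<close> gives the claim for the first leg. The third factor yields
  the third leg in the same way.
\<close>

lemma counit_at13: "counit_at1 \<Phi> = \<one>\<^sub>H2" "counit_at3 \<Phi> = \<one>\<^sub>H2"
proof -
  let ?T = "H3"
  interpret T2: unital_algebra k "H2" by (rule tpow_algebra)
  interpret T: unital_algebra k ?T by (rule tpow_algebra)
  interpret T4: unital_algebra k "H4" by (rule tpow_algebra)
  note M = tpow_module and R = reassoc_closed and cl = pent_closed[OF reassoc_closed]
  note s = qb_closed tens_closed
  let ?e2 = "\<lambda>a b c d. \<epsilon> b \<odot>\<^sub>?T tens k H [a, c, d]" and ?e3 = "\<lambda>a b c d. \<epsilon> c \<odot>\<^sub>?T tens k H [a, b, d]"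
  have q: "quadlin k H ?T ?e2" "quadlin k H ?T ?e3" by (intro qb_lin; simp add: s)+
  have h: "(\<lambda>t. sw4 k ?T t ?e2) \<in> alg_hom k H4 ?T" "(\<lambda>t. sw4 k ?T t ?e3) \<in> alg_hom k H4 ?T"
    using q by (intro sw4_alg_hom[OF tpow_algebra]; simp add: s counit_mult counit_tens_mult tens_mult counit_one tens_ones)+
  note p = pent_sw[OF M q(1) R] pent_sw[OF M q(2) R]
  note e2 = counit_at2_sw[OF M _ R counit_at2]
  have \<Phi>: "sw3 k ?T \<Phi> (\<lambda>a b c. tens k H [a, b, c]) = \<Phi>"
  proof -
    have "tlift k ?T \<Phi> (\<lambda>w. tens k H [w ! 0, w ! 1, w ! 2]) = tlift k ?T \<Phi> (tens k H)"
      by (rule tlift_cong_closed_free[OF R]) (auto simp: length_cases)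
    then show ?thesis using lin_eq_tlift[OF M lin_id R] by (simp add: sw3_def)
  qed
  let ?U = "sw3 k ?T \<Phi> (\<lambda>X1 X2 X3. \<epsilon> X1 \<odot>\<^sub>?T tens k H [\<one>\<^sub>H, X2, X3])"
  let ?W = "sw3 k ?T \<Phi> (\<lambda>X1 X2 X3. \<epsilon> X3 \<odot>\<^sub>?T tens k H [X1, X2, \<one>\<^sub>H])"
  have cUW: "?U \<in> carrier ?T" "?W \<in> carrier ?T" by (intro sw3_closed; simp add: s)+
  have E2: "sw4 k ?T (pentM \<Phi>) ?e2 = \<Phi>" "sw4 k ?T (pent4 \<Phi>) ?e2 = \<one>\<^sub>?T" "sw4 k ?T (pentR \<Phi>) ?e2 = \<one>\<^sub>?T"
      "sw4 k ?T (pentL \<Phi>) ?e2 = \<Phi>" "sw4 k ?T (pent1 \<Phi>) ?e2 = ?U"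
  proof -
    have "sw3 k ?T \<Phi> (\<lambda>X1 X2 X3. sw2 k ?T (\<Delta> X2) (\<lambda>a b. \<epsilon> a \<odot>\<^sub>?T tens k H [X1, b, X3])) = sw3 k ?T \<Phi> (\<lambda>a b c. tens k H [a, b, c])"
      by (intro sw3_cong counit_left_sw qb_lin M) (simp_all add: s)
    then show "sw4 k ?T (pentM \<Phi>) ?e2 = \<Phi>" by (simp add: p \<Phi>)
    have "sw3 k ?T \<Phi> (\<lambda>X1 X2 X3. sw2 k ?T (\<Delta> X1) (\<lambda>a b. \<epsilon> b \<odot>\<^sub>?T tens k H [a, X2, X3])) = sw3 k ?T \<Phi> (\<lambda>a b c. tens k H [a, b, c])"
      by (intro sw3_cong counit_right_sw qb_lin M) (simp_all add: s)
    then show "sw4 k ?T (pentL \<Phi>) ?e2 = \<Phi>" by (simp add: p \<Phi>)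
    have "sw3 k ?T \<Phi> (\<lambda>X1 X2 X3. \<epsilon> X2 \<odot>\<^sub>?T tens k H [X1, X3, \<one>\<^sub>H]) = tens k H [\<one>\<^sub>H, \<one>\<^sub>H, \<one>\<^sub>H]"
      by (intro e2 qb_lin) (simp_all add: s)
    then show "sw4 k ?T (pent4 \<Phi>) ?e2 = \<one>\<^sub>?T" by (simp add: p tens_ones)
    have "sw3 k ?T \<Phi> (\<lambda>X1 X2 X3. sw2 k ?T (\<Delta> X3) (\<lambda>a b. \<epsilon> X2 \<odot>\<^sub>?T tens k H [X1, a, b]))
      = sw3 k ?T \<Phi> (\<lambda>X1 X2 X3. \<epsilon> X2 \<odot>\<^sub>?T sw2 k ?T (\<Delta> X3) (\<lambda>a b. tens k H [X1, a, b]))"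
      by (intro sw3_cong lin_sw2[OF M M lin_smult_right[OF M _ lin_id], symmetric]) (simp_all add: s)
    also have "\<dots> = sw2 k ?T (\<Delta> \<one>\<^sub>H) (\<lambda>a b. tens k H [\<one>\<^sub>H, a, b])" by (intro e2 qb_lin) (simp_all add: s)
    also have "\<dots> = tens k H [\<one>\<^sub>H, \<one>\<^sub>H, \<one>\<^sub>H]" by (intro comult_one_sw qb_lin) (simp_all add: s)
    finally show "sw4 k ?T (pentR \<Phi>) ?e2 = \<one>\<^sub>?T" by (simp add: p tens_ones)
  qed (simp add: p)
  have E3: "sw4 k ?T (pentM \<Phi>) ?e3 = \<Phi>" "sw4 k ?T (pent1 \<Phi>) ?e3 = \<one>\<^sub>?T" "sw4 k ?T (pentL \<Phi>) ?e3 = \<one>\<^sub>?T"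
      "sw4 k ?T (pentR \<Phi>) ?e3 = \<Phi>" "sw4 k ?T (pent4 \<Phi>) ?e3 = ?W"
  proof -
    have "sw3 k ?T \<Phi> (\<lambda>X1 X2 X3. sw2 k ?T (\<Delta> X2) (\<lambda>a b. \<epsilon> b \<odot>\<^sub>?T tens k H [X1, a, X3])) = sw3 k ?T \<Phi> (\<lambda>a b c. tens k H [a, b, c])"
      by (intro sw3_cong counit_right_sw qb_lin M) (simp_all add: s)
    then show "sw4 k ?T (pentM \<Phi>) ?e3 = \<Phi>" by (simp add: p \<Phi>)
    have "sw3 k ?T \<Phi> (\<lambda>X1 X2 X3. sw2 k ?T (\<Delta> X3) (\<lambda>a b. \<epsilon> a \<odot>\<^sub>?T tens k H [X1, X2, b])) = sw3 k ?T \<Phi> (\<lambda>a b c. tens k H [a, b, c])"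
      by (intro sw3_cong counit_left_sw qb_lin M) (simp_all add: s)
    then show "sw4 k ?T (pentR \<Phi>) ?e3 = \<Phi>" by (simp add: p \<Phi>)
    have "sw3 k ?T \<Phi> (\<lambda>X1 X2 X3. \<epsilon> X2 \<odot>\<^sub>?T tens k H [\<one>\<^sub>H, X1, X3]) = tens k H [\<one>\<^sub>H, \<one>\<^sub>H, \<one>\<^sub>H]"
      by (intro e2 qb_lin) (simp_all add: s)
    then show "sw4 k ?T (pent1 \<Phi>) ?e3 = \<one>\<^sub>?T" by (simp add: p tens_ones)
    have "sw3 k ?T \<Phi> (\<lambda>X1 X2 X3. sw2 k ?T (\<Delta> X1) (\<lambda>a b. \<epsilon> X2 \<odot>\<^sub>?T tens k H [a, b, X3]))
      = sw3 k ?T \<Phi> (\<lambda>X1 X2 X3. \<epsilon> X2 \<odot>\<^sub>?T sw2 k ?T (\<Delta> X1) (\<lambda>a b. tens k H [a, b, X3]))"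
      by (intro sw3_cong lin_sw2[OF M M lin_smult_right[OF M _ lin_id], symmetric]) (simp_all add: s)
    also have "\<dots> = sw2 k ?T (\<Delta> \<one>\<^sub>H) (\<lambda>a b. tens k H [a, b, \<one>\<^sub>H])" by (intro e2 qb_lin) (simp_all add: s)
    also have "\<dots> = tens k H [\<one>\<^sub>H, \<one>\<^sub>H, \<one>\<^sub>H]" by (intro comult_one_sw qb_lin) (simp_all add: s)
    finally show "sw4 k ?T (pentL \<Phi>) ?e3 = \<one>\<^sub>?T" by (simp add: p tens_ones)
  qed (simp add: p)
  have "?U \<otimes>\<^sub>?T \<Phi> = \<Phi>"
    using arg_cong[OF pentagon', of "\<lambda>t. sw4 k ?T t ?e2"] cUW by (simp add: alg_homD(4)[OF h(1)] cl E2 s)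
  then have U: "?U = \<Phi> \<otimes>\<^sub>?T \<phi>i"
    using cUW T.A.m_assoc[OF cUW(1) R reassoc_inv_closed] by (simp add: reassoc_mult_inv s)
  have "\<Phi> \<otimes>\<^sub>?T ?W = \<Phi>"
    using arg_cong[OF pentagon', of "\<lambda>t. sw4 k ?T t ?e3"] cUW by (simp add: alg_homD(4)[OF h(2)] cl E3 s)
  then have W: "?W = \<phi>i \<otimes>\<^sub>?T \<Phi>"
    using cUW T.A.m_assoc[OF reassoc_inv_closed R cUW(2)] by (simp add: reassoc_inv_mult s)
  have "counit_at1 ?U = counit_at1 \<Phi>"
    by (simp add: sw3_sw3[OF unital_algebra_axioms tpow_module _ R] lin_smult[OF sw3_arg_lin[OF tpow_module _ lin_id]] sw3_tens[OF tpow_module]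
      qb_lin s counit_one cong: sw3_cong)
  then show "counit_at1 \<Phi> = \<one>\<^sub>H2" by (simp add: U reassoc_mult_inv alg_homD(5)[OF counit_at_hom(1)])
  have "counit_at3 ?W = counit_at3 \<Phi>"
    by (simp add: sw3_sw3[OF unital_algebra_axioms tpow_module _ R] lin_smult[OF sw3_arg_lin[OF tpow_module _ lin_id]] sw3_tens[OF tpow_module]
      qb_lin s counit_one cong: sw3_cong)
  then show "counit_at3 \<Phi> = \<one>\<^sub>H2" by (simp add: W reassoc_inv_mult alg_homD(5)[OF counit_at_hom(3)])
qed

lemma pent4_inv: "pent4 \<Phi> \<otimes>\<^sub>H4 pent4 \<phi>i = \<one>\<^sub>H4"
proof -
  have "(\<lambda>t. pent4 t) \<in> alg_hom k H3 H4"
    by (rule sw3_alg_hom[OF tpow_algebra]; (intro qb_lin)?; simp add: tens_mult tens_ones)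
  from alg_homD(4,5)[OF this] show ?thesis by (metis reassoc_closed reassoc_inv_closed reassoc_mult_inv)
qed

lemma pentR_inv: "pentR \<phi>i \<otimes>\<^sub>H4 pentR \<Phi> = \<one>\<^sub>H4"
proof -
  let ?T = "H4"
  interpret T: unital_algebra k ?T by (rule tpow_algebra)
  have f: "trilin k H ?T (\<lambda>X1 X2 X3. sw2 k ?T (\<Delta> X3) (\<lambda>a b. tens k H [X1, X2, a, b]))"
    by (intro qb_lin) simp_all
  have b: "bilin k H ?T (\<lambda>p q. tens k H [a, b, p, q])" if "a \<in> carrier H" "b \<in> carrier H" for a b
    using that by (intro qb_lin) simp_all
  have "(\<lambda>t. pentR t) \<in> alg_hom k H3 (?T)"
  proof (rule sw3_alg_hom[OF tpow_algebra f])
    fix a b c a' b' c' assume c: "a \<in> carrier H" "b \<in> carrier H" "c \<in> carrier H" "a' \<in> carrier H" "b' \<in> carrier H" "c' \<in> carrier H"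
    let ?S = "sw2 k ?T (\<Delta> c') (\<lambda>p' q'. tens k H [a', b', p', q'])"
    have S: "?S \<in> carrier ?T" using c by (simp add: sw2_closed tens_closed)
    have "sw2 k ?T (\<Delta> (c \<cdot> c')) (\<lambda>p q. tens k H [a \<cdot> a', b \<cdot> b', p, q])
      = sw2 k ?T (\<Delta> c) (\<lambda>p q. sw2 k ?T (\<Delta> c') (\<lambda>p' q'.
      tens k H [a \<cdot> a', b \<cdot> b', p \<cdot> p', q \<cdot> q']))"
      using c by (intro comult_mult_sw[OF tpow_module b]) simp_all
    also have "\<dots> = sw2 k ?T (\<Delta> c) (\<lambda>p q. sw2 k ?T (\<Delta> c') (\<lambda>p' q'.
      tens k H [a, b, p, q] \<otimes>\<^sub>?T tens k H [a', b', p', q']))"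
      using c by (intro sw2_cong) (simp_all add: tens_mult)
    also have "\<dots> = sw2 k ?T (\<Delta> c) (\<lambda>p q. tens k H [a, b, p, q] \<otimes>\<^sub>?T ?S)"
      using c by (intro sw2_cong lin_sw2[OF tpow_module tpow_module lin_mult(2)[OF tpow_algebra lin_id], symmetric])
      (simp_all add: tens_closed)
    also have "\<dots> = sw2 k ?T (\<Delta> c) (\<lambda>p q. tens k H [a, b, p, q]) \<otimes>\<^sub>?T ?S"
      using c S by (intro lin_sw2[OF tpow_module tpow_module lin_mult(1)[OF tpow_algebra lin_id], symmetric])
      (simp_all add: tens_closed)
    finally show "sw2 k ?T (\<Delta> (c \<cdot> c')) (\<lambda>p q. tens k H [a \<cdot> a', b \<cdot> b', p, q])
      = sw2 k ?T (\<Delta> c) (\<lambda>p q. tens k H [a, b, p, q]) \<otimes>\<^sub>?T ?S" .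
  qed (use comult_one_sw[OF tpow_module b, of "\<one>\<^sub>H" "\<one>\<^sub>H"] in \<open>simp add: tens_ones\<close>)
  from alg_homD(4,5)[OF this] show ?thesis by (metis reassoc_closed reassoc_inv_closed reassoc_inv_mult)
qed

text \<open>
  The form of the pentagon needed for \<open>pentagon_antipode\<close>: the factors \<open>\<Phi> \<otimes> 1\<close> and
  \<open>(id \<otimes> id \<otimes> \<Delta>)(\<Phi>)\<close> are moved to the opposite sides.
\<close>

lemma pentagon_rearranged:
  "pentL \<Phi> \<otimes>\<^sub>H4 pent4 \<phi>i = pentR \<phi>i \<otimes>\<^sub>H4 (pent1 \<Phi> \<otimes>\<^sub>H4 pentM \<Phi>)"
proof -
  interpret T: unital_algebra k "H4" by (rule tpow_algebra)
  note cl = pent_closed[OF reassoc_closed] pent_closed[OF reassoc_inv_closed]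
  have "pentR \<phi>i \<otimes>\<^sub>H4 (pent1 \<Phi> \<otimes>\<^sub>H4 pentM \<Phi>)
    = pentR \<phi>i \<otimes>\<^sub>H4 (pent1 \<Phi> \<otimes>\<^sub>H4 pentM \<Phi> \<otimes>\<^sub>H4 pent4 \<Phi>) \<otimes>\<^sub>H4 pent4 \<phi>i"
    using cl by (simp add: T.A.m_assoc pent4_inv)
  also have "\<dots> = (pentR \<phi>i \<otimes>\<^sub>H4 pentR \<Phi>) \<otimes>\<^sub>H4 pentL \<Phi> \<otimes>\<^sub>H4 pent4 \<phi>i"
    unfolding pentagon' using cl by (simp add: T.A.m_assoc)
  finally show ?thesis using cl by (simp add: pentR_inv)
qed

context
  fixes V :: "('k, 'v, 'y) module_scheme"
  assumes V: "module k V"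
begin

interpretation V: module k V by (rule V)

lemma quadlin_right:
  assumes F: "quadlin k H V F" and s: "s \<in> carrier H4"
  shows "quadlin k H V (\<lambda>a b c d. sw4 k V s (\<lambda>x y z w. F (a \<cdot> x) (b \<cdot> y) (c \<cdot> z) (d \<cdot> w)))"
  by (intro qb_lin quadlin_lin[OF F] V s) simp_all

lemma pentagon_rearranged_sw:
  assumes F: "quadlin k H V F"
  shows "sw3 k V \<Phi> (\<lambda>X1 X2 X3. sw2 k V (\<Delta> X1) (\<lambda>a b. sw3 k V \<phi>i (\<lambda>x1 x2 x3.
      F (a \<cdot> x1) (b \<cdot> x2) (X2 \<cdot> x3) X3)))
    = sw3 k V \<phi>i (\<lambda>y1 y2 y3. sw2 k V (\<Delta> y3) (\<lambda>c d. sw3 k V \<Phi> (\<lambda>X1 X2 X3. sw3 k V \<Phi> (\<lambda>Z1 Z2 Z3.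
      sw2 k V (\<Delta> Z2) (\<lambda>e g. F (y1 \<cdot> Z1) (y2 \<cdot> (X1 \<cdot> e)) (c \<cdot> (X2 \<cdot> g)) (d \<cdot> (X3 \<cdot> Z3)))))))"
proof -
  interpret T: unital_algebra k "H4" by (rule tpow_algebra)
  note cl = pent_closed[OF reassoc_closed] pent_closed[OF reassoc_inv_closed]
  note fl = quadlin_lin[OF F]
  have "sw4 k V (pentL \<Phi> \<otimes>\<^sub>H4 pent4 \<phi>i) F
    = sw3 k V \<Phi> (\<lambda>X1 X2 X3. sw2 k V (\<Delta> X1) (\<lambda>a b. sw4 k V (pent4 \<phi>i)
      (\<lambda>x y z w. F (a \<cdot> x) (b \<cdot> y) (X2 \<cdot> z) (X3 \<cdot> w))))"
    unfolding sw4_mult[OF V F cl(5) cl(7)] pent_sw(5)[OF V quadlin_right[OF F cl(7)] reassoc_closed] ..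
  also have "\<dots> = sw3 k V \<Phi> (\<lambda>X1 X2 X3. sw2 k V (\<Delta> X1) (\<lambda>a b. sw3 k V \<phi>i (\<lambda>x1 x2 x3.
      F (a \<cdot> x1) (b \<cdot> x2) (X2 \<cdot> x3) (X3 \<cdot> \<one>\<^sub>H))))"
    by (intro sw3_cong sw2_cong pent_sw(2)[OF V] qb_lin fl) simp_all
  also have "\<dots> = sw3 k V \<Phi> (\<lambda>X1 X2 X3. sw2 k V (\<Delta> X1) (\<lambda>a b. sw3 k V \<phi>i (\<lambda>x1 x2 x3.
      F (a \<cdot> x1) (b \<cdot> x2) (X2 \<cdot> x3) X3)))"
    by (intro sw3_cong sw2_cong) simp_all
  finally have L: "sw4 k V (pentL \<Phi> \<otimes>\<^sub>H4 pent4 \<phi>i) F = \<dots>" .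
  have "sw4 k V (pentR \<phi>i \<otimes>\<^sub>H4 (pent1 \<Phi> \<otimes>\<^sub>H4 pentM \<Phi>)) F
    = sw4 k V (pentR \<phi>i) (\<lambda>a b c d. sw4 k V (pent1 \<Phi> \<otimes>\<^sub>H4 pentM \<Phi>)
      (\<lambda>x y z w. F (a \<cdot> x) (b \<cdot> y) (c \<cdot> z) (d \<cdot> w)))"
    using cl by (intro sw4_mult[OF V F]) simp_all
  also have "\<dots> = sw3 k V \<phi>i (\<lambda>y1 y2 y3. sw2 k V (\<Delta> y3) (\<lambda>c d. sw4 k V (pent1 \<Phi> \<otimes>\<^sub>H4 pentM \<Phi>)
      (\<lambda>x y z w. F (y1 \<cdot> x) (y2 \<cdot> y) (c \<cdot> z) (d \<cdot> w))))"
    using cl by (intro pent_sw(4)[OF V] quadlin_right F) simp_all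
  also have "\<dots> = sw3 k V \<phi>i (\<lambda>y1 y2 y3. sw2 k V (\<Delta> y3) (\<lambda>c d. sw4 k V (pent1 \<Phi>) (\<lambda>a' b' c' d'. sw4 k V (pentM \<Phi>)
      (\<lambda>x y z w. F (y1 \<cdot> (a' \<cdot> x)) (y2 \<cdot> (b' \<cdot> y)) (c \<cdot> (c' \<cdot> z)) (d \<cdot> (d' \<cdot> w))))))"
    using cl by (intro sw3_cong sw2_cong sw4_mult[OF V] qb_lin fl) simp_all
  also have "\<dots> = sw3 k V \<phi>i (\<lambda>y1 y2 y3. sw2 k V (\<Delta> y3) (\<lambda>c d. sw3 k V \<Phi> (\<lambda>X1 X2 X3. sw4 k V (pentM \<Phi>)
      (\<lambda>x y z w. F (y1 \<cdot> (\<one>\<^sub>H \<cdot> x)) (y2 \<cdot> (X1 \<cdot> y)) (c \<cdot> (X2 \<cdot> z)) (d \<cdot> (X3 \<cdot> w))))))"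
    using cl by (intro sw3_cong sw2_cong pent_sw(1)[OF V] qb_lin fl V) simp_all
  also have "\<dots> = sw3 k V \<phi>i (\<lambda>y1 y2 y3. sw2 k V (\<Delta> y3) (\<lambda>c d. sw3 k V \<Phi> (\<lambda>X1 X2 X3. sw3 k V \<Phi> (\<lambda>Z1 Z2 Z3.
      sw2 k V (\<Delta> Z2) (\<lambda>e g. F (y1 \<cdot> (\<one>\<^sub>H \<cdot> Z1)) (y2 \<cdot> (X1 \<cdot> e)) (c \<cdot> (X2 \<cdot> g)) (d \<cdot> (X3 \<cdot> Z3)))))))"
    using cl by (intro sw3_cong sw2_cong pent_sw(3)[OF V] qb_lin fl V) simp_all
  also have "\<dots> = sw3 k V \<phi>i (\<lambda>y1 y2 y3. sw2 k V (\<Delta> y3) (\<lambda>c d. sw3 k V \<Phi> (\<lambda>X1 X2 X3. sw3 k V \<Phi> (\<lambda>Z1 Z2 Z3.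
      sw2 k V (\<Delta> Z2) (\<lambda>e g. F (y1 \<cdot> Z1) (y2 \<cdot> (X1 \<cdot> e)) (c \<cdot> (X2 \<cdot> g)) (d \<cdot> (X3 \<cdot> Z3)))))))"
    by (intro sw3_cong sw2_cong) simp_all
  finally show ?thesis using L by (simp add: pentagon_rearranged)
qed

end

lemmas counit_reassoc1_sw = counit_at1_sw[OF _ _ reassoc_closed counit_at13(1)]
lemmas counit_reassoc2_sw = counit_at2_sw[OF _ _ reassoc_closed counit_at2]
lemmas counit_reassoc3_sw = counit_at3_sw[OF _ _ reassoc_closed counit_at13(2)]
lemmas counit_reassoc_inv1_sw = counit_at1_sw[OF _ _ reassoc_inv_closed reassoc_inv_trivial[OF counit_at_hom(1) tpow_algebra counit_at13(1)]]
lemmas counit_reassoc_inv2_sw = counit_at2_sw[OF _ _ reassoc_inv_closed reassoc_inv_trivial[OF counit_at_hom(2) tpow_algebra counit_at2]]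
lemmas counit_reassoc_inv3_sw = counit_at3_sw[OF _ _ reassoc_inv_closed reassoc_inv_trivial[OF counit_at_hom(3) tpow_algebra counit_at13(2)]]

end

section \<open>The antipode and characters\<close>

context quasi_hopf_algebra
begin

abbreviation "\<S> \<equiv> antipode H"
abbreviation "\<alpha> \<equiv> alpha H"
abbreviation "\<beta> \<equiv> beta H"

lemma antipode_in: "h \<in> carrier H \<Longrightarrow> \<S> h \<in> carrier H"
  using antipode_closed by auto

lemma antipode_lin: "\<S> \<in> lin k H H"
  by (rule linI) (simp_all add: antipode_in antipode_add antipode_smult)

lemmas qh_closed [simp] = qb_closed antipode_in alpha_closed beta_closed
lemmas qh_lin = qb_lin lin_comp[OF antipode_lin]

lemma antipode_alpha_sw:
  assumes V: "module k V" and g: "g \<in> lin k H V" and h: "h \<in> carrier H"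
  shows "sw2 k V (\<Delta> h) (\<lambda>a b. g (\<S> a \<cdot> \<alpha> \<cdot> b)) = \<epsilon> h \<odot>\<^sub>V g \<alpha>"
  using lin_sw2[OF module_axioms V g comult_closed[OF h], of "\<lambda>a b. \<S> a \<cdot> \<alpha> \<cdot> b"]
  by (simp add: antipode_alpha h lin_smult[OF g])

lemma antipode_beta_sw:
  assumes V: "module k V" and g: "g \<in> lin k H V" and h: "h \<in> carrier H"
  shows "sw2 k V (\<Delta> h) (\<lambda>a b. g (a \<cdot> \<beta> \<cdot> \<S> b)) = \<epsilon> h \<odot>\<^sub>V g \<beta>"
  using lin_sw2[OF module_axioms V g comult_closed[OF h], of "\<lambda>a b. a \<cdot> \<beta> \<cdot> \<S> b"]
  by (simp add: antipode_beta h lin_smult[OF g])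

lemma antipode_reassoc_sw:
  assumes V: "module k V" and g: "g \<in> lin k H V"
  shows "sw3 k V \<Phi> (\<lambda>X1 X2 X3. g (X1 \<cdot> \<beta> \<cdot> \<S> X2 \<cdot> \<alpha> \<cdot> X3)) = g \<one>\<^sub>H"
  using lin_sw3[OF module_axioms V g reassoc_closed, of "\<lambda>X1 X2 X3. X1 \<cdot> \<beta> \<cdot> \<S> X2 \<cdot> \<alpha> \<cdot> X3"]
  by (simp add: antipode_reassoc)

lemma antipode_reassoc_inv_sw:
  assumes V: "module k V" and g: "g \<in> lin k H V"
  shows "sw3 k V \<phi>i (\<lambda>x1 x2 x3. g (\<S> x1 \<cdot> \<alpha> \<cdot> x2 \<cdot> \<beta> \<cdot> \<S> x3)) = g \<one>\<^sub>H"
  using lin_sw3[OF module_axioms V g reassoc_inv_closed, of "\<lambda>x1 x2 x3. \<S> x1 \<cdot> \<alpha> \<cdot> x2 \<cdot> \<beta> \<cdot> \<S> x3"]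
  by (simp add: antipode_reassoc_inv)

text \<open>
  The rearranged pentagon contracted with \<open>\<psi> \<otimes> id\<close>, \<open>\<beta>\<close>, the antipode and \<open>\<alpha>\<close>. On the right side the
  antipode axioms collapse the copies of \<open>\<Phi>\<close> one after the other, and the counit removes the rest.
  The left side is what remains when \<open>\<kappa>\<close> is evaluated at a coinvariant (\<open>kap_coinv\<close>).
\<close>

lemma pentagon_antipode:
  assumes \<psi>: "\<psi> \<in> lin k H (scalars k)"
  shows "sw3 k H \<Phi> (\<lambda>X1 X2 X3. sw2 k H (\<Delta> X1) (\<lambda>a b. sw3 k H \<phi>i (\<lambda>x1 x2 x3.
      \<psi> (a \<cdot> x1) \<odot>\<^sub>H (b \<cdot> x2 \<cdot> \<beta> \<cdot> \<S> (X2 \<cdot> x3) \<cdot> \<alpha> \<cdot> X3))))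
    = \<psi> \<one>\<^sub>H \<odot>\<^sub>H \<one>\<^sub>H"
proof -
  let ?W = "\<lambda>f. sw3 k H \<phi>i (\<lambda>y1 y2 y3. sw2 k H (\<Delta> y3) (\<lambda>c d. sw3 k H \<Phi> (\<lambda>X1 X2 X3. f y1 y2 y3 c d X1 X2 X3)))"
  have \<psi>c: "\<psi> a \<in> carrier k" if "a \<in> carrier H" for a using lin_closed[OF \<psi> that] by simp
  note l = qh_lin lin_comp[OF \<psi>]
  note M = module_axioms
  note s = qh_closed \<psi>c antipode_mult A.m_assoc
  note push = lin_sw2[OF M M lin_smult_right[OF M _ lin_id]] lin_sw3[OF M M lin_smult_right[OF M _ lin_id]]
  have "sw3 k H \<Phi> (\<lambda>X1 X2 X3. sw2 k H (\<Delta> X1) (\<lambda>a b. sw3 k H \<phi>i (\<lambda>x1 x2 x3.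
      \<psi> (a \<cdot> x1) \<odot>\<^sub>H (b \<cdot> x2 \<cdot> \<beta> \<cdot> \<S> (X2 \<cdot> x3) \<cdot> \<alpha> \<cdot> X3))))
    = ?W (\<lambda>y1 y2 y3 c d X1 X2 X3. sw3 k H \<Phi> (\<lambda>Z1 Z2 Z3.
      sw2 k H (\<Delta> Z2) (\<lambda>e g. \<psi> (y1 \<cdot> Z1) \<odot>\<^sub>H (y2 \<cdot> (X1 \<cdot> e) \<cdot> \<beta> \<cdot> \<S> (c \<cdot> (X2 \<cdot> g))
      \<cdot> \<alpha> \<cdot> (d \<cdot> (X3 \<cdot> Z3))))))"
    by (rule pentagon_rearranged_sw[OF M]) (intro l; simp add: s)
  also have "\<dots> = ?W (\<lambda>y1 y2 y3 c d X1 X2 X3. sw3 k H \<Phi> (\<lambda>Z1 Z2 Z3.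
      sw2 k H (\<Delta> Z2) (\<lambda>e g. \<psi> (y1 \<cdot> Z1) \<odot>\<^sub>H (y2 \<cdot> X1 \<cdot> (e \<cdot> \<beta> \<cdot> \<S> g) \<cdot>
      (\<S> X2 \<cdot> \<S> c \<cdot> \<alpha> \<cdot> d \<cdot> X3 \<cdot> Z3)))))"
    by (intro sw3_cong sw2_cong) (simp_all add: s)
  also have "\<dots> = ?W (\<lambda>y1 y2 y3 c d X1 X2 X3. sw3 k H \<Phi> (\<lambda>Z1 Z2 Z3.
      \<epsilon> Z2 \<odot>\<^sub>H (\<psi> (y1 \<cdot> Z1) \<odot>\<^sub>H (y2 \<cdot> X1 \<cdot> \<beta> \<cdot>
      (\<S> X2 \<cdot> \<S> c \<cdot> \<alpha> \<cdot> d \<cdot> X3 \<cdot> Z3)))))"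
    by (intro sw3_cong sw2_cong antipode_beta_sw[OF M] l) (simp_all add: s)
  also have "\<dots> = ?W (\<lambda>y1 y2 y3 c d X1 X2 X3.
      \<psi> (y1 \<cdot> \<one>\<^sub>H) \<odot>\<^sub>H (y2 \<cdot> X1 \<cdot> \<beta> \<cdot>
      (\<S> X2 \<cdot> \<S> c \<cdot> \<alpha> \<cdot> d \<cdot> X3 \<cdot> \<one>\<^sub>H)))"
    by (intro sw3_cong sw2_cong counit_reassoc2_sw[OF M] l) (simp_all add: s)
  also have "\<dots> = sw3 k H \<phi>i (\<lambda>y1 y2 y3. sw3 k H \<Phi> (\<lambda>X1 X2 X3. sw2 k H (\<Delta> y3) (\<lambda>c d.
      \<psi> (y1 \<cdot> \<one>\<^sub>H) \<odot>\<^sub>H (y2 \<cdot> X1 \<cdot> \<beta> \<cdot>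
      (\<S> X2 \<cdot> \<S> c \<cdot> \<alpha> \<cdot> d \<cdot> X3 \<cdot> \<one>\<^sub>H)))))"
    by (intro sw3_cong sw2_sw3_swap[OF unital_algebra_axioms M]) (simp_all add: s)
  also have "\<dots> = sw3 k H \<phi>i (\<lambda>y1 y2 y3. sw3 k H \<Phi> (\<lambda>X1 X2 X3. sw2 k H (\<Delta> y3) (\<lambda>c d.
      \<psi> y1 \<odot>\<^sub>H (y2 \<cdot> X1 \<cdot> \<beta> \<cdot> \<S> X2 \<cdot> (\<S> c \<cdot> \<alpha> \<cdot> d) \<cdot> X3))))"
    by (intro sw3_cong sw2_cong) (simp_all add: s)
  also have "\<dots> = sw3 k H \<phi>i (\<lambda>y1 y2 y3. sw3 k H \<Phi> (\<lambda>X1 X2 X3. \<epsilon> y3 \<odot>\<^sub>H (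
      \<psi> y1 \<odot>\<^sub>H (y2 \<cdot> X1 \<cdot> \<beta> \<cdot> \<S> X2 \<cdot> \<alpha> \<cdot> X3))))"
    by (intro sw3_cong sw2_cong antipode_alpha_sw[OF M] l) (simp_all add: s)
  also have "\<dots> = sw3 k H \<phi>i (\<lambda>y1 y2 y3. sw3 k H \<Phi> (\<lambda>X1 X2 X3. \<epsilon> y3 \<odot>\<^sub>H (
      \<psi> y1 \<odot>\<^sub>H (y2 \<cdot> (X1 \<cdot> \<beta> \<cdot> \<S> X2 \<cdot> \<alpha> \<cdot> X3)))))"
    by (intro sw3_cong sw2_cong) (simp_all add: s)
  also have "\<dots> = sw3 k H \<phi>i (\<lambda>y1 y2 y3. \<epsilon> y3 \<odot>\<^sub>H (\<psi> y1 \<odot>\<^sub>H (y2 \<cdot> \<one>\<^sub>H)))"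
    by (intro sw3_cong antipode_reassoc_sw[OF M] l) (simp_all add: s)
  also have "\<dots> = \<psi> \<one>\<^sub>H \<odot>\<^sub>H (\<one>\<^sub>H \<cdot> \<one>\<^sub>H)"
    by (intro counit_reassoc_inv3_sw[OF M] l) (simp_all add: s)
  finally show ?thesis by simp
qed

end

text \<open>
  Convolution of functionals; over a quasi-bialgebra it need not be associative.
\<close>

definition conv ::
  "('k, 'm) ring_scheme \<Rightarrow> ('k, 'a, 'x) quasi_hopf_scheme \<Rightarrow> ('a \<Rightarrow> 'k) \<Rightarrow> ('a \<Rightarrow> 'k) \<Rightarrow> 'a \<Rightarrow> 'k"
  where "conv k H f g h = sw2 k (scalars k) (comult H h) (\<lambda>a b. f a \<otimes>\<^sub>k g b)"

context quasi_hopf_algebra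
begin

text \<open>
  Convolution of characters is associative: a triple of characters takes the reassociator to an
  invertible scalar and \<open>\<Phi>\<^sup>-\<^sup>1\<close> to its inverse, so that conjugation by \<open>\<Phi>\<close> is not seen.
\<close>

lemma sw3_char_unit:
  assumes f: "f \<in> lin k H (scalars k)" "g \<in> lin k H (scalars k)" "h \<in> lin k H (scalars k)"
    and m: "\<And>a b. \<lbrakk>a \<in> carrier H; b \<in> carrier H\<rbrakk> \<Longrightarrow> f (a \<cdot> b) = f a \<otimes> f b"
      "\<And>a b. \<lbrakk>a \<in> carrier H; b \<in> carrier H\<rbrakk> \<Longrightarrow> g (a \<cdot> b) = g a \<otimes> g b"
      "\<And>a b. \<lbrakk>a \<in> carrier H; b \<in> carrier H\<rbrakk> \<Longrightarrow> h (a \<cdot> b) = h a \<otimes> h b"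
    and o: "f \<one>\<^sub>H = \<one>" "g \<one>\<^sub>H = \<one>" "h \<one>\<^sub>H = \<one>"
    and a: "a \<in> carrier H"
  shows "sw2 k (scalars k) (\<Delta> a) (\<lambda>a b. sw2 k (scalars k) (\<Delta> b) (\<lambda>b1 b2. f a \<otimes> (g b1 \<otimes> h b2)))
    = sw2 k (scalars k) (\<Delta> a) (\<lambda>a b. sw2 k (scalars k) (\<Delta> a) (\<lambda>a1 a2. f a1 \<otimes> (g a2 \<otimes> h b)))"
proof -
  let ?K = "scalars k"
  interpret K: unital_algebra k ?K by (rule scalars_unital_algebra)
  let ?F = "\<lambda>a b c. f a \<otimes> (g b \<otimes> h c)"
  have c: "f x \<in> carrier k" "g x \<in> carrier k" "h x \<in> carrier k" if "x \<in> carrier H" for x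
    using f that lin_closed[of _ k H ?K x] by auto
  have F: "trilin k H ?K ?F"
    by (intro qb_lin lin_scalar_mult[OF field_axioms] lin_comp[OF f(1)] lin_comp[OF f(2)] lin_comp[OF f(3)]) (simp_all add: c)
  have Fm: "?F (a \<cdot> a') (b \<cdot> b') (d \<cdot> d') = ?F a b d \<otimes>\<^sub>?K ?F a' b' d'"
    if "a \<in> carrier H" "b \<in> carrier H" "d \<in> carrier H" "a' \<in> carrier H" "b' \<in> carrier H" "d' \<in> carrier H"
    for a b d a' b' d'
    using that by (simp add: m c m_ac)
  let ?F3 = "\<lambda>t. sw3 k ?K t ?F"
  have Fc: "?F3 t \<in> carrier k" if "t \<in> carrier H3" for t
    using sw3_closed[OF scalars_module that, of ?F] by (simp add: c)
  have mult: "?F3 (t \<otimes>\<^sub>H3 s) = ?F3 t \<otimes> ?F3 s"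
    if "t \<in> carrier H3" "s \<in> carrier H3" for t s
    using alg_homD(4)[OF sw3_alg_hom[OF scalars_unital_algebra F] that] Fm by (simp add: o)
  note cl = DL_DR_closed[OF scalars_module a]
  interpret T: unital_algebra k "H3" by (rule tpow_algebra)
  have "?F3 \<Phi> \<otimes> ?F3 \<phi>i = \<one>"
    using mult[OF reassoc_closed reassoc_inv_closed] sw3_one[OF scalars_module F] by (simp add: reassoc_mult_inv o)
  moreover have "?F3 (DR a) = ?F3 \<Phi> \<otimes> ?F3 (DL a) \<otimes> ?F3 \<phi>i"
    unfolding quasi_coassoc[OF a] using cl by (simp add: mult)
  moreover have "x \<otimes> y \<otimes> z = (x \<otimes> z) \<otimes> y"
    if "x \<in> carrier k" "y \<in> carrier k" "z \<in> carrier k" for x y z using that by (simp add: m_ac)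
  ultimately have "?F3 (DR a) = ?F3 (DL a)"
    using Fc[OF reassoc_closed] Fc[OF reassoc_inv_closed] Fc[OF cl(1)] by simp
  then show ?thesis by (simp add: DR_sw[OF scalars_module F a] DL_sw[OF scalars_module F a])
qed

text \<open>
  The functional \<open>\<tau> = \<chi> S\<close> is a left convolution inverse of \<open>\<chi>\<close>: the scalar \<open>\<chi>(\<alpha>)\<close>, which appears in
  the antipode axiom, can be cancelled, since it is a factor of \<open>\<chi>(X\<^sup>1 \<beta> S(X\<^sup>2) \<alpha> X\<^sup>3) = 1\<close>. Then
  \<open>\<chi> = (\<tau> * \<chi>) * \<chi> = \<tau> * (\<chi> * \<chi>) = \<tau> * \<chi> = \<epsilon>\<close>.
\<close>

lemma idempotent_char:
  assumes \<chi>: "\<chi> \<in> alg_char k H" and i: "\<And>a. a \<in> carrier H \<Longrightarrow> conv k H \<chi> \<chi> a = \<chi> a"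
    and a: "a \<in> carrier H"
  shows "\<chi> a = \<epsilon> a"
proof -
  let ?K = "scalars k"
  interpret K: unital_algebra k ?K by (rule scalars_unital_algebra)
  note KM = scalars_module
  have \<chi>l: "\<chi> \<in> lin k H ?K" by (rule alg_char_lin[OF \<chi>])
  have m: "\<chi> (a \<cdot> b) = \<chi> a \<otimes> \<chi> b" if "a \<in> carrier H" "b \<in> carrier H" for a b
    using \<chi> that by (simp add: alg_char_def ring_hom_def)
  have o: "\<chi> \<one>\<^sub>H = \<one>" using \<chi> by (simp add: alg_char_def ring_hom_def)
  have c: "\<chi> x \<in> carrier k" if "x \<in> carrier H" for x using lin_closed[OF \<chi>l that] by simp
  have "\<chi> \<alpha> \<noteq> \<zero>"
  proof
    assume z: "\<chi> \<alpha> = \<zero>"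
    have "\<one> = sw3 k ?K \<Phi> (\<lambda>X1 X2 X3. \<chi> (X1 \<cdot> \<beta> \<cdot> \<S> X2 \<cdot> \<alpha> \<cdot> X3))"
      using antipode_reassoc_sw[OF KM \<chi>l] o by simp
    also have "\<dots> = sw3 k ?K \<Phi> (\<lambda>X1 X2 X3. \<zero> \<odot>\<^sub>?K \<zero>)"
      by (intro sw3_cong) (simp_all add: m c z)
    also have "\<dots> = \<zero> \<odot>\<^sub>?K sw3 k ?K \<Phi> (\<lambda>X1 X2 X3. \<zero>)"
      by (rule lin_sw3[OF KM KM lin_smult_right[OF KM _ lin_id] reassoc_closed, symmetric]) simp_all
    also have "\<dots> = \<zero>" using sw3_closed[OF KM reassoc_closed, of "\<lambda>_ _ _. \<zero>"] by simp
    finally show False by simp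
  qed
  let ?\<tau> = "\<lambda>a. \<chi> (\<S> a)"
  have \<tau>l: "?\<tau> \<in> lin k H ?K" by (rule lin_comp[OF \<chi>l antipode_lin])
  have tau: "sw2 k ?K (\<Delta> b) (\<lambda>a b. ?\<tau> a \<otimes> \<chi> b) = \<epsilon> b" if b: "b \<in> carrier H" for b
  proof -
    have "\<epsilon> b \<otimes> \<chi> \<alpha> = sw2 k ?K (\<Delta> b) (\<lambda>a b. \<chi> (\<S> a \<cdot> \<alpha> \<cdot> b))"
      using antipode_alpha_sw[OF KM \<chi>l b] by simp
    also have "\<dots> = sw2 k ?K (\<Delta> b) (\<lambda>a b. \<chi> \<alpha> \<odot>\<^sub>?K (?\<tau> a \<otimes> \<chi> b))"
      using b by (intro sw2_cong) (simp_all add: m c m_ac)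
    also have "\<dots> = \<chi> \<alpha> \<odot>\<^sub>?K sw2 k ?K (\<Delta> b) (\<lambda>a b. ?\<tau> a \<otimes> \<chi> b)"
      using b by (intro lin_sw2[OF KM KM lin_smult_right[OF KM _ lin_id], symmetric]) (simp_all add: c)
    finally have "\<chi> \<alpha> \<otimes> \<epsilon> b = \<chi> \<alpha> \<otimes> sw2 k ?K (\<Delta> b) (\<lambda>a b. ?\<tau> a \<otimes> \<chi> b)"
      using b by (simp add: c m_comm)
    moreover have "sw2 k ?K (\<Delta> b) (\<lambda>a b. ?\<tau> a \<otimes> \<chi> b) \<in> carrier k"
      using sw2_closed[OF KM comult_closed[OF b], of "\<lambda>a b. ?\<tau> a \<otimes> \<chi> b"] by (simp add: c)
    ultimately show ?thesis
      using \<open>\<chi> \<alpha> \<noteq> \<zero>\<close> b m_lcancel[of "\<chi> \<alpha>" "\<epsilon> b"] by (simp add: c)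
  qed
  have "\<chi> a = sw2 k ?K (\<Delta> a) (\<lambda>a b. \<epsilon> a \<odot>\<^sub>?K \<chi> b)"
    by (rule counit_left_sw[OF KM \<chi>l a, symmetric])
  also have "\<dots> = sw2 k ?K (\<Delta> a) (\<lambda>a b. \<chi> b \<odot>\<^sub>?K sw2 k ?K (\<Delta> a) (\<lambda>a1 a2. ?\<tau> a1 \<otimes> \<chi> a2))"
    using a by (intro sw2_cong) (simp_all add: tau c m_comm)
  also have "\<dots> = sw2 k ?K (\<Delta> a) (\<lambda>a b. sw2 k ?K (\<Delta> a) (\<lambda>a1 a2. \<chi> b \<odot>\<^sub>?K (?\<tau> a1 \<otimes> \<chi> a2)))"
    using a by (intro sw2_cong lin_sw2[OF KM KM lin_smult_right[OF KM _ lin_id]]) (simp_all add: c)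
  also have "\<dots> = sw2 k ?K (\<Delta> a) (\<lambda>a b. sw2 k ?K (\<Delta> a) (\<lambda>a1 a2. ?\<tau> a1 \<otimes> (\<chi> a2 \<otimes> \<chi> b)))"
    using a by (intro sw2_cong) (simp_all add: c m_ac)
  also have "\<dots> = sw2 k ?K (\<Delta> a) (\<lambda>a b. sw2 k ?K (\<Delta> b) (\<lambda>b1 b2. ?\<tau> a \<otimes> (\<chi> b1 \<otimes> \<chi> b2)))"
    by (rule sw3_char_unit[symmetric]) (use \<tau>l \<chi>l a in \<open>simp_all add: m o c antipode_mult antipode_one antipode_in m_comm\<close>)
  also have "\<dots> = sw2 k ?K (\<Delta> a) (\<lambda>a b. ?\<tau> a \<otimes> conv k H \<chi> \<chi> b)"
    unfolding conv_def using a
    by (intro sw2_cong lin_sw2[OF KM KM lin_smult_right[OF KM _ lin_id], simplified, symmetric])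
      (simp_all add: c)
  also have "\<dots> = sw2 k ?K (\<Delta> a) (\<lambda>a b. ?\<tau> a \<otimes> \<chi> b)"
    using a by (intro sw2_cong) (simp_all add: i)
  also have "\<dots> = \<epsilon> a" by (rule tau[OF a])
  finally show ?thesis .
qed

end

section \<open>Morphisms and projections\<close>

locale quasi_hopf_hom = H: quasi_hopf_algebra k H + A: quasi_hopf_algebra k A
  for k :: "('k, 'm) ring_scheme" (structure) and H :: "('k, 'h, 'x) quasi_hopf_scheme"
    and A :: "('k, 'a, 'y) quasi_hopf_scheme" +
  fixes f :: "'h \<Rightarrow> 'a"
  assumes morphism: "quasi_hopf_morphism k H A f"
begin

abbreviation "\<Delta> \<equiv> comult H"
abbreviation "\<epsilon> \<equiv> counit H"
abbreviation "\<Phi> \<equiv> reassoc H"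
abbreviation "\<S> \<equiv> antipode H"
abbreviation "\<alpha> \<equiv> alpha H"
abbreviation "\<beta> \<equiv> beta H"
abbreviation "\<Delta>\<^sub>A \<equiv> comult A"
abbreviation "\<epsilon>\<^sub>A \<equiv> counit A"
abbreviation "\<Phi>\<^sub>A \<equiv> reassoc A"
abbreviation "\<S>\<^sub>A \<equiv> antipode A"
abbreviation "\<alpha>\<^sub>A \<equiv> alpha A"
abbreviation "\<beta>\<^sub>A \<equiv> beta A"

lemma alg_hom: "f \<in> alg_hom k H A"
  using morphism by (simp add: quasi_hopf_morphism_def)

lemma linear: "f \<in> lin k H A"
  by (rule alg_hom_lin[OF alg_hom])

lemma closed: "h \<in> carrier H \<Longrightarrow> f h \<in> carrier A"
  by (rule lin_closed[OF linear])

lemma mult: "\<lbrakk>g \<in> carrier H; h \<in> carrier H\<rbrakk> \<Longrightarrow> f (g \<cdot> h) = f g \<otimes>\<^sub>A f h"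
  and one: "f \<one>\<^sub>H = \<one>\<^sub>A"
  using alg_hom by (auto simp: alg_hom_def ring_hom_def)

lemma smult: "\<lbrakk>r \<in> carrier k; h \<in> carrier H\<rbrakk> \<Longrightarrow> f (r \<odot>\<^sub>H h) = r \<odot>\<^sub>A f h"
  by (rule lin_smult[OF linear])

lemma counit: "h \<in> carrier H \<Longrightarrow> \<epsilon>\<^sub>A (f h) = \<epsilon> h"
  and antipode: "h \<in> carrier H \<Longrightarrow> \<S>\<^sub>A (f h) = f (\<S> h)"
  and alpha: "f \<alpha> = \<alpha>\<^sub>A" and beta: "f \<beta> = \<beta>\<^sub>A"
  using morphism by (auto simp: quasi_hopf_morphism_def)

lemma tmap2: "t \<in> carrier (tpow k H 2) \<Longrightarrow> tmap k A 2 f t = sw2 k (tpow k A 2) t (\<lambda>a b. tens k A [f a, f b])"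
  unfolding tmap_def sw2_def by (rule H.tlift_cong_closed_free) (auto simp: H.length_cases)

lemma tmap3: "t \<in> carrier (tpow k H 3) \<Longrightarrow>
    tmap k A 3 f t = sw3 k (tpow k A 3) t (\<lambda>a b c. tens k A [f a, f b, f c])"
  unfolding tmap_def sw3_def by (rule H.tlift_cong_closed_free) (auto simp: H.length_cases)

lemma comult_sw:
  assumes V: "module k V" and g: "bilin k A V g" and h: "h \<in> carrier H"
  shows "sw2 k V (\<Delta>\<^sub>A (f h)) g = sw2 k V (\<Delta> h) (\<lambda>a b. g (f a) (f b))"
proof -
  have "\<Delta>\<^sub>A (f h) = sw2 k (tpow k A 2) (\<Delta> h) (\<lambda>a b. tens k A [f a, f b])"
    using morphism h by (simp add: quasi_hopf_morphism_def tmap2 H.qh_closed)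
  then show ?thesis
    using h by (simp add: A.sw2_sw2[OF H.unital_algebra_axioms V g] A.sw2_tens[OF V g] H.qh_closed
      A.tens_closed closed cong: H.sw_cong)
qed

lemma reassoc_sw:
  assumes V: "module k V" and g: "trilin k A V g"
  shows "sw3 k V \<Phi>\<^sub>A g = sw3 k V \<Phi> (\<lambda>a b c. g (f a) (f b) (f c))"
proof -
  have "\<Phi>\<^sub>A = sw3 k (tpow k A 3) \<Phi> (\<lambda>a b c. tens k A [f a, f b, f c])"
    using morphism by (simp add: quasi_hopf_morphism_def tmap3 H.qh_closed)
  then show ?thesis
    by (simp add: A.sw3_sw3[OF H.unital_algebra_axioms V g] A.sw3_tens[OF V g] H.qh_closed
      A.tens_closed closed cong: H.sw_cong)
qed

lemma reassoc_inv_sw: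
  assumes V: "module k V" and g: "trilin k A V g"
  shows "sw3 k V (reassoc_inv k A) g = sw3 k V (reassoc_inv k H) (\<lambda>a b c. g (f a) (f b) (f c))"
proof -
  interpret T: unital_algebra k "tpow k A 3" by (rule A.tpow_algebra)
  let ?F = "\<lambda>a b c. tens k A [f a, f b, f c]"
  have F: "trilin k H (tpow k A 3) ?F"
    by (intro trilinI A.tens_lin3 linear closed)
  have c: "sw3 k (tpow k A 3) (reassoc_inv k H) ?F \<in> carrier (tpow k A 3)"
    by (intro H.sw3_closed) (simp_all add: H.qh_closed A.qh_closed A.tens_closed closed)
  have "sw3 k (tpow k A 3) (reassoc_inv k H \<otimes>\<^bsub>tpow k H 3\<^esub> \<Phi>) ?F
    = sw3 k (tpow k A 3) (reassoc_inv k H) ?F \<otimes>\<^bsub>tpow k A 3\<^esub> sw3 k (tpow k A 3) \<Phi> ?F"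
    by (rule alg_homD(4)[OF H.sw3_alg_hom[OF A.tpow_algebra F]]) (simp_all add: H.qh_closed mult one A.tens_mult A.tens_ones closed)
  moreover have "sw3 k (tpow k A 3) \<Phi> ?F = \<Phi>\<^sub>A"
    using morphism by (simp add: quasi_hopf_morphism_def tmap3 H.qh_closed)
  ultimately have "sw3 k (tpow k A 3) (reassoc_inv k H) ?F \<otimes>\<^bsub>tpow k A 3\<^esub> \<Phi>\<^sub>A = \<one>\<^bsub>tpow k A 3\<^esub>"
    using H.sw3_one[OF A.tpow_module F] by (simp add: H.reassoc_inv_mult one A.tens_ones)
  then have "reassoc_inv k A
    = sw3 k (tpow k A 3) (reassoc_inv k H) ?F \<otimes>\<^bsub>tpow k A 3\<^esub> \<Phi>\<^sub>A \<otimes>\<^bsub>tpow k A 3\<^esub> reassoc_inv k A"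
    by (simp add: A.qh_closed)
  also have "\<dots> = sw3 k (tpow k A 3) (reassoc_inv k H) ?F"
    using c by (simp add: T.A.m_assoc A.reassoc_mult_inv A.qh_closed)
  finally have "reassoc_inv k A = sw3 k (tpow k A 3) (reassoc_inv k H) ?F" .
  then show ?thesis
    by (simp add: A.sw3_sw3[OF H.unital_algebra_axioms V g] A.sw3_tens[OF V g] H.qh_closed
      A.tens_closed closed cong: H.sw_cong)
qed

end

locale quasi_hopf_projection = H: quasi_hopf_algebra k H + A: quasi_hopf_algebra k A +
    i: quasi_hopf_hom k H A i + p: quasi_hopf_hom k A H \<pi>
  for k :: "('k, 'm) ring_scheme" (structure) and H :: "('k, 'h, 'x) quasi_hopf_scheme"
    and A :: "('k, 'a, 'y) quasi_hopf_scheme" and i :: "'h \<Rightarrow> 'a" and \<pi> :: "'a \<Rightarrow> 'h" +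
  assumes proj: "h \<in> carrier H \<Longrightarrow> \<pi> (i h) = h"
begin

abbreviation mult_A (infixl "\<star>" 70) where "x \<star> y \<equiv> x \<otimes>\<^sub>A y"
abbreviation "\<Delta> \<equiv> comult H"
abbreviation "\<epsilon> \<equiv> counit H"
abbreviation "\<Phi> \<equiv> reassoc H"
abbreviation "\<S> \<equiv> antipode H"
abbreviation "\<alpha> \<equiv> alpha H"
abbreviation "\<beta> \<equiv> beta H"
abbreviation "\<Delta>\<^sub>A \<equiv> comult A"
abbreviation "\<epsilon>\<^sub>A \<equiv> counit A"
abbreviation "\<Phi>\<^sub>A \<equiv> reassoc A"
abbreviation "\<S>\<^sub>A \<equiv> antipode A"
abbreviation "\<alpha>\<^sub>A \<equiv> alpha A"
abbreviation "\<beta>\<^sub>A \<equiv> beta A"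

abbreviation "\<phi>i \<equiv> reassoc_inv k H"

lemmas cl [simp] = H.qh_closed A.qh_closed i.closed p.closed
lemmas pl = H.qh_lin A.qh_lin lin_comp[OF i.linear] lin_comp[OF p.linear]
lemmas pcong = H.sw_cong A.sw_cong
lemmas psimp = i.mult i.one i.smult p.mult p.one p.smult proj p.counit i.counit A.A.m_assoc H.A.m_assoc
  H.counit_mult H.counit_one A.counit_mult A.counit_one
  H.smult_mult_left H.smult_mult_right A.smult_mult_left A.smult_mult_right
  H.smult_assoc1 A.smult_assoc1 H.smult_left_comm A.smult_left_comm

context
  fixes V :: "('k, 'v, 'w) module_scheme"
  assumes V: "module k V"
begin

interpretation V: module k V by (rule V)

text \<open>
  The laws of \<open>A\<close> in the form in which they are used below: factors and reassociators that come from
  \<open>H\<close> are expanded in \<open>H\<close>, since \<open>i\<close> is a morphism.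
\<close>

lemma comult_mult_i:
  assumes g: "bilin k A V g" and a: "a \<in> carrier A" and h: "h \<in> carrier H"
  shows "sw2 k V (\<Delta>\<^sub>A (a \<star> i h)) g = sw2 k V (\<Delta>\<^sub>A a) (\<lambda>a1 a2. sw2 k V (\<Delta> h) (\<lambda>h1 h2.
    g (a1 \<star> i h1) (a2 \<star> i h2)))"
proof -
  have "sw2 k V (\<Delta>\<^sub>A (a \<star> i h)) g = sw2 k V (\<Delta>\<^sub>A a) (\<lambda>a1 a2. sw2 k V (\<Delta>\<^sub>A (i h)) (\<lambda>h1 h2.
    g (a1 \<star> h1) (a2 \<star> h2)))"
    using a h by (intro A.comult_mult_sw[OF V g]) simp_all
  also have "\<dots> = sw2 k V (\<Delta>\<^sub>A a) (\<lambda>a1 a2. sw2 k V (\<Delta> h) (\<lambda>h1 h2.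
    g (a1 \<star> i h1) (a2 \<star> i h2)))"
    using a h by (intro A.sw2_cong i.comult_sw[OF V] pl bilin_lin[OF g]) simp_all
  finally show ?thesis .
qed

lemma comult_i_mult:
  assumes g: "bilin k A V g" and a: "a \<in> carrier A" and h: "h \<in> carrier H"
  shows "sw2 k V (\<Delta>\<^sub>A (i h \<star> a)) g = sw2 k V (\<Delta> h) (\<lambda>h1 h2. sw2 k V (\<Delta>\<^sub>A a) (\<lambda>a1 a2.
    g (i h1 \<star> a1) (i h2 \<star> a2)))"
proof -
  have "sw2 k V (\<Delta>\<^sub>A (i h \<star> a)) g = sw2 k V (\<Delta>\<^sub>A (i h)) (\<lambda>h1 h2. sw2 k V (\<Delta>\<^sub>A a) (\<lambda>a1 a2.
    g (h1 \<star> a1) (h2 \<star> a2)))"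
    using a h by (intro A.comult_mult_sw[OF V g]) simp_all
  also have "\<dots> = sw2 k V (\<Delta> h) (\<lambda>h1 h2. sw2 k V (\<Delta>\<^sub>A a) (\<lambda>a1 a2.
    g (i h1 \<star> a1) (i h2 \<star> a2)))"
    using a h by (intro i.comult_sw[OF V] pl bilin_lin[OF g] V) simp_all
  finally show ?thesis .
qed

lemma coassoc:
  assumes f: "trilin k A V f" and m: "m \<in> carrier A"
  shows "sw2 k V (\<Delta>\<^sub>A m) (\<lambda>a b. sw2 k V (\<Delta>\<^sub>A b) (\<lambda>b1 b2. f a b1 b2))
    = sw3 k V \<Phi> (\<lambda>X1 X2 X3. sw2 k V (\<Delta>\<^sub>A m) (\<lambda>a b. sw2 k V (\<Delta>\<^sub>A a) (\<lambda>a1 a2.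
      sw3 k V \<phi>i (\<lambda>x1 x2 x3. f (i X1 \<star> a1 \<star> i x1) (i X2 \<star> a2 \<star> i x2) (i X3 \<star> b \<star> i x3)))))"
proof -
  note fl = trilin_lin[OF f]
  note A.coassoc_sw[OF V f m]
  also have "sw3 k V \<Phi>\<^sub>A (\<lambda>X1 X2 X3. sw2 k V (\<Delta>\<^sub>A m) (\<lambda>a b. sw2 k V (\<Delta>\<^sub>A a) (\<lambda>a1 a2.
      sw3 k V (reassoc_inv k A) (\<lambda>x1 x2 x3. f (X1 \<star> a1 \<star> x1) (X2 \<star> a2 \<star> x2) (X3 \<star> b \<star> x3)))))
    = sw3 k V \<Phi> (\<lambda>X1 X2 X3. sw2 k V (\<Delta>\<^sub>A m) (\<lambda>a b. sw2 k V (\<Delta>\<^sub>A a) (\<lambda>a1 a2.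
      sw3 k V (reassoc_inv k A) (\<lambda>x1 x2 x3. f (i X1 \<star> a1 \<star> x1) (i X2 \<star> a2 \<star> x2) (i X3 \<star> b \<star> x3)))))"
    using m by (intro i.reassoc_sw[OF V] pl fl V) simp_all
  also have "\<dots> = sw3 k V \<Phi> (\<lambda>X1 X2 X3. sw2 k V (\<Delta>\<^sub>A m) (\<lambda>a b. sw2 k V (\<Delta>\<^sub>A a) (\<lambda>a1 a2.
      sw3 k V \<phi>i (\<lambda>x1 x2 x3. f (i X1 \<star> a1 \<star> i x1) (i X2 \<star> a2 \<star> i x2) (i X3 \<star> b \<star> i x3)))))"
    using m by (intro H.sw3_cong A.sw2_cong i.reassoc_inv_sw[OF V] pl fl) simp_all
  finally show ?thesis .
qed

lemma coassoc_inv: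
  assumes f: "trilin k A V f" and m: "m \<in> carrier A"
  shows "sw2 k V (\<Delta>\<^sub>A m) (\<lambda>a b. sw2 k V (\<Delta>\<^sub>A a) (\<lambda>a1 a2. f a1 a2 b))
    = sw3 k V \<phi>i (\<lambda>x1 x2 x3. sw2 k V (\<Delta>\<^sub>A m) (\<lambda>a b. sw2 k V (\<Delta>\<^sub>A b) (\<lambda>b1 b2.
      sw3 k V \<Phi> (\<lambda>X1 X2 X3. f (i x1 \<star> a \<star> i X1) (i x2 \<star> b1 \<star> i X2) (i x3 \<star> b2 \<star> i X3)))))"
proof -
  note fl = trilin_lin[OF f]
  note A.coassoc_inv_sw[OF V f m]
  also have "sw3 k V (reassoc_inv k A) (\<lambda>x1 x2 x3. sw2 k V (\<Delta>\<^sub>A m) (\<lambda>a b. sw2 k V (\<Delta>\<^sub>A b) (\<lambda>b1 b2.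
      sw3 k V \<Phi>\<^sub>A (\<lambda>X1 X2 X3. f (x1 \<star> a \<star> X1) (x2 \<star> b1 \<star> X2) (x3 \<star> b2 \<star> X3)))))
    = sw3 k V \<phi>i (\<lambda>x1 x2 x3. sw2 k V (\<Delta>\<^sub>A m) (\<lambda>a b. sw2 k V (\<Delta>\<^sub>A b) (\<lambda>b1 b2.
      sw3 k V \<Phi>\<^sub>A (\<lambda>X1 X2 X3. f (i x1 \<star> a \<star> X1) (i x2 \<star> b1 \<star> X2) (i x3 \<star> b2 \<star> X3)))))"
    using m by (intro i.reassoc_inv_sw[OF V] pl fl V) simp_all
  also have "\<dots> = sw3 k V \<phi>i (\<lambda>x1 x2 x3. sw2 k V (\<Delta>\<^sub>A m) (\<lambda>a b. sw2 k V (\<Delta>\<^sub>A b) (\<lambda>b1 b2.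
      sw3 k V \<Phi> (\<lambda>X1 X2 X3. f (i x1 \<star> a \<star> i X1) (i x2 \<star> b1 \<star> i X2) (i x3 \<star> b2 \<star> i X3)))))"
    using m by (intro H.sw3_cong A.sw2_cong i.reassoc_sw[OF V] pl fl) simp_all
  finally show ?thesis .
qed

lemma coassoc_mixed:
  assumes f: "trilin k A V f" and m: "m \<in> carrier A"
  shows "sw3 k V \<Phi> (\<lambda>X1 X2 X3. sw2 k V (\<Delta>\<^sub>A m) (\<lambda>a b. sw2 k V (\<Delta>\<^sub>A a) (\<lambda>a1 a2.
      f (i X1 \<star> a1) (i X2 \<star> a2) (i X3 \<star> b))))
    = sw2 k V (\<Delta>\<^sub>A m) (\<lambda>a b. sw2 k V (\<Delta>\<^sub>A b) (\<lambda>b1 b2.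
      sw3 k V \<Phi> (\<lambda>X1 X2 X3. f (a \<star> i X1) (b1 \<star> i X2) (b2 \<star> i X3))))"
proof -
  note fl = trilin_lin[OF f]
  have "sw3 k V \<Phi> (\<lambda>X1 X2 X3. sw2 k V (\<Delta>\<^sub>A m) (\<lambda>a b. sw2 k V (\<Delta>\<^sub>A a) (\<lambda>a1 a2.
      f (i X1 \<star> a1) (i X2 \<star> a2) (i X3 \<star> b))))
    = sw3 k V \<Phi>\<^sub>A (\<lambda>X1 X2 X3. sw2 k V (\<Delta>\<^sub>A m) (\<lambda>a b. sw2 k V (\<Delta>\<^sub>A a) (\<lambda>a1 a2.
      f (X1 \<star> a1) (X2 \<star> a2) (X3 \<star> b))))"
    using m by (intro i.reassoc_sw[OF V, symmetric] pl fl V) simp_all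
  also note A.coassoc_mixed_sw[OF V f m]
  also have "sw2 k V (\<Delta>\<^sub>A m) (\<lambda>a b. sw2 k V (\<Delta>\<^sub>A b) (\<lambda>b1 b2.
      sw3 k V \<Phi>\<^sub>A (\<lambda>X1 X2 X3. f (a \<star> X1) (b1 \<star> X2) (b2 \<star> X3))))
    = sw2 k V (\<Delta>\<^sub>A m) (\<lambda>a b. sw2 k V (\<Delta>\<^sub>A b) (\<lambda>b1 b2.
      sw3 k V \<Phi> (\<lambda>X1 X2 X3. f (a \<star> i X1) (b1 \<star> i X2) (b2 \<star> i X3))))"
    using m by (intro A.sw2_cong i.reassoc_sw[OF V] pl fl) simp_all
  finally show ?thesis .
qed

end

end

section \<open>Coinvariants and the structure theorem\<close>

context quasi_hopf_projection
begin

lemmas pcongA = H.sw3_cong A.sw2_cong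
lemmas pintro = H.sw3_cong A.sw2_cong H.sw2_cong

text \<open>
  The projection onto the coinvariants of the \<open>H\<close>-comodule structure \<open>(id \<otimes> \<pi>) \<Delta>\<close> of \<open>A\<close>. The
  elements \<open>\<alpha>\<close>, \<open>\<beta>\<close> and \<open>\<Phi>\<close> correct the formula \<open>m\<^sub>1 S(\<pi>(m\<^sub>2))\<close> valid for Hopf algebras.
\<close>

definition coinv :: "'a \<Rightarrow> 'a"
  where "coinv m = sw3 k A \<Phi> (\<lambda>X1 X2 X3. sw2 k A (\<Delta>\<^sub>A m) (\<lambda>a b.
    i X1 \<star> a \<star> i (\<beta> \<cdot> \<S> (X2 \<cdot> \<pi> b) \<cdot> \<alpha> \<cdot> X3)))"

text \<open>
  These functionals are those that factor through \<open>coinv\<close> (\<open>\<phi>_coinv\<close>); in coordinates they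
  correspond to functionals on the coinvariants.
\<close>

definition right_invariant :: "('a \<Rightarrow> 'k) \<Rightarrow> bool"
  where "right_invariant \<phi> \<longleftrightarrow> \<phi> \<in> lin k A (scalars k) \<and>
    (\<forall>a\<in>carrier A. \<forall>h\<in>carrier H. \<phi> (a \<star> i h) = \<phi> a \<otimes> \<epsilon> h)"

text \<open>
  The \<open>H\<close>-linear extension of an invariant functional \<open>\<phi>\<close>, which is recovered from it by the counit
  (\<open>counit_kap\<close>). For the counit of \<open>A\<close> it is \<open>\<pi>\<close> (\<open>kap_counit\<close>).
\<close>

definition kap :: "('a \<Rightarrow> 'k) \<Rightarrow> 'a \<Rightarrow> 'h"
  where "kap \<phi> m = sw2 k H (\<Delta>\<^sub>A m) (\<lambda>a b. \<phi> a \<odot>\<^sub>H \<pi> b)"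

lemma coinv_lin: "coinv \<in> lin k A A"
  unfolding coinv_def[abs_def] by (intro pl) simp_all

lemma coinv_closed: "m \<in> carrier A \<Longrightarrow> coinv m \<in> carrier A"
  by (rule lin_closed[OF coinv_lin])

text \<open>
  After quasi-coassociativity has moved the reassociator to the right, the antipode axioms for \<open>\<alpha>\<close>
  and for \<open>\<Phi>\<close> contract everything except \<open>m\<close>.
\<close>

lemma coinv_decomp:
  assumes m: "m \<in> carrier A"
  shows "sw2 k A (\<Delta>\<^sub>A m) (\<lambda>a b. coinv a \<star> i (\<pi> b)) = m"
proof -
  note M = A.module_axioms
  note rmult = A.lin_sw2[OF M M lin_mult(1)[OF A.unital_algebra_axioms lin_id]]
    H.lin_sw3[OF M M lin_mult(1)[OF A.unital_algebra_axioms lin_id]]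
  have "sw2 k A (\<Delta>\<^sub>A m) (\<lambda>a b. coinv a \<star> i (\<pi> b))
    = sw2 k A (\<Delta>\<^sub>A m) (\<lambda>a b. sw3 k A \<Phi> (\<lambda>X1 X2 X3. sw2 k A (\<Delta>\<^sub>A a) (\<lambda>a1 a2.
      i X1 \<star> a1 \<star> i (\<beta> \<cdot> \<S> (X2 \<cdot> \<pi> a2) \<cdot> \<alpha> \<cdot> X3) \<star> i (\<pi> b))))"
    using m unfolding coinv_def by (intro A.sw2_cong) (simp_all add: rmult A.sw2_closed cong: pcongA)
  also have "\<dots> = sw3 k A \<Phi> (\<lambda>X1 X2 X3. sw2 k A (\<Delta>\<^sub>A m) (\<lambda>a b. sw2 k A (\<Delta>\<^sub>A a) (\<lambda>a1 a2.
      i X1 \<star> a1 \<star> i (\<beta> \<cdot> \<S> (X2 \<cdot> \<pi> a2) \<cdot> \<alpha> \<cdot> X3) \<star> i (\<pi> b))))"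
    using m by (intro A.sw2_sw3_swap[OF H.unital_algebra_axioms M]) (simp_all add: A.sw2_closed)
  also have "\<dots> = sw3 k A \<Phi> (\<lambda>X1 X2 X3. sw2 k A (\<Delta>\<^sub>A m) (\<lambda>a b. sw2 k A (\<Delta>\<^sub>A a) (\<lambda>a1 a2.
      i X1 \<star> a1 \<star> i (\<beta> \<cdot> \<S> (\<pi> (i X2 \<star> a2)) \<cdot> \<alpha> \<cdot> \<pi> (i X3 \<star> b)))))"
    using m by (simp add: psimp cong: pcongA)
  also have "\<dots> = sw2 k A (\<Delta>\<^sub>A m) (\<lambda>a b. sw2 k A (\<Delta>\<^sub>A b) (\<lambda>b1 b2. sw3 k A \<Phi> (\<lambda>X1 X2 X3.
      a \<star> i X1 \<star> i (\<beta> \<cdot> \<S> (\<pi> (b1 \<star> i X2)) \<cdot> \<alpha> \<cdot> \<pi> (b2 \<star> i X3)))))"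
    by (rule coassoc_mixed[OF M _ m, where f = "\<lambda>a b c. a \<star> i (\<beta> \<cdot> \<S> (\<pi> b) \<cdot> \<alpha> \<cdot> \<pi> c)"])
      (intro pl; simp)
  also have "\<dots> = sw2 k A (\<Delta>\<^sub>A m) (\<lambda>a b. sw3 k A \<Phi> (\<lambda>X1 X2 X3. sw2 k A (\<Delta>\<^sub>A b) (\<lambda>b1 b2.
      a \<star> i X1 \<star> i (\<beta> \<cdot> \<S> (\<pi> (b1 \<star> i X2)) \<cdot> \<alpha> \<cdot> \<pi> (b2 \<star> i X3)))))"
    using m by (intro A.sw2_cong A.sw2_sw3_swap[OF H.unital_algebra_axioms M]) simp_all
  also have "\<dots> = sw2 k A (\<Delta>\<^sub>A m) (\<lambda>a b. sw3 k A \<Phi> (\<lambda>X1 X2 X3. sw2 k A (\<Delta>\<^sub>A b) (\<lambda>b1 b2.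
      a \<star> i (X1 \<cdot> \<beta> \<cdot> \<S> X2 \<cdot> (\<S> (\<pi> b1) \<cdot> \<alpha> \<cdot> \<pi> b2) \<cdot> X3))))"
    using m by (simp add: psimp H.antipode_mult cong: pcongA)
  also have "\<dots> = sw2 k A (\<Delta>\<^sub>A m) (\<lambda>a b. sw3 k A \<Phi> (\<lambda>X1 X2 X3. sw2 k A (\<Delta> (\<pi> b)) (\<lambda>b1 b2.
      a \<star> i (X1 \<cdot> \<beta> \<cdot> \<S> X2 \<cdot> (\<S> b1 \<cdot> \<alpha> \<cdot> b2) \<cdot> X3))))"
    using m by (intro A.sw2_cong H.sw3_cong p.comult_sw[OF M, symmetric] pl) simp_all
  also have "\<dots> = sw2 k A (\<Delta>\<^sub>A m) (\<lambda>a b. sw3 k A \<Phi> (\<lambda>X1 X2 X3. \<epsilon> (\<pi> b) \<odot>\<^sub>A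
      (a \<star> i (X1 \<cdot> \<beta> \<cdot> \<S> X2 \<cdot> \<alpha> \<cdot> X3))))"
    using m by (intro A.sw2_cong H.sw3_cong H.antipode_alpha_sw[OF M] pl) simp_all
  also have "\<dots> = sw2 k A (\<Delta>\<^sub>A m) (\<lambda>a b. \<epsilon> (\<pi> b) \<odot>\<^sub>A (a \<star> i \<one>\<^sub>H))"
    using m by (intro A.sw2_cong H.antipode_reassoc_sw[OF M] pl) simp_all
  also have "\<dots> = sw2 k A (\<Delta>\<^sub>A m) (\<lambda>a b. \<epsilon>\<^sub>A b \<odot>\<^sub>A a)"
    using m by (intro A.sw2_cong) (simp_all add: psimp)
  also have "\<dots> = m" by (rule A.counit_right[OF m])
  finally show ?thesis .
qed

lemma coinv_mult:
  assumes m: "m \<in> carrier A" and h: "h \<in> carrier H"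
  shows "coinv (m \<star> i h) = \<epsilon> h \<odot>\<^sub>A coinv m"
proof -
  note M = A.module_axioms
  note push = A.lin_sw2[OF M M lin_smult_right[OF M _ lin_id]] H.lin_sw3[OF M M lin_smult_right[OF M _ lin_id]]
  have "coinv (m \<star> i h) = sw3 k A \<Phi> (\<lambda>X1 X2 X3. sw2 k A (\<Delta>\<^sub>A m) (\<lambda>a b. sw2 k A (\<Delta> h) (\<lambda>h1 h2.
    i X1 \<star> (a \<star> i h1) \<star> i (\<beta> \<cdot> \<S> (X2 \<cdot> \<pi> (b \<star> i h2)) \<cdot> \<alpha> \<cdot> X3))))"
    unfolding coinv_def using m h by (intro H.sw3_cong comult_mult_i[OF M] pl) simp_all
  also have "\<dots> = sw3 k A \<Phi> (\<lambda>X1 X2 X3. sw2 k A (\<Delta>\<^sub>A m) (\<lambda>a b. sw2 k A (\<Delta> h) (\<lambda>h1 h2.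
    i X1 \<star> a \<star> i (h1 \<cdot> \<beta> \<cdot> \<S> h2) \<star> i (\<S> (X2 \<cdot> \<pi> b) \<cdot> \<alpha> \<cdot> X3))))"
    using m h by (intro pintro) (simp_all add: psimp H.antipode_mult)
  also have "\<dots> = sw3 k A \<Phi> (\<lambda>X1 X2 X3. sw2 k A (\<Delta>\<^sub>A m) (\<lambda>a b. \<epsilon> h \<odot>\<^sub>A
    (i X1 \<star> a \<star> i \<beta> \<star> i (\<S> (X2 \<cdot> \<pi> b) \<cdot> \<alpha> \<cdot> X3))))"
    using m h by (intro A.sw2_cong H.sw3_cong H.antipode_beta_sw[OF M] pl) simp_all
  also have "\<dots> = \<epsilon> h \<odot>\<^sub>A coinv m"
    unfolding coinv_def using m h by (simp add: push psimp A.sw2_closed cong: pcongA)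
  finally show ?thesis .
qed

lemma coinv_one: "coinv \<one>\<^sub>A = \<one>\<^sub>A"
proof -
  note M = A.module_axioms
  have "coinv \<one>\<^sub>A = sw3 k A \<Phi> (\<lambda>X1 X2 X3.
    i X1 \<star> \<one>\<^sub>A \<star> i (\<beta> \<cdot> \<S> (X2 \<cdot> \<pi> \<one>\<^sub>A) \<cdot> \<alpha> \<cdot> X3))"
    unfolding coinv_def by (intro H.sw3_cong A.comult_one_sw[OF M] pl) simp_all
  also have "\<dots> = sw3 k A \<Phi> (\<lambda>X1 X2 X3. i (X1 \<cdot> \<beta> \<cdot> \<S> X2 \<cdot> \<alpha> \<cdot> X3))"
    by (simp add: psimp cong: pcongA)
  also have "\<dots> = i \<one>\<^sub>H" by (rule H.antipode_reassoc_sw[OF M i.linear])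
  finally show ?thesis by (simp add: psimp)
qed

lemma counit_right_invariant: "right_invariant \<epsilon>\<^sub>A"
  by (simp add: right_invariant_def A.counit_lin psimp)

context
  fixes \<phi> :: "'a \<Rightarrow> 'k"
  assumes \<phi>: "right_invariant \<phi>"
begin

lemma \<phi>_lin: "\<phi> \<in> lin k A (scalars k)"
  and \<phi>_mult_i: "\<lbrakk>a \<in> carrier A; h \<in> carrier H\<rbrakk> \<Longrightarrow> \<phi> (a \<star> i h) = \<phi> a \<otimes> \<epsilon> h"
  using \<phi> by (auto simp: right_invariant_def)

lemma \<phi>_closed: "a \<in> carrier A \<Longrightarrow> \<phi> a \<in> carrier k"
  using lin_closed[OF \<phi>_lin] by simp

lemma kap_lin: "kap \<phi> \<in> lin k A H"
  unfolding kap_def[abs_def] by (intro pl lin_comp[OF \<phi>_lin]) (simp_all add: \<phi>_closed)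

lemma kap_closed: "m \<in> carrier A \<Longrightarrow> kap \<phi> m \<in> carrier H"
  by (rule lin_closed[OF kap_lin])

lemma counit_kap:
  assumes m: "m \<in> carrier A"
  shows "\<epsilon> (kap \<phi> m) = \<phi> m"
proof -
  have "\<epsilon> (kap \<phi> m) = sw2 k (scalars k) (\<Delta>\<^sub>A m) (\<lambda>a b. \<epsilon> (\<phi> a \<odot>\<^sub>H \<pi> b))"
    unfolding kap_def using m by (intro A.lin_sw2[OF H.module_axioms A.scalars_module H.counit_lin]) (simp_all add: \<phi>_closed)
  also have "\<dots> = sw2 k (scalars k) (\<Delta>\<^sub>A m) (\<lambda>a b. \<epsilon>\<^sub>A b \<odot>\<^bsub>scalars k\<^esub> \<phi> a)"
    using m by (intro A.sw2_cong) (simp_all add: \<phi>_closed lin_smult[OF H.counit_lin] p.counit H.m_comm)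
  also have "\<dots> = \<phi> m" by (rule A.counit_right_sw[OF A.scalars_module \<phi>_lin m])
  finally show ?thesis .
qed

lemma kap_mult_i:
  assumes m: "m \<in> carrier A" and h: "h \<in> carrier H"
  shows "kap \<phi> (m \<star> i h) = kap \<phi> m \<cdot> h"
proof -
  note M = H.module_axioms
  have "kap \<phi> (m \<star> i h) = sw2 k H (\<Delta>\<^sub>A m) (\<lambda>a b. sw2 k H (\<Delta> h) (\<lambda>h1 h2.
      \<phi> (a \<star> i h1) \<odot>\<^sub>H \<pi> (b \<star> i h2)))"
    unfolding kap_def using m h by (intro comult_mult_i[OF M] pl lin_comp[OF \<phi>_lin]) (simp_all add: \<phi>_closed)
  also have "\<dots> = sw2 k H (\<Delta>\<^sub>A m) (\<lambda>a b. sw2 k H (\<Delta> h) (\<lambda>h1 h2. \<epsilon> h1 \<odot>\<^sub>H (\<phi> a \<odot>\<^sub>H (\<pi> b \<cdot> h2))))"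
    using m h by (intro pintro) (simp_all add: \<phi>_mult_i psimp \<phi>_closed H.m_comm)
  also have "\<dots> = sw2 k H (\<Delta>\<^sub>A m) (\<lambda>a b. \<phi> a \<odot>\<^sub>H (\<pi> b \<cdot> h))"
    using m h by (intro A.sw2_cong H.counit_left_sw[OF M] pl) (simp_all add: \<phi>_closed)
  also have "\<dots> = kap \<phi> m \<cdot> h"
    unfolding kap_def using m h
    by (simp add: A.lin_sw2[OF M M lin_mult(1)[OF H.unital_algebra_axioms lin_id]] psimp \<phi>_closed cong: pcongA)
  finally show ?thesis .
qed

lemma kap_i_mult:
  assumes m: "m \<in> carrier A" and h: "h \<in> carrier H"
  shows "kap \<phi> (i h \<star> m) = sw2 k H (\<Delta> h) (\<lambda>h1 h2. sw2 k H (\<Delta>\<^sub>A m) (\<lambda>a b.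
    \<phi> (i h1 \<star> a) \<odot>\<^sub>H (h2 \<cdot> \<pi> b)))"
proof -
  note M = H.module_axioms
  have "kap \<phi> (i h \<star> m) = sw2 k H (\<Delta> h) (\<lambda>h1 h2. sw2 k H (\<Delta>\<^sub>A m) (\<lambda>a b.
      \<phi> (i h1 \<star> a) \<odot>\<^sub>H \<pi> (i h2 \<star> b)))"
    unfolding kap_def using m h by (intro comult_i_mult[OF M] pl lin_comp[OF \<phi>_lin]) (simp_all add: \<phi>_closed)
  also have "\<dots> = sw2 k H (\<Delta> h) (\<lambda>h1 h2. sw2 k H (\<Delta>\<^sub>A m) (\<lambda>a b.
    \<phi> (i h1 \<star> a) \<odot>\<^sub>H (h2 \<cdot> \<pi> b)))"
    using m h by (intro pintro) (simp_all add: psimp)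
  finally show ?thesis .
qed

text \<open>
  Coinvariance of \<open>coinv m\<close>, seen through \<open>\<phi>\<close>. Quasi-coassociativity and the invariance of \<open>\<phi>\<close>
  bring the left side into the form treated in \<open>pentagon_antipode\<close>.
\<close>

lemma kap_coinv:
  assumes m: "m \<in> carrier A"
  shows "kap \<phi> (coinv m) = \<phi> m \<odot>\<^sub>H \<one>\<^sub>H"
proof -
  let ?W = "\<lambda>f. sw3 k H \<Phi> (\<lambda>X1 X2 X3. sw2 k H (\<Delta> X1) (\<lambda>h1 h2. sw3 k H \<phi>i (\<lambda>x1 x2 x3. sw2 k H (\<Delta>\<^sub>A m) (\<lambda>a b. f X1 X2 X3 h1 h2 x1 x2 x3 a b))))"
  note M = H.module_axioms
  note c = cl \<phi>_closed kap_closed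
  note l = pl lin_comp[OF \<phi>_lin]
  note rmult = A.lin_sw2[OF M M lin_mult(1)[OF H.unital_algebra_axioms lin_id]]
    H.lin_sw2[OF M M lin_mult(1)[OF H.unital_algebra_axioms lin_id]]
  have "kap \<phi> (coinv m) = sw3 k H \<Phi> (\<lambda>X1 X2 X3. sw2 k H (\<Delta>\<^sub>A m) (\<lambda>a b. kap \<phi>
    (i X1 \<star> a \<star> i (\<beta> \<cdot> \<S> (X2 \<cdot> \<pi> b) \<cdot> \<alpha> \<cdot> X3))))"
    unfolding coinv_def using m
    by (simp add: A.lin_sw2[OF A.module_axioms M kap_lin] H.lin_sw3[OF A.module_axioms M kap_lin] A.sw2_closed cong: pcongA)
  also have "\<dots> = sw3 k H \<Phi> (\<lambda>X1 X2 X3. sw2 k H (\<Delta>\<^sub>A m) (\<lambda>a b. sw2 k H (\<Delta> X1) (\<lambda>h1 h2. sw2 k H (\<Delta>\<^sub>A a) (\<lambda>a1 a2.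
      \<phi> (i h1 \<star> a1) \<odot>\<^sub>H (h2 \<cdot> \<pi> a2 \<cdot> \<beta> \<cdot> \<S> (X2 \<cdot> \<pi> b) \<cdot> \<alpha> \<cdot> X3)))))"
  proof -
    have "kap \<phi> (i X1 \<star> a \<star> i (\<beta> \<cdot> \<S> (X2 \<cdot> \<pi> b) \<cdot> \<alpha> \<cdot> X3))
      = sw2 k H (\<Delta> X1) (\<lambda>h1 h2. sw2 k H (\<Delta>\<^sub>A a) (\<lambda>a1 a2. \<phi> (i h1 \<star> a1) \<odot>\<^sub>H (h2 \<cdot> \<pi> a2)) \<cdot>
      (\<beta> \<cdot> \<S> (X2 \<cdot> \<pi> b) \<cdot> \<alpha> \<cdot> X3))"
      if "a \<in> carrier A" "b \<in> carrier A" "X1 \<in> carrier H" "X2 \<in> carrier H" "X3 \<in> carrier H" for a b X1 X2 X3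
      using that by (simp add: kap_mult_i kap_i_mult rmult A.sw2_closed c)
    moreover have "sw2 k H (\<Delta>\<^sub>A a) (\<lambda>a1 a2. \<phi> (i h1 \<star> a1) \<odot>\<^sub>H (h2 \<cdot> \<pi> a2)) \<cdot>
      (\<beta> \<cdot> \<S> (X2 \<cdot> \<pi> b) \<cdot> \<alpha> \<cdot> X3) = sw2 k H (\<Delta>\<^sub>A a) (\<lambda>a1 a2.
      \<phi> (i h1 \<star> a1) \<odot>\<^sub>H (h2 \<cdot> \<pi> a2 \<cdot> \<beta> \<cdot> \<S> (X2 \<cdot> \<pi> b) \<cdot> \<alpha> \<cdot> X3))"
      if "a \<in> carrier A" "b \<in> carrier A" "X2 \<in> carrier H" "X3 \<in> carrier H" "h1 \<in> carrier H" "h2 \<in> carrier H"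
      for a b X2 X3 h1 h2
      using that by (simp add: rmult psimp c cong: pcongA)
    ultimately show ?thesis using m by (intro pintro) (simp_all add: c, intro pintro, simp_all add: c)
  qed
  also have "\<dots> = sw3 k H \<Phi> (\<lambda>X1 X2 X3. sw2 k H (\<Delta> X1) (\<lambda>h1 h2. sw2 k H (\<Delta>\<^sub>A m) (\<lambda>a b. sw2 k H (\<Delta>\<^sub>A a) (\<lambda>a1 a2.
      \<phi> (i h1 \<star> a1) \<odot>\<^sub>H (h2 \<cdot> \<pi> a2 \<cdot> \<beta> \<cdot> \<S> (X2 \<cdot> \<pi> b) \<cdot> \<alpha> \<cdot> X3)))))"
    using m by (intro H.sw3_cong A.sw2_sw2_swap[OF H.unital_algebra_axioms M]) (simp_all add: A.sw2_closed c)
  also have "\<dots> = ?W (\<lambda>X1 X2 X3 h1 h2 x1 x2 x3 a b. sw2 k H (\<Delta>\<^sub>A b) (\<lambda>b1 b2. sw3 k H \<Phi> (\<lambda>Y1 Y2 Y3.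
      \<phi> (i h1 \<star> (i x1 \<star> a \<star> i Y1)) \<odot>\<^sub>H (h2 \<cdot> \<pi> (i x2 \<star> b1 \<star> i Y2) \<cdot> \<beta>
      \<cdot> \<S> (X2 \<cdot> \<pi> (i x3 \<star> b2 \<star> i Y3)) \<cdot> \<alpha> \<cdot> X3))))"
    using m by (intro H.sw3_cong H.sw2_cong coassoc_inv[OF M] l) (simp_all add: c)
  also have "\<dots> = ?W (\<lambda>X1 X2 X3 h1 h2 x1 x2 x3 a b. sw2 k H (\<Delta>\<^sub>A b) (\<lambda>b1 b2. sw3 k H \<Phi> (\<lambda>Y1 Y2 Y3. \<epsilon> Y1 \<odot>\<^sub>H (
      \<phi> (i (h1 \<cdot> x1) \<star> a) \<odot>\<^sub>H (h2 \<cdot> x2 \<cdot> \<pi> b1 \<cdot> Y2 \<cdot> \<beta>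
      \<cdot> \<S> (X2 \<cdot> x3 \<cdot> \<pi> b2 \<cdot> Y3) \<cdot> \<alpha> \<cdot> X3)))))"
  proof -
    have e: "\<phi> (i h1 \<star> (i x1 \<star> (a \<star> i Y1))) = \<epsilon> Y1 \<otimes> \<phi> (i h1 \<star> (i x1 \<star> a))"
      if "h1 \<in> carrier H" "x1 \<in> carrier H" "Y1 \<in> carrier H" "a \<in> carrier A" for h1 x1 Y1 a
      using that \<phi>_mult_i[of "i h1 \<star> (i x1 \<star> a)" Y1] by (simp add: psimp c H.m_comm)
    show ?thesis using m by (intro pintro) (simp_all add: e psimp c)
  qed
  also have "\<dots> = ?W (\<lambda>X1 X2 X3 h1 h2 x1 x2 x3 a b. sw2 k H (\<Delta>\<^sub>A b) (\<lambda>b1 b2.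
      \<phi> (i (h1 \<cdot> x1) \<star> a) \<odot>\<^sub>H (h2 \<cdot> x2 \<cdot> \<pi> b1 \<cdot> \<one>\<^sub>H \<cdot> \<beta>
      \<cdot> \<S> (X2 \<cdot> x3 \<cdot> \<pi> b2 \<cdot> \<one>\<^sub>H) \<cdot> \<alpha> \<cdot> X3)))"
    using m by (intro H.sw3_cong H.sw2_cong A.sw2_cong H.counit_reassoc1_sw[OF M] l) (simp_all add: c)
  also have "\<dots> = ?W (\<lambda>X1 X2 X3 h1 h2 x1 x2 x3 a b. sw2 k H (\<Delta>\<^sub>A b) (\<lambda>b1 b2.
      \<phi> (i (h1 \<cdot> x1) \<star> a) \<odot>\<^sub>H (h2 \<cdot> x2 \<cdot> (\<pi> b1 \<cdot> \<beta>
      \<cdot> \<S> (\<pi> b2)) \<cdot> (\<S> (X2 \<cdot> x3) \<cdot> \<alpha> \<cdot> X3))))"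
    using m by (intro pintro) (simp_all add: psimp H.antipode_mult c)
  also have "\<dots> = ?W (\<lambda>X1 X2 X3 h1 h2 x1 x2 x3 a b. sw2 k H (\<Delta> (\<pi> b)) (\<lambda>b1 b2.
      \<phi> (i (h1 \<cdot> x1) \<star> a) \<odot>\<^sub>H (h2 \<cdot> x2 \<cdot> (b1 \<cdot> \<beta>
      \<cdot> \<S> b2) \<cdot> (\<S> (X2 \<cdot> x3) \<cdot> \<alpha> \<cdot> X3))))"
    using m by (intro H.sw3_cong H.sw2_cong A.sw2_cong p.comult_sw[OF M, symmetric] l) (simp_all add: c)
  also have "\<dots> = ?W (\<lambda>X1 X2 X3 h1 h2 x1 x2 x3 a b. \<epsilon> (\<pi> b) \<odot>\<^sub>H (
      \<phi> (i (h1 \<cdot> x1) \<star> a) \<odot>\<^sub>H (h2 \<cdot> x2 \<cdot> \<beta> \<cdot> (\<S> (X2 \<cdot> x3) \<cdot> \<alpha> \<cdot> X3))))"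
    using m by (intro H.sw3_cong H.sw2_cong A.sw2_cong H.antipode_beta_sw[OF M] l) (simp_all add: c)
  also have "\<dots> = ?W (\<lambda>X1 X2 X3 h1 h2 x1 x2 x3 a b. \<epsilon>\<^sub>A b \<odot>\<^sub>H (
      \<phi> (i (h1 \<cdot> x1) \<star> a) \<odot>\<^sub>H (h2 \<cdot> x2 \<cdot> \<beta> \<cdot> \<S> (X2 \<cdot> x3) \<cdot> \<alpha> \<cdot> X3)))"
    using m by (intro pintro) (simp_all add: psimp c)
  also have "\<dots> = sw3 k H \<Phi> (\<lambda>X1 X2 X3. sw2 k H (\<Delta> X1) (\<lambda>h1 h2. sw3 k H \<phi>i (\<lambda>x1 x2 x3.
      \<phi> (i (h1 \<cdot> x1) \<star> m) \<odot>\<^sub>H (h2 \<cdot> x2 \<cdot> \<beta> \<cdot> \<S> (X2 \<cdot> x3) \<cdot> \<alpha> \<cdot> X3))))"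
    using m by (intro H.sw3_cong H.sw2_cong A.counit_right_sw[OF M] l) (simp_all add: c)
  also have "\<dots> = \<phi> (i \<one>\<^sub>H \<star> m) \<odot>\<^sub>H \<one>\<^sub>H"
    using m by (intro H.pentagon_antipode l) (simp_all add: c)
  finally show ?thesis using m by (simp add: psimp)
qed

lemma \<phi>_coinv: "m \<in> carrier A \<Longrightarrow> \<phi> (coinv m) = \<phi> m"
  using counit_kap[of "coinv m"] kap_coinv[of m]
  by (simp add: coinv_closed lin_smult[OF H.counit_lin] \<phi>_closed H.counit_one)

end

lemma kap_counit:
  assumes m: "m \<in> carrier A"
  shows "kap \<epsilon>\<^sub>A m = \<pi> m"
  unfolding kap_def by (rule A.counit_left_sw[OF H.module_axioms p.linear m])

end

(* In an algebra the names of the ring laws denote the laws of the algebra; the prefix k_ refers to the ground field. *)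
lemmas (in field) k_l_distr = l_distr
lemmas (in field) k_r_distr = r_distr
lemmas (in field) k_a_ac = a_ac
lemmas (in field) k_m_ac = m_ac
lemmas (in field) k_l_minus = l_minus
lemmas (in field) k_r_minus = r_minus
lemmas (in field) k_r_neg = r_neg
lemmas (in field) k_l_neg = l_neg

context unital_algebra
begin

lemma sw2_add:
  assumes V: "module k V" and f: "bilin k A V f" and g: "bilin k A V g" and t: "t \<in> carrier (tpow k A 2)"
  shows "sw2 k V t (\<lambda>a b. f a b \<oplus>\<^sub>V g a b) = sw2 k V t f \<oplus>\<^sub>V sw2 k V t g"
proof -
  have "(\<lambda>t. sw2 k V t f \<oplus>\<^sub>V sw2 k V t g) \<in> lin k (tpow k A 2) V"
    by (intro lin_add_fun sw2_arg_lin V f g lin_id)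
  from lin_eq_sw2[OF V this t] show ?thesis
    using t by (simp add: sw2_tens[OF V f] sw2_tens[OF V g] cong: sw2_cong)
qed

end

context quasi_hopf_projection
begin

text \<open>
  Let \<open>f1\<close> and \<open>f2\<close> be the counits of the two coordinates with respect to the basis \<open>e1\<close>, \<open>e2\<close>.
  Since \<open>coinv\<close> turns multiplication by \<open>h\<close> into multiplication by \<open>\<epsilon> h\<close>, it has the form
  \<open>coinv m = f1(m) E1 + f2(m) E2\<close> with \<open>E1 = coinv e1\<close> and \<open>E2 = coinv e2\<close>; in particular
  \<open>1 = p E1 + q E2\<close>. A second vector of this plane, in the kernel of the counit, is
  \<open>\<theta> = b E1 - a E2\<close>, where \<open>a\<close> and \<open>b\<close> are the counits of \<open>e1\<close> and \<open>e2\<close>. The determinant of the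
  change from \<open>E1\<close>, \<open>E2\<close> to \<open>1\<close>, \<open>\<theta>\<close> is \<open>-(p a + q b)\<close>, which is \<open>-\<epsilon>(1) = -1\<close>, and
  \<open>\<phi> = q f1 - p f2\<close> is the coordinate function of \<open>\<theta>\<close>.
\<close>

lemma rank_two_generator:
  assumes free: "free_right_module H A i 2"
  obtains \<theta> \<phi> where "\<theta> \<in> carrier A" "right_invariant \<phi>" "\<phi> \<one>\<^sub>A = \<zero>" "\<pi> \<theta> = \<zero>\<^sub>H" "kap \<phi> \<theta> = \<one>\<^sub>H"
    "\<And>m. m \<in> carrier A \<Longrightarrow> coinv m = \<epsilon>\<^sub>A m \<odot>\<^sub>A \<one>\<^sub>A \<oplus>\<^sub>A \<phi> m \<odot>\<^sub>A \<theta>"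
proof -
  obtain E where E0: "E \<subseteq> carrier A \<and> finite E \<and> card E = 2 \<and>
      (\<forall>a\<in>carrier A. \<exists>!c. c \<in> E \<rightarrow>\<^sub>E carrier H \<and> a = (\<Oplus>\<^bsub>A\<^esub>e\<in>E. e \<star> i (c e)))"
    using free unfolding free_right_module_def by (rule exE)
  then have E: "E \<subseteq> carrier A" "finite E" "card E = 2"
    and ex: "\<And>a. a \<in> carrier A \<Longrightarrow> \<exists>!c. c \<in> E \<rightarrow>\<^sub>E carrier H \<and> a = (\<Oplus>\<^bsub>A\<^esub>e\<in>E. e \<star> i (c e))"
    by (simp_all only:)
  from E(3) obtain e1 e2 where e: "E = {e1, e2}" "e1 \<noteq> e2" by (auto simp: card_2_iff)
  have ec: "e1 \<in> carrier A" "e2 \<in> carrier A" using E e by auto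
  have sum: "(\<Oplus>\<^bsub>A\<^esub>e\<in>E. e \<star> i (c e)) = e1 \<star> i (c e1) \<oplus>\<^sub>A e2 \<star> i (c e2)"
    if "c e1 \<in> carrier H" "c e2 \<in> carrier H" for c
    using that e ec A.M.finsum_insert
    by (simp add: A.M.finsum_empty)
  define c where "c a = (THE c. c \<in> E \<rightarrow>\<^sub>E carrier H \<and> a = (\<Oplus>\<^bsub>A\<^esub>e\<in>E. e \<star> i (c e)))" for a
  define c1 where "c1 a = c a e1" for a
  define c2 where "c2 a = c a e2" for a
  have c: "c a \<in> E \<rightarrow>\<^sub>E carrier H" "a = (\<Oplus>\<^bsub>A\<^esub>e\<in>E. e \<star> i (c a e))" if "a \<in> carrier A" for a
    unfolding c_def by (rule theI'[OF ex[OF that], THEN conjunct1], rule theI'[OF ex[OF that], THEN conjunct2])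
  have c12: "c1 a \<in> carrier H" "c2 a \<in> carrier H" "a = e1 \<star> i (c1 a) \<oplus>\<^sub>A e2 \<star> i (c2 a)"
    if "a \<in> carrier A" for a
  proof -
    show *: "c1 a \<in> carrier H" "c2 a \<in> carrier H" using c(1)[OF that] e by (auto simp: c1_def c2_def)
    show "a = e1 \<star> i (c1 a) \<oplus>\<^sub>A e2 \<star> i (c2 a)"
      unfolding c1_def c2_def
      by (rule trans[OF c(2)[OF that] sum]) (use * in \<open>simp_all add: c1_def c2_def\<close>)
  qed
  have uniq: "c1 a = h1 \<and> c2 a = h2"
    if h: "h1 \<in> carrier H" "h2 \<in> carrier H" and a: "a = e1 \<star> i h1 \<oplus>\<^sub>A e2 \<star> i h2" for a h1 h2
  proof -
    have aA: "a \<in> carrier A" using h ec a by simp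
    let ?c = "\<lambda>e\<in>E. if e = e1 then h1 else h2"
    have "?c \<in> E \<rightarrow>\<^sub>E carrier H" using h by auto
    moreover have "a = (\<Oplus>\<^bsub>A\<^esub>e\<in>E. e \<star> i (?c e))"
      using sum[of ?c] h e a by auto
    ultimately have "?c = c a"
      unfolding c_def by (intro the1_equality[OF ex[OF aA], symmetric] conjI)
    then show ?thesis using e by (auto simp: c1_def c2_def fun_eq_iff split: if_splits)
  qed
  have add: "c1 (a \<oplus>\<^sub>A b) = c1 a \<oplus>\<^sub>H c1 b \<and> c2 (a \<oplus>\<^sub>A b) = c2 a \<oplus>\<^sub>H c2 b"
    if "a \<in> carrier A" "b \<in> carrier A" for a b
  proof (rule uniq)
    have "a \<oplus>\<^sub>A b = (e1 \<star> i (c1 a) \<oplus>\<^sub>A e2 \<star> i (c2 a)) \<oplus>\<^sub>A (e1 \<star> i (c1 b) \<oplus>\<^sub>A e2 \<star> i (c2 b))"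
      by (rule arg_cong2[OF c12(3)[OF that(1)] c12(3)[OF that(2)]])
    also have "\<dots> = e1 \<star> i (c1 a \<oplus>\<^sub>H c1 b) \<oplus>\<^sub>A e2 \<star> i (c2 a \<oplus>\<^sub>H c2 b)"
      using that c12(1,2) ec by (simp add: lin_add[OF i.linear] A.A.r_distr A.M.a_ac)
    finally show "a \<oplus>\<^sub>A b = \<dots>" .
  qed (use that c12(1,2) in auto)
  have smult: "c1 (r \<odot>\<^sub>A a) = r \<odot>\<^sub>H c1 a \<and> c2 (r \<odot>\<^sub>A a) = r \<odot>\<^sub>H c2 a"
    if "r \<in> carrier k" "a \<in> carrier A" for r a
  proof (rule uniq)
    have "r \<odot>\<^sub>A a = r \<odot>\<^sub>A (e1 \<star> i (c1 a) \<oplus>\<^sub>A e2 \<star> i (c2 a))" by (rule arg_cong[OF c12(3)[OF that(2)]])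
    also have "\<dots> = e1 \<star> i (r \<odot>\<^sub>H c1 a) \<oplus>\<^sub>A e2 \<star> i (r \<odot>\<^sub>H c2 a)"
      using that c12(1,2) ec by (simp add: i.smult A.smult_r_distr A.smult_mult_right)
    finally show "r \<odot>\<^sub>A a = \<dots>" .
  qed (use that c12(1,2) in auto)
  have mult: "c1 (a \<star> i h) = c1 a \<cdot> h \<and> c2 (a \<star> i h) = c2 a \<cdot> h"
    if "a \<in> carrier A" "h \<in> carrier H" for a h
  proof (rule uniq)
    have "a \<star> i h = (e1 \<star> i (c1 a) \<oplus>\<^sub>A e2 \<star> i (c2 a)) \<star> i h" by (rule arg_cong[OF c12(3)[OF that(1)], of "\<lambda>a. a \<star> i h"])
    also have "\<dots> = e1 \<star> i (c1 a \<cdot> h) \<oplus>\<^sub>A e2 \<star> i (c2 a \<cdot> h)"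
      using that c12(1,2) ec by (simp add: i.mult A.A.l_distr A.A.m_assoc)
    finally show "a \<star> i h = \<dots>" .
  qed (use that c12(1,2) in auto)
  have basis: "c1 e1 = \<one>\<^sub>H \<and> c2 e1 = \<zero>\<^sub>H" "c1 e2 = \<zero>\<^sub>H \<and> c2 e2 = \<one>\<^sub>H"
    by (rule uniq; use ec in \<open>simp add: i.one lin_zero[OF H.module_axioms A.module_axioms i.linear]\<close>)+
  define f1 where "f1 a = \<epsilon> (c1 a)" for a
  define f2 where "f2 a = \<epsilon> (c2 a)" for a
  have "c1 \<in> lin k A H" "c2 \<in> lin k A H"
    using c12(1,2) add smult by (auto intro!: linI)
  from lin_comp[OF H.counit_lin this(1)] lin_comp[OF H.counit_lin this(2)]
  have fl: "f1 \<in> lin k A (scalars k)" "f2 \<in> lin k A (scalars k)"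
    unfolding f1_def[abs_def] f2_def[abs_def] by blast+
  have fc: "f1 a \<in> carrier k" "f2 a \<in> carrier k" if "a \<in> carrier A" for a
    using that c12(1,2) by (auto simp: f1_def f2_def cl)
  have fm: "f1 (a \<star> i h) = f1 a \<otimes> \<epsilon> h" "f2 (a \<star> i h) = f2 a \<otimes> \<epsilon> h"
    if "a \<in> carrier A" "h \<in> carrier H" for a h
    using that mult c12(1,2) by (simp_all add: f1_def f2_def H.counit_mult)
  have zero: "\<epsilon> \<zero>\<^sub>H = \<zero>"
    using lin_zero[OF H.module_axioms H.scalars_module H.counit_lin] by simp
  have fe: "f1 e1 = \<one>" "f2 e1 = \<zero>" "f1 e2 = \<zero>" "f2 e2 = \<one>"
    using basis by (simp_all add: f1_def f2_def H.counit_one zero)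
  note E1 = coinv_closed[OF ec(1)] coinv_closed[OF ec(2)]
  have coinv: "coinv m = f1 m \<odot>\<^sub>A coinv e1 \<oplus>\<^sub>A f2 m \<odot>\<^sub>A coinv e2" if m: "m \<in> carrier A" for m
  proof -
    have "coinv m = coinv (e1 \<star> i (c1 m) \<oplus>\<^sub>A e2 \<star> i (c2 m))" by (rule arg_cong[OF c12(3)[OF m]])
    then show ?thesis using c12(1,2)[OF m] ec
      by (simp add: lin_add[OF coinv_lin] coinv_mult f1_def f2_def)
  qed
  let ?a = "\<epsilon>\<^sub>A e1" and ?b = "\<epsilon>\<^sub>A e2" and ?p = "f1 \<one>\<^sub>A" and ?q = "f2 \<one>\<^sub>A"
  have sc: "?a \<in> carrier k" "?b \<in> carrier k" "?p \<in> carrier k" "?q \<in> carrier k"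
    using ec fc by (auto simp: cl)
  have eps: "\<epsilon>\<^sub>A m = f1 m \<otimes> ?a \<oplus> f2 m \<otimes> ?b" if m: "m \<in> carrier A" for m
  proof -
    have "\<epsilon>\<^sub>A m = \<epsilon>\<^sub>A (f1 m \<odot>\<^sub>A coinv e1 \<oplus>\<^sub>A f2 m \<odot>\<^sub>A coinv e2)"
      using \<phi>_coinv[OF counit_right_invariant m] coinv[OF m] by simp
    then show ?thesis
      using m fc ec E1 by (simp add: lin_add[OF A.counit_lin] lin_smult[OF A.counit_lin] \<phi>_coinv[OF counit_right_invariant])
  qed
  have pq: "?p \<otimes> ?a \<oplus> ?q \<otimes> ?b = \<one>" using eps[of "\<one>\<^sub>A"] by (simp add: A.counit_one)
  define m0 where "m0 = ?b \<odot>\<^sub>A e1 \<oplus>\<^sub>A (\<ominus> ?a) \<odot>\<^sub>A e2"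
  define \<theta> where "\<theta> = coinv m0"
  define \<phi> where "\<phi> m = ?q \<otimes> f1 m \<oplus> (\<ominus> ?p) \<otimes> f2 m" for m
  have m0: "m0 \<in> carrier A" using ec sc by (simp add: m0_def)
  have fm0: "f1 m0 = ?b" "f2 m0 = \<ominus> ?a"
    using ec sc fe by (simp_all add: m0_def lin_add[OF fl(1)] lin_add[OF fl(2)] lin_smult[OF fl(1)] lin_smult[OF fl(2)])
  have inv: "right_invariant \<phi>"
  proof -
    have "\<phi> \<in> lin k A (scalars k)"
      unfolding \<phi>_def[abs_def] using sc lin_add_fun[OF H.scalars_module lin_scalar_mult(2)[OF H.field_axioms fl(1), of ?q]
      lin_scalar_mult(2)[OF H.field_axioms fl(2), of "\<ominus> ?p"]] by simp
    moreover have "\<phi> (a \<star> i h) = \<phi> a \<otimes> \<epsilon> h" if "a \<in> carrier A" "h \<in> carrier H" for a h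
      using that sc fc H.counit_closed by (simp add: \<phi>_def fm H.k_l_distr H.k_r_distr H.k_m_ac)
    ultimately show ?thesis by (simp add: right_invariant_def)
  qed
  have \<phi>1: "\<phi> \<one>\<^sub>A = \<zero>" using sc by (simp add: \<phi>_def H.k_l_minus H.k_r_minus H.k_m_ac H.k_r_neg)
  have \<phi>m0: "\<phi> m0 = \<one>"
    using sc pq by (simp add: \<phi>_def fm0 H.k_l_minus H.k_r_minus H.k_a_ac)
  have \<epsilon>m0: "\<epsilon>\<^sub>A m0 = \<zero>" using sc eps[OF m0] by (simp add: fm0 H.k_l_minus H.k_r_minus H.k_m_ac H.k_r_neg)
  show ?thesis
  proof (rule that)
    show "\<theta> \<in> carrier A" using m0 by (simp add: \<theta>_def coinv_closed)
    show "right_invariant \<phi>" by (rule inv)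
    show "\<phi> \<one>\<^sub>A = \<zero>" by (rule \<phi>1)
    show "kap \<phi> \<theta> = \<one>\<^sub>H" using kap_coinv[OF inv m0] by (simp add: \<theta>_def \<phi>m0)
    show "\<pi> \<theta> = \<zero>\<^sub>H"
      using kap_coinv[OF counit_right_invariant m0] kap_counit[of \<theta>] m0
      by (simp add: \<theta>_def \<epsilon>m0 coinv_closed)
    fix m assume m: "m \<in> carrier A"
    let ?x = "f1 m" and ?y = "f2 m"
    have xy: "?x \<in> carrier k" "?y \<in> carrier k" using fc m by auto
    have 1: "\<one>\<^sub>A = ?p \<odot>\<^sub>A coinv e1 \<oplus>\<^sub>A ?q \<odot>\<^sub>A coinv e2"
      using coinv[of "\<one>\<^sub>A"] coinv_one by simp
    have 2: "\<theta> = ?b \<odot>\<^sub>A coinv e1 \<oplus>\<^sub>A (\<ominus> ?a) \<odot>\<^sub>A coinv e2"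
      using coinv[OF m0] by (simp add: \<theta>_def fm0)
    have 3: "s \<odot>\<^sub>A (r1 \<odot>\<^sub>A coinv e1 \<oplus>\<^sub>A r2 \<odot>\<^sub>A coinv e2) \<oplus>\<^sub>A t \<odot>\<^sub>A (r3 \<odot>\<^sub>A coinv e1 \<oplus>\<^sub>A r4 \<odot>\<^sub>A coinv e2)
      = (s \<otimes> r1 \<oplus> t \<otimes> r3) \<odot>\<^sub>A coinv e1 \<oplus>\<^sub>A (s \<otimes> r2 \<oplus> t \<otimes> r4) \<odot>\<^sub>A coinv e2"
      if "s \<in> carrier k" "t \<in> carrier k" "r1 \<in> carrier k" "r2 \<in> carrier k" "r3 \<in> carrier k" "r4 \<in> carrier k" for s t r1 r2 r3 r4
      using that E1 by (simp add: A.smult_r_distr A.smult_l_distr A.smult_assoc1 A.M.a_ac)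
    have 4: "(?x \<otimes> ?a \<oplus> ?y \<otimes> ?b) \<otimes> ?p \<oplus> (?q \<otimes> ?x \<oplus> \<ominus> ?p \<otimes> ?y) \<otimes> ?b
      = ?x \<otimes> (?p \<otimes> ?a \<oplus> ?q \<otimes> ?b)" using sc xy by algebra
    have 5: "(?x \<otimes> ?a \<oplus> ?y \<otimes> ?b) \<otimes> ?q \<oplus> (?q \<otimes> ?x \<oplus> \<ominus> ?p \<otimes> ?y) \<otimes> \<ominus> ?a
      = ?y \<otimes> (?p \<otimes> ?a \<oplus> ?q \<otimes> ?b)" using sc xy by algebra
    have "\<epsilon>\<^sub>A m \<odot>\<^sub>A \<one>\<^sub>A \<oplus>\<^sub>A \<phi> m \<odot>\<^sub>A \<theta>
      = \<epsilon>\<^sub>A m \<odot>\<^sub>A (?p \<odot>\<^sub>A coinv e1 \<oplus>\<^sub>A ?q \<odot>\<^sub>A coinv e2) \<oplus>\<^sub>A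
      \<phi> m \<odot>\<^sub>A (?b \<odot>\<^sub>A coinv e1 \<oplus>\<^sub>A (\<ominus> ?a) \<odot>\<^sub>A coinv e2)"
      using 1 2 by simp
    also have "\<dots> = ?x \<odot>\<^sub>A coinv e1 \<oplus>\<^sub>A ?y \<odot>\<^sub>A coinv e2"
      unfolding eps[OF m] \<phi>_def using sc xy by (subst 3) (simp_all add: 4 5 pq)
    also have "\<dots> = coinv m" using coinv[OF m] by simp
    finally show "coinv m = \<epsilon>\<^sub>A m \<odot>\<^sub>A \<one>\<^sub>A \<oplus>\<^sub>A \<phi> m \<odot>\<^sub>A \<theta>" ..
  qed
qed

end

section \<open>The algebra of rank two\<close>

locale rank_two = quasi_hopf_projection k H A i \<pi>
  for k :: "('k, 'm) ring_scheme" (structure) and H :: "('k, 'h, 'x) quasi_hopf_scheme"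
    and A :: "('k, 'a, 'y) quasi_hopf_scheme" and i :: "'h \<Rightarrow> 'a" and \<pi> :: "'a \<Rightarrow> 'h" +
  fixes \<theta> :: 'a and \<phi> :: "'a \<Rightarrow> 'k"
  assumes \<theta>_closed: "\<theta> \<in> carrier A" and \<phi>_inv: "right_invariant \<phi>" and \<phi>_one: "\<phi> \<one>\<^sub>A = \<zero>"
    and \<pi>_\<theta>: "\<pi> \<theta> = \<zero>\<^sub>H" and kap_\<theta>: "kap \<phi> \<theta> = \<one>\<^sub>H"
    and coinv_eq: "m \<in> carrier A \<Longrightarrow> coinv m = \<epsilon>\<^sub>A m \<odot>\<^sub>A \<one>\<^sub>A \<oplus>\<^sub>A \<phi> m \<odot>\<^sub>A \<theta>"
begin

abbreviation "\<kappa> \<equiv> kap \<phi>"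

text \<open>
  The scalar data of \<open>A\<close>: \<open>\<chi>\<close> is the factor in the twisted derivation rule for \<open>\<phi>\<close> (\<open>\<phi>_mult\<close>),
  and \<open>L\<close> is the counterpart of \<open>\<kappa>\<close> with the legs exchanged. The scalars \<open>c\<close> and \<open>d\<close> are the
  structure constants in \<open>\<theta> \<theta> = c \<theta>\<close> and in \<open>\<phi> * \<phi> = d \<phi>\<close>; that \<open>\<theta> \<theta>\<close> has this form is not clear
  at this point (\<open>\<theta>_square\<close>).
\<close>

definition \<chi> where "\<chi> a = \<phi> (a \<star> \<theta>)"
definition \<sigma> where "\<sigma> h = \<chi> (i h)"
definition L where "L m = sw2 k H (\<Delta>\<^sub>A m) (\<lambda>a b. \<phi> b \<odot>\<^sub>H \<pi> a)"
definition v where "v = L \<theta>"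
definition c where "c = \<chi> \<theta>"
definition d where "d = conv k A \<phi> \<phi> \<theta>"

lemmas \<phi>_linear = \<phi>_lin[OF \<phi>_inv]
lemmas \<phi>_cl = \<phi>_closed[OF \<phi>_inv]
lemmas \<phi>_mi = \<phi>_mult_i[OF \<phi>_inv]
lemmas \<kappa>_lin = kap_lin[OF \<phi>_inv]
lemmas \<kappa>_cl = kap_closed[OF \<phi>_inv]
lemmas \<kappa>_mi = kap_mult_i[OF \<phi>_inv]

lemma \<chi>_lin: "\<chi> \<in> lin k A (scalars k)"
  unfolding \<chi>_def[abs_def] by (intro pl lin_comp[OF \<phi>_linear]) (simp_all add: cl \<theta>_closed)

lemma \<sigma>_lin: "\<sigma> \<in> lin k H (scalars k)"
  unfolding \<sigma>_def[abs_def] by (rule lin_comp[OF \<chi>_lin i.linear])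

lemma L_lin: "L \<in> lin k A H"
  unfolding L_def[abs_def] by (intro pl lin_comp[OF \<phi>_linear]) (simp_all add: cl \<phi>_cl)

lemma \<chi>_cl: "a \<in> carrier A \<Longrightarrow> \<chi> a \<in> carrier k" using lin_closed[OF \<chi>_lin] by simp
lemma \<sigma>_cl: "h \<in> carrier H \<Longrightarrow> \<sigma> h \<in> carrier k" using lin_closed[OF \<sigma>_lin] by simp
lemma L_cl: "a \<in> carrier A \<Longrightarrow> L a \<in> carrier H" using lin_closed[OF L_lin] by simp
lemma v_cl: "v \<in> carrier H" by (simp add: v_def L_cl \<theta>_closed)
lemma c_cl: "c \<in> carrier k" by (simp add: c_def \<chi>_cl \<theta>_closed)

lemmas qc [simp] = cl \<phi>_cl \<kappa>_cl \<chi>_cl \<sigma>_cl L_cl v_cl c_cl \<theta>_closed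
lemmas ql = pl lin_comp[OF \<phi>_linear] lin_comp[OF \<kappa>_lin] lin_comp[OF \<chi>_lin] lin_comp[OF \<sigma>_lin] lin_comp[OF L_lin]

lemma conv_cl:
  assumes "f \<in> lin k A (scalars k)" "g \<in> lin k A (scalars k)" "m \<in> carrier A"
  shows "conv k A f g m \<in> carrier k"
  using A.sw2_closed[OF A.scalars_module A.comult_closed[OF assms(3)], of "\<lambda>a b. f a \<otimes> g b"]
    lin_closed[OF assms(1)] lin_closed[OF assms(2)] by (simp add: conv_def)

lemma d_cl [simp]: "d \<in> carrier k" by (simp add: d_def conv_cl \<phi>_linear \<theta>_closed)

lemma counit_\<theta>: "\<epsilon>\<^sub>A \<theta> = \<zero>"
  using p.counit[OF \<theta>_closed] lin_zero[OF H.module_axioms H.scalars_module H.counit_lin] by (simp add: \<pi>_\<theta>)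

lemma \<phi>_\<theta>: "\<phi> \<theta> = \<one>"
  using counit_kap[OF \<phi>_inv \<theta>_closed] by (simp add: kap_\<theta> H.counit_one)

lemma kap_apply:
  assumes "module k V" "g \<in> lin k H V" "m \<in> carrier A"
  shows "sw2 k V (\<Delta>\<^sub>A m) (\<lambda>a b. \<phi> a \<odot>\<^sub>V g (\<pi> b)) = g (\<kappa> m)"
  unfolding kap_def using assms
  by (simp add: A.lin_sw2[OF H.module_axioms assms(1,2)] lin_smult[OF assms(2)] cong: A.sw2_cong)

lemma L_apply:
  assumes "module k V" "g \<in> lin k H V" "m \<in> carrier A"
  shows "sw2 k V (\<Delta>\<^sub>A m) (\<lambda>a b. \<phi> b \<odot>\<^sub>V g (\<pi> a)) = g (L m)"
  unfolding L_def using assms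
  by (simp add: A.lin_sw2[OF H.module_axioms assms(1,2)] lin_smult[OF assms(2)] cong: A.sw2_cong)

lemma decomp:
  assumes m: "m \<in> carrier A"
  shows "m = i (\<pi> m) \<oplus>\<^sub>A \<theta> \<star> i (\<kappa> m)"
proof -
  note M = A.module_axioms
  have "m = sw2 k A (\<Delta>\<^sub>A m) (\<lambda>a b. coinv a \<star> i (\<pi> b))" by (rule coinv_decomp[OF m, symmetric])
  also have "\<dots> = sw2 k A (\<Delta>\<^sub>A m) (\<lambda>a b. \<epsilon>\<^sub>A a \<odot>\<^sub>A i (\<pi> b) \<oplus>\<^sub>A \<phi> a \<odot>\<^sub>A (\<theta> \<star> i (\<pi> b)))"
    using m by (intro A.sw2_cong) (simp_all add: coinv_eq A.A.l_distr A.smult_mult_left)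
  also have "\<dots> = sw2 k A (\<Delta>\<^sub>A m) (\<lambda>a b. \<epsilon>\<^sub>A a \<odot>\<^sub>A i (\<pi> b)) \<oplus>\<^sub>A sw2 k A (\<Delta>\<^sub>A m) (\<lambda>a b. \<phi> a \<odot>\<^sub>A (\<theta> \<star> i (\<pi> b)))"
    using m by (intro A.sw2_add ql) simp_all
  also have "sw2 k A (\<Delta>\<^sub>A m) (\<lambda>a b. \<epsilon>\<^sub>A a \<odot>\<^sub>A i (\<pi> b)) = i (\<pi> m)"
    using m by (intro A.counit_left_sw ql) simp_all
  also have "sw2 k A (\<Delta>\<^sub>A m) (\<lambda>a b. \<phi> a \<odot>\<^sub>A (\<theta> \<star> i (\<pi> b))) = \<theta> \<star> i (\<kappa> m)"
    using m by (intro kap_apply ql) simp_all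
  finally show ?thesis .
qed

lemma invariant_decomp:
  assumes \<psi>: "right_invariant \<psi>" and m: "m \<in> carrier A"
  shows "\<psi> m = \<psi> \<one>\<^sub>A \<otimes> \<epsilon>\<^sub>A m \<oplus> \<psi> \<theta> \<otimes> \<phi> m"
proof -
  note \<psi>l = \<phi>_lin[OF \<psi>]
  have "\<psi> m = \<psi> (i (\<pi> m) \<oplus>\<^sub>A \<theta> \<star> i (\<kappa> m))" by (rule arg_cong[OF decomp[OF m]])
  moreover have "\<psi> (i (\<pi> m)) = \<psi> \<one>\<^sub>A \<otimes> \<epsilon>\<^sub>A m"
    using \<phi>_mult_i[OF \<psi>, of "\<one>\<^sub>A" "\<pi> m"] m by (simp add: p.counit)
  ultimately show ?thesis using m
    by (simp add: lin_add[OF \<psi>l] \<phi>_mult_i[OF \<psi>] counit_kap[OF \<phi>_inv])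
qed

lemma \<phi>_i: "h \<in> carrier H \<Longrightarrow> \<phi> (i h) = \<zero>"
  using \<phi>_mi[of "\<one>\<^sub>A" h] by (simp add: \<phi>_one)

lemma \<phi>_mult:
  assumes a: "a \<in> carrier A" and b: "b \<in> carrier A"
  shows "\<phi> (a \<star> b) = \<phi> a \<otimes> \<epsilon>\<^sub>A b \<oplus> \<chi> a \<otimes> \<phi> b"
proof -
  have "\<phi> (a \<star> b) = \<phi> (a \<star> (i (\<pi> b) \<oplus>\<^sub>A \<theta> \<star> i (\<kappa> b)))"
    by (rule arg_cong[OF decomp[OF b], of "\<lambda>b. \<phi> (a \<star> b)"])
  also have "\<dots> = \<phi> (a \<star> i (\<pi> b)) \<oplus> \<phi> (a \<star> \<theta> \<star> i (\<kappa> b))"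
    using a b by (simp add: A.A.r_distr lin_add[OF \<phi>_linear] A.A.m_assoc)
  also have "\<dots> = \<phi> a \<otimes> \<epsilon>\<^sub>A b \<oplus> \<chi> a \<otimes> \<phi> b"
    using a b by (simp add: \<phi>_mi \<chi>_def counit_kap[OF \<phi>_inv] p.counit)
  finally show ?thesis .
qed

text \<open>
  Associativity of the product in \<open>\<phi> (a b \<theta>)\<close>, by the rule for \<open>\<phi>\<close> of a product.
\<close>

lemma \<chi>_mult:
  assumes a: "a \<in> carrier A" and b: "b \<in> carrier A"
  shows "\<chi> (a \<star> b) = \<chi> a \<otimes> \<chi> b"
  using \<phi>_mult[of a "b \<star> \<theta>"] a b by (simp add: \<chi>_def A.A.m_assoc A.counit_mult counit_\<theta>)

lemma \<chi>_one: "\<chi> \<one>\<^sub>A = \<one>"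
  by (simp add: \<chi>_def \<phi>_\<theta>)

lemma \<chi>_char: "\<chi> \<in> alg_char k A"
  using lin_add[OF \<chi>_lin] lin_smult[OF \<chi>_lin]
  by (auto simp: alg_char_def \<chi>_cl \<chi>_mult \<chi>_one intro!: ring_hom_memI)

lemma \<sigma>_mult: "\<lbrakk>a \<in> carrier H; b \<in> carrier H\<rbrakk> \<Longrightarrow> \<sigma> (a \<cdot> b) = \<sigma> a \<otimes> \<sigma> b"
  and \<sigma>_one: "\<sigma> \<one>\<^sub>H = \<one>"
  by (simp_all add: \<sigma>_def i.mult i.one \<chi>_mult \<chi>_one)

lemma \<sigma>_char: "\<sigma> \<in> alg_char k H"
  using lin_add[OF \<sigma>_lin] lin_smult[OF \<sigma>_lin]
  by (auto simp: alg_char_def \<sigma>_cl \<sigma>_mult \<sigma>_one intro!: ring_hom_memI)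

lemma \<phi>_i_mult: "\<lbrakk>h \<in> carrier H; a \<in> carrier A\<rbrakk> \<Longrightarrow> \<phi> (i h \<star> a) = \<sigma> h \<otimes> \<phi> a"
  using \<phi>_mult[of "i h" a] by (simp add: \<phi>_i \<sigma>_def)

lemma \<phi>_sandwich:
  "\<lbrakk>h \<in> carrier H; a \<in> carrier A; g \<in> carrier H\<rbrakk> \<Longrightarrow> \<phi> (i h \<star> a \<star> i g) = \<epsilon> g \<otimes> (\<sigma> h \<otimes> \<phi> a)"
  by (simp add: \<phi>_mi \<phi>_i_mult H.k_m_ac)

lemma \<kappa>_i:
  assumes "h \<in> carrier H"
  shows "\<kappa> (i h) = \<zero>\<^sub>H"
proof -
  have "\<kappa> \<one>\<^sub>A = \<phi> \<one>\<^sub>A \<odot>\<^sub>H \<pi> \<one>\<^sub>A"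
    unfolding kap_def by (intro A.comult_one_sw ql) simp_all
  then show ?thesis using \<kappa>_mi[of "\<one>\<^sub>A" h] assms by (simp add: \<phi>_one)
qed

lemma \<kappa>_\<theta>_i: "h \<in> carrier H \<Longrightarrow> \<kappa> (\<theta> \<star> i h) = h"
  by (simp add: \<kappa>_mi kap_\<theta>)

lemma \<kappa>_i_mult:
  assumes h: "h \<in> carrier H" and m: "m \<in> carrier A"
  shows "\<kappa> (i h \<star> m) = sw2 k H (\<Delta> h) (\<lambda>h1 h2. \<sigma> h1 \<odot>\<^sub>H (h2 \<cdot> \<kappa> m))"
proof -
  have "\<kappa> (i h \<star> m) = sw2 k H (\<Delta> h) (\<lambda>h1 h2. sw2 k H (\<Delta>\<^sub>A m) (\<lambda>a b.
      \<phi> a \<odot>\<^sub>H (\<sigma> h1 \<odot>\<^sub>H (h2 \<cdot> \<pi> b))))"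
    unfolding kap_i_mult[OF \<phi>_inv m h] using h m
    by (intro pintro) (simp_all add: \<phi>_i_mult H.smult_assoc1 H.smult_left_comm)
  also have "\<dots> = sw2 k H (\<Delta> h) (\<lambda>h1 h2. \<sigma> h1 \<odot>\<^sub>H (h2 \<cdot> \<kappa> m))"
    using h m by (intro H.sw2_cong kap_apply ql) simp_all
  finally show ?thesis .
qed

lemma i_\<theta>:
  assumes h: "h \<in> carrier H"
  shows "i h \<star> \<theta> = sw2 k A (\<Delta> h) (\<lambda>h1 h2. \<sigma> h1 \<odot>\<^sub>A (\<theta> \<star> i h2))"
proof -
  have "i h \<star> \<theta> = \<theta> \<star> i (\<kappa> (i h \<star> \<theta>))"
    using decomp[of "i h \<star> \<theta>"] h
    by (simp add: p.mult \<pi>_\<theta> lin_zero[OF H.module_axioms A.module_axioms i.linear])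
  also have "\<dots> = \<theta> \<star> i (sw2 k H (\<Delta> h) (\<lambda>h1 h2. \<sigma> h1 \<odot>\<^sub>H h2))"
    using h by (subst \<kappa>_i_mult) (simp_all add: kap_\<theta> cong: H.sw2_cong)
  also have "\<dots> = sw2 k A (\<Delta> h) (\<lambda>h1 h2. \<theta> \<star> i (\<sigma> h1 \<odot>\<^sub>H h2))"
    using h by (intro H.lin_sw2[where g = "\<lambda>h. \<theta> \<star> i h", OF H.module_axioms A.module_axioms] ql) simp_all
  also have "\<dots> = sw2 k A (\<Delta> h) (\<lambda>h1 h2. \<sigma> h1 \<odot>\<^sub>A (\<theta> \<star> i h2))"
    using h by (intro H.sw2_cong) (simp_all add: i.smult A.smult_mult_right)
  finally show ?thesis .
qed

lemma \<chi>_decomp: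
  assumes m: "m \<in> carrier A"
  shows "\<chi> m = \<sigma> (\<pi> m) \<oplus> c \<otimes> \<sigma> (\<kappa> m)"
proof -
  have "\<chi> m = \<chi> (i (\<pi> m) \<oplus>\<^sub>A \<theta> \<star> i (\<kappa> m))" by (rule arg_cong[OF decomp[OF m]])
  then show ?thesis using m by (simp add: lin_add[OF \<chi>_lin] \<chi>_mult c_def \<sigma>_def)
qed

lemma right_invariant_conv:
  assumes f: "right_invariant f" and g: "right_invariant g"
  shows "right_invariant (conv k A f g)"
proof -
  let ?K = "scalars k"
  note fl = \<phi>_lin[OF f] and gl = \<phi>_lin[OF g] and fc = \<phi>_closed[OF f] and gc = \<phi>_closed[OF g]
  note sm = lin_scalar_mult[OF H.field_axioms]
  have "conv k A f g \<in> lin k A ?K"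
    unfolding conv_def[abs_def] by (intro ql sm lin_comp[OF fl] lin_comp[OF gl]) (simp_all add: fc gc)
  moreover have "conv k A f g (m \<star> i h) = conv k A f g m \<otimes> \<epsilon> h"
    if m: "m \<in> carrier A" and h: "h \<in> carrier H" for m h
  proof -
    have "conv k A f g (m \<star> i h) = sw2 k ?K (\<Delta>\<^sub>A m) (\<lambda>a b. sw2 k ?K (\<Delta> h) (\<lambda>h1 h2.
      f (a \<star> i h1) \<otimes> g (b \<star> i h2)))"
      unfolding conv_def using m h
      by (intro comult_mult_i ql sm lin_comp[OF fl] lin_comp[OF gl]) (simp_all add: fc gc)
    also have "\<dots> = sw2 k ?K (\<Delta>\<^sub>A m) (\<lambda>a b. sw2 k ?K (\<Delta> h) (\<lambda>h1 h2.
      \<epsilon> h1 \<odot>\<^sub>?K (f a \<otimes> g b \<otimes> \<epsilon> h2)))"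
      using m h by (intro pintro) (simp_all add: \<phi>_mult_i[OF f] \<phi>_mult_i[OF g] fc gc H.k_m_ac)
    also have "\<dots> = sw2 k ?K (\<Delta>\<^sub>A m) (\<lambda>a b. f a \<otimes> g b \<otimes> \<epsilon> h)"
      using m h by (intro A.sw2_cong H.counit_left_sw ql sm) (simp_all add: fc gc)
    also have "\<dots> = conv k A f g m \<otimes> \<epsilon> h"
      unfolding conv_def using m h
      by (intro A.lin_sw2[OF H.scalars_module H.scalars_module sm(1)[OF lin_id], symmetric]) (simp_all add: fc gc)
    finally show ?thesis .
  qed
  ultimately show ?thesis by (simp add: right_invariant_def)
qed

lemma conv_one:
  assumes "f \<in> lin k A (scalars k)" "g \<in> lin k A (scalars k)"
  shows "conv k A f g \<one>\<^sub>A = f \<one>\<^sub>A \<otimes> g \<one>\<^sub>A"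
  unfolding conv_def using lin_closed[OF assms(1)] lin_closed[OF assms(2)]
  by (intro A.comult_one_sw ql lin_scalar_mult[OF H.field_axioms] lin_comp[OF assms(1)] lin_comp[OF assms(2)]) simp_all

lemma conv_\<phi>_\<phi>: "m \<in> carrier A \<Longrightarrow> conv k A \<phi> \<phi> m = d \<otimes> \<phi> m"
  using invariant_decomp[OF right_invariant_conv[OF \<phi>_inv \<phi>_inv], of m]
  by (simp add: conv_one \<phi>_linear \<phi>_one flip: d_def)

lemma conv_\<phi>_i_mult:
  assumes h: "h \<in> carrier H" and m: "m \<in> carrier A"
  shows "conv k A \<phi> \<phi> (i h \<star> m) = conv k H \<sigma> \<sigma> h \<otimes> conv k A \<phi> \<phi> m"
proof -
  let ?K = "scalars k"
  note sm = lin_scalar_mult[OF H.field_axioms]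
  note KK = H.scalars_module
  have "conv k A \<phi> \<phi> (i h \<star> m) = sw2 k ?K (\<Delta> h) (\<lambda>h1 h2. sw2 k ?K (\<Delta>\<^sub>A m) (\<lambda>a b.
      \<phi> (i h1 \<star> a) \<otimes> \<phi> (i h2 \<star> b)))"
    unfolding conv_def using m h by (intro comult_i_mult ql sm) simp_all
  also have "\<dots> = sw2 k ?K (\<Delta> h) (\<lambda>h1 h2. sw2 k ?K (\<Delta>\<^sub>A m) (\<lambda>a b.
      (\<sigma> h1 \<otimes> \<sigma> h2) \<otimes> (\<phi> a \<otimes> \<phi> b)))"
    using m h by (intro pintro) (simp_all add: \<phi>_i_mult H.k_m_ac)
  also have "\<dots> = sw2 k ?K (\<Delta> h) (\<lambda>h1 h2. (\<sigma> h1 \<otimes> \<sigma> h2) \<otimes> conv k A \<phi> \<phi> m)"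
    unfolding conv_def using m h
    by (intro H.sw2_cong A.lin_sw2[OF KK KK sm(2)[OF lin_id], symmetric]) simp_all
  also have "\<dots> = conv k H \<sigma> \<sigma> h \<otimes> conv k A \<phi> \<phi> m"
    unfolding conv_def[of k H] using m h conv_cl[OF \<phi>_linear \<phi>_linear m]
    by (intro H.lin_sw2[OF KK KK sm(1)[OF lin_id], symmetric]) simp_all
  finally show ?thesis .
qed

lemma conv_\<sigma>_cl: "h \<in> carrier H \<Longrightarrow> conv k H \<sigma> \<sigma> h \<in> carrier k"
  using H.sw2_closed[OF H.scalars_module H.comult_closed, of h "\<lambda>a b. \<sigma> a \<otimes> \<sigma> b"] by (simp add: conv_def)

text \<open>
  Both sides of \<open>\<phi> * \<phi> = d \<phi>\<close> are semi-invariant under left multiplication by \<open>h\<close>, with the characters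
  \<open>\<sigma> * \<sigma>\<close> and \<open>\<sigma>\<close>.
\<close>

lemma \<sigma>_idem_d:
  assumes "d \<noteq> \<zero>" and h: "h \<in> carrier H"
  shows "conv k H \<sigma> \<sigma> h = \<sigma> h"
proof -
  have "d \<otimes> conv k H \<sigma> \<sigma> h = d \<otimes> \<sigma> h"
    using conv_\<phi>_i_mult[OF h \<theta>_closed] h conv_\<sigma>_cl[OF h] d_cl
    by (simp add: conv_\<phi>_\<phi> \<phi>_i_mult \<phi>_\<theta> H.k_m_ac)
  then show ?thesis using H.m_lcancel[OF assms(1) d_cl] conv_\<sigma>_cl[OF h] \<sigma>_cl[OF h] by simp
qed

text \<open>
  Apply the character \<open>\<chi>\<close> to \<open>h \<theta> = \<sigma>(h\<^sub>1) \<theta> h\<^sub>2\<close>.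
\<close>

lemma \<sigma>_idem_c:
  assumes "c \<noteq> \<zero>" and h: "h \<in> carrier H"
  shows "conv k H \<sigma> \<sigma> h = \<sigma> h"
proof -
  let ?K = "scalars k"
  note KK = H.scalars_module
  have "c \<otimes> \<sigma> h = \<chi> (i h \<star> \<theta>)" using h by (simp add: \<chi>_mult c_def \<sigma>_def H.k_m_ac)
  also have "\<dots> = sw2 k ?K (\<Delta> h) (\<lambda>h1 h2. \<chi> (\<sigma> h1 \<odot>\<^sub>A (\<theta> \<star> i h2)))"
    unfolding i_\<theta>[OF h] using h by (intro H.lin_sw2[OF A.module_axioms KK \<chi>_lin]) simp_all
  also have "\<dots> = sw2 k ?K (\<Delta> h) (\<lambda>h1 h2. c \<odot>\<^sub>?K (\<sigma> h1 \<otimes> \<sigma> h2))"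
    using h by (intro H.sw2_cong) (simp_all add: lin_smult[OF \<chi>_lin] \<chi>_mult H.k_m_ac flip: c_def \<sigma>_def)
  also have "\<dots> = c \<otimes> conv k H \<sigma> \<sigma> h"
    unfolding conv_def scalars_sel(4)[symmetric] using h
    by (intro H.lin_sw2[OF KK KK lin_smult_right[OF KK _ lin_id], symmetric]) simp_all
  finally show ?thesis using H.m_lcancel[OF assms(1) c_cl] conv_\<sigma>_cl[OF h] \<sigma>_cl[OF h] by simp
qed

lemma \<sigma>_counit:
  assumes "c \<noteq> \<zero> \<or> d \<noteq> \<zero>" and h: "h \<in> carrier H"
  shows "\<sigma> h = \<epsilon> h"
  using assms \<sigma>_idem_c \<sigma>_idem_d by (intro H.idempotent_char[OF \<sigma>_char]) auto

end

section \<open>The element v and the legs of the coproduct\<close>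

context rank_two
begin

lemma L_mi:
  assumes m: "m \<in> carrier A" and h: "h \<in> carrier H"
  shows "L (m \<star> i h) = L m \<cdot> h"
proof -
  note M = H.module_axioms
  have "L (m \<star> i h) = sw2 k H (\<Delta>\<^sub>A m) (\<lambda>a b. sw2 k H (\<Delta> h) (\<lambda>h1 h2.
      \<phi> (b \<star> i h2) \<odot>\<^sub>H \<pi> (a \<star> i h1)))"
    unfolding L_def using m h by (intro comult_mult_i ql) simp_all
  also have "\<dots> = sw2 k H (\<Delta>\<^sub>A m) (\<lambda>a b. sw2 k H (\<Delta> h) (\<lambda>h1 h2. \<epsilon> h2 \<odot>\<^sub>H (\<phi> b \<odot>\<^sub>H (\<pi> a \<cdot> h1))))"
    using m h by (intro pintro) (simp_all add: \<phi>_mi psimp H.k_m_ac)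
  also have "\<dots> = sw2 k H (\<Delta>\<^sub>A m) (\<lambda>a b. \<phi> b \<odot>\<^sub>H (\<pi> a \<cdot> h))"
    using m h by (intro A.sw2_cong H.counit_right_sw ql) simp_all
  also have "\<dots> = L m \<cdot> h"
    using m h by (intro L_apply ql) simp_all
  finally show ?thesis .
qed

lemma L_i:
  assumes "h \<in> carrier H"
  shows "L (i h) = \<zero>\<^sub>H"
proof -
  have "L \<one>\<^sub>A = \<phi> \<one>\<^sub>A \<odot>\<^sub>H \<pi> \<one>\<^sub>A"
    unfolding L_def by (intro A.comult_one_sw ql) simp_all
  then show ?thesis using L_mi[of "\<one>\<^sub>A" h] assms by (simp add: \<phi>_one)
qed

text \<open>
  The map \<open>L\<close> is right \<open>H\<close>-linear and vanishes on \<open>H\<close>, so it is determined by its value \<open>v\<close> at \<open>\<theta>\<close>.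
\<close>

lemma L_eq:
  assumes m: "m \<in> carrier A"
  shows "L m = v \<cdot> \<kappa> m"
proof -
  have "L m = L (i (\<pi> m) \<oplus>\<^sub>A \<theta> \<star> i (\<kappa> m))" by (rule arg_cong[OF decomp[OF m]])
  then show ?thesis using m by (simp add: lin_add[OF L_lin] L_i L_mi v_def)
qed

lemma L_i_mult:
  assumes h: "h \<in> carrier H" and m: "m \<in> carrier A"
  shows "L (i h \<star> m) = sw2 k H (\<Delta> h) (\<lambda>h1 h2. \<sigma> h2 \<odot>\<^sub>H (h1 \<cdot> L m))"
proof -
  have "L (i h \<star> m) = sw2 k H (\<Delta> h) (\<lambda>h1 h2. sw2 k H (\<Delta>\<^sub>A m) (\<lambda>a b.
      \<phi> (i h2 \<star> b) \<odot>\<^sub>H \<pi> (i h1 \<star> a)))"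
    unfolding L_def using m h by (intro comult_i_mult ql) simp_all
  also have "\<dots> = sw2 k H (\<Delta> h) (\<lambda>h1 h2. sw2 k H (\<Delta>\<^sub>A m) (\<lambda>a b.
      \<phi> b \<odot>\<^sub>H (\<sigma> h2 \<odot>\<^sub>H (h1 \<cdot> \<pi> a))))"
    using m h by (intro pintro) (simp_all add: \<phi>_i_mult psimp)
  also have "\<dots> = sw2 k H (\<Delta> h) (\<lambda>h1 h2. \<sigma> h2 \<odot>\<^sub>H (h1 \<cdot> L m))"
    using m h by (intro H.sw2_cong L_apply ql) simp_all
  finally show ?thesis .
qed

lemma counit_v: "\<epsilon> v = \<one>"
proof -
  have "\<epsilon> v = sw2 k (scalars k) (\<Delta>\<^sub>A \<theta>) (\<lambda>a b. \<phi> b \<odot>\<^bsub>scalars k\<^esub> \<epsilon> (\<pi> a))"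
    unfolding v_def by (rule L_apply[OF H.scalars_module H.counit_lin \<theta>_closed, symmetric])
  also have "\<dots> = sw2 k (scalars k) (\<Delta>\<^sub>A \<theta>) (\<lambda>a b. \<epsilon>\<^sub>A a \<odot>\<^bsub>scalars k\<^esub> \<phi> b)"
    by (intro A.sw2_cong) (simp_all add: p.counit H.k_m_ac)
  also have "\<dots> = \<phi> \<theta>" by (rule A.counit_left_sw[OF H.scalars_module \<phi>_linear \<theta>_closed])
  finally show ?thesis by (simp add: \<phi>_\<theta>)
qed

text \<open>
  Both sides are \<open>L (i h \<star> \<theta>)\<close>, computed from the coproduct of the product and from the commutation
  rule for \<open>\<theta>\<close>.
\<close>

lemma v_comm:
  assumes h: "h \<in> carrier H"
  shows "sw2 k H (\<Delta> h) (\<lambda>h1 h2. \<sigma> h2 \<odot>\<^sub>H (h1 \<cdot> v))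
    = sw2 k H (\<Delta> h) (\<lambda>h1 h2. \<sigma> h1 \<odot>\<^sub>H (v \<cdot> h2))"
proof -
  have "sw2 k H (\<Delta> h) (\<lambda>h1 h2. \<sigma> h2 \<odot>\<^sub>H (h1 \<cdot> v)) = L (i h \<star> \<theta>)"
    using h by (simp add: L_i_mult v_def)
  also have "\<dots> = sw2 k H (\<Delta> h) (\<lambda>h1 h2. L (\<sigma> h1 \<odot>\<^sub>A (\<theta> \<star> i h2)))"
    unfolding i_\<theta>[OF h] using h by (intro H.lin_sw2[OF A.module_axioms H.module_axioms L_lin]) simp_all
  also have "\<dots> = sw2 k H (\<Delta> h) (\<lambda>h1 h2. \<sigma> h1 \<odot>\<^sub>H (v \<cdot> h2))"
    using h by (intro H.sw2_cong) (simp_all add: lin_smult[OF L_lin] L_mi flip: v_def)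
  finally show ?thesis .
qed

text \<open>
  The map \<open>(\<phi> \<otimes> \<kappa>) \<Delta>\<close> and its counterpart \<open>(\<kappa> \<otimes> \<phi>) \<Delta>\<close> with the legs exchanged, which enter the
  component \<open>(\<kappa> \<otimes> \<kappa>) \<Delta>(\<theta>)\<close> of the coproduct. By quasi-coassociativity \<open>M\<close> involves only \<open>\<phi> * \<phi> = d \<phi>\<close>,
  and \<open>N\<close> is obtained from \<open>M\<close> (\<open>M_formula\<close>, \<open>N_formula\<close>).
\<close>

definition M where "M m = sw2 k H (\<Delta>\<^sub>A m) (\<lambda>a b. \<phi> a \<odot>\<^sub>H \<kappa> b)"
definition N where "N m = sw2 k H (\<Delta>\<^sub>A m) (\<lambda>a b. \<phi> b \<odot>\<^sub>H \<kappa> a)"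

lemma M_cl: "m \<in> carrier A \<Longrightarrow> M m \<in> carrier H"
  and N_cl: "m \<in> carrier A \<Longrightarrow> N m \<in> carrier H"
  by (simp_all add: M_def N_def A.sw2_closed)

context
  fixes V :: "('k, 'v, 'w) module_scheme"
  assumes V: "module k V"
begin

interpretation V: module k V by (rule V)

lemma pull_smult2A:
  assumes "r \<in> carrier k" "t \<in> carrier (tpow k A 2)" "\<And>a b. \<lbrakk>a \<in> carrier A; b \<in> carrier A\<rbrakk> \<Longrightarrow> f a b \<in> carrier V"
  shows "sw2 k V t (\<lambda>a b. r \<odot>\<^sub>V f a b) = r \<odot>\<^sub>V sw2 k V t f"
  using A.lin_sw2[OF V V lin_smult_right[OF V assms(1) lin_id] assms(2,3)] by simp

text \<open>
  The component \<open>(\<kappa> \<otimes> \<pi>) \<Delta>(\<theta>)\<close> of the coproduct. Writing \<open>\<kappa>\<close> as \<open>(\<phi> \<otimes> \<pi>) \<Delta>\<close> and using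
  quasi-coassociativity produces the coproduct of \<open>\<kappa>(\<theta>) = 1\<close>, so that only \<open>\<Phi>\<^sup>-\<^sup>1\<close> is left.
\<close>

lemma \<theta>_left:
  assumes f: "bilin k H V f"
  shows "sw2 k V (\<Delta>\<^sub>A \<theta>) (\<lambda>a b. f (\<kappa> a) (\<pi> b)) = sw3 k V \<phi>i (\<lambda>x1 x2 x3. \<sigma> x1 \<odot>\<^sub>V f x2 x3)"
proof -
  let ?W = "\<lambda>f. sw3 k V \<phi>i (\<lambda>x1 x2 x3. sw2 k V (\<Delta>\<^sub>A \<theta>) (\<lambda>a b. sw2 k V (\<Delta>\<^sub>A b) (\<lambda>b1 b2. f x1 x2 x3 a b b1 b2)))"
  note fl = bilin_lin[OF f] and fc = bilin_closed[OF f]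
  have "sw2 k V (\<Delta>\<^sub>A \<theta>) (\<lambda>a b. f (\<kappa> a) (\<pi> b))
    = sw2 k V (\<Delta>\<^sub>A \<theta>) (\<lambda>a b. sw2 k V (\<Delta>\<^sub>A a) (\<lambda>a1 a2. \<phi> a1 \<odot>\<^sub>V f (\<pi> a2) (\<pi> b)))"
    by (intro A.sw2_cong kap_apply[where g = "\<lambda>h. f h (\<pi> _)", symmetric] ql fl V) simp_all
  also have "\<dots> = ?W (\<lambda>x1 x2 x3 a b b1 b2.
      sw3 k V \<Phi> (\<lambda>X1 X2 X3. \<phi> (i x1 \<star> a \<star> i X1) \<odot>\<^sub>V
      f (\<pi> (i x2 \<star> b1 \<star> i X2)) (\<pi> (i x3 \<star> b2 \<star> i X3))))"
    by (intro coassoc_inv ql fl V) (simp_all add: fc)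
  also have "\<dots> = ?W (\<lambda>x1 x2 x3 a b b1 b2.
      sw3 k V \<Phi> (\<lambda>X1 X2 X3. \<epsilon> X1 \<odot>\<^sub>V (\<sigma> x1 \<odot>\<^sub>V (\<phi> a \<odot>\<^sub>V
      f (x2 \<cdot> \<pi> b1 \<cdot> X2) (x3 \<cdot> \<pi> b2 \<cdot> X3)))))"
    by (intro pintro) (simp_all add: \<phi>_sandwich p.mult proj V.smult_assoc1 fc)
  also have "\<dots> = ?W (\<lambda>x1 x2 x3 a b b1 b2.
      \<sigma> x1 \<odot>\<^sub>V (\<phi> a \<odot>\<^sub>V f (x2 \<cdot> \<pi> b1 \<cdot> \<one>\<^sub>H) (x3 \<cdot> \<pi> b2 \<cdot> \<one>\<^sub>H)))"
    by (intro H.sw3_cong A.sw2_cong H.counit_reassoc1_sw ql fl V) (simp_all add: fc)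
  also have "\<dots> = sw3 k V \<phi>i (\<lambda>x1 x2 x3. sw2 k V (\<Delta>\<^sub>A \<theta>) (\<lambda>a b. sw2 k V (\<Delta> (\<pi> b)) (\<lambda>b1 b2.
      \<sigma> x1 \<odot>\<^sub>V (\<phi> a \<odot>\<^sub>V f (x2 \<cdot> b1 \<cdot> \<one>\<^sub>H) (x3 \<cdot> b2 \<cdot> \<one>\<^sub>H)))))"
    by (intro H.sw3_cong A.sw2_cong p.comult_sw[symmetric] ql fl V) (simp_all add: fc)
  also have "\<dots> = sw3 k V \<phi>i (\<lambda>x1 x2 x3. sw2 k V (\<Delta>\<^sub>A \<theta>) (\<lambda>a b. \<phi> a \<odot>\<^sub>V sw2 k V (\<Delta> (\<pi> b)) (\<lambda>b1 b2.
      \<sigma> x1 \<odot>\<^sub>V f (x2 \<cdot> b1) (x3 \<cdot> b2))))"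
  proof -
    have "sw2 k V (\<Delta> h) (\<lambda>b1 b2. \<sigma> x1 \<odot>\<^sub>V (r \<odot>\<^sub>V f (x2 \<cdot> b1 \<cdot> \<one>\<^sub>H) (x3 \<cdot> b2 \<cdot> \<one>\<^sub>H)))
      = r \<odot>\<^sub>V sw2 k V (\<Delta> h) (\<lambda>b1 b2. \<sigma> x1 \<odot>\<^sub>V f (x2 \<cdot> b1) (x3 \<cdot> b2))"
      if "h \<in> carrier H" "r \<in> carrier k" "x1 \<in> carrier H" "x2 \<in> carrier H" "x3 \<in> carrier H" for h r x1 x2 x3
      using that by (simp add: H.lin_sw2[OF V V lin_smult_right[OF V _ lin_id]] V.smult_left_comm fc cong: H.sw2_cong)
    then show ?thesis by (intro H.sw3_cong A.sw2_cong) simp_all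
  qed
  also have "\<dots> = sw3 k V \<phi>i (\<lambda>x1 x2 x3. sw2 k V (\<Delta> (\<kappa> \<theta>)) (\<lambda>b1 b2.
      \<sigma> x1 \<odot>\<^sub>V f (x2 \<cdot> b1) (x3 \<cdot> b2)))"
    by (intro H.sw3_cong kap_apply ql fl V) (simp_all add: fc)
  also have "\<dots> = sw3 k V \<phi>i (\<lambda>x1 x2 x3. \<sigma> x1 \<odot>\<^sub>V f (x2 \<cdot> \<one>\<^sub>H) (x3 \<cdot> \<one>\<^sub>H))"
    unfolding kap_\<theta> by (intro H.sw3_cong H.comult_one_sw ql fl V) (simp_all add: fc)
  also have "\<dots> = sw3 k V \<phi>i (\<lambda>x1 x2 x3. \<sigma> x1 \<odot>\<^sub>V f x2 x3)"
    by (intro H.sw3_cong) simp_all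
  finally show ?thesis .
qed

text \<open>
  The component \<open>(\<pi> \<otimes> \<kappa>) \<Delta>(\<theta>)\<close>. Here quasi-coassociativity produces \<open>L\<close> on the first leg, that is \<open>v \<kappa>\<close>,
  which brings the computation back to \<open>\<theta>_left\<close>.
\<close>

lemma \<theta>_right:
  assumes f: "bilin k H V f"
  shows "sw2 k V (\<Delta>\<^sub>A \<theta>) (\<lambda>a b. f (\<pi> a) (\<kappa> b))
    = sw3 k V \<Phi> (\<lambda>X1 X2 X3. sw3 k V \<phi>i (\<lambda>x1 x2 x3.
      \<sigma> (X2 \<cdot> x1) \<odot>\<^sub>V f (X1 \<cdot> v \<cdot> x2) (X3 \<cdot> x3)))"
proof -
  let ?W = "\<lambda>f. sw3 k V \<Phi> (\<lambda>X1 X2 X3. sw2 k V (\<Delta>\<^sub>A \<theta>) (\<lambda>a b. sw2 k V (\<Delta>\<^sub>A a) (\<lambda>a1 a2. f X1 X2 X3 a b a1 a2)))"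
  note fl = bilin_lin[OF f] and fc = bilin_closed[OF f]
  have "sw2 k V (\<Delta>\<^sub>A \<theta>) (\<lambda>a b. f (\<pi> a) (\<kappa> b))
    = sw2 k V (\<Delta>\<^sub>A \<theta>) (\<lambda>a b. sw2 k V (\<Delta>\<^sub>A b) (\<lambda>b1 b2. \<phi> b1 \<odot>\<^sub>V f (\<pi> a) (\<pi> b2)))"
    by (intro A.sw2_cong kap_apply[symmetric] ql fl V) simp_all
  also have "\<dots> = ?W (\<lambda>X1 X2 X3 a b a1 a2.
      sw3 k V \<phi>i (\<lambda>x1 x2 x3. \<phi> (i X2 \<star> a2 \<star> i x2) \<odot>\<^sub>V
      f (\<pi> (i X1 \<star> a1 \<star> i x1)) (\<pi> (i X3 \<star> b \<star> i x3))))"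
    by (intro coassoc ql fl V) (simp_all add: fc)
  also have "\<dots> = ?W (\<lambda>X1 X2 X3 a b a1 a2.
      sw3 k V \<phi>i (\<lambda>x1 x2 x3. \<epsilon> x2 \<odot>\<^sub>V (\<phi> a2 \<odot>\<^sub>V (\<sigma> X2 \<odot>\<^sub>V
      f (X1 \<cdot> \<pi> a1 \<cdot> x1) (X3 \<cdot> \<pi> b \<cdot> x3)))))"
    by (intro pintro) (simp_all add: \<phi>_sandwich p.mult proj V.smult_assoc1 V.smult_left_comm fc)
  also have "\<dots> = ?W (\<lambda>X1 X2 X3 a b a1 a2.
      \<phi> a2 \<odot>\<^sub>V (\<sigma> X2 \<odot>\<^sub>V f (X1 \<cdot> \<pi> a1 \<cdot> \<one>\<^sub>H) (X3 \<cdot> \<pi> b \<cdot> \<one>\<^sub>H)))"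
    by (intro H.sw3_cong A.sw2_cong H.counit_reassoc_inv2_sw ql fl V) (simp_all add: fc)
  also have "\<dots> = sw3 k V \<Phi> (\<lambda>X1 X2 X3. sw2 k V (\<Delta>\<^sub>A \<theta>) (\<lambda>a b.
      \<sigma> X2 \<odot>\<^sub>V f (X1 \<cdot> L a \<cdot> \<one>\<^sub>H) (X3 \<cdot> \<pi> b \<cdot> \<one>\<^sub>H)))"
    by (intro H.sw3_cong A.sw2_cong L_apply ql fl V) (simp_all add: fc)
  also have "\<dots> = sw3 k V \<Phi> (\<lambda>X1 X2 X3. sw2 k V (\<Delta>\<^sub>A \<theta>) (\<lambda>a b.
      \<sigma> X2 \<odot>\<^sub>V f (X1 \<cdot> (v \<cdot> \<kappa> a)) (X3 \<cdot> \<pi> b)))"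
    by (intro H.sw3_cong A.sw2_cong) (simp_all add: L_eq)
  also have "\<dots> = sw3 k V \<Phi> (\<lambda>X1 X2 X3. sw3 k V \<phi>i (\<lambda>x1 x2 x3.
      \<sigma> x1 \<odot>\<^sub>V (\<sigma> X2 \<odot>\<^sub>V f (X1 \<cdot> (v \<cdot> x2)) (X3 \<cdot> x3))))"
    by (intro H.sw3_cong \<theta>_left ql fl V) (simp_all add: fc)
  also have "\<dots> = sw3 k V \<Phi> (\<lambda>X1 X2 X3. sw3 k V \<phi>i (\<lambda>x1 x2 x3.
      \<sigma> (X2 \<cdot> x1) \<odot>\<^sub>V f (X1 \<cdot> v \<cdot> x2) (X3 \<cdot> x3)))"
    by (intro H.sw3_cong) (simp_all add: \<sigma>_mult V.smult_assoc1 V.smult_left_comm H.A.m_assoc fc)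
  finally show ?thesis .
qed

text \<open>
  As \<open>v = \<pi>(\<theta>\<^sub>1) \<phi>(\<theta>\<^sub>2)\<close>, quasi-coassociativity turns the coproduct of \<open>v\<close> into the image of \<open>\<Delta>(\<theta>)\<close> under
  \<open>\<pi> \<otimes> L\<close>, which is known from \<open>\<theta>_right\<close>.
\<close>

lemma \<Delta>_v:
  assumes f: "bilin k H V f"
  shows "sw2 k V (\<Delta> v) f
    = sw3 k V \<Phi> (\<lambda>X1 X2 X3. sw3 k V \<phi>i (\<lambda>x1 x2 x3. sw3 k V \<phi>i (\<lambda>y1 y2 y3.
      \<sigma> (y1 \<cdot> x3 \<cdot> X2) \<odot>\<^sub>V
      f (x1 \<cdot> X1 \<cdot> v \<cdot> y2) (x2 \<cdot> v \<cdot> X3 \<cdot> y3))))"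
proof -
  let ?W = "\<lambda>f. sw3 k V \<phi>i (\<lambda>x1 x2 x3. sw2 k V (\<Delta>\<^sub>A \<theta>) (\<lambda>a b. sw2 k V (\<Delta>\<^sub>A b) (\<lambda>b1 b2. f x1 x2 x3 a b b1 b2)))"
  note fl = bilin_lin[OF f] and fc = bilin_closed[OF f]
  have "sw2 k V (\<Delta> v) f = sw2 k V (\<Delta>\<^sub>A \<theta>) (\<lambda>a b. \<phi> b \<odot>\<^sub>V sw2 k V (\<Delta> (\<pi> a)) f)"
    unfolding v_def by (intro L_apply[symmetric] ql fl V f) simp_all
  also have "\<dots> = sw2 k V (\<Delta>\<^sub>A \<theta>) (\<lambda>a b. \<phi> b \<odot>\<^sub>V sw2 k V (\<Delta>\<^sub>A a) (\<lambda>a1 a2. f (\<pi> a1) (\<pi> a2)))"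
    by (intro A.sw2_cong arg_cong[where f = "smult V _"] p.comult_sw ql fl V f) simp_all
  also have "\<dots> = sw2 k V (\<Delta>\<^sub>A \<theta>) (\<lambda>a b. sw2 k V (\<Delta>\<^sub>A a) (\<lambda>a1 a2. \<phi> b \<odot>\<^sub>V f (\<pi> a1) (\<pi> a2)))"
    by (intro A.sw2_cong pull_smult2A[symmetric]) (simp_all add: fc)
  also have "\<dots> = ?W (\<lambda>x1 x2 x3 a b b1 b2.
      sw3 k V \<Phi> (\<lambda>X1 X2 X3. \<phi> (i x3 \<star> b2 \<star> i X3) \<odot>\<^sub>V
      f (\<pi> (i x1 \<star> a \<star> i X1)) (\<pi> (i x2 \<star> b1 \<star> i X2))))"
    by (intro coassoc_inv ql fl V) (simp_all add: fc)
  also have "\<dots> = ?W (\<lambda>x1 x2 x3 a b b1 b2.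
      sw3 k V \<Phi> (\<lambda>X1 X2 X3. \<epsilon> X3 \<odot>\<^sub>V (\<phi> b2 \<odot>\<^sub>V (\<sigma> x3 \<odot>\<^sub>V
      f (x1 \<cdot> \<pi> a \<cdot> X1) (x2 \<cdot> \<pi> b1 \<cdot> X2)))))"
    by (intro pintro) (simp_all add: \<phi>_sandwich p.mult proj V.smult_assoc1 V.smult_left_comm fc)
  also have "\<dots> = ?W (\<lambda>x1 x2 x3 a b b1 b2.
      \<phi> b2 \<odot>\<^sub>V (\<sigma> x3 \<odot>\<^sub>V f (x1 \<cdot> \<pi> a \<cdot> \<one>\<^sub>H) (x2 \<cdot> \<pi> b1 \<cdot> \<one>\<^sub>H)))"
    by (intro H.sw3_cong A.sw2_cong H.counit_reassoc3_sw ql fl V) (simp_all add: fc)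
  also have "\<dots> = sw3 k V \<phi>i (\<lambda>x1 x2 x3. sw2 k V (\<Delta>\<^sub>A \<theta>) (\<lambda>a b.
      \<sigma> x3 \<odot>\<^sub>V f (x1 \<cdot> \<pi> a \<cdot> \<one>\<^sub>H) (x2 \<cdot> L b \<cdot> \<one>\<^sub>H)))"
    by (intro H.sw3_cong A.sw2_cong L_apply ql fl V) (simp_all add: fc)
  also have "\<dots> = sw3 k V \<phi>i (\<lambda>x1 x2 x3. sw2 k V (\<Delta>\<^sub>A \<theta>) (\<lambda>a b.
      \<sigma> x3 \<odot>\<^sub>V f (x1 \<cdot> \<pi> a) (x2 \<cdot> (v \<cdot> \<kappa> b))))"
    by (intro H.sw3_cong A.sw2_cong) (simp_all add: L_eq)
  also have "\<dots> = sw3 k V \<phi>i (\<lambda>x1 x2 x3. sw3 k V \<Phi> (\<lambda>X1 X2 X3. sw3 k V \<phi>i (\<lambda>y1 y2 y3.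
      \<sigma> (X2 \<cdot> y1) \<odot>\<^sub>V (\<sigma> x3 \<odot>\<^sub>V
      f (x1 \<cdot> (X1 \<cdot> v \<cdot> y2)) (x2 \<cdot> (v \<cdot> (X3 \<cdot> y3)))))))"
    by (intro H.sw3_cong \<theta>_right ql fl V) (simp_all add: fc)
  also have "\<dots> = sw3 k V \<Phi> (\<lambda>X1 X2 X3. sw3 k V \<phi>i (\<lambda>x1 x2 x3. sw3 k V \<phi>i (\<lambda>y1 y2 y3.
      \<sigma> (X2 \<cdot> y1) \<odot>\<^sub>V (\<sigma> x3 \<odot>\<^sub>V
      f (x1 \<cdot> (X1 \<cdot> v \<cdot> y2)) (x2 \<cdot> (v \<cdot> (X3 \<cdot> y3)))))))"
    by (intro H.sw3_sw3_swap[OF H.unital_algebra_axioms V]) (simp_all add: fc H.sw3_closed V)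
  also have "\<dots> = sw3 k V \<Phi> (\<lambda>X1 X2 X3. sw3 k V \<phi>i (\<lambda>x1 x2 x3. sw3 k V \<phi>i (\<lambda>y1 y2 y3.
      \<sigma> (y1 \<cdot> x3 \<cdot> X2) \<odot>\<^sub>V
      f (x1 \<cdot> X1 \<cdot> v \<cdot> y2) (x2 \<cdot> v \<cdot> X3 \<cdot> y3))))"
    by (intro H.sw3_cong) (simp_all add: \<sigma>_mult V.smult_assoc1 V.smult_left_comm H.A.m_assoc fc)
  finally show ?thesis .
qed

end

lemma M_formula:
  assumes m: "m \<in> carrier A"
  shows "M m = sw3 k H \<Phi> (\<lambda>X1 X2 X3. \<sigma> X1 \<odot>\<^sub>H (\<sigma> X2 \<odot>\<^sub>H (d \<odot>\<^sub>H (X3 \<cdot> \<kappa> m))))"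
proof -
  let ?W = "\<lambda>f. sw3 k H \<Phi> (\<lambda>X1 X2 X3. sw2 k H (\<Delta>\<^sub>A m) (\<lambda>a b. sw2 k H (\<Delta>\<^sub>A a) (\<lambda>a1 a2. f X1 X2 X3 a b a1 a2)))"
  note V = H.module_axioms
  have "M m = sw2 k H (\<Delta>\<^sub>A m) (\<lambda>a b. sw2 k H (\<Delta>\<^sub>A b) (\<lambda>b1 b2. \<phi> b1 \<odot>\<^sub>H (\<phi> a \<odot>\<^sub>H \<pi> b2)))"
    unfolding M_def using m by (intro A.sw2_cong kap_apply[symmetric] ql) simp_all
  also have "\<dots> = ?W (\<lambda>X1 X2 X3 a b a1 a2.
      sw3 k H \<phi>i (\<lambda>x1 x2 x3. \<phi> (i X2 \<star> a2 \<star> i x2) \<odot>\<^sub>H (\<phi> (i X1 \<star> a1 \<star> i x1) \<odot>\<^sub>H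
      \<pi> (i X3 \<star> b \<star> i x3))))"
    using m by (intro coassoc ql) simp_all
  also have "\<dots> = ?W (\<lambda>X1 X2 X3 a b a1 a2.
      sw3 k H \<phi>i (\<lambda>x1 x2 x3. \<epsilon> x1 \<odot>\<^sub>H (\<epsilon> x2 \<odot>\<^sub>H (\<sigma> X1 \<odot>\<^sub>H (\<sigma> X2 \<odot>\<^sub>H
      ((\<phi> a1 \<otimes> \<phi> a2) \<odot>\<^sub>H (X3 \<cdot> \<pi> b \<cdot> x3)))))))"
    using m by (intro pintro) (simp_all add: \<phi>_sandwich p.mult proj H.smult_assoc1 H.smult_left_comm)
  also have "\<dots> = ?W (\<lambda>X1 X2 X3 a b a1 a2.
      \<epsilon> \<one>\<^sub>H \<odot>\<^sub>H (\<sigma> X1 \<odot>\<^sub>H (\<sigma> X2 \<odot>\<^sub>H ((\<phi> a1 \<otimes> \<phi> a2) \<odot>\<^sub>H (X3 \<cdot> \<pi> b \<cdot> \<one>\<^sub>H)))))"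
    using m by (intro H.sw3_cong A.sw2_cong H.counit_reassoc_inv1_sw ql) simp_all
  also have "\<dots> = ?W (\<lambda>X1 X2 X3 a b a1 a2.
      ((\<phi> a1 \<otimes> \<phi> a2) \<odot>\<^sub>H (\<sigma> X1 \<odot>\<^sub>H (\<sigma> X2 \<odot>\<^sub>H (X3 \<cdot> \<pi> b)))))"
    using m by (intro pintro) (simp_all add: H.counit_one H.smult_assoc1 H.smult_left_comm)
  also have "\<dots> = sw3 k H \<Phi> (\<lambda>X1 X2 X3. sw2 k H (\<Delta>\<^sub>A m) (\<lambda>a b.
      conv k A \<phi> \<phi> a \<odot>\<^sub>H (\<sigma> X1 \<odot>\<^sub>H (\<sigma> X2 \<odot>\<^sub>H (X3 \<cdot> \<pi> b)))))"
    unfolding conv_def using m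
    by (intro H.sw3_cong A.sw2_cong A.lin_sw2[OF H.scalars_module V lin_smult_left[OF V lin_id], symmetric]) simp_all
  also have "\<dots> = sw3 k H \<Phi> (\<lambda>X1 X2 X3. sw2 k H (\<Delta>\<^sub>A m) (\<lambda>a b.
      \<phi> a \<odot>\<^sub>H (\<sigma> X1 \<odot>\<^sub>H (\<sigma> X2 \<odot>\<^sub>H (d \<odot>\<^sub>H (X3 \<cdot> \<pi> b))))))"
    using m by (intro pintro) (simp_all add: conv_\<phi>_\<phi> H.smult_assoc1 H.smult_left_comm)
  also have "\<dots> = sw3 k H \<Phi> (\<lambda>X1 X2 X3. \<sigma> X1 \<odot>\<^sub>H (\<sigma> X2 \<odot>\<^sub>H (d \<odot>\<^sub>H (X3 \<cdot> \<kappa> m))))"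
    using m by (intro H.sw3_cong kap_apply ql) simp_all
  finally show ?thesis .
qed

lemma N_formula:
  assumes m: "m \<in> carrier A"
  shows "N m = sw3 k H \<phi>i (\<lambda>x1 x2 x3. \<sigma> x1 \<odot>\<^sub>H (\<sigma> x3 \<odot>\<^sub>H (x2 \<cdot> (v \<cdot> M m))))"
proof -
  let ?W = "\<lambda>f. sw3 k H \<phi>i (\<lambda>x1 x2 x3. sw2 k H (\<Delta>\<^sub>A m) (\<lambda>a b. sw2 k H (\<Delta>\<^sub>A b) (\<lambda>b1 b2. f x1 x2 x3 a b b1 b2)))"
  note V = H.module_axioms
  have "N m = sw2 k H (\<Delta>\<^sub>A m) (\<lambda>a b. sw2 k H (\<Delta>\<^sub>A a) (\<lambda>a1 a2. \<phi> a1 \<odot>\<^sub>H (\<phi> b \<odot>\<^sub>H \<pi> a2)))"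
    unfolding N_def using m by (intro A.sw2_cong kap_apply[symmetric] ql) simp_all
  also have "\<dots> = ?W (\<lambda>x1 x2 x3 a b b1 b2.
      sw3 k H \<Phi> (\<lambda>X1 X2 X3. \<phi> (i x1 \<star> a \<star> i X1) \<odot>\<^sub>H (\<phi> (i x3 \<star> b2 \<star> i X3) \<odot>\<^sub>H
      \<pi> (i x2 \<star> b1 \<star> i X2))))"
    using m by (intro coassoc_inv ql) simp_all
  also have "\<dots> = ?W (\<lambda>x1 x2 x3 a b b1 b2.
      sw3 k H \<Phi> (\<lambda>X1 X2 X3. \<epsilon> X1 \<odot>\<^sub>H (\<epsilon> X3 \<odot>\<^sub>H (\<phi> b2 \<odot>\<^sub>H (\<sigma> x1 \<odot>\<^sub>H (\<sigma> x3 \<odot>\<^sub>H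
      (\<phi> a \<odot>\<^sub>H (x2 \<cdot> \<pi> b1 \<cdot> X2))))))))"
    using m by (intro pintro) (simp_all add: \<phi>_sandwich p.mult proj H.smult_assoc1 H.smult_left_comm)
  also have "\<dots> = ?W (\<lambda>x1 x2 x3 a b b1 b2.
      \<epsilon> \<one>\<^sub>H \<odot>\<^sub>H (\<phi> b2 \<odot>\<^sub>H (\<sigma> x1 \<odot>\<^sub>H (\<sigma> x3 \<odot>\<^sub>H
      (\<phi> a \<odot>\<^sub>H (x2 \<cdot> \<pi> b1 \<cdot> \<one>\<^sub>H))))))"
    using m by (intro H.sw3_cong A.sw2_cong H.counit_reassoc1_sw[where g = "\<lambda>X2 X3. \<epsilon> X3 \<odot>\<^sub>H (_ X2)"] ql) simp_all
  also have "\<dots> = ?W (\<lambda>x1 x2 x3 a b b1 b2.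
      \<phi> b2 \<odot>\<^sub>H (\<sigma> x1 \<odot>\<^sub>H (\<sigma> x3 \<odot>\<^sub>H (\<phi> a \<odot>\<^sub>H (x2 \<cdot> \<pi> b1)))))"
    using m by (intro pintro) (simp_all add: H.counit_one H.smult_assoc1 H.smult_left_comm)
  also have "\<dots> = sw3 k H \<phi>i (\<lambda>x1 x2 x3. sw2 k H (\<Delta>\<^sub>A m) (\<lambda>a b.
      \<sigma> x1 \<odot>\<^sub>H (\<sigma> x3 \<odot>\<^sub>H (\<phi> a \<odot>\<^sub>H (x2 \<cdot> L b)))))"
    using m by (intro H.sw3_cong A.sw2_cong L_apply ql) simp_all
  also have "\<dots> = sw3 k H \<phi>i (\<lambda>x1 x2 x3. sw2 k H (\<Delta>\<^sub>A m) (\<lambda>a b.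
      \<sigma> x1 \<odot>\<^sub>H (\<sigma> x3 \<odot>\<^sub>H (x2 \<cdot> (v \<cdot> (\<phi> a \<odot>\<^sub>H \<kappa> b))))))"
    using m by (intro pintro) (simp_all add: L_eq psimp)
  also have "\<dots> = sw3 k H \<phi>i (\<lambda>x1 x2 x3. \<sigma> x1 \<odot>\<^sub>H (\<sigma> x3 \<odot>\<^sub>H (x2 \<cdot> (v \<cdot> M m))))"
    unfolding M_def using m
    by (intro H.sw3_cong A.lin_sw2[OF V V, symmetric] ql) simp_all
  finally show ?thesis .
qed

end

section \<open>The coproduct of the generator\<close>

context unital_algebra
begin

lemma bilin_add:
  assumes "module k V" "bilin k A V f" "bilin k A V g"
  shows "bilin k A V (\<lambda>a b. f a b \<oplus>\<^sub>V g a b)"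
  by (intro bilinI lin_add_fun[OF assms(1)] bilin_lin[OF assms(2)] bilin_lin[OF assms(3)] lin_id)

lemma sw2_zero:
  assumes V: "module k V" and t: "t \<in> carrier (tpow k A 2)"
  shows "sw2 k V t (\<lambda>a b. \<zero>\<^sub>V) = \<zero>\<^sub>V"
proof -
  interpret V: module k V by (rule V)
  have "sw2 k V t (\<lambda>a b. \<zero>\<^sub>V) = sw2 k V t (\<lambda>a b. \<zero>\<^sub>k \<odot>\<^sub>V \<zero>\<^sub>V)" by simp
  also have "\<dots> = \<zero>\<^sub>k \<odot>\<^sub>V sw2 k V t (\<lambda>a b. \<zero>\<^sub>V)"
    by (rule lin_sw2[OF V V lin_smult_right[OF V _ lin_id] t, symmetric]) simp_all
  finally show ?thesis using sw2_closed[OF V t, of "\<lambda>_ _. \<zero>\<^sub>V"] by simp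
qed

lemma sw3_zero:
  assumes V: "module k V" and t: "t \<in> carrier (tpow k A 3)"
  shows "sw3 k V t (\<lambda>a b c. \<zero>\<^sub>V) = \<zero>\<^sub>V"
proof -
  interpret V: module k V by (rule V)
  have "sw3 k V t (\<lambda>a b c. \<zero>\<^sub>V) = sw3 k V t (\<lambda>a b c. \<zero>\<^sub>k \<odot>\<^sub>V \<zero>\<^sub>V)" by simp
  also have "\<dots> = \<zero>\<^sub>k \<odot>\<^sub>V sw3 k V t (\<lambda>a b c. \<zero>\<^sub>V)"
    by (rule lin_sw3[OF V V lin_smult_right[OF V _ lin_id] t, symmetric]) simp_all
  finally show ?thesis using sw3_closed[OF V t, of "\<lambda>_ _ _. \<zero>\<^sub>V"] by simp
qed

end

context rank_two
begin

text \<open>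
  Satisfied in both of the cases distinguished below (\<open>trivial_c0\<close>, \<open>trivial_c\<close>). It reduces the
  component \<open>(\<kappa> \<otimes> \<kappa>) \<Delta>(\<theta>)\<close> to \<open>d v \<otimes> 1\<close>, by making either all terms or all characters in the
  formulas for \<open>M\<close> and \<open>N\<close> trivial.
\<close>

definition trivial_case :: bool
  where "trivial_case \<longleftrightarrow> d = \<zero> \<or> (\<forall>h\<in>carrier H. \<sigma> h = \<epsilon> h)"

lemma N_eq:
  assumes tc: "trivial_case" and m: "m \<in> carrier A"
  shows "N m = d \<odot>\<^sub>H (v \<cdot> \<kappa> m)"
  using tc unfolding trivial_case_def
proof
  assume d: "d = \<zero>"
  have "M m = sw3 k H \<Phi> (\<lambda>_ _ _. \<zero>\<^sub>H)"
    unfolding M_formula[OF m] using m by (intro H.sw3_cong) (simp_all add: d)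
  then have "M m = \<zero>\<^sub>H" by (simp add: H.sw3_zero)
  then have "N m = sw3 k H \<phi>i (\<lambda>_ _ _. \<zero>\<^sub>H)"
    unfolding N_formula[OF m] using m by (intro H.sw3_cong) simp_all
  then show ?thesis using m by (simp add: H.sw3_zero d)
next
  assume s: "\<forall>h\<in>carrier H. \<sigma> h = \<epsilon> h"
  have "M m = sw3 k H \<Phi> (\<lambda>X1 X2 X3. \<epsilon> X1 \<odot>\<^sub>H (\<epsilon> X2 \<odot>\<^sub>H (d \<odot>\<^sub>H (X3 \<cdot> \<kappa> m))))"
    unfolding M_formula[OF m] using m s by (intro H.sw3_cong) simp_all
  also have "\<dots> = \<epsilon> \<one>\<^sub>H \<odot>\<^sub>H (d \<odot>\<^sub>H (\<one>\<^sub>H \<cdot> \<kappa> m))"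
    using m by (intro H.counit_reassoc1_sw ql) simp_all
  finally have M: "M m = d \<odot>\<^sub>H \<kappa> m" using m by (simp add: H.counit_one)
  have "N m = sw3 k H \<phi>i (\<lambda>x1 x2 x3. \<epsilon> x1 \<odot>\<^sub>H (\<epsilon> x3 \<odot>\<^sub>H (x2 \<cdot> (v \<cdot> M m))))"
    unfolding N_formula[OF m] using m s by (intro H.sw3_cong) simp_all
  also have "\<dots> = \<epsilon> \<one>\<^sub>H \<odot>\<^sub>H (\<one>\<^sub>H \<cdot> (v \<cdot> M m))"
    using m by (intro H.counit_reassoc_inv1_sw[where g = "\<lambda>x2 x3. \<epsilon> x3 \<odot>\<^sub>H (x2 \<cdot> (v \<cdot> M m))"] ql) (simp_all add: M_cl)
  finally show ?thesis using m by (simp add: M H.counit_one H.smult_mult_right)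
qed

context
  fixes V :: "('k, 'v, 'w) module_scheme"
  assumes V: "module k V"
begin

interpretation V: module k V by (rule V)

lemma N_apply:
  assumes "g \<in> lin k H V" "m \<in> carrier A"
  shows "sw2 k V (\<Delta>\<^sub>A m) (\<lambda>a b. \<phi> b \<odot>\<^sub>V g (\<kappa> a)) = g (N m)"
  unfolding N_def using assms
  by (simp add: A.lin_sw2[OF H.module_axioms V assms(1)] lin_smult[OF assms(1)] cong: A.sw2_cong)

lemma \<theta>_both:
  assumes tc: "trivial_case" and f: "bilin k H V f"
  shows "sw2 k V (\<Delta>\<^sub>A \<theta>) (\<lambda>a b. f (\<kappa> a) (\<kappa> b)) = f (d \<odot>\<^sub>H v) \<one>\<^sub>H"
proof -
  let ?W = "\<lambda>f. sw3 k V \<Phi> (\<lambda>X1 X2 X3. sw2 k V (\<Delta>\<^sub>A \<theta>) (\<lambda>a b. sw2 k V (\<Delta>\<^sub>A a) (\<lambda>a1 a2. f X1 X2 X3 a b a1 a2)))"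
  note fl = bilin_lin[OF f] and fc = bilin_closed[OF f]
  let ?f = "\<lambda>x a y b. f (x \<cdot> (d \<odot>\<^sub>H (v \<cdot> \<kappa> a))) (y \<cdot> \<pi> b)"
  have "sw2 k V (\<Delta>\<^sub>A \<theta>) (\<lambda>a b. f (\<kappa> a) (\<kappa> b))
    = sw2 k V (\<Delta>\<^sub>A \<theta>) (\<lambda>a b. sw2 k V (\<Delta>\<^sub>A b) (\<lambda>b1 b2. \<phi> b1 \<odot>\<^sub>V f (\<kappa> a) (\<pi> b2)))"
    by (intro A.sw2_cong kap_apply[symmetric] ql fl V) simp_all
  also have "\<dots> = ?W (\<lambda>X1 X2 X3 a b a1 a2.
      sw3 k V \<phi>i (\<lambda>x1 x2 x3. \<phi> (i X2 \<star> a2 \<star> i x2) \<odot>\<^sub>V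
      f (\<kappa> (i X1 \<star> a1 \<star> i x1)) (\<pi> (i X3 \<star> b \<star> i x3))))"
    by (intro coassoc ql fl V) (simp_all add: fc)
  also have "\<dots> = ?W (\<lambda>X1 X2 X3 a b a1 a2.
      sw3 k V \<phi>i (\<lambda>x1 x2 x3. \<epsilon> x2 \<odot>\<^sub>V (\<phi> a2 \<odot>\<^sub>V (\<sigma> X2 \<odot>\<^sub>V
      f (\<kappa> (i X1 \<star> a1) \<cdot> x1) (X3 \<cdot> \<pi> b \<cdot> x3)))))"
    by (intro pintro) (simp_all add: \<phi>_sandwich \<kappa>_mi p.mult proj V.smult_assoc1 V.smult_left_comm fc)
  also have "\<dots> = ?W (\<lambda>X1 X2 X3 a b a1 a2.
      \<phi> a2 \<odot>\<^sub>V (\<sigma> X2 \<odot>\<^sub>V f (\<kappa> (i X1 \<star> a1) \<cdot> \<one>\<^sub>H) (X3 \<cdot> \<pi> b \<cdot> \<one>\<^sub>H)))"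
    by (intro H.sw3_cong A.sw2_cong H.counit_reassoc_inv2_sw ql fl V) (simp_all add: fc)
  also have "\<dots> = ?W (\<lambda>X1 X2 X3 a b a1 a2.
      \<phi> a2 \<odot>\<^sub>V (\<sigma> X2 \<odot>\<^sub>V sw2 k V (\<Delta> X1) (\<lambda>h1 h2. \<sigma> h1 \<odot>\<^sub>V f (h2 \<cdot> \<kappa> a1) (X3 \<cdot> \<pi> b))))"
  proof -
    have "f (\<kappa> (i X1 \<star> a1)) y = sw2 k V (\<Delta> X1) (\<lambda>h1 h2. \<sigma> h1 \<odot>\<^sub>V f (h2 \<cdot> \<kappa> a1) y)"
      if c: "X1 \<in> carrier H" "a1 \<in> carrier A" "y \<in> carrier H" for X1 a1 y
    proof -
      have l: "(\<lambda>x. f x y) \<in> lin k H V" using c by (intro fl lin_id)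
      show ?thesis using c
        by (simp add: \<kappa>_i_mult H.lin_sw2[OF H.module_axioms V l] lin_smult[OF l] cong: H.sw2_cong)
    qed
    then show ?thesis by (intro H.sw3_cong A.sw2_cong) simp_all
  qed
  also have "\<dots> = sw3 k V \<Phi> (\<lambda>X1 X2 X3. sw2 k V (\<Delta>\<^sub>A \<theta>) (\<lambda>a b.
      \<sigma> X2 \<odot>\<^sub>V sw2 k V (\<Delta> X1) (\<lambda>h1 h2. \<sigma> h1 \<odot>\<^sub>V f (h2 \<cdot> N a) (X3 \<cdot> \<pi> b))))"
    by (intro H.sw3_cong A.sw2_cong N_apply ql fl V) (simp_all add: fc)
  also have "\<dots> = sw3 k V \<Phi> (\<lambda>X1 X2 X3. sw2 k V (\<Delta>\<^sub>A \<theta>) (\<lambda>a b.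
      \<sigma> X2 \<odot>\<^sub>V sw2 k V (\<Delta> X1) (\<lambda>h1 h2. \<sigma> h1 \<odot>\<^sub>V ?f h2 a X3 b)))"
    by (intro H.sw3_cong A.sw2_cong) (simp_all add: N_eq[OF tc])
  also have "\<dots> = f (d \<odot>\<^sub>H v) \<one>\<^sub>H"
    using tc unfolding trivial_case_def
  proof
    assume d: "d = \<zero>"
    have f0: "f \<zero>\<^sub>H y = \<zero>\<^sub>V" if "y \<in> carrier H" for y
      using that by (intro lin_zero[OF H.module_axioms V, of "\<lambda>x. f x y"] fl lin_id)
    have "sw2 k V (\<Delta> X1) (\<lambda>h1 h2. \<sigma> h1 \<odot>\<^sub>V ?f h2 a X3 b) = \<zero>\<^sub>V"
      if "X1 \<in> carrier H" "X3 \<in> carrier H" "a \<in> carrier A" "b \<in> carrier A" for X1 X3 a b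
    proof -
      have "sw2 k V (\<Delta> X1) (\<lambda>h1 h2. \<sigma> h1 \<odot>\<^sub>V ?f h2 a X3 b)
      = sw2 k V (\<Delta> X1) (\<lambda>_ _. \<zero>\<^sub>V)"
        using that by (intro H.sw2_cong) (simp_all add: d f0)
      then show ?thesis using that by (simp add: H.sw2_zero[OF V])
    qed
    then have "sw3 k V \<Phi> (\<lambda>X1 X2 X3. sw2 k V (\<Delta>\<^sub>A \<theta>) (\<lambda>a b.
      \<sigma> X2 \<odot>\<^sub>V sw2 k V (\<Delta> X1) (\<lambda>h1 h2. \<sigma> h1 \<odot>\<^sub>V ?f h2 a X3 b)))
      = sw3 k V \<Phi> (\<lambda>_ _ _. sw2 k V (\<Delta>\<^sub>A \<theta>) (\<lambda>_ _. \<zero>\<^sub>V))"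
      by (intro H.sw3_cong A.sw2_cong) simp_all
    then show ?thesis by (simp add: A.sw2_zero[OF V] H.sw3_zero[OF V] f0 d)
  next
    assume s: "\<forall>h\<in>carrier H. \<sigma> h = \<epsilon> h"
    have "sw3 k V \<Phi> (\<lambda>X1 X2 X3. sw2 k V (\<Delta>\<^sub>A \<theta>) (\<lambda>a b.
      \<sigma> X2 \<odot>\<^sub>V sw2 k V (\<Delta> X1) (\<lambda>h1 h2. \<sigma> h1 \<odot>\<^sub>V ?f h2 a X3 b)))
      = sw3 k V \<Phi> (\<lambda>X1 X2 X3. sw2 k V (\<Delta>\<^sub>A \<theta>) (\<lambda>a b.
      \<epsilon> X2 \<odot>\<^sub>V ?f X1 a X3 b))"
    proof -
      have "sw2 k V (\<Delta> X1) (\<lambda>h1 h2. \<sigma> h1 \<odot>\<^sub>V ?f h2 a X3 b)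
      = ?f X1 a X3 b"
      if "X1 \<in> carrier H" "X3 \<in> carrier H" "a \<in> carrier A" "b \<in> carrier A" for X1 X3 a b
      proof -
      have "sw2 k V (\<Delta> X1) (\<lambda>h1 h2. \<sigma> h1 \<odot>\<^sub>V ?f h2 a X3 b)
      = sw2 k V (\<Delta> X1) (\<lambda>h1 h2. \<epsilon> h1 \<odot>\<^sub>V ?f h2 a X3 b)"
       using that s by (intro H.sw2_cong) simp_all
      also have "\<dots> = ?f X1 a X3 b"
       using that by (intro H.counit_left_sw ql fl V) simp_all
      finally show ?thesis .
      qed
      then show ?thesis using s by (intro H.sw3_cong A.sw2_cong) simp_all
    qed
    also have "\<dots> = sw2 k V (\<Delta>\<^sub>A \<theta>) (\<lambda>a b. sw3 k V \<Phi> (\<lambda>X1 X2 X3.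
      \<epsilon> X2 \<odot>\<^sub>V ?f X1 a X3 b))"
      by (intro A.sw2_sw3_swap[OF H.unital_algebra_axioms V, symmetric]) (simp_all add: fc)
    also have "\<dots> = sw2 k V (\<Delta>\<^sub>A \<theta>) (\<lambda>a b. f (\<one>\<^sub>H \<cdot> (d \<odot>\<^sub>H (v \<cdot> \<kappa> a))) (\<one>\<^sub>H \<cdot> \<pi> b))"
      by (intro A.sw2_cong H.counit_reassoc2_sw ql fl V) simp_all
    also have "\<dots> = sw3 k V \<phi>i (\<lambda>x1 x2 x3. \<sigma> x1 \<odot>\<^sub>V f (\<one>\<^sub>H \<cdot> (d \<odot>\<^sub>H (v \<cdot> x2))) (\<one>\<^sub>H \<cdot> x3))"
      by (intro \<theta>_left ql fl V) simp_all
    also have "\<dots> = sw3 k V \<phi>i (\<lambda>x1 x2 x3. \<epsilon> x1 \<odot>\<^sub>V f (d \<odot>\<^sub>H (v \<cdot> x2)) x3)"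
      using s by (intro H.sw3_cong) simp_all
    also have "\<dots> = f (d \<odot>\<^sub>H (v \<cdot> \<one>\<^sub>H)) \<one>\<^sub>H"
      by (intro H.counit_reassoc_inv1_sw ql fl V) simp_all
    finally show ?thesis by simp
  qed
  finally show ?thesis .
qed

text \<open>
  The decomposition \<open>m = \<pi>(m) + \<theta> \<kappa>(m)\<close> is applied to both legs. The component \<open>(\<pi> \<otimes> \<pi>) \<Delta>(\<theta>)\<close>
  vanishes, as \<open>\<pi>(\<theta>) = 0\<close>.
\<close>

lemma comult_\<theta>:
  assumes tc: "trivial_case" and g: "bilin k A V g"
  shows "sw2 k V (\<Delta>\<^sub>A \<theta>) g = sw3 k V \<Phi> (\<lambda>X1 X2 X3. sw3 k V \<phi>i (\<lambda>x1 x2 x3.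
      \<sigma> (X2 \<cdot> x1) \<odot>\<^sub>V g (i (X1 \<cdot> v \<cdot> x2)) (\<theta> \<star> i (X3 \<cdot> x3))))
    \<oplus>\<^sub>V sw3 k V \<phi>i (\<lambda>x1 x2 x3. \<sigma> x1 \<odot>\<^sub>V g (\<theta> \<star> i x2) (i x3))
    \<oplus>\<^sub>V d \<odot>\<^sub>V g (\<theta> \<star> i v) \<theta>"
proof -
  note gl = bilin_lin[OF g] and gc = bilin_closed[OF g]
  have gadd: "g (x \<oplus>\<^sub>A y) z = g x z \<oplus>\<^sub>V g y z" "g z (x \<oplus>\<^sub>A y) = g z x \<oplus>\<^sub>V g z y"
    if "x \<in> carrier A" "y \<in> carrier A" "z \<in> carrier A" for x y z
    using lin_add[OF gl(1)[OF lin_id that(3)] that(1,2)] lin_add[OF gl(2)[OF lin_id that(3)] that(1,2)] by simp_all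
  have "sw2 k V (\<Delta>\<^sub>A \<theta>) g = sw2 k V (\<Delta>\<^sub>A \<theta>) (\<lambda>a b.
      ((g (i (\<pi> a)) (\<theta> \<star> i (\<kappa> b)) \<oplus>\<^sub>V g (\<theta> \<star> i (\<kappa> a)) (i (\<pi> b)))
      \<oplus>\<^sub>V g (\<theta> \<star> i (\<kappa> a)) (\<theta> \<star> i (\<kappa> b))) \<oplus>\<^sub>V g (i (\<pi> a)) (i (\<pi> b)))"
  proof (intro A.sw2_cong)
    fix a b assume ab: "a \<in> carrier A" "b \<in> carrier A"
    have "g a b = g (i (\<pi> a) \<oplus>\<^sub>A \<theta> \<star> i (\<kappa> a)) (i (\<pi> b) \<oplus>\<^sub>A \<theta> \<star> i (\<kappa> b))"
      by (rule arg_cong2[OF decomp[OF ab(1)] decomp[OF ab(2)]])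
    then show "g a b = ((g (i (\<pi> a)) (\<theta> \<star> i (\<kappa> b)) \<oplus>\<^sub>V g (\<theta> \<star> i (\<kappa> a)) (i (\<pi> b)))
      \<oplus>\<^sub>V g (\<theta> \<star> i (\<kappa> a)) (\<theta> \<star> i (\<kappa> b))) \<oplus>\<^sub>V g (i (\<pi> a)) (i (\<pi> b))"
      using ab by (simp add: gadd gc V.a_ac)
  qed simp
  also have "\<dots> = ((sw2 k V (\<Delta>\<^sub>A \<theta>) (\<lambda>a b. g (i (\<pi> a)) (\<theta> \<star> i (\<kappa> b)))
      \<oplus>\<^sub>V sw2 k V (\<Delta>\<^sub>A \<theta>) (\<lambda>a b. g (\<theta> \<star> i (\<kappa> a)) (i (\<pi> b))))
      \<oplus>\<^sub>V sw2 k V (\<Delta>\<^sub>A \<theta>) (\<lambda>a b. g (\<theta> \<star> i (\<kappa> a)) (\<theta> \<star> i (\<kappa> b))))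
      \<oplus>\<^sub>V sw2 k V (\<Delta>\<^sub>A \<theta>) (\<lambda>a b. g (i (\<pi> a)) (i (\<pi> b)))"
  proof -
    have b: "bilin k A V (\<lambda>a b. g (i (\<pi> a)) (\<theta> \<star> i (\<kappa> b)))"
      "bilin k A V (\<lambda>a b. g (\<theta> \<star> i (\<kappa> a)) (i (\<pi> b)))"
      "bilin k A V (\<lambda>a b. g (\<theta> \<star> i (\<kappa> a)) (\<theta> \<star> i (\<kappa> b)))"
      "bilin k A V (\<lambda>a b. g (i (\<pi> a)) (i (\<pi> b)))"
      by (intro ql gl; simp)+
    note t = A.comult_closed[OF \<theta>_closed]
    show ?thesis
      unfolding A.sw2_add[OF V A.bilin_add[OF V A.bilin_add[OF V b(1,2)] b(3)] b(4) t]
      A.sw2_add[OF V A.bilin_add[OF V b(1,2)] b(3) t] A.sw2_add[OF V b(1,2) t] ..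
  qed
  also have "sw2 k V (\<Delta>\<^sub>A \<theta>) (\<lambda>a b. g (i (\<pi> a)) (\<theta> \<star> i (\<kappa> b)))
    = sw3 k V \<Phi> (\<lambda>X1 X2 X3. sw3 k V \<phi>i (\<lambda>x1 x2 x3.
      \<sigma> (X2 \<cdot> x1) \<odot>\<^sub>V g (i (X1 \<cdot> v \<cdot> x2)) (\<theta> \<star> i (X3 \<cdot> x3))))"
    by (rule \<theta>_right[OF V, where f = "\<lambda>p q. g (i p) (\<theta> \<star> i q)"]) (intro ql gl; simp)
  also have "sw2 k V (\<Delta>\<^sub>A \<theta>) (\<lambda>a b. g (\<theta> \<star> i (\<kappa> a)) (i (\<pi> b)))
    = sw3 k V \<phi>i (\<lambda>x1 x2 x3. \<sigma> x1 \<odot>\<^sub>V g (\<theta> \<star> i x2) (i x3))"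
    by (rule \<theta>_left[OF V, where f = "\<lambda>p q. g (\<theta> \<star> i p) (i q)"]) (intro ql gl; simp)
  also have "sw2 k V (\<Delta>\<^sub>A \<theta>) (\<lambda>a b. g (\<theta> \<star> i (\<kappa> a)) (\<theta> \<star> i (\<kappa> b)))
    = g (\<theta> \<star> i (d \<odot>\<^sub>H v)) (\<theta> \<star> i \<one>\<^sub>H)"
    by (rule \<theta>_both[OF tc, where f = "\<lambda>p q. g (\<theta> \<star> i p) (\<theta> \<star> i q)"]) (intro ql gl; simp)
  also have "\<dots> = d \<odot>\<^sub>V g (\<theta> \<star> i v) \<theta>"
    using lin_smult[OF gl(1)[OF lin_id \<theta>_closed], of d "\<theta> \<star> i v"]
    by (simp add: i.smult i.one A.smult_mult_right)
  also have "sw2 k V (\<Delta>\<^sub>A \<theta>) (\<lambda>a b. g (i (\<pi> a)) (i (\<pi> b))) = \<zero>\<^sub>V"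
  proof -
    have b: "bilin k H V (\<lambda>a b. g (i a) (i b))" by (intro ql gl) simp_all
    have "sw2 k V (\<Delta>\<^sub>A \<theta>) (\<lambda>a b. g (i (\<pi> a)) (i (\<pi> b))) = sw2 k V (\<Delta> (\<pi> \<theta>)) (\<lambda>a b. g (i a) (i b))"
      by (rule p.comult_sw[OF V b \<theta>_closed, symmetric])
    also have "\<dots> = \<zero>\<^sub>V"
      using lin_zero[OF H.module_axioms V H.sw2_arg_lin[OF V b H.comult_lin]] by (simp add: \<pi>_\<theta>)
    finally show ?thesis .
  qed
  finally show ?thesis by (simp add: H.sw3_closed V gc)
qed

end

end

lemmas (in field) k_minus_equality = minus_equality

section \<open>The quadratic relation and the two cases\<close>

context quasi_hopf_algebra
begin

lemma bilin_scalars: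
  assumes "f \<in> lin k H (scalars k)" "g \<in> lin k H (scalars k)"
  shows "bilin k H (scalars k) (\<lambda>a b. f a \<otimes> g b)"
  using lin_closed[OF assms(1)] lin_closed[OF assms(2)]
  by (intro bilinI lin_scalar_mult[OF field_axioms] lin_comp[OF assms(1)] lin_comp[OF assms(2)]) (simp_all add: lin_id)

lemma conv_counit:
  assumes "f \<in> lin k H (scalars k)" "m \<in> carrier H"
  shows "conv k H \<epsilon> f m = f m" "conv k H f \<epsilon> m = f m"
proof -
  show "conv k H \<epsilon> f m = f m"
    using counit_left_sw[OF scalars_module assms] by (simp add: conv_def)
  have "conv k H f \<epsilon> m = sw2 k (scalars k) (\<Delta> m) (\<lambda>a b. \<epsilon> b \<odot>\<^bsub>scalars k\<^esub> f a)"
    unfolding conv_def using assms lin_closed[OF assms(1)]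
    by (intro sw2_cong) (simp_all add: k_m_ac qb_closed)
  then show "conv k H f \<epsilon> m = f m" using counit_right_sw[OF scalars_module assms] by simp
qed

lemma conv_lincomb:
  assumes l: "f \<in> lin k H (scalars k)" "f' \<in> lin k H (scalars k)" "g \<in> lin k H (scalars k)"
    and s: "r \<in> carrier k" "s \<in> carrier k" and m: "m \<in> carrier H"
  shows "conv k H (\<lambda>x. r \<otimes> f x \<oplus> s \<otimes> f' x) g m = r \<otimes> conv k H f g m \<oplus> s \<otimes> conv k H f' g m"
    "conv k H g (\<lambda>x. r \<otimes> f x \<oplus> s \<otimes> f' x) m = r \<otimes> conv k H g f m \<oplus> s \<otimes> conv k H g f' m"
proof -
  let ?K = "scalars k"
  note c = l[THEN lin_closed, simplified] qb_closed
  note sm = lin_scalar_mult[OF field_axioms]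
  note K = scalars_module and t = comult_closed[OF m]
  have p: "sw2 k ?K (\<Delta> m) (\<lambda>a b. q \<otimes> h a b) = q \<otimes> sw2 k ?K (\<Delta> m) h"
    if "q \<in> carrier k" "\<And>a b. \<lbrakk>a \<in> carrier H; b \<in> carrier H\<rbrakk> \<Longrightarrow> h a b \<in> carrier k" for q h
    using lin_sw2[OF K K sm(2)[OF lin_id that(1)] t, of h] that(2) by simp
  have b: "bilin k H ?K (\<lambda>a b. q \<otimes> (h a \<otimes> h' b))"
    if "q \<in> carrier k" "h \<in> lin k H ?K" "h' \<in> lin k H ?K" for q h h'
    by (intro bilinI sm that(1) bilin_lin[OF bilin_scalars[OF that(2,3)]] lin_id)
  show "conv k H (\<lambda>x. r \<otimes> f x \<oplus> s \<otimes> f' x) g m = r \<otimes> conv k H f g m \<oplus> s \<otimes> conv k H f' g m"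
    using sw2_add[OF K b[OF s(1) l(1,3)] b[OF s(2) l(2,3)] t] s m
    by (simp add: conv_def c p k_l_distr k_r_distr k_m_ac cong: sw2_cong)
  show "conv k H g (\<lambda>x. r \<otimes> f x \<oplus> s \<otimes> f' x) m = r \<otimes> conv k H g f m \<oplus> s \<otimes> conv k H g f' m"
    using sw2_add[OF K b[OF s(1) l(3,1)] b[OF s(2) l(3,2)] t] s m
    by (simp add: conv_def c p k_l_distr k_r_distr k_m_ac cong: sw2_cong)
qed

end

context rank_two
begin

lemma bilin_zero:
  assumes V: "module k V" and f: "bilin k H V f"
  shows "sw2 k V (\<Delta>\<^sub>A \<theta>) (\<lambda>a b. f (\<pi> a) (\<pi> b)) = \<zero>\<^sub>V"
  using p.comult_sw[OF V f \<theta>_closed] lin_zero[OF H.module_axioms V H.sw2_arg_lin[OF V f H.comult_lin]]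
  by (simp add: \<pi>_\<theta>)

text \<open>
  Since \<open>\<pi>(\<theta> \<theta>) = 0\<close>, only \<open>\<kappa>(\<theta> \<theta>)\<close> matters. The rule for \<open>\<phi>\<close> of a product reduces it to
  \<open>\<chi>(\<theta>\<^sub>1) \<pi>(\<theta>\<^sub>2)\<close>. The assumption holds in both cases below: it is
  \<open>\<chi>_decomp\<close> with \<open>c \<phi>(m)\<close> in place of \<open>c \<sigma>(\<kappa>(m))\<close>.
\<close>

lemma \<theta>_square:
  assumes "\<And>m. m \<in> carrier A \<Longrightarrow> \<chi> m = \<sigma> (\<pi> m) \<oplus> c \<otimes> \<phi> m"
  shows "\<theta> \<star> \<theta> = c \<odot>\<^sub>A \<theta>"
proof -
  note M = H.module_axioms
  note t = A.comult_closed[OF \<theta>_closed]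
  have "\<kappa> (\<theta> \<star> \<theta>) = sw2 k H (\<Delta>\<^sub>A \<theta>) (\<lambda>a1 a2. sw2 k H (\<Delta>\<^sub>A \<theta>) (\<lambda>b1 b2.
      \<phi> (a1 \<star> b1) \<odot>\<^sub>H \<pi> (a2 \<star> b2)))"
    unfolding kap_def by (intro A.comult_mult_sw ql) simp_all
  also have "\<dots> = sw2 k H (\<Delta>\<^sub>A \<theta>) (\<lambda>a1 a2. \<phi> a1 \<odot>\<^sub>H (\<pi> a2 \<cdot> \<pi> \<theta>) \<oplus>\<^sub>H \<chi> a1 \<odot>\<^sub>H (\<pi> a2 \<cdot> \<kappa> \<theta>))"
  proof (intro A.sw2_cong)
    fix a1 a2 assume a: "a1 \<in> carrier A" "a2 \<in> carrier A"
    have "sw2 k H (\<Delta>\<^sub>A \<theta>) (\<lambda>b1 b2. \<phi> (a1 \<star> b1) \<odot>\<^sub>H \<pi> (a2 \<star> b2))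
      = sw2 k H (\<Delta>\<^sub>A \<theta>) (\<lambda>b1 b2. \<epsilon>\<^sub>A b1 \<odot>\<^sub>H (\<phi> a1 \<odot>\<^sub>H (\<pi> a2 \<cdot> \<pi> b2)) \<oplus>\<^sub>H \<phi> b1 \<odot>\<^sub>H (\<chi> a1 \<odot>\<^sub>H (\<pi> a2 \<cdot> \<pi> b2)))"
      using a by (intro A.sw2_cong)
      (simp_all add: \<phi>_mult p.mult H.smult_l_distr H.smult_assoc1 H.smult_left_comm)
    also have "\<dots> = sw2 k H (\<Delta>\<^sub>A \<theta>) (\<lambda>b1 b2. \<epsilon>\<^sub>A b1 \<odot>\<^sub>H (\<phi> a1 \<odot>\<^sub>H (\<pi> a2 \<cdot> \<pi> b2)))
      \<oplus>\<^sub>H sw2 k H (\<Delta>\<^sub>A \<theta>) (\<lambda>b1 b2. \<phi> b1 \<odot>\<^sub>H (\<chi> a1 \<odot>\<^sub>H (\<pi> a2 \<cdot> \<pi> b2)))"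
      using a by (intro A.sw2_add[OF M _ _ t] ql) simp_all
    also have "\<dots> = \<phi> a1 \<odot>\<^sub>H (\<pi> a2 \<cdot> \<pi> \<theta>) \<oplus>\<^sub>H \<chi> a1 \<odot>\<^sub>H (\<pi> a2 \<cdot> \<kappa> \<theta>)"
      using a by (intro arg_cong2[where f = "add H"] A.counit_left_sw kap_apply ql) simp_all
    finally show "sw2 k H (\<Delta>\<^sub>A \<theta>) (\<lambda>b1 b2. \<phi> (a1 \<star> b1) \<odot>\<^sub>H \<pi> (a2 \<star> b2))
      = \<phi> a1 \<odot>\<^sub>H (\<pi> a2 \<cdot> \<pi> \<theta>) \<oplus>\<^sub>H \<chi> a1 \<odot>\<^sub>H (\<pi> a2 \<cdot> \<kappa> \<theta>)" .
  qed simp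
  also have "\<dots> = sw2 k H (\<Delta>\<^sub>A \<theta>) (\<lambda>a1 a2. \<sigma> (\<pi> a1) \<odot>\<^sub>H \<pi> a2 \<oplus>\<^sub>H \<phi> a1 \<odot>\<^sub>H (c \<odot>\<^sub>H \<pi> a2))"
    by (intro A.sw2_cong) (simp_all add: \<pi>_\<theta> kap_\<theta> assms H.smult_l_distr H.smult_assoc1 H.smult_left_comm)
  also have "\<dots> = sw2 k H (\<Delta>\<^sub>A \<theta>) (\<lambda>a1 a2. \<sigma> (\<pi> a1) \<odot>\<^sub>H \<pi> a2)
      \<oplus>\<^sub>H sw2 k H (\<Delta>\<^sub>A \<theta>) (\<lambda>a1 a2. \<phi> a1 \<odot>\<^sub>H (c \<odot>\<^sub>H \<pi> a2))"
    by (intro A.sw2_add[OF M _ _ t] ql) simp_all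
  also have "sw2 k H (\<Delta>\<^sub>A \<theta>) (\<lambda>a1 a2. \<sigma> (\<pi> a1) \<odot>\<^sub>H \<pi> a2) = \<zero>\<^sub>H"
    by (rule bilin_zero[OF M, where f = "\<lambda>a b. \<sigma> a \<odot>\<^sub>H b"]) (intro ql; simp)
  also have "sw2 k H (\<Delta>\<^sub>A \<theta>) (\<lambda>a1 a2. \<phi> a1 \<odot>\<^sub>H (c \<odot>\<^sub>H \<pi> a2)) = c \<odot>\<^sub>H \<kappa> \<theta>"
    by (intro kap_apply ql) simp_all
  finally have "\<kappa> (\<theta> \<star> \<theta>) = c \<odot>\<^sub>H \<one>\<^sub>H" by (simp add: kap_\<theta>)
  then show ?thesis using decomp[of "\<theta> \<star> \<theta>"] lin_zero[OF H.module_axioms A.module_axioms i.linear]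
    by (simp add: p.mult \<pi>_\<theta> i.smult i.one A.smult_mult_right)
qed

text \<open>
  Both sides are the value of \<open>\<phi> * \<phi>\<close> at \<open>\<theta> \<theta>\<close>: the right side by \<open>\<phi> * \<phi> = d \<phi>\<close>, the left side by
  multiplicativity of the coproduct and the rule for \<open>\<phi>\<close> of a product.
\<close>

lemma quadratic_relation:
  "conv k A \<phi> \<chi> \<theta> \<oplus> conv k A \<chi> \<phi> \<theta> \<oplus> d \<otimes> conv k A \<chi> \<chi> \<theta> = d \<otimes> c"
proof -
  let ?K = "scalars k"
  note K = H.scalars_module
  note sm = lin_scalar_mult[OF H.field_axioms]
  note t = A.comult_closed[OF \<theta>_closed]
  note ls = \<phi>_linear \<chi>_lin A.counit_lin
  note b = A.bilin_scalars[OF \<phi>_linear \<chi>_lin] A.bilin_scalars[OF \<chi>_lin \<phi>_linear] A.bilin_scalars[OF \<chi>_lin \<chi>_lin]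
  have cl: "(\<lambda>x. r \<otimes> \<epsilon>\<^sub>A x \<oplus> s \<otimes> \<phi> x) \<in> lin k A ?K" if "r \<in> carrier k" "s \<in> carrier k" for r s
    using lin_add_fun[OF K sm(2)[OF A.counit_lin that(1)] sm(2)[OF \<phi>_linear that(2)]] by simp
  have "d \<otimes> c = conv k A \<phi> \<phi> (\<theta> \<star> \<theta>)" by (simp add: conv_\<phi>_\<phi> c_def \<chi>_def)
  also have "\<dots> = sw2 k ?K (\<Delta>\<^sub>A \<theta>) (\<lambda>a1 a2. sw2 k ?K (\<Delta>\<^sub>A \<theta>) (\<lambda>b1 b2.
      \<phi> (a1 \<star> b1) \<otimes> \<phi> (a2 \<star> b2)))"
    unfolding conv_def by (intro A.comult_mult_sw ql sm) simp_all
  also have "\<dots> = sw2 k ?K (\<Delta>\<^sub>A \<theta>) (\<lambda>a1 a2. conv k A (\<lambda>b. \<phi> a1 \<otimes> \<epsilon>\<^sub>A b \<oplus> \<chi> a1 \<otimes> \<phi> b)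
      (\<lambda>b. \<phi> a2 \<otimes> \<epsilon>\<^sub>A b \<oplus> \<chi> a2 \<otimes> \<phi> b) \<theta>)"
    unfolding conv_def by (intro A.sw2_cong) (simp_all add: \<phi>_mult)
  also have "\<dots> = sw2 k ?K (\<Delta>\<^sub>A \<theta>) (\<lambda>a1 a2. (\<phi> a1 \<otimes> \<chi> a2 \<oplus>\<^sub>?K \<chi> a1 \<otimes> \<phi> a2) \<oplus>\<^sub>?K d \<otimes> (\<chi> a1 \<otimes> \<chi> a2))"
    by (intro A.sw2_cong) (simp_all add: A.conv_lincomb A.conv_counit cl ls \<phi>_\<theta> counit_\<theta>
      H.k_r_distr H.k_m_ac H.k_a_ac flip: d_def)
  also have "\<dots> = sw2 k ?K (\<Delta>\<^sub>A \<theta>) (\<lambda>a1 a2. \<phi> a1 \<otimes> \<chi> a2 \<oplus>\<^sub>?K \<chi> a1 \<otimes> \<phi> a2)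
      \<oplus>\<^sub>?K sw2 k ?K (\<Delta>\<^sub>A \<theta>) (\<lambda>a1 a2. d \<otimes> (\<chi> a1 \<otimes> \<chi> a2))"
    by (intro A.sw2_add[OF K _ _ t] A.bilin_add[OF K] b bilinI sm bilin_lin[OF b(3)] lin_id d_cl)
  also have "\<dots> = (conv k A \<phi> \<chi> \<theta> \<oplus>\<^sub>?K conv k A \<chi> \<phi> \<theta>) \<oplus>\<^sub>?K d \<otimes> conv k A \<chi> \<chi> \<theta>"
    unfolding conv_def A.sw2_add[OF K b(1,2) t]
    using A.lin_sw2[OF K K sm(2)[OF lin_id d_cl] t, of "\<lambda>a1 a2. \<chi> a1 \<otimes> \<chi> a2"] by simp
  finally show ?thesis by simp
qed

subsection \<open>The nilpotent case\<close>

context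
  assumes c0: "c = \<zero>" and char: "\<one> \<oplus> \<one> \<noteq> \<zero>"
begin

lemma \<chi>_c0: "m \<in> carrier A \<Longrightarrow> \<chi> m = \<sigma> (\<pi> m)"
  using \<chi>_decomp[of m] by (simp add: c0)

text \<open>
  Here \<open>\<chi> = \<sigma> \<pi>\<close>, so the three convolutions in the quadratic relation become \<open>\<sigma>(\<kappa>(\<theta>)) = 1\<close>,
  \<open>\<sigma>(v)\<close> and \<open>0\<close>.
\<close>

lemma \<sigma>_v: "\<sigma> v = \<ominus> \<one>"
proof -
  note K = H.scalars_module
  have "conv k A \<phi> \<chi> \<theta> = \<sigma> (\<kappa> \<theta>)"
    using kap_apply[OF K \<sigma>_lin \<theta>_closed] by (simp add: conv_def \<chi>_c0 cong: A.sw2_cong)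
  moreover have "conv k A \<chi> \<phi> \<theta> = \<sigma> v"
    using L_apply[OF K \<sigma>_lin \<theta>_closed] by (simp add: v_def conv_def \<chi>_c0 H.k_m_ac cong: A.sw2_cong)
  moreover have "conv k A \<chi> \<chi> \<theta> = \<zero>"
    using bilin_zero[OF K H.bilin_scalars[OF \<sigma>_lin \<sigma>_lin]] by (simp add: conv_def \<chi>_c0 cong: A.sw2_cong)
  ultimately have "\<one> \<oplus> \<sigma> v = \<zero>"
    using quadratic_relation by (simp add: kap_\<theta> \<sigma>_one c0)
  then show ?thesis using H.k_minus_equality[of "\<sigma> v" "\<one>"] by (simp add: H.k_a_ac)
qed

text \<open>
  Otherwise \<open>\<sigma>\<close> would be the counit, with value \<open>1\<close> at \<open>v\<close>.
\<close>

lemma d_zero: "d = \<zero>"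
proof (rule ccontr)
  assume "d \<noteq> \<zero>"
  then have "\<sigma> v = \<one>" by (simp add: \<sigma>_counit counit_v)
  then show False using \<sigma>_v char H.k_r_neg[of "\<one>"] by simp
qed

lemma trivial_c0: trivial_case
  by (simp add: trivial_case_def d_zero)

lemma \<theta>_nilpotent: "\<theta> \<star> \<theta> = \<zero>\<^sub>A"
  using \<theta>_square by (simp add: \<chi>_c0 c0)

end

end

lemmas (in field) k_integral_iff = integral_iff
lemmas (in field) k_add_right_cancel = add.right_cancel

lemma (in unital_algebra) smult_cancel:
  assumes r: "r \<in> carrier k" "r \<noteq> \<zero>\<^sub>k" and x: "x \<in> carrier A" "y \<in> carrier A"
    and e: "r \<odot>\<^sub>A x = r \<odot>\<^sub>A y"
  shows "x = y"
proof -
  have u: "r \<in> Units k" using r field_Units by simp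
  have "inv\<^bsub>k\<^esub> r \<odot>\<^sub>A (r \<odot>\<^sub>A z) = z" if "z \<in> carrier A" for z
    using u that r(1) smult_assoc1[of "inv\<^bsub>k\<^esub> r" r z] by simp
  then show ?thesis using x e by metis
qed

context rank_two
begin

subsection \<open>The case of a group-like generator\<close>

text \<open>
  The map \<open>a \<mapsto> \<pi>(a\<^sub>1) \<chi>(a\<^sub>2)\<close> is multiplicative, like \<open>\<pi>\<close>, \<open>\<chi>\<close> and the coproduct. It transfers the
  equation for \<open>\<theta> \<theta>\<close> to one for \<open>v\<close> (\<open>v_idem\<close>).
\<close>

lemma \<rho>_mult:
  assumes a: "a \<in> carrier A" and b: "b \<in> carrier A"
  shows "sw2 k H (\<Delta>\<^sub>A (a \<star> b)) (\<lambda>x y. \<chi> y \<odot>\<^sub>H \<pi> x)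
    = sw2 k H (\<Delta>\<^sub>A a) (\<lambda>x y. \<chi> y \<odot>\<^sub>H \<pi> x) \<cdot> sw2 k H (\<Delta>\<^sub>A b) (\<lambda>x y. \<chi> y \<odot>\<^sub>H \<pi> x)"
    (is "?l = ?r a \<cdot> ?r b")
proof -
  note M = H.module_axioms
  note ml = lin_mult[OF H.unital_algebra_axioms lin_id]
  note t = A.comult_closed[OF a] A.comult_closed[OF b]
  have c: "?r b \<in> carrier H" by (intro A.sw2_closed[OF M t(2)]) simp
  have "?l = sw2 k H (\<Delta>\<^sub>A a) (\<lambda>a1 a2. sw2 k H (\<Delta>\<^sub>A b) (\<lambda>b1 b2. \<chi> (a2 \<star> b2) \<odot>\<^sub>H \<pi> (a1 \<star> b1)))"
    using a b by (intro A.comult_mult_sw ql) simp_all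
  also have "\<dots> = sw2 k H (\<Delta>\<^sub>A a) (\<lambda>a1 a2. sw2 k H (\<Delta>\<^sub>A b) (\<lambda>b1 b2.
      (\<chi> a2 \<odot>\<^sub>H \<pi> a1) \<cdot> (\<chi> b2 \<odot>\<^sub>H \<pi> b1)))"
    using a b by (intro A.sw2_cong)
      (simp_all add: \<chi>_mult p.mult H.smult_mult_left H.smult_mult_right H.smult_assoc1 H.smult_left_comm)
  also have "\<dots> = sw2 k H (\<Delta>\<^sub>A a) (\<lambda>a1 a2. (\<chi> a2 \<odot>\<^sub>H \<pi> a1) \<cdot> ?r b)"
    using a b by (intro A.sw2_cong A.lin_sw2[OF M M ml(2) t(2), symmetric]) simp_all
  also have "\<dots> = ?r a \<cdot> ?r b"
    using a b by (intro A.lin_sw2[OF M M ml(1)[OF c] t(1), symmetric]) simp_all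
  finally show ?thesis .
qed

text \<open>
  The coefficient \<open>d\<close> is dictated by \<open>\<Delta>(\<theta>) = 1 \<otimes> \<theta> + \<theta> \<otimes> 1 + d \<theta> \<otimes> \<theta>\<close>, which is what \<open>comult_\<theta>\<close> becomes
  for \<open>\<sigma> = \<epsilon>\<close> and \<open>v = 1\<close>.
\<close>

definition \<gamma> where "\<gamma> = \<one>\<^sub>A \<oplus>\<^sub>A d \<odot>\<^sub>A \<theta>"

lemma \<gamma>_cl: "\<gamma> \<in> carrier A" by (simp add: \<gamma>_def)

lemma counit_\<gamma>: "\<epsilon>\<^sub>A \<gamma> = \<one>"
  by (simp add: \<gamma>_def lin_add[OF A.counit_lin] lin_smult[OF A.counit_lin] counit_\<theta> A.counit_one)

context
  assumes c0: "c \<noteq> \<zero>"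
begin

lemma \<sigma>_trivial: "h \<in> carrier H \<Longrightarrow> \<sigma> h = \<epsilon> h"
  by (rule \<sigma>_counit) (simp add: c0)

lemma \<chi>_eq: "m \<in> carrier A \<Longrightarrow> \<chi> m = \<epsilon>\<^sub>A m \<oplus> c \<otimes> \<phi> m"
  using \<chi>_decomp[of m] by (simp add: \<sigma>_trivial p.counit counit_kap[OF \<phi>_inv])

lemma trivial_c: trivial_case
  by (simp add: trivial_case_def \<sigma>_trivial)

lemma \<theta>_square_c: "\<theta> \<star> \<theta> = c \<odot>\<^sub>A \<theta>"
  by (rule \<theta>_square) (simp add: \<chi>_eq \<sigma>_trivial p.counit)

lemma i_\<theta>_commute:
  assumes h: "h \<in> carrier H"
  shows "i h \<star> \<theta> = \<theta> \<star> i h"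
proof -
  have "i h \<star> \<theta> = sw2 k A (\<Delta> h) (\<lambda>h1 h2. \<epsilon> h1 \<odot>\<^sub>A (\<theta> \<star> i h2))"
    unfolding i_\<theta>[OF h] using h by (intro H.sw2_cong) (simp_all add: \<sigma>_trivial)
  then show ?thesis using h by (simp add: H.counit_left_sw[OF A.module_axioms] ql)
qed

lemma conv_\<chi>:
  assumes m: "m \<in> carrier A"
  shows "conv k A \<phi> \<chi> m = (\<one> \<oplus> c \<otimes> d) \<otimes> \<phi> m" "conv k A \<chi> \<phi> m = (\<one> \<oplus> c \<otimes> d) \<otimes> \<phi> m"
    "conv k A \<chi> \<chi> m = \<epsilon>\<^sub>A m \<oplus> c \<otimes> ((\<one> \<oplus> (\<one> \<oplus> c \<otimes> d)) \<otimes> \<phi> m)"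
proof -
  let ?K = "scalars k"
  have e: "conv k A f g m = conv k A f' g' m" if "\<And>x. x \<in> carrier A \<Longrightarrow> f x = f' x"
    "\<And>x. x \<in> carrier A \<Longrightarrow> g x = g' x" for f g f' g'
    unfolding conv_def using that m by (intro A.sw2_cong) simp_all
  let ?c = "\<lambda>x. \<one> \<otimes> \<epsilon>\<^sub>A x \<oplus> c \<otimes> \<phi> x"
  have l: "?c \<in> lin k A ?K"
    using lin_add_fun[OF H.scalars_module lin_scalar_mult(2)[OF H.field_axioms A.counit_lin]
      lin_scalar_mult(2)[OF H.field_axioms \<phi>_linear c_cl]] by simp
  have x: "\<chi> x = ?c x" if "x \<in> carrier A" for x using that by (simp add: \<chi>_eq)
  have "conv k A \<phi> \<chi> m = conv k A \<phi> ?c m" by (rule e) (simp_all only: x)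
  then show 1: "conv k A \<phi> \<chi> m = (\<one> \<oplus> c \<otimes> d) \<otimes> \<phi> m" using m
    by (simp add: A.conv_lincomb A.counit_lin \<phi>_linear A.conv_counit conv_\<phi>_\<phi> H.k_l_distr H.k_r_distr H.k_m_ac)
  have "conv k A \<chi> \<phi> m = conv k A ?c \<phi> m" by (rule e) (simp_all only: x)
  then show 2: "conv k A \<chi> \<phi> m = (\<one> \<oplus> c \<otimes> d) \<otimes> \<phi> m" using m
    by (simp add: A.conv_lincomb A.counit_lin \<phi>_linear A.conv_counit conv_\<phi>_\<phi> H.k_l_distr H.k_r_distr H.k_m_ac)
  have "conv k A \<chi> \<chi> m = conv k A \<chi> ?c m" by (rule e) (simp_all only: x)
  then show "conv k A \<chi> \<chi> m = \<epsilon>\<^sub>A m \<oplus> c \<otimes> ((\<one> \<oplus> (\<one> \<oplus> c \<otimes> d)) \<otimes> \<phi> m)" using m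
    by (simp add: A.conv_lincomb A.counit_lin \<phi>_linear \<chi>_lin A.conv_counit 2 \<chi>_eq
      H.k_l_distr H.k_r_distr H.k_m_ac H.k_a_ac)
qed

text \<open>
  With \<open>e = c d\<close> the quadratic relation becomes \<open>(1 + e) (2 + e) = 0\<close>. If \<open>1 + e\<close> were zero,
  \<open>\<chi> * \<chi>\<close> would be \<open>\<chi>\<close>, and \<open>idempotent_char\<close> in \<open>A\<close> would give \<open>c = \<chi>(\<theta>) = \<epsilon>(\<theta>) = 0\<close>.
\<close>

lemma c_d: "c \<otimes> d = \<ominus> (\<one> \<oplus> \<one>)"
proof -
  define e where "e = c \<otimes> d"
  have ec: "e \<in> carrier k" by (simp add: e_def)
  have q: "(\<one> \<oplus> e) \<oplus> (\<one> \<oplus> e) \<oplus> d \<otimes> (c \<otimes> (\<one> \<oplus> (\<one> \<oplus> e))) = d \<otimes> c"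
    using quadratic_relation ec by (simp add: conv_\<chi> \<phi>_\<theta> counit_\<theta> flip: e_def)
  have dc: "d \<otimes> c = e" "\<And>x. x \<in> carrier k \<Longrightarrow> d \<otimes> (c \<otimes> x) = e \<otimes> x"
    by (simp_all add: e_def H.k_m_ac)
  have q': "(\<one> \<oplus> e) \<oplus> (\<one> \<oplus> e) \<oplus> e \<otimes> (\<one> \<oplus> (\<one> \<oplus> e)) = e"
    using q dc(2)[of "\<one> \<oplus> (\<one> \<oplus> e)"] dc(1) ec by simp
  have "(\<one> \<oplus> e) \<otimes> (\<one> \<oplus> \<one> \<oplus> e) = \<zero>"
  proof -
    have "((\<one> \<oplus> e) \<otimes> (\<one> \<oplus> \<one> \<oplus> e)) \<oplus> e = \<zero> \<oplus> e"
      using q' ec by (simp add: H.k_l_distr H.k_r_distr H.k_a_ac)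
    then show ?thesis using ec H.k_add_right_cancel by simp
  qed
  moreover have "\<one> \<oplus> e \<noteq> \<zero>"
  proof
    assume e: "\<one> \<oplus> e = \<zero>"
    have "conv k A \<chi> \<chi> a = \<chi> a" if "a \<in> carrier A" for a
      using that e by (simp add: conv_\<chi> \<chi>_eq flip: e_def)
    from A.idempotent_char[OF \<chi>_char this \<theta>_closed] have "c = \<zero>" by (simp add: c_def counit_\<theta>)
    then show False using c0 by simp
  qed
  ultimately have "\<one> \<oplus> \<one> \<oplus> e = \<zero>" using ec H.k_integral_iff by simp
  then show ?thesis using ec H.k_minus_equality[of e "\<one> \<oplus> \<one>"] by (simp add: H.k_a_ac flip: e_def)
qed

lemma v_central: "h \<in> carrier H \<Longrightarrow> v \<cdot> h = h \<cdot> v"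
proof -
  assume h: "h \<in> carrier H"
  have "sw2 k H (\<Delta> h) (\<lambda>h1 h2. \<epsilon> h2 \<odot>\<^sub>H (h1 \<cdot> v))
    = sw2 k H (\<Delta> h) (\<lambda>h1 h2. \<epsilon> h1 \<odot>\<^sub>H (v \<cdot> h2))"
    using v_comm[OF h] h by (simp add: \<sigma>_trivial cong: H.sw2_cong)
  then show ?thesis using h
    by (simp add: H.counit_left_sw[OF H.module_axioms] H.counit_right_sw[OF H.module_axioms] ql)
qed

text \<open>
  The multiplicative map of \<open>\<rho>_mult\<close> sends \<open>\<theta>\<close> to \<open>c v\<close>, and \<open>\<theta> \<theta> = c \<theta>\<close> with \<open>c \<noteq> 0\<close>.
\<close>

lemma v_idem: "v \<cdot> v = v"
proof -
  note M = H.module_axioms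
  note t = A.comult_closed[OF \<theta>_closed]
  let ?r = "\<lambda>m. sw2 k H (\<Delta>\<^sub>A m) (\<lambda>x y. \<chi> y \<odot>\<^sub>H \<pi> x)"
  have rl: "?r \<in> lin k A H" by (intro ql) simp_all
  have "?r \<theta> = sw2 k H (\<Delta>\<^sub>A \<theta>) (\<lambda>x y. \<epsilon>\<^sub>A y \<odot>\<^sub>H \<pi> x \<oplus>\<^sub>H \<phi> y \<odot>\<^sub>H (c \<odot>\<^sub>H \<pi> x))"
    by (intro A.sw2_cong) (simp_all add: \<chi>_eq H.smult_l_distr H.smult_assoc1 H.smult_left_comm)
  also have "\<dots> = sw2 k H (\<Delta>\<^sub>A \<theta>) (\<lambda>x y. \<epsilon>\<^sub>A y \<odot>\<^sub>H \<pi> x) \<oplus>\<^sub>H sw2 k H (\<Delta>\<^sub>A \<theta>) (\<lambda>x y. \<phi> y \<odot>\<^sub>H (c \<odot>\<^sub>H \<pi> x))"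
    by (intro A.sw2_add[OF M _ _ t] ql) simp_all
  also have "\<dots> = \<pi> \<theta> \<oplus>\<^sub>H c \<odot>\<^sub>H L \<theta>"
    by (intro arg_cong2[where f = "add H"] A.counit_right_sw L_apply ql) simp_all
  finally have r: "?r \<theta> = c \<odot>\<^sub>H v" by (simp add: \<pi>_\<theta> v_def)
  have "c \<odot>\<^sub>H (c \<odot>\<^sub>H v) = ?r (\<theta> \<star> \<theta>)" by (simp add: \<theta>_square_c lin_smult[OF rl] r)
  also have "\<dots> = c \<odot>\<^sub>H (c \<odot>\<^sub>H (v \<cdot> v))"
    unfolding \<rho>_mult[OF \<theta>_closed \<theta>_closed] r by (simp add: H.smult_mult_left H.smult_mult_right)
  finally have e: "c \<odot>\<^sub>H (c \<odot>\<^sub>H (v \<cdot> v)) = c \<odot>\<^sub>H (c \<odot>\<^sub>H v)" ..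
  show ?thesis
    by (rule H.smult_cancel[OF c_cl c0 _ _ H.smult_cancel[OF c_cl c0 _ _ e]]) simp_all
qed

context
  fixes V :: "('k, 'v, 'w) module_scheme"
  assumes V: "module k V"
begin

interpretation V: module k V by (rule V)

text \<open>
  For \<open>\<sigma> = \<epsilon>\<close> the counit is applied to a leg of each reassociator in \<open>\<Delta>_v\<close>, which makes it disappear.
\<close>

lemma \<Delta>_v_grouplike:
  assumes f: "bilin k H V f"
  shows "sw2 k V (\<Delta> v) f = f v v"
proof -
  note fl = bilin_lin[OF f] and fc = bilin_closed[OF f]
  have "sw2 k V (\<Delta> v) f
    = sw3 k V \<Phi> (\<lambda>X1 X2 X3. sw3 k V \<phi>i (\<lambda>x1 x2 x3. sw3 k V \<phi>i (\<lambda>y1 y2 y3.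
      \<epsilon> y1 \<odot>\<^sub>V (\<epsilon> x3 \<odot>\<^sub>V (\<epsilon> X2 \<odot>\<^sub>V
      f (x1 \<cdot> X1 \<cdot> v \<cdot> y2) (x2 \<cdot> v \<cdot> X3 \<cdot> y3))))))"
    unfolding \<Delta>_v[OF V f]
    by (intro H.sw3_cong) (simp_all add: \<sigma>_trivial H.counit_mult V.smult_assoc1 fc)
  also have "\<dots> = sw3 k V \<Phi> (\<lambda>X1 X2 X3. sw3 k V \<phi>i (\<lambda>x1 x2 x3.
      \<epsilon> x3 \<odot>\<^sub>V (\<epsilon> X2 \<odot>\<^sub>V f (x1 \<cdot> X1 \<cdot> v \<cdot> \<one>\<^sub>H) (x2 \<cdot> v \<cdot> X3 \<cdot> \<one>\<^sub>H))))"
  proof (intro H.sw3_cong)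
    fix X1 X2 X3 x1 x2 x3
    assume "X1 \<in> carrier H" "X2 \<in> carrier H" "X3 \<in> carrier H" "x1 \<in> carrier H" "x2 \<in> carrier H" "x3 \<in> carrier H"
    then show "sw3 k V \<phi>i (\<lambda>y1 y2 y3.
      \<epsilon> y1 \<odot>\<^sub>V (\<epsilon> x3 \<odot>\<^sub>V (\<epsilon> X2 \<odot>\<^sub>V
      f (x1 \<cdot> X1 \<cdot> v \<cdot> y2) (x2 \<cdot> v \<cdot> X3 \<cdot> y3))))
      = \<epsilon> x3 \<odot>\<^sub>V (\<epsilon> X2 \<odot>\<^sub>V f (x1 \<cdot> X1 \<cdot> v \<cdot> \<one>\<^sub>H) (x2 \<cdot> v \<cdot> X3 \<cdot> \<one>\<^sub>H))"
      by (intro H.counit_reassoc_inv1_sw[OF V, where g = "\<lambda>y2 y3. \<epsilon> x3 \<odot>\<^sub>V (\<epsilon> X2 \<odot>\<^sub>V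
      f (x1 \<cdot> X1 \<cdot> v \<cdot> y2) (x2 \<cdot> v \<cdot> X3 \<cdot> y3))"] ql fl V) (simp_all add: fc)
  qed simp_all
  also have "\<dots> = sw3 k V \<Phi> (\<lambda>X1 X2 X3. \<epsilon> X2 \<odot>\<^sub>V f (\<one>\<^sub>H \<cdot> X1 \<cdot> v \<cdot> \<one>\<^sub>H) (\<one>\<^sub>H \<cdot> v \<cdot> X3 \<cdot> \<one>\<^sub>H))"
  proof (intro H.sw3_cong)
    fix X1 X2 X3
    assume "X1 \<in> carrier H" "X2 \<in> carrier H" "X3 \<in> carrier H"
    then show "sw3 k V \<phi>i (\<lambda>x1 x2 x3.
      \<epsilon> x3 \<odot>\<^sub>V (\<epsilon> X2 \<odot>\<^sub>V f (x1 \<cdot> X1 \<cdot> v \<cdot> \<one>\<^sub>H) (x2 \<cdot> v \<cdot> X3 \<cdot> \<one>\<^sub>H)))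
      = \<epsilon> X2 \<odot>\<^sub>V f (\<one>\<^sub>H \<cdot> X1 \<cdot> v \<cdot> \<one>\<^sub>H) (\<one>\<^sub>H \<cdot> v \<cdot> X3 \<cdot> \<one>\<^sub>H)"
      by (intro H.counit_reassoc_inv3_sw[OF V, where g = "\<lambda>x1 x2. \<epsilon> X2 \<odot>\<^sub>V
      f (x1 \<cdot> X1 \<cdot> v \<cdot> \<one>\<^sub>H) (x2 \<cdot> v \<cdot> X3 \<cdot> \<one>\<^sub>H)"] ql fl V) (simp_all add: fc)
  qed simp_all
  also have "\<dots> = f (\<one>\<^sub>H \<cdot> \<one>\<^sub>H \<cdot> v \<cdot> \<one>\<^sub>H) (\<one>\<^sub>H \<cdot> v \<cdot> \<one>\<^sub>H \<cdot> \<one>\<^sub>H)"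
    by (intro H.counit_reassoc2_sw ql fl V) (simp_all add: fc)
  finally show ?thesis by simp
qed

end

text \<open>
  The antipode axiom for \<open>\<beta>\<close>, applied to the group-like element \<open>v\<close>, reads \<open>v \<beta> S(v) = \<beta>\<close>;
  idempotency then gives \<open>v \<beta> = \<beta>\<close>. As \<open>v\<close> is central,
  \<open>v = X\<^sup>1 v \<beta> S(X\<^sup>2) \<alpha> X\<^sup>3 = X\<^sup>1 \<beta> S(X\<^sup>2) \<alpha> X\<^sup>3 = 1\<close>.
\<close>

lemma v_one: "v = \<one>\<^sub>H"
proof -
  note M = H.module_axioms
  note ml = lin_mult(2)[OF H.unital_algebra_axioms lin_id v_cl]
  have "v \<cdot> \<beta> \<cdot> \<S> v = sw2 k H (\<Delta> v) (\<lambda>a b. a \<cdot> \<beta> \<cdot> \<S> b)"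
    by (rule \<Delta>_v_grouplike[OF M, symmetric]) (intro ql; simp)
  then have b: "v \<cdot> \<beta> \<cdot> \<S> v = \<beta>" by (simp add: H.antipode_beta v_cl counit_v)
  have "v \<cdot> \<beta> = v \<cdot> (v \<cdot> \<beta> \<cdot> \<S> v)" by (simp add: b)
  also have "\<dots> = (v \<cdot> v) \<cdot> \<beta> \<cdot> \<S> v" by (simp add: H.A.m_assoc)
  finally have vb: "v \<cdot> \<beta> = \<beta>" by (simp add: v_idem b)
  have "v \<cdot> \<one>\<^sub>H = sw3 k H \<Phi> (\<lambda>X1 X2 X3. v \<cdot> (X1 \<cdot> \<beta> \<cdot> \<S> X2 \<cdot> \<alpha> \<cdot> X3))"
    by (rule H.antipode_reassoc_sw[OF M ml, symmetric])
  also have "\<dots> = sw3 k H \<Phi> (\<lambda>X1 X2 X3. X1 \<cdot> \<beta> \<cdot> \<S> X2 \<cdot> \<alpha> \<cdot> X3)"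
  proof (intro H.sw3_cong)
    fix X1 X2 X3 assume X: "X1 \<in> carrier H" "X2 \<in> carrier H" "X3 \<in> carrier H"
    have "v \<cdot> (X1 \<cdot> \<beta> \<cdot> \<S> X2 \<cdot> \<alpha> \<cdot> X3)
      = (v \<cdot> X1) \<cdot> (\<beta> \<cdot> (\<S> X2 \<cdot> (\<alpha> \<cdot> X3)))" using X by (simp add: H.A.m_assoc)
    also have "\<dots> = X1 \<cdot> ((v \<cdot> \<beta>) \<cdot> (\<S> X2 \<cdot> (\<alpha> \<cdot> X3)))"
      using X by (simp only: v_central) (simp add: H.A.m_assoc)
    finally show "v \<cdot> (X1 \<cdot> \<beta> \<cdot> \<S> X2 \<cdot> \<alpha> \<cdot> X3)
      = X1 \<cdot> \<beta> \<cdot> \<S> X2 \<cdot> \<alpha> \<cdot> X3" using X by (simp add: vb H.A.m_assoc)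
  qed simp
  finally show ?thesis by (simp add: H.antipode_reassoc)
qed

lemma \<gamma>_square: "\<gamma> \<star> \<gamma> = \<one>\<^sub>A"
proof -
  have "\<gamma> \<star> \<gamma> = \<one>\<^sub>A \<oplus>\<^sub>A (\<one> \<oplus> \<one> \<oplus> c \<otimes> d) \<odot>\<^sub>A (d \<odot>\<^sub>A \<theta>)"
    by (simp add: \<gamma>_def A.A.l_distr A.A.r_distr A.smult_mult_left A.smult_mult_right \<theta>_square_c
      A.smult_l_distr A.smult_r_distr A.smult_assoc1 A.smult_left_comm A.M.a_ac d_cl)
  also have "\<one> \<oplus> \<one> \<oplus> c \<otimes> d = \<zero>" by (simp add: c_d H.k_r_neg)
  finally show ?thesis by simp
qed

lemma \<gamma>_i: "h \<in> carrier H \<Longrightarrow> \<gamma> \<star> i h = i h \<star> \<gamma>"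
  by (simp add: \<gamma>_def A.A.l_distr A.A.r_distr A.smult_mult_left A.smult_mult_right i_\<theta>_commute)

lemma comult_\<gamma>:
  assumes V: "module k V" and f: "bilin k A V f"
  shows "sw2 k V (\<Delta>\<^sub>A \<gamma>) f = f \<gamma> \<gamma>"
proof -
  interpret V: module k V by (rule V)
  note fl = bilin_lin[OF f] and fc = bilin_closed[OF f]
  note sl = A.sw2_arg_lin[OF V f A.comult_lin]
  have fadd: "f (x \<oplus>\<^sub>A y) z = f x z \<oplus>\<^sub>V f y z" "f z (x \<oplus>\<^sub>A y) = f z x \<oplus>\<^sub>V f z y"
    if "x \<in> carrier A" "y \<in> carrier A" "z \<in> carrier A" for x y z
    using lin_add[OF fl(1)[OF lin_id that(3)] that(1,2)] lin_add[OF fl(2)[OF lin_id that(3)] that(1,2)] by simp_all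
  have fsm: "f (r \<odot>\<^sub>A x) z = r \<odot>\<^sub>V f x z" "f z (r \<odot>\<^sub>A x) = r \<odot>\<^sub>V f z x"
    if "r \<in> carrier k" "x \<in> carrier A" "z \<in> carrier A" for r x z
    using lin_smult[OF fl(1)[OF lin_id that(3)] that(1,2)] lin_smult[OF fl(2)[OF lin_id that(3)] that(1,2)] by simp_all
  have "sw2 k V (\<Delta>\<^sub>A \<theta>) f = f \<one>\<^sub>A \<theta> \<oplus>\<^sub>V f \<theta> \<one>\<^sub>A \<oplus>\<^sub>V d \<odot>\<^sub>V f \<theta> \<theta>"
  proof -
    have r: "sw3 k V \<phi>i (\<lambda>x1 x2 x3. \<sigma> x1 \<odot>\<^sub>V h x2 x3) = h \<one>\<^sub>H \<one>\<^sub>H" if h: "bilin k H V h" for h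
      using H.counit_reassoc_inv1_sw[OF V h] bilin_closed[OF h]
      by (simp add: \<sigma>_trivial cong: H.sw3_cong)
    have "sw3 k V \<Phi> (\<lambda>X1 X2 X3. sw3 k V \<phi>i (\<lambda>x1 x2 x3.
      \<sigma> (X2 \<cdot> x1) \<odot>\<^sub>V f (i (X1 \<cdot> v \<cdot> x2)) (\<theta> \<star> i (X3 \<cdot> x3))))
      = sw3 k V \<Phi> (\<lambda>X1 X2 X3. sw3 k V \<phi>i (\<lambda>x1 x2 x3.
      \<sigma> x1 \<odot>\<^sub>V (\<epsilon> X2 \<odot>\<^sub>V f (i (X1 \<cdot> x2)) (\<theta> \<star> i (X3 \<cdot> x3)))))"
      by (intro H.sw3_cong) (simp_all add: \<sigma>_trivial H.counit_mult v_one fc V.smult_assoc1 V.smult_left_comm)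
    also have "\<dots> = sw3 k V \<Phi> (\<lambda>X1 X2 X3. \<epsilon> X2 \<odot>\<^sub>V f (i (X1 \<cdot> \<one>\<^sub>H)) (\<theta> \<star> i (X3 \<cdot> \<one>\<^sub>H)))"
    proof (intro H.sw3_cong)
      fix X1 X2 X3 assume "X1 \<in> carrier H" "X2 \<in> carrier H" "X3 \<in> carrier H"
      then show "sw3 k V \<phi>i (\<lambda>x1 x2 x3.
      \<sigma> x1 \<odot>\<^sub>V (\<epsilon> X2 \<odot>\<^sub>V f (i (X1 \<cdot> x2)) (\<theta> \<star> i (X3 \<cdot> x3))))
      = \<epsilon> X2 \<odot>\<^sub>V f (i (X1 \<cdot> \<one>\<^sub>H)) (\<theta> \<star> i (X3 \<cdot> \<one>\<^sub>H))"
        by (intro r[where h = "\<lambda>x2 x3. \<epsilon> X2 \<odot>\<^sub>V f (i (X1 \<cdot> x2)) (\<theta> \<star> i (X3 \<cdot> x3))"] ql fl V) (simp_all add: fc)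
    qed simp
    also have "\<dots> = f (i (\<one>\<^sub>H \<cdot> \<one>\<^sub>H)) (\<theta> \<star> i (\<one>\<^sub>H \<cdot> \<one>\<^sub>H))"
      by (intro H.counit_reassoc2_sw ql fl V) (simp_all add: fc)
    finally have 1: "sw3 k V \<Phi> (\<lambda>X1 X2 X3. sw3 k V \<phi>i (\<lambda>x1 x2 x3.
      \<sigma> (X2 \<cdot> x1) \<odot>\<^sub>V f (i (X1 \<cdot> v \<cdot> x2)) (\<theta> \<star> i (X3 \<cdot> x3)))) = f \<one>\<^sub>A \<theta>"
      by (simp add: i.one)
    have "sw3 k V \<phi>i (\<lambda>x1 x2 x3. \<sigma> x1 \<odot>\<^sub>V f (\<theta> \<star> i x2) (i x3)) = f (\<theta> \<star> i \<one>\<^sub>H) (i \<one>\<^sub>H)"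
      by (intro r ql fl V) (simp_all add: fc)
    then show ?thesis unfolding comult_\<theta>[OF V trivial_c f] 1 by (simp add: v_one i.one)
  qed
  then have "sw2 k V (\<Delta>\<^sub>A \<gamma>) f = f \<one>\<^sub>A \<one>\<^sub>A \<oplus>\<^sub>V d \<odot>\<^sub>V (f \<one>\<^sub>A \<theta> \<oplus>\<^sub>V f \<theta> \<one>\<^sub>A \<oplus>\<^sub>V d \<odot>\<^sub>V f \<theta> \<theta>)"
    by (simp add: \<gamma>_def lin_add[OF sl] lin_smult[OF sl] A.comult_one_sw[OF V f])
  then show ?thesis by (simp add: \<gamma>_def fadd fsm fc V.smult_r_distr V.a_ac)
qed

text \<open>
  Group-likeness gives \<open>S(\<gamma>) \<alpha> \<gamma> = \<alpha>\<close>, hence \<open>S(\<gamma>) \<alpha> = \<gamma> \<alpha>\<close>. Both \<open>S(\<gamma>)\<close> and \<open>\<gamma>\<close> commute with the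
  elements \<open>S(x\<^sup>1)\<close>, so multiplication by \<open>1 = S(x\<^sup>1) \<alpha> x\<^sup>2 \<beta> S(x\<^sup>3)\<close> shows that they agree.
\<close>

lemma antipode_\<gamma>: "\<S>\<^sub>A \<gamma> = \<gamma>"
proof -
  note M = A.module_axioms
  note ml = lin_mult(2)[OF A.unital_algebra_axioms lin_id]
  have "\<S>\<^sub>A \<gamma> \<star> \<alpha>\<^sub>A \<star> \<gamma> = sw2 k A (\<Delta>\<^sub>A \<gamma>) (\<lambda>a b. \<S>\<^sub>A a \<star> \<alpha>\<^sub>A \<star> b)"
    by (rule comult_\<gamma>[OF M, symmetric]) (intro ql; simp)
  then have "\<S>\<^sub>A \<gamma> \<star> \<alpha>\<^sub>A \<star> \<gamma> = \<alpha>\<^sub>A" by (simp add: A.antipode_alpha \<gamma>_cl counit_\<gamma>)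
  then have "\<alpha>\<^sub>A \<star> \<gamma> = \<S>\<^sub>A \<gamma> \<star> \<alpha>\<^sub>A \<star> (\<gamma> \<star> \<gamma>)"
    by (simp add: \<gamma>_cl flip: A.A.m_assoc)
  then have a: "\<S>\<^sub>A \<gamma> \<star> \<alpha>\<^sub>A = \<gamma> \<star> \<alpha>\<^sub>A"
    using \<gamma>_i[OF H.alpha_closed] by (simp add: \<gamma>_square \<gamma>_cl i.alpha)
  have sc: "\<S>\<^sub>A \<gamma> \<star> i (\<S> h) = i (\<S> h) \<star> \<S>\<^sub>A \<gamma>" if "h \<in> carrier H" for h
    using arg_cong[OF \<gamma>_i[OF that], of "\<S>\<^sub>A"] that by (simp add: A.antipode_mult i.antipode \<gamma>_cl)
  have e: "x \<star> \<one>\<^sub>A = sw3 k A \<phi>i (\<lambda>x1 x2 x3. x \<star> i (\<S> x1 \<cdot> \<alpha> \<cdot> x2 \<cdot> \<beta> \<cdot> \<S> x3))"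
    if "x \<in> carrier A" for x
    unfolding i.one[symmetric] using that
    by (intro H.antipode_reassoc_inv_sw[symmetric] ql) simp_all
  have "\<S>\<^sub>A \<gamma> \<star> \<one>\<^sub>A = \<gamma> \<star> \<one>\<^sub>A"
    unfolding e[OF A.antipode_in[OF \<gamma>_cl]] e[OF \<gamma>_cl]
  proof (intro H.sw3_cong)
    fix x1 x2 x3 assume x: "x1 \<in> carrier H" "x2 \<in> carrier H" "x3 \<in> carrier H"
    let ?y = "i (x2 \<cdot> \<beta> \<cdot> \<S> x3)"
    have "\<S>\<^sub>A \<gamma> \<star> i (\<S> x1 \<cdot> \<alpha> \<cdot> x2 \<cdot> \<beta> \<cdot> \<S> x3)
      = (\<S>\<^sub>A \<gamma> \<star> i (\<S> x1)) \<star> (\<alpha>\<^sub>A \<star> ?y)" using x \<gamma>_cl by (simp add: i.mult i.alpha A.A.m_assoc)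
    also have "\<dots> = i (\<S> x1) \<star> ((\<S>\<^sub>A \<gamma> \<star> \<alpha>\<^sub>A) \<star> ?y)"
      unfolding sc[OF x(1)] using x \<gamma>_cl by (simp add: A.A.m_assoc)
    also have "\<dots> = (i (\<S> x1) \<star> \<gamma>) \<star> (\<alpha>\<^sub>A \<star> ?y)"
      unfolding a using x \<gamma>_cl by (simp add: A.A.m_assoc)
    also have "\<dots> = \<gamma> \<star> i (\<S> x1 \<cdot> \<alpha> \<cdot> x2 \<cdot> \<beta> \<cdot> \<S> x3)"
      unfolding \<gamma>_i[OF H.antipode_in[OF x(1)], symmetric]
      using x \<gamma>_cl by (simp add: i.mult i.alpha A.A.m_assoc)
    finally show "\<S>\<^sub>A \<gamma> \<star> i (\<S> x1 \<cdot> \<alpha> \<cdot> x2 \<cdot> \<beta> \<cdot> \<S> x3)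
      = \<gamma> \<star> i (\<S> x1 \<cdot> \<alpha> \<cdot> x2 \<cdot> \<beta> \<cdot> \<S> x3)" .
  qed simp
  then show ?thesis using \<gamma>_cl by simp
qed

end

end

lemma neg_lin:
  assumes "module k V" "f \<in> lin k U V"
  shows "(\<lambda>x. \<ominus>\<^sub>V f x) \<in> lin k U V"
proof -
  interpret V: module k V by fact
  show ?thesis using lin_closed[OF assms(2)]
    by (intro linI) (simp_all add: lin_add[OF assms(2)] lin_smult[OF assms(2)] V.M.minus_add V.smult_r_minus)
qed

context rank_two
begin

subsection \<open>The antipode of the nilpotent generator\<close>

context
  assumes c0: "c = \<zero>" and char: "\<one> \<oplus> \<one> \<noteq> \<zero>"
begin

text \<open>
  Multiplying by \<open>\<sigma>(Y\<^sup>1) Y\<^sup>2 \<otimes> Y\<^sup>3\<close> cancels the factor \<open>\<sigma>(x\<^sup>1) x\<^sup>2 \<otimes> x\<^sup>3\<close>, which stands on the right of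
  both terms of \<open>\<Delta>(\<theta>)\<close>.
\<close>

lemma comult_\<theta>_twisted:
  assumes V: "module k V" and g: "bilin k A V g"
  shows "sw3 k V \<Phi> (\<lambda>Y1 Y2 Y3. \<sigma> Y1 \<odot>\<^sub>V sw2 k V (\<Delta>\<^sub>A \<theta>) (\<lambda>a b. g (a \<star> i Y2) (b \<star> i Y3)))
    = sw3 k V \<Phi> (\<lambda>X1 X2 X3. \<sigma> X2 \<odot>\<^sub>V g (i (X1 \<cdot> v)) (\<theta> \<star> i X3)) \<oplus>\<^sub>V g \<theta> \<one>\<^sub>A"
proof -
  interpret V: module k V by (rule V)
  note gl = bilin_lin[OF g] and gc = bilin_closed[OF g]
  let ?F = "\<lambda>a b. sw3 k V \<Phi> (\<lambda>Y1 Y2 Y3. \<sigma> Y1 \<odot>\<^sub>V g (a \<star> i Y2) (b \<star> i Y3))"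
  have F: "bilin k A V ?F" by (intro ql gl V) (simp_all add: gc)
  have col: "sw3 k V \<phi>i (\<lambda>x1 x2 x3. \<sigma> x1 \<odot>\<^sub>V sw3 k V \<Phi> (\<lambda>Y1 Y2 Y3. \<sigma> Y1 \<odot>\<^sub>V h (x2 \<cdot> Y2) (x3 \<cdot> Y3)))
      = h \<one>\<^sub>H \<one>\<^sub>H" if h: "bilin k H V h" for h
  proof -
    note hl = bilin_lin[OF h] and hc = bilin_closed[OF h]
    have "sw3 k V \<phi>i (\<lambda>x1 x2 x3. \<sigma> x1 \<odot>\<^sub>V sw3 k V \<Phi> (\<lambda>Y1 Y2 Y3. \<sigma> Y1 \<odot>\<^sub>V h (x2 \<cdot> Y2) (x3 \<cdot> Y3)))
      = sw3 k V \<phi>i (\<lambda>x1 x2 x3. sw3 k V \<Phi> (\<lambda>Y1 Y2 Y3. \<sigma> x1 \<odot>\<^sub>V (\<sigma> Y1 \<odot>\<^sub>V h (x2 \<cdot> Y2) (x3 \<cdot> Y3))))"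
      by (intro H.sw3_cong H.lin_sw3[OF V V lin_smult_right[OF V _ lin_id]]) (simp_all add: hc)
    also have "\<dots> = sw3 k V \<phi>i (\<lambda>x1 x2 x3. sw3 k V \<Phi> (\<lambda>Y1 Y2 Y3. \<sigma> (x1 \<cdot> Y1) \<odot>\<^sub>V h (x2 \<cdot> Y2) (x3 \<cdot> Y3)))"
      by (intro H.sw3_cong) (simp_all add: \<sigma>_mult V.smult_assoc1 hc)
    also have "\<dots> = \<sigma> \<one>\<^sub>H \<odot>\<^sub>V h \<one>\<^sub>H \<one>\<^sub>H"
      by (intro H.reassoc_inv_reassoc_sw[OF V, where f = "\<lambda>p q r. \<sigma> p \<odot>\<^sub>V h q r"] ql hl V) (simp_all add: hc)
    finally show ?thesis by (simp add: \<sigma>_one hc)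
  qed
  have "sw3 k V \<Phi> (\<lambda>Y1 Y2 Y3. \<sigma> Y1 \<odot>\<^sub>V sw2 k V (\<Delta>\<^sub>A \<theta>) (\<lambda>a b. g (a \<star> i Y2) (b \<star> i Y3)))
    = sw3 k V \<Phi> (\<lambda>Y1 Y2 Y3. sw2 k V (\<Delta>\<^sub>A \<theta>) (\<lambda>a b. \<sigma> Y1 \<odot>\<^sub>V g (a \<star> i Y2) (b \<star> i Y3)))"
    by (intro H.sw3_cong pull_smult2A[OF V, symmetric]) (simp_all add: gc)
  also have "\<dots> = sw2 k V (\<Delta>\<^sub>A \<theta>) ?F"
    by (intro A.sw2_sw3_swap[OF H.unital_algebra_axioms V, symmetric]) (simp_all add: gc)
  also have "\<dots> = sw3 k V \<Phi> (\<lambda>X1 X2 X3. sw3 k V \<phi>i (\<lambda>x1 x2 x3.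
      \<sigma> (X2 \<cdot> x1) \<odot>\<^sub>V ?F (i (X1 \<cdot> v \<cdot> x2)) (\<theta> \<star> i (X3 \<cdot> x3))))
    \<oplus>\<^sub>V sw3 k V \<phi>i (\<lambda>x1 x2 x3. \<sigma> x1 \<odot>\<^sub>V ?F (\<theta> \<star> i x2) (i x3))"
    unfolding comult_\<theta>[OF V trivial_c0[OF c0 char] F]
    by (simp add: d_zero[OF c0 char] H.sw3_closed V gc)
  also have "sw3 k V \<Phi> (\<lambda>X1 X2 X3. sw3 k V \<phi>i (\<lambda>x1 x2 x3.
      \<sigma> (X2 \<cdot> x1) \<odot>\<^sub>V ?F (i (X1 \<cdot> v \<cdot> x2)) (\<theta> \<star> i (X3 \<cdot> x3))))
    = sw3 k V \<Phi> (\<lambda>X1 X2 X3. \<sigma> X2 \<odot>\<^sub>V g (i (X1 \<cdot> v \<cdot> \<one>\<^sub>H)) (\<theta> \<star> i (X3 \<cdot> \<one>\<^sub>H)))"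
  proof (intro H.sw3_cong)
    fix X1 X2 X3 assume X: "X1 \<in> carrier H" "X2 \<in> carrier H" "X3 \<in> carrier H"
    have "sw3 k V \<phi>i (\<lambda>x1 x2 x3. \<sigma> (X2 \<cdot> x1) \<odot>\<^sub>V ?F (i (X1 \<cdot> v \<cdot> x2)) (\<theta> \<star> i (X3 \<cdot> x3)))
      = sw3 k V \<phi>i (\<lambda>x1 x2 x3. \<sigma> x1 \<odot>\<^sub>V sw3 k V \<Phi> (\<lambda>Y1 Y2 Y3. \<sigma> Y1 \<odot>\<^sub>V (\<sigma> X2 \<odot>\<^sub>V
      g (i (X1 \<cdot> v \<cdot> (x2 \<cdot> Y2))) (\<theta> \<star> i (X3 \<cdot> (x3 \<cdot> Y3))))))"
    proof (intro H.sw3_cong)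
      fix x1 x2 x3 assume x: "x1 \<in> carrier H" "x2 \<in> carrier H" "x3 \<in> carrier H"
      let ?G = "\<lambda>Y1 Y2 Y3. \<sigma> Y1 \<odot>\<^sub>V g (i (X1 \<cdot> v \<cdot> (x2 \<cdot> Y2))) (\<theta> \<star> i (X3 \<cdot> (x3 \<cdot> Y3)))"
      have "?F (i (X1 \<cdot> v \<cdot> x2)) (\<theta> \<star> i (X3 \<cdot> x3)) = sw3 k V \<Phi> ?G"
        using X x by (intro H.sw3_cong) (simp_all add: i.mult A.A.m_assoc)
      moreover have "sw3 k V \<Phi> (\<lambda>Y1 Y2 Y3. \<sigma> X2 \<odot>\<^sub>V ?G Y1 Y2 Y3) = \<sigma> X2 \<odot>\<^sub>V sw3 k V \<Phi> ?G"
        using X x by (intro H.lin_sw3[OF V V lin_smult_right[OF V _ lin_id], symmetric]) (simp_all add: gc)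
      moreover have "sw3 k V \<Phi> ?G \<in> carrier V" using X x by (intro H.sw3_closed[OF V]) (simp_all add: gc)
      ultimately show "\<sigma> (X2 \<cdot> x1) \<odot>\<^sub>V ?F (i (X1 \<cdot> v \<cdot> x2)) (\<theta> \<star> i (X3 \<cdot> x3))
      = \<sigma> x1 \<odot>\<^sub>V sw3 k V \<Phi> (\<lambda>Y1 Y2 Y3. \<sigma> Y1 \<odot>\<^sub>V (\<sigma> X2 \<odot>\<^sub>V
      g (i (X1 \<cdot> v \<cdot> (x2 \<cdot> Y2))) (\<theta> \<star> i (X3 \<cdot> (x3 \<cdot> Y3)))))"
        using X x by (simp add: \<sigma>_mult V.smult_assoc1 V.smult_left_comm gc cong: H.sw3_cong)
    qed simp
    also have "\<dots> = \<sigma> X2 \<odot>\<^sub>V g (i (X1 \<cdot> v \<cdot> \<one>\<^sub>H)) (\<theta> \<star> i (X3 \<cdot> \<one>\<^sub>H))"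
      using X by (intro col[where h = "\<lambda>p q. \<sigma> X2 \<odot>\<^sub>V g (i (X1 \<cdot> v \<cdot> p)) (\<theta> \<star> i (X3 \<cdot> q))"] ql gl V)
      (simp_all add: gc)
    finally show "sw3 k V \<phi>i (\<lambda>x1 x2 x3. \<sigma> (X2 \<cdot> x1) \<odot>\<^sub>V ?F (i (X1 \<cdot> v \<cdot> x2)) (\<theta> \<star> i (X3 \<cdot> x3)))
      = \<sigma> X2 \<odot>\<^sub>V g (i (X1 \<cdot> v \<cdot> \<one>\<^sub>H)) (\<theta> \<star> i (X3 \<cdot> \<one>\<^sub>H))" .
  qed simp
  also have "sw3 k V \<phi>i (\<lambda>x1 x2 x3. \<sigma> x1 \<odot>\<^sub>V ?F (\<theta> \<star> i x2) (i x3))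
    = sw3 k V \<phi>i (\<lambda>x1 x2 x3. \<sigma> x1 \<odot>\<^sub>V sw3 k V \<Phi> (\<lambda>Y1 Y2 Y3. \<sigma> Y1 \<odot>\<^sub>V g (\<theta> \<star> i (x2 \<cdot> Y2)) (i (x3 \<cdot> Y3))))"
    by (intro H.sw3_cong arg_cong[where f = "smult V _"]) (simp_all add: i.mult A.A.m_assoc)
  also have "\<dots> = g (\<theta> \<star> i \<one>\<^sub>H) (i \<one>\<^sub>H)"
    by (intro col ql gl V) (simp_all add: gc)
  finally show ?thesis by (simp add: i.one cong: H.sw3_cong)
qed

text \<open>
  The antipode axiom for \<open>\<alpha>\<close> at \<open>\<theta>\<close>, where \<open>\<epsilon>(\<theta>) = 0\<close>. Its twisted form has only two terms, one of
  which is \<open>S(\<theta>) \<alpha>\<close>.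
\<close>

lemma antipode_\<theta>_alpha:
  "\<S>\<^sub>A \<theta> \<star> \<alpha>\<^sub>A = \<ominus>\<^sub>A sw3 k A \<Phi> (\<lambda>X1 X2 X3.
    \<sigma> X2 \<odot>\<^sub>A (i (\<S> (X1 \<cdot> v) \<cdot> \<alpha>) \<star> \<theta> \<star> i X3))" (is "_ = \<ominus>\<^sub>A ?T")
proof -
  note M = A.module_axioms
  have "sw3 k A \<Phi> (\<lambda>X1 X2 X3. \<sigma> X2 \<odot>\<^sub>A (\<S>\<^sub>A (i (X1 \<cdot> v)) \<star> \<alpha>\<^sub>A \<star> (\<theta> \<star> i X3)))
      \<oplus>\<^sub>A \<S>\<^sub>A \<theta> \<star> \<alpha>\<^sub>A \<star> \<one>\<^sub>A
    = sw3 k A \<Phi> (\<lambda>Y1 Y2 Y3. \<sigma> Y1 \<odot>\<^sub>A sw2 k A (\<Delta>\<^sub>A \<theta>) (\<lambda>a b. \<S>\<^sub>A (a \<star> i Y2) \<star> \<alpha>\<^sub>A \<star> (b \<star> i Y3)))"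
    by (rule comult_\<theta>_twisted[OF M, symmetric]) (intro ql; simp)
  also have "\<dots> = sw3 k A \<Phi> (\<lambda>_ _ _. \<zero>\<^sub>A)"
  proof (intro H.sw3_cong)
    fix Y1 Y2 Y3 assume Y: "Y1 \<in> carrier H" "Y2 \<in> carrier H" "Y3 \<in> carrier H"
    have "sw2 k A (\<Delta>\<^sub>A \<theta>) (\<lambda>a b. \<S>\<^sub>A (a \<star> i Y2) \<star> \<alpha>\<^sub>A \<star> (b \<star> i Y3))
      = sw2 k A (\<Delta>\<^sub>A \<theta>) (\<lambda>a b. \<S>\<^sub>A (i Y2) \<star> (\<S>\<^sub>A a \<star> \<alpha>\<^sub>A \<star> b) \<star> i Y3)"
      using Y by (intro A.sw2_cong) (simp_all add: A.antipode_mult A.A.m_assoc)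
    also have "\<dots> = \<epsilon>\<^sub>A \<theta> \<odot>\<^sub>A (\<S>\<^sub>A (i Y2) \<star> \<alpha>\<^sub>A \<star> i Y3)"
      using Y by (intro A.antipode_alpha_sw ql M) simp_all
    finally show "\<sigma> Y1 \<odot>\<^sub>A sw2 k A (\<Delta>\<^sub>A \<theta>) (\<lambda>a b. \<S>\<^sub>A (a \<star> i Y2) \<star> \<alpha>\<^sub>A \<star> (b \<star> i Y3)) = \<zero>\<^sub>A"
      using Y by (simp add: counit_\<theta>)
  qed simp
  also have "\<dots> = \<zero>\<^sub>A" by (simp add: H.sw3_zero[OF M])
  also have "sw3 k A \<Phi> (\<lambda>X1 X2 X3. \<sigma> X2 \<odot>\<^sub>A (\<S>\<^sub>A (i (X1 \<cdot> v)) \<star> \<alpha>\<^sub>A \<star> (\<theta> \<star> i X3))) = ?T"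
    by (intro H.sw3_cong) (simp_all add: A.antipode_mult H.antipode_mult i.antipode i.mult i.alpha A.A.m_assoc)
  finally have "?T \<oplus>\<^sub>A \<S>\<^sub>A \<theta> \<star> \<alpha>\<^sub>A \<star> \<one>\<^sub>A = \<zero>\<^sub>A" .
  moreover have "?T \<in> carrier A" by (intro H.sw3_closed[OF M]) simp_all
  ultimately show ?thesis
    using A.M.minus_equality[of "\<S>\<^sub>A \<theta> \<star> \<alpha>\<^sub>A" ?T] by (simp add: A.M.a_ac)
qed

lemma v_comm_apply:
  assumes V: "module k V" and f: "f \<in> lin k H V" and h: "h \<in> carrier H"
  shows "sw2 k V (\<Delta> h) (\<lambda>h1 h2. \<sigma> h1 \<odot>\<^sub>V f (v \<cdot> h2)) = sw2 k V (\<Delta> h) (\<lambda>h1 h2. \<sigma> h2 \<odot>\<^sub>V f (h1 \<cdot> v))"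
  using arg_cong[OF v_comm[OF h], of f] h
  by (simp add: H.lin_sw2[OF H.module_axioms V f] lin_smult[OF f] cong: H.sw2_cong)

text \<open>
  Multiply by \<open>1 = S(x\<^sup>1) \<alpha> x\<^sup>2 \<beta> S(x\<^sup>3)\<close> on the right and write \<open>S(\<theta>) S(x\<^sup>1)\<close> as \<open>S(x\<^sup>1 \<theta>)\<close>. The
  commutation rule for \<open>\<theta>\<close> produces \<open>S(\<theta>) \<alpha>\<close>, which is known, and the one for \<open>v\<close> brings \<open>v\<close> to
  the right of \<open>x\<^sup>1\<^sub>1\<close>.
\<close>

lemma antipode_\<theta>:
  "\<S>\<^sub>A \<theta> = \<ominus>\<^sub>A sw3 k A \<Phi> (\<lambda>X1 X2 X3. sw3 k A \<phi>i (\<lambda>x1 x2 x3. sw2 k A (\<Delta> x1) (\<lambda>x11 x12.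
      \<sigma> (X2 \<cdot> x12) \<odot>\<^sub>A (i (\<S> (X1 \<cdot> x11 \<cdot> v) \<cdot> \<alpha>) \<star> \<theta> \<star>
      i (X3 \<cdot> x2 \<cdot> \<beta> \<cdot> \<S> x3)))))"
proof -
  let ?w = "\<lambda>X1 X2 p q z. \<sigma> p \<odot>\<^sub>A (\<sigma> X2 \<odot>\<^sub>A (i (\<S> (X1 \<cdot> q) \<cdot> \<alpha>) \<star> \<theta> \<star> i z))"
  note M = A.module_axioms
  let ?T = "sw3 k A \<Phi> (\<lambda>X1 X2 X3.
    \<sigma> X2 \<odot>\<^sub>A (i (\<S> (X1 \<cdot> v) \<cdot> \<alpha>) \<star> \<theta> \<star> i X3))"
  have Tc: "?T \<in> carrier A" by (intro H.sw3_closed[OF M]) simp_all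
  have "\<S>\<^sub>A \<theta> = \<S>\<^sub>A \<theta> \<star> i \<one>\<^sub>H" by (simp add: i.one)
  also have "\<dots> = sw3 k A \<phi>i (\<lambda>x1 x2 x3. \<S>\<^sub>A \<theta> \<star> i (\<S> x1 \<cdot> \<alpha> \<cdot> x2 \<cdot> \<beta> \<cdot> \<S> x3))"
    by (intro H.antipode_reassoc_inv_sw[symmetric] ql M) simp_all
  also have "\<dots> = sw3 k A \<phi>i (\<lambda>x1 x2 x3. \<S>\<^sub>A (i x1 \<star> \<theta>) \<star> i (\<alpha> \<cdot> (x2 \<cdot> \<beta> \<cdot> \<S> x3)))"
    by (intro H.sw3_cong) (simp_all add: A.antipode_mult i.antipode i.mult A.A.m_assoc)
  also have "\<dots> = sw3 k A \<phi>i (\<lambda>x1 x2 x3. \<ominus>\<^sub>A sw2 k A (\<Delta> x1) (\<lambda>x11 x12. sw3 k A \<Phi> (\<lambda>X1 X2 X3.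
      ?w X1 X2 x11 (v \<cdot> x12) (X3 \<cdot> x2 \<cdot> \<beta> \<cdot> \<S> x3))))"
  proof (intro H.sw3_cong)
    fix x1 x2 x3 assume x: "x1 \<in> carrier H" "x2 \<in> carrier H" "x3 \<in> carrier H"
    define y where "y = x2 \<cdot> \<beta> \<cdot> \<S> x3"
    have y: "y \<in> carrier H" using x by (simp add: y_def)
    have l: "(\<lambda>z. \<S>\<^sub>A z \<star> i (\<alpha> \<cdot> y)) \<in> lin k A A" using y by (intro ql) simp_all
    have "\<S>\<^sub>A (i x1 \<star> \<theta>) \<star> i (\<alpha> \<cdot> y)
      = sw2 k A (\<Delta> x1) (\<lambda>x11 x12. \<S>\<^sub>A (\<sigma> x11 \<odot>\<^sub>A (\<theta> \<star> i x12)) \<star> i (\<alpha> \<cdot> y))"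
      unfolding i_\<theta>[OF x(1)] using x by (intro H.lin_sw2[OF M M l]) simp_all
    also have "\<dots> = sw2 k A (\<Delta> x1) (\<lambda>x11 x12. \<ominus>\<^sub>A sw3 k A \<Phi> (\<lambda>X1 X2 X3.
      ?w X1 X2 x11 (v \<cdot> x12) (X3 \<cdot> y)))"
    proof (intro H.sw2_cong)
      fix x11 x12 assume z: "x11 \<in> carrier H" "x12 \<in> carrier H"
      have l': "(\<lambda>z. \<sigma> x11 \<odot>\<^sub>A (i (\<S> x12) \<star> z \<star> i y)) \<in> lin k A A" using y z by (intro ql) simp_all
      have "\<S>\<^sub>A (\<sigma> x11 \<odot>\<^sub>A (\<theta> \<star> i x12)) \<star> i (\<alpha> \<cdot> y)
      = \<sigma> x11 \<odot>\<^sub>A (i (\<S> x12) \<star> (\<S>\<^sub>A \<theta> \<star> \<alpha>\<^sub>A) \<star> i y)"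
        using y z by (simp add: A.antipode_mult A.antipode_smult i.antipode i.mult i.alpha A.smult_mult_left A.A.m_assoc)
      also have "\<dots> = \<ominus>\<^sub>A (\<sigma> x11 \<odot>\<^sub>A (i (\<S> x12) \<star> ?T \<star> i y))"
      unfolding antipode_\<theta>_alpha using lin_zero[OF M M l'] lin_minus[OF M M l' A.M.zero_closed Tc] lin_closed[OF l' Tc] Tc by (simp add: A.M.minus_eq)
      also have "\<sigma> x11 \<odot>\<^sub>A (i (\<S> x12) \<star> ?T \<star> i y) = sw3 k A \<Phi> (\<lambda>X1 X2 X3. \<sigma> x11 \<odot>\<^sub>A (i (\<S> x12) \<star>
      (\<sigma> X2 \<odot>\<^sub>A (i (\<S> (X1 \<cdot> v) \<cdot> \<alpha>) \<star> \<theta> \<star> i X3)) \<star> i y))"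
        by (intro H.lin_sw3[OF M M l']) simp_all
      also have "\<dots> = sw3 k A \<Phi> (\<lambda>X1 X2 X3.
      ?w X1 X2 x11 (v \<cdot> x12) (X3 \<cdot> y))"
        using y z by (intro H.sw3_cong arg_cong[where f = "smult A _"])
      (simp_all add: H.antipode_mult i.mult A.smult_mult_left A.smult_mult_right A.A.m_assoc)
      finally show "\<S>\<^sub>A (\<sigma> x11 \<odot>\<^sub>A (\<theta> \<star> i x12)) \<star> i (\<alpha> \<cdot> y) = \<ominus>\<^sub>A sw3 k A \<Phi> (\<lambda>X1 X2 X3.
      ?w X1 X2 x11 (v \<cdot> x12) (X3 \<cdot> y))" .
    qed (simp add: x)
    also have "\<dots> = \<ominus>\<^sub>A sw2 k A (\<Delta> x1) (\<lambda>x11 x12. sw3 k A \<Phi> (\<lambda>X1 X2 X3.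
      ?w X1 X2 x11 (v \<cdot> x12) (X3 \<cdot> y)))"
      using x y by (intro H.lin_sw2[OF M M neg_lin[OF M lin_id], symmetric] H.sw3_closed M) simp_all
    finally show "\<S>\<^sub>A (i x1 \<star> \<theta>) \<star> i (\<alpha> \<cdot> (x2 \<cdot> \<beta> \<cdot> \<S> x3))
      = \<ominus>\<^sub>A sw2 k A (\<Delta> x1) (\<lambda>x11 x12. sw3 k A \<Phi> (\<lambda>X1 X2 X3.
      ?w X1 X2 x11 (v \<cdot> x12) (X3 \<cdot> x2 \<cdot> \<beta> \<cdot> \<S> x3)))"
      using x unfolding y_def by (simp add: H.A.m_assoc cong: H.sw_cong)
  qed simp
  also have "\<dots> = \<ominus>\<^sub>A sw3 k A \<phi>i (\<lambda>x1 x2 x3. sw2 k A (\<Delta> x1) (\<lambda>x11 x12. sw3 k A \<Phi> (\<lambda>X1 X2 X3.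
      ?w X1 X2 x11 (v \<cdot> x12) (X3 \<cdot> x2 \<cdot> \<beta> \<cdot> \<S> x3))))"
    by (intro H.lin_sw3[OF M M neg_lin[OF M lin_id], symmetric] H.sw3_closed H.sw2_closed M) simp_all
  also have "sw3 k A \<phi>i (\<lambda>x1 x2 x3. sw2 k A (\<Delta> x1) (\<lambda>x11 x12. sw3 k A \<Phi> (\<lambda>X1 X2 X3.
      ?w X1 X2 x11 (v \<cdot> x12) (X3 \<cdot> x2 \<cdot> \<beta> \<cdot> \<S> x3))))
    = sw3 k A \<phi>i (\<lambda>x1 x2 x3. sw3 k A \<Phi> (\<lambda>X1 X2 X3. sw2 k A (\<Delta> x1) (\<lambda>x11 x12.
      ?w X1 X2 x11 (v \<cdot> x12) (X3 \<cdot> x2 \<cdot> \<beta> \<cdot> \<S> x3))))"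
    by (intro H.sw3_cong H.sw2_sw3_swap[OF H.unital_algebra_axioms M]) simp_all
  also have "\<dots> = sw3 k A \<phi>i (\<lambda>x1 x2 x3. sw3 k A \<Phi> (\<lambda>X1 X2 X3. sw2 k A (\<Delta> x1) (\<lambda>x11 x12.
      ?w X1 X2 x12 (x11 \<cdot> v) (X3 \<cdot> x2 \<cdot> \<beta> \<cdot> \<S> x3))))"
    by (intro H.sw3_cong v_comm_apply M ql) simp_all
  also have "\<dots> = sw3 k A \<Phi> (\<lambda>X1 X2 X3. sw3 k A \<phi>i (\<lambda>x1 x2 x3. sw2 k A (\<Delta> x1) (\<lambda>x11 x12.
      ?w X1 X2 x12 (x11 \<cdot> v) (X3 \<cdot> x2 \<cdot> \<beta> \<cdot> \<S> x3))))"
    by (intro H.sw3_sw3_swap[OF H.unital_algebra_axioms M] H.sw2_closed M) simp_all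
  also have "\<dots> = sw3 k A \<Phi> (\<lambda>X1 X2 X3. sw3 k A \<phi>i (\<lambda>x1 x2 x3. sw2 k A (\<Delta> x1) (\<lambda>x11 x12.
      \<sigma> (X2 \<cdot> x12) \<odot>\<^sub>A (i (\<S> (X1 \<cdot> x11 \<cdot> v) \<cdot> \<alpha>) \<star> \<theta> \<star>
      i (X3 \<cdot> x2 \<cdot> \<beta> \<cdot> \<S> x3)))))"
    by (intro H.sw3_cong H.sw2_cong) (simp_all add: \<sigma>_mult A.smult_assoc1 A.smult_left_comm H.A.m_assoc)
  finally show ?thesis .
qed

end

end

section \<open>Algebras presented by one generator over a given algebra\<close>

lemma (in monoid_algebra) lincomb_alg_hom:
  assumes B: "unital_algebra k B" and f: "\<And>w. w \<in> carrier M \<Longrightarrow> f w \<in> carrier B"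
    and mult: "\<And>u v. \<lbrakk>u \<in> carrier M; v \<in> carrier M\<rbrakk> \<Longrightarrow> f (u \<otimes>\<^sub>M v) = f u \<otimes>\<^sub>B f v"
    and one: "f \<one>\<^sub>M = \<one>\<^sub>B"
  shows "(\<lambda>p. lincomb k B p f) \<in> alg_hom k F B"
proof -
  interpret B: unital_algebra k B by (rule B)
  note M = B.module_axioms
  have l: "(\<lambda>p. lincomb k B p f) \<in> lin k F B" by (rule lincomb_lin[OF M]) (rule f)
  have "lincomb k B (p \<otimes>\<^sub>F q) f = lincomb k B p f \<otimes>\<^sub>B lincomb k B q f"
    if p: "p \<in> carrier F" and q: "q \<in> carrier F" for p q
  proof -
    note ml = lin_mult[OF B lin_id]
    have "lincomb k B (p \<otimes>\<^sub>F q) f = lincomb k B p (\<lambda>u. lincomb k B q (\<lambda>v. f (u \<otimes>\<^sub>M v)))"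
      by (rule lincomb_mult[OF M p q f])
    also have "\<dots> = lincomb k B p (\<lambda>u. f u \<otimes>\<^sub>B lincomb k B q f)"
    proof (rule lincomb_cong[OF M p])
      fix u assume u: "u \<in> carrier M"
      have "lincomb k B q (\<lambda>v. f (u \<otimes>\<^sub>M v)) = lincomb k B q (\<lambda>v. f u \<otimes>\<^sub>B f v)"
        using u by (intro lincomb_cong[OF M q]) (simp_all add: mult f)
      then show "lincomb k B q (\<lambda>v. f (u \<otimes>\<^sub>M v)) = f u \<otimes>\<^sub>B lincomb k B q f"
        using lin_lincomb[OF M M ml(2)[OF f[OF u]] q f] by simp
      show "f u \<otimes>\<^sub>B lincomb k B q f \<in> carrier B" using u q by (simp add: f lincomb_closed[OF M])
    qed
    also have "\<dots> = lincomb k B p f \<otimes>\<^sub>B lincomb k B q f"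
      by (rule lin_lincomb[OF M M ml(1) p f, symmetric]) (simp add: lincomb_closed[OF M q f])
    finally show ?thesis .
  qed
  moreover have "lincomb k B \<one>\<^sub>F f = \<one>\<^sub>B" by (simp add: one_F lincomb_basis[OF M] f one)
  ultimately show ?thesis by (intro alg_homI) (simp_all add: lin_closed[OF l] lin_add[OF l] lin_smult[OF l])
qed

lemma alg_hom_comp: "\<lbrakk>g \<in> alg_hom k B C; f \<in> alg_hom k A B\<rbrakk> \<Longrightarrow> (\<lambda>x. g (f x)) \<in> alg_hom k A C"
  by (rule alg_homI) (simp_all add: alg_homD)

context unital_algebra
begin

lemma alg_hom_minus:
  assumes "unital_algebra k B" "f \<in> alg_hom k A B" "x \<in> carrier A" "y \<in> carrier A"
  shows "f (x \<ominus>\<^sub>A y) = f x \<ominus>\<^sub>B f y"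
  using lin_minus[OF module_axioms unital_algebra.axioms(2)[OF assms(1)] alg_hom_lin[OF assms(2)] assms(3,4)] .

lemma alg_hom_ideal_zero:
  assumes B: "unital_algebra k B" and f: "f \<in> alg_hom k A B" and S: "S \<subseteq> carrier A"
    and z: "\<And>s. s \<in> S \<Longrightarrow> f s = \<zero>\<^sub>B" and x: "x \<in> Idl\<^bsub>A\<^esub> S"
  shows "f x = \<zero>\<^sub>B"
proof -
  interpret B: unital_algebra k B by (rule B)
  have fr: "ring_hom_ring A B f"
    using f unfolding alg_hom_def by (blast intro: ring_hom_ringI2 A.ring_axioms B.A.ring_axioms)
  have "S \<subseteq> a_kernel A B f" using S z by (auto simp: a_kernel_def')
  then have "Idl\<^bsub>A\<^esub> S \<subseteq> a_kernel A B f"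
    by (rule A.genideal_minimal[OF ring_hom_ring.kernel_is_ideal[OF fr]])
  then show ?thesis using x by (auto simp: a_kernel_def')
qed

lemma quot_zero:
  assumes "S \<subseteq> carrier A" "s \<in> S"
  shows "Idl\<^bsub>A\<^esub> S +>\<^bsub>A\<^esub> s = \<zero>\<^bsub>quot_alg A (Idl\<^bsub>A\<^esub> S)\<^esub>"
proof -
  interpret I: ideal "Idl\<^bsub>A\<^esub> S" A by (rule A.genideal_ideal[OF assms(1)])
  have "Idl\<^bsub>A\<^esub> S +>\<^bsub>A\<^esub> s = Idl\<^bsub>A\<^esub> S +>\<^bsub>A\<^esub> \<zero>\<^sub>A"
    using assms A.genideal_self[OF assms(1)] by (subst coset_eq_iff[OF I.ideal_axioms]) (auto simp: a_minus_def)
  then show ?thesis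
    using lin_zero[OF module_axioms unital_algebra.axioms(2)[OF quot_unital_algebra[OF I.ideal_axioms]]
      alg_hom_lin[OF coset_alg_hom[OF I.ideal_axioms]]] by simp
qed

lemma monoid_algebra_words: "monoid_algebra k (word_monoid A)"
  by (intro monoid_algebra.intro field_axioms monoidI) (auto simp: word_monoid_def)

abbreviation "Wd \<equiv> mon_alg k (word_monoid A)"

lemma words_algebra: "unital_algebra k Wd"
  by (rule monoid_algebra.unital_algebra_F[OF monoid_algebra_words])

lemma words_one: "\<one>\<^sub>Wd = basis k []"
  using monoid_algebra.one_F[OF monoid_algebra_words] by (simp add: word_monoid_def)

lemma base_rels_closed: "base_rels k A \<subseteq> carrier Wd"
proof -
  interpret W: monoid_algebra k "word_monoid A" by (rule monoid_algebra_words)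
  interpret F: unital_algebra k Wd by (rule words_algebra)
  have "basis k w \<in> carrier Wd" if "set w \<subseteq> insert None (Some ` carrier A)" for w
    using that by (intro W.basis_mem) (auto simp: word_monoid_def)
  then show ?thesis by (auto simp: base_rels_def Let_def)
qed

lemma base_ideal: "ideal (base_ideal k A) Wd"
proof -
  interpret F: unital_algebra k Wd by (rule words_algebra)
  show ?thesis unfolding base_ideal_def by (rule F.A.genideal_ideal[OF base_rels_closed])
qed

abbreviation "Ad \<equiv> adjoin k A"

lemma adjoin_algebra: "unital_algebra k Ad"
  unfolding adjoin_def by (rule unital_algebra.quot_unital_algebra[OF words_algebra base_ideal])

abbreviation "wd w \<equiv> base_ideal k A +>\<^bsub>Wd\<^esub> basis k w"

lemma wd_hom: "(\<lambda>p. base_ideal k A +>\<^bsub>Wd\<^esub> p) \<in> alg_hom k Wd Ad"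
  unfolding adjoin_def by (rule unital_algebra.coset_alg_hom[OF words_algebra base_ideal])

lemma adjoin_gen_closed: "adjoin_gen k A \<in> carrier Ad"
  unfolding adjoin_gen_def
  by (rule alg_homD(1)[OF wd_hom], rule monoid_algebra.basis_mem[OF monoid_algebra_words]) (simp add: word_monoid_def)

lemma adjoin_emb_hom: "adjoin_emb k A \<in> alg_hom k A Ad"
proof -
  interpret W: monoid_algebra k "word_monoid A" by (rule monoid_algebra_words)
  interpret F: unital_algebra k Wd by (rule words_algebra)
  note h = alg_homD[OF wd_hom]
  have b: "basis k w \<in> carrier Wd" if "set w \<subseteq> insert None (Some ` carrier A)" for w
    using that by (intro W.basis_mem) (auto simp: word_monoid_def)
  have m: "basis k [Some x] \<otimes>\<^sub>Wd basis k [Some y] = basis k [Some x, Some y]" if "x \<in> carrier A" "y \<in> carrier A" for x y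
    using that by (subst W.basis_mult) (auto simp: word_monoid_def)
  have e: "base_ideal k A +>\<^bsub>Wd\<^esub> p = base_ideal k A +>\<^bsub>Wd\<^esub> q"
    if "p \<in> carrier Wd" "q \<in> carrier Wd" "p \<ominus>\<^sub>Wd q \<in> base_rels k A" for p q
    using that F.coset_eq_iff[OF base_ideal that(1,2)] F.A.genideal_self[OF base_rels_closed]
    by (auto simp: base_ideal_def)
  have r: "\<And>x y. \<lbrakk>x \<in> carrier A; y \<in> carrier A\<rbrakk> \<Longrightarrow>
      basis k [Some (x \<oplus>\<^sub>A y)] \<ominus>\<^sub>Wd (basis k [Some x] \<oplus>\<^sub>Wd basis k [Some y]) \<in> base_rels k A"
    "\<And>r x. \<lbrakk>r \<in> carrier k; x \<in> carrier A\<rbrakk> \<Longrightarrow>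
      basis k [Some (r \<odot>\<^sub>A x)] \<ominus>\<^sub>Wd r \<odot>\<^sub>Wd basis k [Some x] \<in> base_rels k A"
    "\<And>x y. \<lbrakk>x \<in> carrier A; y \<in> carrier A\<rbrakk> \<Longrightarrow>
      basis k [Some (x \<otimes>\<^sub>A y)] \<ominus>\<^sub>Wd basis k [Some x, Some y] \<in> base_rels k A"
    "basis k [Some \<one>\<^sub>A] \<ominus>\<^sub>Wd basis k [] \<in> base_rels k A"
    unfolding base_rels_def Let_def by blast+
  note d = adjoin_emb_def
  show ?thesis
  proof (rule alg_homI)
    show "adjoin_emb k A x \<in> carrier Ad" if "x \<in> carrier A" for x
      using that by (simp add: d h b)
    fix x assume x: "x \<in> carrier A"
    fix y assume y: "y \<in> carrier A"
    have "wd [Some (x \<oplus>\<^sub>A y)] = base_ideal k A +>\<^bsub>Wd\<^esub> (basis k [Some x] \<oplus>\<^sub>Wd basis k [Some y])"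
      using x y by (intro e r) (simp_all add: b W.F.smult_closed)
    then show "adjoin_emb k A (x \<oplus>\<^sub>A y) = adjoin_emb k A x \<oplus>\<^sub>Ad adjoin_emb k A y"
      using x y by (simp add: d h b)
    have "wd [Some (x \<otimes>\<^sub>A y)] = wd [Some x, Some y]"
      using x y by (intro e r) (simp_all add: b W.F.smult_closed)
    then show "adjoin_emb k A (x \<otimes>\<^sub>A y) = adjoin_emb k A x \<otimes>\<^sub>Ad adjoin_emb k A y"
      using x y by (simp add: d b m flip: h(4))
  next
    fix r x assume rx: "r \<in> carrier k" "x \<in> carrier A"
    have "wd [Some (r \<odot>\<^sub>A x)] = base_ideal k A +>\<^bsub>Wd\<^esub> (r \<odot>\<^sub>Wd basis k [Some x])"
      using rx by (intro e r) (simp_all add: b W.F.smult_closed)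
    then show "adjoin_emb k A (r \<odot>\<^sub>A x) = r \<odot>\<^sub>Ad adjoin_emb k A x"
      using rx by (simp add: d h b)
  next
    have "wd [Some \<one>\<^sub>A] = wd []" by (intro e r) (simp_all add: b W.F.smult_closed)
    then show "adjoin_emb k A \<one>\<^sub>A = \<one>\<^sub>Ad" using h(5) by (simp add: d words_one)
  qed
qed

text \<open>
  The universal property: a map on words is given by its values at letters, and it respects the
  relations of \<open>A\<close> because \<open>j\<close> is an algebra map.
\<close>

lemma adjoin_hom:
  assumes B: "unital_algebra k B" and j: "j \<in> alg_hom k A B" and t: "t \<in> carrier B"
  obtains g where "g \<in> alg_hom k Ad B" "\<And>h. h \<in> carrier A \<Longrightarrow> g (adjoin_emb k A h) = j h"
    "g (adjoin_gen k A) = t"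
proof -
  interpret W: monoid_algebra k "word_monoid A" by (rule monoid_algebra_words)
  interpret F: unital_algebra k Wd by (rule words_algebra)
  interpret B: unital_algebra k B by (rule B)
  define l where "l = (\<lambda>x. case x of None \<Rightarrow> t | Some h \<Rightarrow> j h)"
  define f where "f w = foldr (\<lambda>x b. l x \<otimes>\<^sub>B b) w \<one>\<^sub>B" for w
  have lc: "l x \<in> carrier B" if "x \<in> insert None (Some ` carrier A)" for x
    using that t alg_homD(1)[OF j] by (auto simp: l_def)
  have fc: "f w \<in> carrier B" if "set w \<subseteq> insert None (Some ` carrier A)" for w
    using that by (induction w) (auto simp: f_def lc)
  have fm: "f (u @ w) = f u \<otimes>\<^sub>B f w"
    if "set u \<subseteq> insert None (Some ` carrier A)" "set w \<subseteq> insert None (Some ` carrier A)" for u w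
    using that(1)
  proof (induction u)
    case Nil
    then show ?case using fc[OF that(2)] by (simp add: f_def)
  next
    case (Cons x u)
    then have "l x \<in> carrier B" "f u \<in> carrier B" by (simp_all add: lc fc)
    then show ?case using Cons fc[OF that(2)] by (simp add: f_def B.A.m_assoc)
  qed
  let ?G = "\<lambda>p. lincomb k B p f"
  have G: "?G \<in> alg_hom k Wd B"
    by (rule W.lincomb_alg_hom[OF B]) (auto simp: word_monoid_def fm[unfolded subset_iff] fc[unfolded subset_iff], simp_all add: f_def)
  have Gb: "?G (basis k w) = f w" if "set w \<subseteq> insert None (Some ` carrier A)" for w
    using that fc by (intro W.lincomb_basis[OF B.module_axioms]) (auto simp: word_monoid_def)
  have b: "basis k w \<in> carrier Wd" if "set w \<subseteq> insert None (Some ` carrier A)" for w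
    using that by (intro W.basis_mem) (auto simp: word_monoid_def)
  note Gm = F.alg_hom_minus[OF B G] alg_homD[OF G]
  have fs: "f [Some h] = j h" if "h \<in> carrier A" for h using that alg_homD(1)[OF j] by (simp add: f_def l_def)
  have "?G s = \<zero>\<^sub>B" if "s \<in> base_rels k A" for s
    using that alg_homD[OF j]
    by (auto simp: base_rels_def Let_def Gm b Gb fs B.M.r_neg B.M.minus_eq) (simp_all add: f_def l_def B.M.r_neg)
  then have G0: "?G p = \<zero>\<^sub>B" if "p \<in> base_ideal k A" for p
    using F.alg_hom_ideal_zero[OF B G base_rels_closed] that by (simp add: base_ideal_def)
  have ind: "induced ?G (wd w) = f w" if "set w \<subseteq> insert None (Some ` carrier A)" for w
    using F.induced_coset[OF base_ideal B.module_axioms alg_hom_lin[OF G] G0 b] that by (simp add: Gb)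
  show thesis
  proof (rule that)
    show "induced ?G \<in> alg_hom k Ad B"
      unfolding adjoin_def by (rule F.induced_alg_hom[OF base_ideal B G G0])
    show "induced ?G (adjoin_emb k A h) = j h" if "h \<in> carrier A" for h
      using that by (simp add: adjoin_emb_def ind fs)
    show "induced ?G (adjoin_gen k A) = t"
      using t by (simp add: adjoin_gen_def ind) (simp add: f_def l_def)
  qed
qed

lemma adjoin_induct [consumes 1, case_names zero one add smult emb gen]:
  assumes x: "x \<in> carrier Ad"
    and zero: "P \<zero>\<^sub>Ad" and one: "P \<one>\<^sub>Ad"
    and add: "\<And>x y. \<lbrakk>x \<in> carrier Ad; y \<in> carrier Ad; P x; P y\<rbrakk> \<Longrightarrow> P (x \<oplus>\<^sub>Ad y)"
    and smult: "\<And>r x. \<lbrakk>r \<in> carrier k; x \<in> carrier Ad; P x\<rbrakk> \<Longrightarrow> P (r \<odot>\<^sub>Ad x)"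
    and emb: "\<And>h x. \<lbrakk>h \<in> carrier A; x \<in> carrier Ad; P x\<rbrakk> \<Longrightarrow> P (adjoin_emb k A h \<otimes>\<^sub>Ad x)"
    and gen: "\<And>x. \<lbrakk>x \<in> carrier Ad; P x\<rbrakk> \<Longrightarrow> P (adjoin_gen k A \<otimes>\<^sub>Ad x)"
  shows "P x"
proof -
  interpret W: monoid_algebra k "word_monoid A" by (rule monoid_algebra_words)
  interpret F: unital_algebra k Wd by (rule words_algebra)
  note h = alg_homD[OF wd_hom]
  have b: "basis k w \<in> carrier Wd" if "set w \<subseteq> insert None (Some ` carrier A)" for w
    using that by (intro W.basis_mem) (auto simp: word_monoid_def)
  have w: "P (wd w)" if "set w \<subseteq> insert None (Some ` carrier A)" for w
    using that
  proof (induction w)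
    case Nil
    then show ?case using one h(5) by (simp add: words_one)
  next
    case (Cons y w)
    have "basis k (y # w) = basis k [y] \<otimes>\<^sub>Wd basis k w"
      using Cons.prems by (subst W.basis_mult) (auto simp: word_monoid_def)
    then have "wd (y # w) = wd [y] \<otimes>\<^sub>Ad wd w" using Cons.prems by (simp add: h b)
    moreover have "P (wd [y] \<otimes>\<^sub>Ad wd w)"
      using Cons emb[of _ "wd w"] gen[of "wd w"] h(1)[OF b[of w]]
      by (auto simp: adjoin_emb_def adjoin_gen_def)
    ultimately show ?case by simp
  qed
  obtain p where p: "p \<in> carrier Wd" "x = base_ideal k A +>\<^bsub>Wd\<^esub> p"
    using x F.coset_surj[OF base_ideal] by (auto simp: adjoin_def)
  from p(1) have "P (base_ideal k A +>\<^bsub>Wd\<^esub> p)"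
  proof (induction rule: W.mon_alg_induct)
    case zero
    then show ?case using \<open>P \<zero>\<^sub>Ad\<close>
      lin_zero[OF W.module_F unital_algebra.axioms(2)[OF adjoin_algebra] alg_hom_lin[OF wd_hom]] by simp
  next
    case (basis v r)
    then have "set v \<subseteq> insert None (Some ` carrier A)" by (auto simp: word_monoid_def)
    then show ?case using basis smult h(1) by (simp add: h(3) b w)
  next
    case (add p q)
    then show ?case using \<open>\<And>x y. \<lbrakk>x \<in> carrier Ad; y \<in> carrier Ad; P x; P y\<rbrakk> \<Longrightarrow> P (x \<oplus>\<^sub>Ad y)\<close>
      by (simp add: h)
  qed
  then show ?thesis by (simp add: p)
qed

context
  fixes R
  assumes R: "R \<subseteq> carrier Ad"
begin

interpretation Ad: unital_algebra k Ad by (rule adjoin_algebra)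

abbreviation "Pr \<equiv> presented k A R"
abbreviation "pr x \<equiv> Idl\<^bsub>Ad\<^esub> R +>\<^sub>Ad x"

lemma presented_algebra: "unital_algebra k Pr"
  unfolding presented_def by (rule Ad.quot_unital_algebra[OF Ad.A.genideal_ideal[OF R]])

lemma pr_hom: "(\<lambda>x. pr x) \<in> alg_hom k Ad Pr"
  unfolding presented_def by (rule Ad.coset_alg_hom[OF Ad.A.genideal_ideal[OF R]])

lemma pr_rel: "r \<in> R \<Longrightarrow> pr r = \<zero>\<^sub>Pr"
  unfolding presented_def by (rule Ad.quot_zero[OF R])

lemma presented_emb_hom: "presented_emb k A R \<in> alg_hom k A Pr"
  using alg_hom_comp[OF pr_hom adjoin_emb_hom] by (simp add: presented_emb_def[abs_def])

lemma presented_gen_closed: "presented_gen k A R \<in> carrier Pr"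
  unfolding presented_gen_def by (rule alg_homD(1)[OF pr_hom adjoin_gen_closed])

text \<open>
  By the hypotheses \<open>move\<close> and \<open>square\<close>, the sum of \<open>A\<close> and the generator times \<open>A\<close> in the
  presented algebra is stable under left multiplication by all generators, so it is the whole
  algebra. The canonical map to \<open>B\<close> is then injective, as the corresponding sum is direct in \<open>B\<close>;
  the isomorphism obtained is its inverse.
\<close>

lemma presented_iso:
  assumes B: "unital_algebra k B" and j: "j \<in> alg_hom k A B" and t: "t \<in> carrier B"
    and kills: "\<And>g r. \<lbrakk>g \<in> alg_hom k Ad B; \<And>h. h \<in> carrier A \<Longrightarrow> g (adjoin_emb k A h) = j h;
      g (adjoin_gen k A) = t; r \<in> R\<rbrakk> \<Longrightarrow> g r = \<zero>\<^sub>B"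
    and move: "\<And>h. h \<in> carrier A \<Longrightarrow> \<exists>h1\<in>carrier A. \<exists>h2\<in>carrier A.
      presented_emb k A R h \<otimes>\<^sub>Pr presented_gen k A R
      = presented_emb k A R h1 \<oplus>\<^sub>Pr presented_gen k A R \<otimes>\<^sub>Pr presented_emb k A R h2"
    and square: "\<exists>h1\<in>carrier A. \<exists>h2\<in>carrier A. presented_gen k A R \<otimes>\<^sub>Pr presented_gen k A R
      = presented_emb k A R h1 \<oplus>\<^sub>Pr presented_gen k A R \<otimes>\<^sub>Pr presented_emb k A R h2"
    and span: "\<And>b. b \<in> carrier B \<Longrightarrow> \<exists>h1\<in>carrier A. \<exists>h2\<in>carrier A. b = j h1 \<oplus>\<^sub>B t \<otimes>\<^sub>B j h2"
    and direct: "\<And>h1 h2. \<lbrakk>h1 \<in> carrier A; h2 \<in> carrier A; j h1 \<oplus>\<^sub>B t \<otimes>\<^sub>B j h2 = \<zero>\<^sub>B\<rbrakk>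
      \<Longrightarrow> h1 = \<zero>\<^sub>A \<and> h2 = \<zero>\<^sub>A"
  obtains f where "f \<in> alg_hom k B Pr" "bij_betw f (carrier B) (carrier Pr)"
    "\<And>h. h \<in> carrier A \<Longrightarrow> f (j h) = presented_emb k A R h" "f t = presented_gen k A R"
proof -
  interpret B: unital_algebra k B by (rule B)
  interpret Q: unital_algebra k Pr by (rule presented_algebra)
  let ?e = "presented_emb k A R" and ?t = "presented_gen k A R"
  note e = alg_homD[OF presented_emb_hom]
  note tc = presented_gen_closed
  note ez = lin_zero[OF module_axioms Q.module_axioms alg_hom_lin[OF presented_emb_hom]]
  note jh = alg_homD[OF j]
  obtain g where g: "g \<in> alg_hom k Ad B" "\<And>h. h \<in> carrier A \<Longrightarrow> g (adjoin_emb k A h) = j h"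
    "g (adjoin_gen k A) = t" using adjoin_hom[OF B j t] by blast
  have g0: "g x = \<zero>\<^sub>B" if "x \<in> Idl\<^bsub>Ad\<^esub> R" for x
    by (rule Ad.alg_hom_ideal_zero[OF B g(1) R kills[OF g] that])
  define q where "q = induced g"
  note gi = Ad.A.genideal_ideal[OF R]
  have q: "q \<in> alg_hom k Pr B"
    unfolding q_def presented_def by (rule Ad.induced_alg_hom[OF gi B g(1) g0])
  have qp: "q (pr x) = g x" if "x \<in> carrier Ad" for x
    unfolding q_def by (rule Ad.induced_coset[OF gi B.module_axioms alg_hom_lin[OF g(1)] g0 that])
  have qe: "q (?e h) = j h" if "h \<in> carrier A" for h
    using that g(2) alg_homD(1)[OF adjoin_emb_hom that] by (simp add: presented_emb_def qp)
  have qt: "q ?t = t" by (simp add: presented_gen_def qp adjoin_gen_closed g(3))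
  note qh = alg_homD[OF q]
  let ?S = "\<lambda>x. \<exists>h1\<in>carrier A. \<exists>h2\<in>carrier A. x = ?e h1 \<oplus>\<^sub>Pr ?t \<otimes>\<^sub>Pr ?e h2"
  have Sadd: "?S (x \<oplus>\<^sub>Pr y)" if x: "?S x" and y: "?S y" for x y
  proof -
    obtain h1 h2 g1 g2 where h: "h1 \<in> carrier A" "h2 \<in> carrier A" "g1 \<in> carrier A" "g2 \<in> carrier A"
      and xy: "x = ?e h1 \<oplus>\<^sub>Pr ?t \<otimes>\<^sub>Pr ?e h2" "y = ?e g1 \<oplus>\<^sub>Pr ?t \<otimes>\<^sub>Pr ?e g2"
      using x y by blast
    have "x \<oplus>\<^sub>Pr y = ?e (h1 \<oplus>\<^sub>A g1) \<oplus>\<^sub>Pr ?t \<otimes>\<^sub>Pr ?e (h2 \<oplus>\<^sub>A g2)"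
      using h by (simp add: xy e tc Q.A.r_distr Q.M.a_ac)
    then show ?thesis using h by blast
  qed
  have Smult: "?S (x \<otimes>\<^sub>Pr ?e h)" if x: "?S x" and h: "h \<in> carrier A" for x h
  proof -
    obtain h1 h2 where h': "h1 \<in> carrier A" "h2 \<in> carrier A" and x: "x = ?e h1 \<oplus>\<^sub>Pr ?t \<otimes>\<^sub>Pr ?e h2"
      using x by blast
    have "x \<otimes>\<^sub>Pr ?e h = ?e (h1 \<otimes>\<^sub>A h) \<oplus>\<^sub>Pr ?t \<otimes>\<^sub>Pr ?e (h2 \<otimes>\<^sub>A h)"
      using h h' by (simp add: x e tc Q.A.l_distr Q.A.m_assoc)
    then show ?thesis using h h' by blast
  qed
  have Se: "?S (?e h)" if "h \<in> carrier A" for h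
    using that ez e tc by (intro bexI[of _ h] bexI[of _ "\<zero>\<^sub>A"]) simp_all
  have St: "?S (?t \<otimes>\<^sub>Pr ?e h)" if "h \<in> carrier A" for h
    using that ez e tc by (intro bexI[of _ h] bexI[of _ "\<zero>\<^sub>A"]) simp_all
  have "?S (pr x)" if "x \<in> carrier Ad" for x
    using that
  proof (induction rule: adjoin_induct)
    case zero
    show ?case using Se[OF M.zero_closed] ez
      lin_zero[OF Ad.module_axioms Q.module_axioms alg_hom_lin[OF pr_hom]] by simp
  next
    case one
    then show ?case using Se[OF A.one_closed] by (simp add: e(5) alg_homD(5)[OF pr_hom])
  next
    case (add x y)
    then show ?case using Sadd by (simp add: alg_homD(2)[OF pr_hom])
  next
    case (smult r x)
    have "pr (r \<odot>\<^sub>Ad x) = pr x \<otimes>\<^sub>Pr ?e (r \<odot>\<^sub>A \<one>\<^sub>A)"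
      using smult by (simp add: alg_homD[OF pr_hom] e Q.smult_mult_right)
    then show ?case using smult Smult by simp
  next
    case (emb h x)
    then obtain h1 h2 where h: "h1 \<in> carrier A" "h2 \<in> carrier A" and x: "pr x = ?e h1 \<oplus>\<^sub>Pr ?t \<otimes>\<^sub>Pr ?e h2"
      by blast
    have "pr (adjoin_emb k A h \<otimes>\<^sub>Ad x) = ?e h \<otimes>\<^sub>Pr pr x"
      using emb alg_homD(1)[OF adjoin_emb_hom] by (simp add: alg_homD(4)[OF pr_hom] presented_emb_def)
    also have "\<dots> = ?e (h \<otimes>\<^sub>A h1) \<oplus>\<^sub>Pr (?e h \<otimes>\<^sub>Pr ?t) \<otimes>\<^sub>Pr ?e h2"
      using h emb by (simp add: x e tc Q.A.r_distr Q.A.m_assoc)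
    finally show ?case using Sadd[OF Se Smult[OF move]] h emb by simp
  next
    case (gen x)
    then obtain h1 h2 where h: "h1 \<in> carrier A" "h2 \<in> carrier A" and x: "pr x = ?e h1 \<oplus>\<^sub>Pr ?t \<otimes>\<^sub>Pr ?e h2"
      by blast
    have "pr (adjoin_gen k A \<otimes>\<^sub>Ad x) = ?t \<otimes>\<^sub>Pr pr x"
      using gen adjoin_gen_closed by (simp add: alg_homD(4)[OF pr_hom] presented_gen_def)
    also have "\<dots> = ?t \<otimes>\<^sub>Pr ?e h1 \<oplus>\<^sub>Pr (?t \<otimes>\<^sub>Pr ?t) \<otimes>\<^sub>Pr ?e h2"
      using h by (simp add: x e tc Q.A.r_distr Q.A.m_assoc)
    finally show ?case using Sadd[OF St Smult[OF square]] h by simp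
  qed
  then have S: "?S y" if "y \<in> carrier Pr" for y
    using that Ad.coset_surj[OF gi] by (auto simp: presented_def)
  have inj: "inj_on q (carrier Pr)"
  proof (rule inj_onI)
    fix x y assume xy: "x \<in> carrier Pr" "y \<in> carrier Pr" "q x = q y"
    obtain h1 h2 where h: "h1 \<in> carrier A" "h2 \<in> carrier A" and d: "x \<ominus>\<^sub>Pr y = ?e h1 \<oplus>\<^sub>Pr ?t \<otimes>\<^sub>Pr ?e h2"
      using S[of "x \<ominus>\<^sub>Pr y"] xy by auto
    have "j h1 \<oplus>\<^sub>B t \<otimes>\<^sub>B j h2 = q (x \<ominus>\<^sub>Pr y)" using h by (simp add: d qh qe qt e tc)
    also have "\<dots> = \<zero>\<^sub>B" using xy Q.alg_hom_minus[OF B q] by (simp add: qh B.M.minus_eq B.M.r_neg)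
    finally have "h1 = \<zero>\<^sub>A \<and> h2 = \<zero>\<^sub>A" by (rule direct[OF h])
    then have "x \<ominus>\<^sub>Pr y = \<zero>\<^sub>Pr" using tc by (simp add: d ez)
    moreover have "x = (x \<ominus>\<^sub>Pr y) \<oplus>\<^sub>Pr y"
      using xy by (simp add: Q.M.minus_eq Q.M.a_assoc Q.M.l_neg)
    ultimately show "x = y" using xy by simp
  qed
  have "\<exists>x\<in>carrier Pr. b = q x" if b: "b \<in> carrier B" for b
  proof -
    obtain h1 h2 where h: "h1 \<in> carrier A" "h2 \<in> carrier A" "b = j h1 \<oplus>\<^sub>B t \<otimes>\<^sub>B j h2" using span[OF b] by blast
    then have "b = q (?e h1 \<oplus>\<^sub>Pr ?t \<otimes>\<^sub>Pr ?e h2)" by (simp add: qh qe qt e tc)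
    moreover have "?e h1 \<oplus>\<^sub>Pr ?t \<otimes>\<^sub>Pr ?e h2 \<in> carrier Pr" using h e(1) tc by simp
    ultimately show ?thesis by blast
  qed
  then have "q ` carrier Pr = carrier B" using qh(1) by auto
  with inj have bij: "bij_betw q (carrier Pr) (carrier B)" by (simp add: bij_betw_def)
  let ?f = "inv_into (carrier Pr) q"
  have fq: "?f (q x) = x" if "x \<in> carrier Pr" for x using inj that by simp
  have qf: "?f b \<in> carrier Pr" "q (?f b) = b" if "b \<in> carrier B" for b
    using bij that by (auto simp: bij_betw_def inv_into_into f_inv_into_f)
  have ff: "?f y = x" if "x \<in> carrier Pr" "q x = y" for x y using that fq by blast
  show thesis
  proof (rule that)
    show "?f \<in> alg_hom k B Pr"
      by (rule alg_homI; (rule ff)?) (simp_all add: qf qh)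
    show "bij_betw ?f (carrier B) (carrier Pr)" by (rule bij_betw_inv_into[OF bij])
    show "?f (j h) = ?e h" if "h \<in> carrier A" for h using fq[of "?e h"] that by (simp add: qe e)
    show "?f t = ?t" using fq[OF tc] by (simp add: qt)
  qed
qed

end

end

section \<open>Transport of structure\<close>

context unital_algebra
begin

context
  fixes B f
  assumes B: "unital_algebra k B" and f: "f \<in> alg_hom k A B"
begin

lemma tmap_multilin: "multilin k A (tpow k B n) n (\<lambda>w. tens k B (map f w))"
proof -
  note m = multilinD[OF unital_algebra.multilin_tens[OF B, of n]]
  have c: "set (map f w) \<subseteq> carrier B" if "set w \<subseteq> carrier A" for w
    using that alg_homD(1)[OF f] by auto
  have "(\<lambda>a. tens k B (map f us @ f a # map f vs)) \<in> lin k A (tpow k B n)"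
    if "length us + length vs + 1 = n" "set us \<subseteq> carrier A" "set vs \<subseteq> carrier A" for us vs
    using that by (intro lin_comp[OF m(2) alg_hom_lin[OF f]] c) simp_all
  then show ?thesis using m(1) c by (simp add: multilin_def del: set_map)
qed

lemma tmap_tens: "\<lbrakk>length w = n; set w \<subseteq> carrier A\<rbrakk> \<Longrightarrow> tmap k B n f (tens k A w) = tens k B (map f w)"
  unfolding tmap_def by (rule tlift_tens[OF unital_algebra.tpow_module[OF B] tmap_multilin])

lemma tmap_lin: "tmap k B n f \<in> lin k (tpow k A n) (tpow k B n)"
  unfolding tmap_def[abs_def] by (rule tlift_arg_lin[OF unital_algebra.tpow_module[OF B] tmap_multilin])

lemma tmap_alg_hom: "tmap k B n f \<in> alg_hom k (tpow k A n) (tpow k B n)"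
  unfolding tmap_def[abs_def]
proof (rule tlift_alg_hom[OF unital_algebra.tpow_algebra[OF B] tmap_multilin])
  interpret B: unital_algebra k B by (rule B)
  note fh = alg_homD[OF f]
  have c: "set (map f w) \<subseteq> carrier B" if "set w \<subseteq> carrier A" for w using that fh(1) by auto
  fix u w assume u: "length u = n" "set u \<subseteq> carrier A" and w: "length w = n" "set w \<subseteq> carrier A"
  have "map f (map2 (mult A) u w) = map2 (mult B) (map f u) (map f w)"
    using u w fh(4) by (intro nth_equalityI) (auto simp: subset_iff in_set_conv_nth)
  then show "tens k B (map f (map2 (mult A) u w)) = tens k B (map f u) \<otimes>\<^bsub>tpow k B n\<^esub> tens k B (map f w)"
    using u w c by (simp add: B.tens_mult del: set_map)
next
  show "tens k B (map f (replicate n \<one>\<^sub>A)) = \<one>\<^bsub>tpow k B n\<^esub>"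
    by (simp add: alg_homD(5)[OF f] unital_algebra.tens_one[OF B])
qed

end

end

text \<open>
  The hypotheses define all operations of \<open>Q\<close> by those of \<open>A\<close> under the mutually inverse algebra
  maps \<open>f\<close> and \<open>g\<close>.
\<close>

locale quasi_hopf_transport = A: quasi_hopf_algebra k A + Q: unital_algebra k Q
  for k :: "('k, 'm) ring_scheme" (structure) and A :: "('k, 'a, 'y) quasi_hopf_scheme"
    and Q :: "('k, 'q, 'z) quasi_hopf_scheme" +
  fixes f :: "'a \<Rightarrow> 'q" and g :: "'q \<Rightarrow> 'a"
  assumes f: "f \<in> alg_hom k A Q" and g: "g \<in> alg_hom k Q A"
    and gf: "a \<in> carrier A \<Longrightarrow> g (f a) = a" and fg: "q \<in> carrier Q \<Longrightarrow> f (g q) = q"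
    and comult_Q: "q \<in> carrier Q \<Longrightarrow> comult Q q = tmap k Q 2 f (comult A (g q))"
    and counit_Q: "q \<in> carrier Q \<Longrightarrow> counit Q q = counit A (g q)"
    and reassoc_Q: "reassoc Q = tmap k Q 3 f (reassoc A)"
    and antipode_Q: "q \<in> carrier Q \<Longrightarrow> antipode Q q = f (antipode A (g q))"
    and alpha_Q: "alpha Q = f (alpha A)" and beta_Q: "beta Q = f (beta A)"
begin

abbreviation "\<Delta>\<^sub>A \<equiv> comult A"
abbreviation "\<epsilon>\<^sub>A \<equiv> counit A"
abbreviation "\<Phi>\<^sub>A \<equiv> reassoc A"
abbreviation "\<S>\<^sub>A \<equiv> antipode A"
abbreviation "\<alpha>\<^sub>A \<equiv> alpha A"
abbreviation "\<beta>\<^sub>A \<equiv> beta A"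
abbreviation "\<Delta>\<^sub>Q \<equiv> comult Q"
abbreviation "\<epsilon>\<^sub>Q \<equiv> counit Q"
abbreviation "\<Phi>\<^sub>Q \<equiv> reassoc Q"
abbreviation "\<S>\<^sub>Q \<equiv> antipode Q"
abbreviation "\<alpha>\<^sub>Q \<equiv> alpha Q"
abbreviation "\<beta>\<^sub>Q \<equiv> beta Q"

abbreviation "T n \<equiv> tmap k Q n f"

lemmas T_hom = A.tmap_alg_hom[OF Q.unital_algebra_axioms f]
lemmas T_lin = A.tmap_lin[OF Q.unital_algebra_axioms f]
lemmas Th = alg_homD[OF T_hom]
lemmas fh = alg_homD[OF f]
lemmas gh = alg_homD[OF g]
lemmas tc = A.qh_closed Q.tpow_module fh(1) gh(1) A.tens_closed Q.tens_closed
lemmas f_lin = alg_hom_lin[OF f]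

lemma T_tens:
  "\<lbrakk>a \<in> carrier A; b \<in> carrier A\<rbrakk> \<Longrightarrow> T 2 (tens k A [a, b]) = tens k Q [f a, f b]"
  "\<lbrakk>a \<in> carrier A; b \<in> carrier A; c \<in> carrier A\<rbrakk> \<Longrightarrow> T 3 (tens k A [a, b, c]) = tens k Q [f a, f b, f c]"
  "\<lbrakk>a \<in> carrier A; b \<in> carrier A; c \<in> carrier A; d \<in> carrier A\<rbrakk> \<Longrightarrow>
    T 4 (tens k A [a, b, c, d]) = tens k Q [f a, f b, f c, f d]"
  by (simp_all add: A.tmap_tens[OF Q.unital_algebra_axioms f])

text \<open>
  Evaluation of Sweedler expressions commutes with transport, so each axiom for \<open>Q\<close> becomes the
  axiom for \<open>A\<close> with \<open>f\<close> applied to it.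
\<close>

lemma T_sw:
  assumes V: "module k V"
  shows "\<lbrakk>bilin k Q V h; t \<in> carrier (tpow k A 2)\<rbrakk> \<Longrightarrow> sw2 k V (T 2 t) h = sw2 k V t (\<lambda>a b. h (f a) (f b))"
    and "\<lbrakk>trilin k Q V h'; s \<in> carrier (tpow k A 3)\<rbrakk> \<Longrightarrow> sw3 k V (T 3 s) h' = sw3 k V s (\<lambda>a b c. h' (f a) (f b) (f c))"
proof -
  have t: "T 2 t = sw2 k (tpow k Q 2) t (\<lambda>a b. tens k Q [f a, f b])" if "t \<in> carrier (tpow k A 2)" for t
    unfolding tmap_def sw2_def using that by (rule A.tlift_cong_closed_free) (auto simp: A.length_cases)
  show "\<lbrakk>bilin k Q V h; t \<in> carrier (tpow k A 2)\<rbrakk> \<Longrightarrow> sw2 k V (T 2 t) h = sw2 k V t (\<lambda>a b. h (f a) (f b))"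
    by (simp add: t Q.sw2_sw2[OF A.unital_algebra_axioms V] Q.sw2_tens[OF V] tc cong: A.sw_cong)
  have s: "T 3 s = sw3 k (tpow k Q 3) s (\<lambda>a b c. tens k Q [f a, f b, f c])" if "s \<in> carrier (tpow k A 3)" for s
    unfolding tmap_def sw3_def using that by (rule A.tlift_cong_closed_free) (auto simp: A.length_cases)
  show "\<lbrakk>trilin k Q V h'; s \<in> carrier (tpow k A 3)\<rbrakk> \<Longrightarrow> sw3 k V (T 3 s) h' = sw3 k V s (\<lambda>a b c. h' (f a) (f b) (f c))"
    by (simp add: s Q.sw3_sw3[OF A.unital_algebra_axioms V] Q.sw3_tens[OF V] tc cong: A.sw_cong)
qed

lemma comult_Q_sw:
  assumes "module k V" "bilin k Q V h" "q \<in> carrier Q"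
  shows "sw2 k V (\<Delta>\<^sub>Q q) h = sw2 k V (\<Delta>\<^sub>A (g q)) (\<lambda>a b. h (f a) (f b))"
  using assms by (simp add: comult_Q T_sw tc)

lemma reassoc_Q_sw:
  assumes "module k V" "trilin k Q V h"
  shows "sw3 k V \<Phi>\<^sub>Q h = sw3 k V \<Phi>\<^sub>A (\<lambda>a b c. h (f a) (f b) (f c))"
  using assms by (simp add: reassoc_Q T_sw tc)

lemma reassoc_Q_inverse:
  "\<Phi>\<^sub>Q \<in> Units (tpow k Q 3)" "reassoc_inv k Q = T 3 (reassoc_inv k A)"
proof -
  interpret TQ: unital_algebra k "tpow k Q 3" by (rule Q.tpow_algebra)
  have c: "\<Phi>\<^sub>Q \<in> carrier (tpow k Q 3)" "T 3 (reassoc_inv k A) \<in> carrier (tpow k Q 3)" by (simp_all add: reassoc_Q Th tc)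
  have i: "\<Phi>\<^sub>Q \<otimes>\<^bsub>tpow k Q 3\<^esub> T 3 (reassoc_inv k A) = \<one>\<^bsub>tpow k Q 3\<^esub>"
    "T 3 (reassoc_inv k A) \<otimes>\<^bsub>tpow k Q 3\<^esub> \<Phi>\<^sub>Q = \<one>\<^bsub>tpow k Q 3\<^esub>"
    by (simp_all add: reassoc_Q tc A.reassoc_mult_inv A.reassoc_inv_mult Th(5) flip: Th(4))
  show "\<Phi>\<^sub>Q \<in> Units (tpow k Q 3)" using c i by (auto simp: Units_def)
  show "reassoc_inv k Q = T 3 (reassoc_inv k A)"
    unfolding reassoc_inv_def[of k Q] by (rule TQ.A.inv_char[OF c i])
qed

lemma comult_Q_lin: "\<Delta>\<^sub>Q \<in> alg_hom k Q (tpow k Q 2)"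
  by (rule alg_homI) (simp_all add: comult_Q Th gh tc alg_homD[OF A.comult_hom])

lemma counit_Q_lin: "\<epsilon>\<^sub>Q \<in> alg_char k Q"
  unfolding alg_char_def
  by (auto simp: counit_Q gh tc lin_add[OF A.counit_lin] lin_smult[OF A.counit_lin] A.counit_mult A.counit_one intro!: ring_hom_memI)

lemmas Q_lin = Q.sw_lin_rules lin_comp[OF alg_hom_lin[OF comult_Q_lin]] lin_comp[OF alg_char_lin[OF counit_Q_lin]]
  lin_comp[OF f_lin] lin_comp[OF alg_hom_lin[OF g]] lin_comp[OF A.antipode_lin]

lemma antipode_Q_lin: "\<S>\<^sub>Q \<in> lin k Q Q"
  by (rule linI) (simp_all add: antipode_Q gh fh tc A.antipode_add A.antipode_smult)

lemma Q_closed: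
  "q \<in> carrier Q \<Longrightarrow> \<Delta>\<^sub>Q q \<in> carrier (tpow k Q 2)" "q \<in> carrier Q \<Longrightarrow> \<epsilon>\<^sub>Q q \<in> carrier k"
  "q \<in> carrier Q \<Longrightarrow> \<S>\<^sub>Q q \<in> carrier Q" "\<alpha>\<^sub>Q \<in> carrier Q" "\<beta>\<^sub>Q \<in> carrier Q"
  "module k Q" "unital_algebra k Q"
  by (simp_all add: comult_Q counit_Q antipode_Q alpha_Q beta_Q Th tc Q.module_axioms Q.unital_algebra_axioms)

lemma quasi_bialgebra_Q: "quasi_bialgebra k Q"
proof (intro quasi_bialgebra.intro Q.unital_algebra_axioms quasi_bialgebra_axioms.intro)
  show "\<Delta>\<^sub>Q \<in> alg_hom k Q (tpow k Q 2)" by (rule comult_Q_lin)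
  show "\<epsilon>\<^sub>Q \<in> alg_char k Q" by (rule counit_Q_lin)
  show "\<Phi>\<^sub>Q \<in> Units (tpow k Q 3)" by (rule reassoc_Q_inverse)
  note M = Q.tpow_module
  note p2 = A.lin_sw2[OF A.tpow_module M T_lin] and p3 = A.lin_sw3[OF A.tpow_module M T_lin]
  note cg = arg_cong2[where f = "mult (tpow k Q _)"]
  fix h assume h: "h \<in> carrier Q"
  have "sw2 k (tpow k Q 3) (\<Delta>\<^sub>Q h) (\<lambda>a b. sw2 k (tpow k Q 3) (\<Delta>\<^sub>Q b) (\<lambda>b1 b2. tens k Q [a, b1, b2]))
    = sw2 k (tpow k Q 3) (\<Delta>\<^sub>A (g h)) (\<lambda>a b. sw2 k (tpow k Q 3) (\<Delta>\<^sub>Q (f b)) (\<lambda>b1 b2. tens k Q [f a, b1, b2]))"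
    using h by (intro comult_Q_sw M Q_lin bilinI Q.tens_lin3 lin_id Q.sw2_closed) (simp_all add: Q_closed tc)
  also have "\<dots> = sw2 k (tpow k Q 3) (\<Delta>\<^sub>A (g h)) (\<lambda>a b. sw2 k (tpow k Q 3) (\<Delta>\<^sub>A b) (\<lambda>b1 b2. tens k Q [f a, f b1, f b2]))"
    using h by (intro A.sw2_cong) (simp_all add: comult_Q_sw[OF M] bilinI Q.tens_lin3 lin_id gf tc)
  also have "\<dots> = T 3 (A.DR (g h))" using h by (simp add: p2 T_tens tc A.sw2_closed cong: A.sw2_cong)
  finally have R: "sw2 k (tpow k Q 3) (\<Delta>\<^sub>Q h) (\<lambda>a b. sw2 k (tpow k Q 3) (\<Delta>\<^sub>Q b) (\<lambda>b1 b2. tens k Q [a, b1, b2]))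
    = T 3 (A.DR (g h))" .
  have "sw2 k (tpow k Q 3) (\<Delta>\<^sub>Q h) (\<lambda>a b. sw2 k (tpow k Q 3) (\<Delta>\<^sub>Q a) (\<lambda>a1 a2. tens k Q [a1, a2, b]))
    = sw2 k (tpow k Q 3) (\<Delta>\<^sub>A (g h)) (\<lambda>a b. sw2 k (tpow k Q 3) (\<Delta>\<^sub>Q (f a)) (\<lambda>a1 a2. tens k Q [a1, a2, f b]))"
    using h by (intro comult_Q_sw M Q_lin bilinI Q.tens_lin3 lin_id Q.sw2_closed) (simp_all add: Q_closed tc)
  also have "\<dots> = sw2 k (tpow k Q 3) (\<Delta>\<^sub>A (g h)) (\<lambda>a b. sw2 k (tpow k Q 3) (\<Delta>\<^sub>A a) (\<lambda>a1 a2. tens k Q [f a1, f a2, f b]))"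
    using h by (intro A.sw2_cong) (simp_all add: comult_Q_sw[OF M] bilinI Q.tens_lin3 lin_id gf tc)
  also have "\<dots> = T 3 (A.DL (g h))" using h by (simp add: p2 T_tens tc A.sw2_closed cong: A.sw2_cong)
  finally have L: "sw2 k (tpow k Q 3) (\<Delta>\<^sub>Q h) (\<lambda>a b. sw2 k (tpow k Q 3) (\<Delta>\<^sub>Q a) (\<lambda>a1 a2. tens k Q [a1, a2, b]))
    = T 3 (A.DL (g h))" .
  interpret TA: unital_algebra k "tpow k A 3" by (rule A.tpow_algebra)
  have "A.DL (g h) \<in> carrier (tpow k A 3)" using h by (intro A.sw2_closed) (simp_all add: tc A.sw2_closed)
  then show "sw2 k (tpow k Q 3) (\<Delta>\<^sub>Q h) (\<lambda>a b. sw2 k (tpow k Q 3) (\<Delta>\<^sub>Q b) (\<lambda>b1 b2. tens k Q [a, b1, b2]))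
      = \<Phi>\<^sub>Q \<otimes>\<^bsub>tpow k Q 3\<^esub> sw2 k (tpow k Q 3) (\<Delta>\<^sub>Q h) (\<lambda>a b. sw2 k (tpow k Q 3) (\<Delta>\<^sub>Q a) (\<lambda>a1 a2. tens k Q [a1, a2, b]))
      \<otimes>\<^bsub>tpow k Q 3\<^esub> reassoc_inv k Q"
    unfolding R L reassoc_Q_inverse reassoc_Q A.quasi_coassoc[OF gh(1)[OF h]] by (simp add: Th tc)
  show "sw2 k Q (\<Delta>\<^sub>Q h) (\<lambda>a b. \<epsilon>\<^sub>Q b \<odot>\<^sub>Q a) = h"
  proof -
    have "sw2 k Q (\<Delta>\<^sub>Q h) (\<lambda>a b. \<epsilon>\<^sub>Q b \<odot>\<^sub>Q a) = sw2 k Q (\<Delta>\<^sub>A (g h)) (\<lambda>a b. \<epsilon>\<^sub>Q (f b) \<odot>\<^sub>Q f a)"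
      using h by (intro comult_Q_sw Q_lin) (simp_all add: Q_closed)
    also have "\<dots> = sw2 k Q (\<Delta>\<^sub>A (g h)) (\<lambda>a b. \<epsilon>\<^sub>A b \<odot>\<^sub>Q f a)"
      using h by (intro A.sw2_cong) (simp_all add: counit_Q gf tc)
    also have "\<dots> = h" using h by (simp add: A.counit_right_sw[OF Q.module_axioms f_lin] tc fg)
    finally show ?thesis .
  qed
  show "sw2 k Q (\<Delta>\<^sub>Q h) (\<lambda>a b. \<epsilon>\<^sub>Q a \<odot>\<^sub>Q b) = h"
  proof -
    have "sw2 k Q (\<Delta>\<^sub>Q h) (\<lambda>a b. \<epsilon>\<^sub>Q a \<odot>\<^sub>Q b) = sw2 k Q (\<Delta>\<^sub>A (g h)) (\<lambda>a b. \<epsilon>\<^sub>Q (f a) \<odot>\<^sub>Q f b)"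
      using h by (intro comult_Q_sw Q_lin) (simp_all add: Q_closed)
    also have "\<dots> = sw2 k Q (\<Delta>\<^sub>A (g h)) (\<lambda>a b. \<epsilon>\<^sub>A a \<odot>\<^sub>Q f b)"
      using h by (intro A.sw2_cong) (simp_all add: counit_Q gf tc)
    also have "\<dots> = h" using h by (simp add: A.counit_left_sw[OF Q.module_axioms f_lin] tc fg)
    finally show ?thesis .
  qed
next
  note M = Q.tpow_module
  have "sw3 k (tpow k Q 2) \<Phi>\<^sub>Q (\<lambda>X1 X2 X3. \<epsilon>\<^sub>Q X2 \<odot>\<^bsub>tpow k Q 2\<^esub> tens k Q [X1, X3])
    = sw3 k (tpow k Q 2) \<Phi>\<^sub>A (\<lambda>X1 X2 X3. \<epsilon>\<^sub>Q (f X2) \<odot>\<^bsub>tpow k Q 2\<^esub> tens k Q [f X1, f X3])"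
    by (intro reassoc_Q_sw M Q_lin Q.tens_lin2 trilinI lin_id module.smult_closed[OF M]) (simp_all add: Q_closed tc)
  also have "\<dots> = sw3 k (tpow k Q 2) \<Phi>\<^sub>A (\<lambda>X1 X2 X3. \<epsilon>\<^sub>A X2 \<odot>\<^bsub>tpow k Q 2\<^esub> tens k Q [f X1, f X3])"
    by (intro A.sw3_cong) (simp_all add: counit_Q gf tc)
  also have "\<dots> = tens k Q [f \<one>\<^sub>A, f \<one>\<^sub>A]"
    by (intro A.counit_reassoc2_sw[where g = "\<lambda>a b. tens k Q [f a, f b]"] M bilinI Q.tens_lin2 f_lin) (simp_all add: tc)
  finally show "sw3 k (tpow k Q 2) \<Phi>\<^sub>Q (\<lambda>X1 X2 X3. \<epsilon>\<^sub>Q X2 \<odot>\<^bsub>tpow k Q 2\<^esub> tens k Q [X1, X3]) = tens k Q [\<one>\<^sub>Q, \<one>\<^sub>Q]"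
    by (simp add: fh)
next
  note M = Q.tpow_module
  note p2 = A.lin_sw2[OF A.tpow_module M T_lin] and p3 = A.lin_sw3[OF A.tpow_module M T_lin]
  note tl = trilinI bilinI Q.tens_lin4 lin_id M
  let ?A = "tpow k A 4" and ?Q = "tpow k Q 4"
  have 1: "sw3 k ?Q \<Phi>\<^sub>Q (\<lambda>X1 X2 X3. tens k Q [\<one>\<^sub>Q, X1, X2, X3]) = T 4 (sw3 k ?A \<Phi>\<^sub>A (\<lambda>X1 X2 X3. tens k A [\<one>\<^sub>A, X1, X2, X3]))"
    by (simp add: reassoc_Q_sw tl p3 T_tens tc fh(5) cong: A.sw3_cong)
  have 2: "sw3 k ?Q \<Phi>\<^sub>Q (\<lambda>X1 X2 X3. tens k Q [X1, X2, X3, \<one>\<^sub>Q]) = T 4 (sw3 k ?A \<Phi>\<^sub>A (\<lambda>X1 X2 X3. tens k A [X1, X2, X3, \<one>\<^sub>A]))"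
    by (simp add: reassoc_Q_sw tl p3 T_tens tc fh(5) cong: A.sw3_cong)
  have m: "sw3 k ?Q \<Phi>\<^sub>Q (\<lambda>X1 X2 X3. sw2 k ?Q (\<Delta>\<^sub>Q (p X1 X2 X3)) (\<lambda>a b. tens k Q (r X1 X2 X3 a b)))
     = T 4 (sw3 k ?A \<Phi>\<^sub>A (\<lambda>X1 X2 X3. sw2 k ?A (\<Delta>\<^sub>A (p' X1 X2 X3)) (\<lambda>a b. tens k A (r' X1 X2 X3 a b))))"
    if tri: "trilin k Q ?Q (\<lambda>X1 X2 X3. sw2 k ?Q (\<Delta>\<^sub>Q (p X1 X2 X3)) (\<lambda>a b. tens k Q (r X1 X2 X3 a b)))"
      and p: "\<And>x y z. \<lbrakk>x \<in> carrier A; y \<in> carrier A; z \<in> carrier A\<rbrakk> \<Longrightarrow> p' x y z \<in> carrier A \<and> p (f x) (f y) (f z) = f (p' x y z)"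
      and b: "\<And>x y z. \<lbrakk>x \<in> carrier A; y \<in> carrier A; z \<in> carrier A\<rbrakk> \<Longrightarrow> bilin k Q ?Q (\<lambda>a b. tens k Q (r (f x) (f y) (f z) a b))"
      and r: "\<And>x y z a b. \<lbrakk>x \<in> carrier A; y \<in> carrier A; z \<in> carrier A; a \<in> carrier A; b \<in> carrier A\<rbrakk> \<Longrightarrow>
      length (r' x y z a b) = 4 \<and> set (r' x y z a b) \<subseteq> carrier A \<and> r (f x) (f y) (f z) (f a) (f b) = map f (r' x y z a b)"
    for p r p' r'
  proof -
    let ?r = "\<lambda>x y z. sw2 k ?A (\<Delta>\<^sub>A (p' x y z)) (\<lambda>a b. tens k A (r' x y z a b))"
    have c: "?r x y z \<in> carrier ?A" if "x \<in> carrier A" "y \<in> carrier A" "z \<in> carrier A" for x y z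
      using that p r by (intro A.sw2_closed) (simp_all add: tc)
    have "sw2 k ?Q (\<Delta>\<^sub>Q (p (f x) (f y) (f z))) (\<lambda>a b. tens k Q (r (f x) (f y) (f z) a b)) = T 4 (?r x y z)"
      if x: "x \<in> carrier A" "y \<in> carrier A" "z \<in> carrier A" for x y z
    proof -
      have px: "p' x y z \<in> carrier A" "p (f x) (f y) (f z) = f (p' x y z)" using p x by simp_all
      have "sw2 k ?Q (\<Delta>\<^sub>Q (p (f x) (f y) (f z))) (\<lambda>a b. tens k Q (r (f x) (f y) (f z) a b))
      = sw2 k ?Q (\<Delta>\<^sub>A (p' x y z)) (\<lambda>a b. tens k Q (r (f x) (f y) (f z) (f a) (f b)))"
        using comult_Q_sw[OF M b[OF x] fh(1)[OF px(1)]] px by (simp add: gf)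
      also have "\<dots> = sw2 k ?Q (\<Delta>\<^sub>A (p' x y z)) (\<lambda>a b. T 4 (tens k A (r' x y z a b)))"
        using px r x by (intro A.sw2_cong) (simp_all add: tc A.tmap_tens[OF Q.unital_algebra_axioms f])
      also have "\<dots> = T 4 (?r x y z)" using px r x by (intro p2[symmetric]) (simp_all add: tc)
      finally show ?thesis .
    qed
    then show ?thesis
      unfolding reassoc_Q_sw[OF M tri] using c by (subst p3) (auto intro!: A.sw3_cong simp: tc)
  qed
  have 3: "sw3 k ?Q \<Phi>\<^sub>Q (\<lambda>X1 X2 X3. sw2 k ?Q (\<Delta>\<^sub>Q X2) (\<lambda>a b. tens k Q [X1, a, b, X3]))
     = T 4 (sw3 k ?A \<Phi>\<^sub>A (\<lambda>X1 X2 X3. sw2 k ?A (\<Delta>\<^sub>A X2) (\<lambda>a b. tens k A [X1, a, b, X3])))"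
    "sw3 k ?Q \<Phi>\<^sub>Q (\<lambda>X1 X2 X3. sw2 k ?Q (\<Delta>\<^sub>Q X3) (\<lambda>a b. tens k Q [X1, X2, a, b]))
     = T 4 (sw3 k ?A \<Phi>\<^sub>A (\<lambda>X1 X2 X3. sw2 k ?A (\<Delta>\<^sub>A X3) (\<lambda>a b. tens k A [X1, X2, a, b])))"
    "sw3 k ?Q \<Phi>\<^sub>Q (\<lambda>X1 X2 X3. sw2 k ?Q (\<Delta>\<^sub>Q X1) (\<lambda>a b. tens k Q [a, b, X2, X3]))
     = T 4 (sw3 k ?A \<Phi>\<^sub>A (\<lambda>X1 X2 X3. sw2 k ?A (\<Delta>\<^sub>A X1) (\<lambda>a b. tens k A [a, b, X2, X3])))"
    by (rule m; (intro Q_lin tl Q.sw2_closed)?; simp add: Q_closed tc)+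
  interpret T4: unital_algebra k ?A by (rule A.tpow_algebra)
  have c: "sw3 k ?A \<Phi>\<^sub>A (\<lambda>X1 X2 X3. tens k A [\<one>\<^sub>A, X1, X2, X3]) \<in> carrier ?A"
    "sw3 k ?A \<Phi>\<^sub>A (\<lambda>X1 X2 X3. tens k A [X1, X2, X3, \<one>\<^sub>A]) \<in> carrier ?A"
    "sw3 k ?A \<Phi>\<^sub>A (\<lambda>X1 X2 X3. sw2 k ?A (\<Delta>\<^sub>A X2) (\<lambda>a b. tens k A [X1, a, b, X3])) \<in> carrier ?A"
    "sw3 k ?A \<Phi>\<^sub>A (\<lambda>X1 X2 X3. sw2 k ?A (\<Delta>\<^sub>A X3) (\<lambda>a b. tens k A [X1, X2, a, b])) \<in> carrier ?A"
    "sw3 k ?A \<Phi>\<^sub>A (\<lambda>X1 X2 X3. sw2 k ?A (\<Delta>\<^sub>A X1) (\<lambda>a b. tens k A [a, b, X2, X3])) \<in> carrier ?A"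
    by (intro A.sw3_closed A.sw2_closed; simp add: tc)+
  show "sw3 k ?Q \<Phi>\<^sub>Q (\<lambda>X1 X2 X3. tens k Q [\<one>\<^sub>Q, X1, X2, X3])
      \<otimes>\<^sub>?Q sw3 k ?Q \<Phi>\<^sub>Q (\<lambda>X1 X2 X3. sw2 k ?Q (\<Delta>\<^sub>Q X2) (\<lambda>a b. tens k Q [X1, a, b, X3]))
      \<otimes>\<^sub>?Q sw3 k ?Q \<Phi>\<^sub>Q (\<lambda>X1 X2 X3. tens k Q [X1, X2, X3, \<one>\<^sub>Q])
      = sw3 k ?Q \<Phi>\<^sub>Q (\<lambda>X1 X2 X3. sw2 k ?Q (\<Delta>\<^sub>Q X3) (\<lambda>a b. tens k Q [X1, X2, a, b]))
      \<otimes>\<^sub>?Q sw3 k ?Q \<Phi>\<^sub>Q (\<lambda>X1 X2 X3. sw2 k ?Q (\<Delta>\<^sub>Q X1) (\<lambda>a b. tens k Q [a, b, X2, X3]))"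
    unfolding 1 2 3 using arg_cong[OF A.pentagon, of "T 4"] c by (simp add: Th T4.A.m_closed)
qed

lemma quasi_hopf_Q: "quasi_hopf_algebra k Q"
proof (intro quasi_hopf_algebra.intro quasi_bialgebra_Q quasi_hopf_algebra_axioms.intro)
  note M = Q.module_axioms
  note ql = Q_lin lin_comp[OF antipode_Q_lin]
  note fl = A.lin_sw2[OF A.module_axioms M f_lin] A.lin_sw3[OF A.module_axioms M f_lin]
  note s = antipode_Q alpha_Q beta_Q gf tc
  show "\<S>\<^sub>Q \<in> carrier Q \<rightarrow> carrier Q" by (simp add: Q_closed)
  show "\<S>\<^sub>Q (x \<oplus>\<^sub>Q y) = \<S>\<^sub>Q x \<oplus>\<^sub>Q \<S>\<^sub>Q y" "\<S>\<^sub>Q (x \<otimes>\<^sub>Q y) = \<S>\<^sub>Q y \<otimes>\<^sub>Q \<S>\<^sub>Q x"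
    if "x \<in> carrier Q" "y \<in> carrier Q" for x y
    using that by (simp_all add: antipode_Q gh fh A.antipode_add A.antipode_mult A.antipode_in)
  show "\<S>\<^sub>Q (r \<odot>\<^sub>Q x) = r \<odot>\<^sub>Q \<S>\<^sub>Q x" if "r \<in> carrier k" "x \<in> carrier Q" for r x
    using that by (simp add: lin_smult[OF antipode_Q_lin])
  show "\<S>\<^sub>Q \<one>\<^sub>Q = \<one>\<^sub>Q" "\<alpha>\<^sub>Q \<in> carrier Q" "\<beta>\<^sub>Q \<in> carrier Q"
    by (simp_all add: antipode_Q gh(5) A.antipode_one fh(5) Q_closed)
  fix h assume h: "h \<in> carrier Q"
  have "sw2 k Q (\<Delta>\<^sub>Q h) (\<lambda>h1 h2. \<S>\<^sub>Q h1 \<otimes>\<^sub>Q \<alpha>\<^sub>Q \<otimes>\<^sub>Q h2)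
      = sw2 k Q (\<Delta>\<^sub>A (g h)) (\<lambda>h1 h2. \<S>\<^sub>Q (f h1) \<otimes>\<^sub>Q \<alpha>\<^sub>Q \<otimes>\<^sub>Q f h2)"
    using h by (intro comult_Q_sw ql) (simp_all add: Q_closed)
  also have "\<dots> = f (sw2 k A (\<Delta>\<^sub>A (g h)) (\<lambda>h1 h2. \<S>\<^sub>A h1 \<otimes>\<^sub>A \<alpha>\<^sub>A \<otimes>\<^sub>A h2))"
    using h by (simp add: fl s fh cong: A.sw2_cong)
  finally show "sw2 k Q (\<Delta>\<^sub>Q h) (\<lambda>h1 h2. \<S>\<^sub>Q h1 \<otimes>\<^sub>Q \<alpha>\<^sub>Q \<otimes>\<^sub>Q h2) = \<epsilon>\<^sub>Q h \<odot>\<^sub>Q \<alpha>\<^sub>Q"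
    using h by (simp add: A.antipode_alpha counit_Q s fh)
  have "sw2 k Q (\<Delta>\<^sub>Q h) (\<lambda>h1 h2. h1 \<otimes>\<^sub>Q \<beta>\<^sub>Q \<otimes>\<^sub>Q \<S>\<^sub>Q h2)
      = sw2 k Q (\<Delta>\<^sub>A (g h)) (\<lambda>h1 h2. f h1 \<otimes>\<^sub>Q \<beta>\<^sub>Q \<otimes>\<^sub>Q \<S>\<^sub>Q (f h2))"
    using h by (intro comult_Q_sw ql) (simp_all add: Q_closed)
  also have "\<dots> = f (sw2 k A (\<Delta>\<^sub>A (g h)) (\<lambda>h1 h2. h1 \<otimes>\<^sub>A \<beta>\<^sub>A \<otimes>\<^sub>A \<S>\<^sub>A h2))"
    using h by (simp add: fl s fh cong: A.sw2_cong)
  finally show "sw2 k Q (\<Delta>\<^sub>Q h) (\<lambda>h1 h2. h1 \<otimes>\<^sub>Q \<beta>\<^sub>Q \<otimes>\<^sub>Q \<S>\<^sub>Q h2) = \<epsilon>\<^sub>Q h \<odot>\<^sub>Q \<beta>\<^sub>Q"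
    using h by (simp add: A.antipode_beta counit_Q s fh)
next
  note M = Q.module_axioms
  note ql = Q_lin lin_comp[OF antipode_Q_lin]
  note fl = A.lin_sw2[OF A.module_axioms M f_lin] A.lin_sw3[OF A.module_axioms M f_lin]
  note s = antipode_Q alpha_Q beta_Q gf tc
  have "sw3 k Q \<Phi>\<^sub>Q (\<lambda>X1 X2 X3. X1 \<otimes>\<^sub>Q \<beta>\<^sub>Q \<otimes>\<^sub>Q \<S>\<^sub>Q X2 \<otimes>\<^sub>Q \<alpha>\<^sub>Q \<otimes>\<^sub>Q X3)
      = sw3 k Q \<Phi>\<^sub>A (\<lambda>X1 X2 X3. f X1 \<otimes>\<^sub>Q \<beta>\<^sub>Q \<otimes>\<^sub>Q \<S>\<^sub>Q (f X2) \<otimes>\<^sub>Q \<alpha>\<^sub>Q \<otimes>\<^sub>Q f X3)"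
    by (intro reassoc_Q_sw ql) (simp_all add: Q_closed)
  also have "\<dots> = f (sw3 k A \<Phi>\<^sub>A (\<lambda>X1 X2 X3. X1 \<otimes>\<^sub>A \<beta>\<^sub>A \<otimes>\<^sub>A \<S>\<^sub>A X2 \<otimes>\<^sub>A \<alpha>\<^sub>A \<otimes>\<^sub>A X3))"
    by (simp add: fl s fh cong: A.sw3_cong)
  finally show "sw3 k Q \<Phi>\<^sub>Q (\<lambda>X1 X2 X3. X1 \<otimes>\<^sub>Q \<beta>\<^sub>Q \<otimes>\<^sub>Q \<S>\<^sub>Q X2 \<otimes>\<^sub>Q \<alpha>\<^sub>Q \<otimes>\<^sub>Q X3) = \<one>\<^sub>Q"
    by (simp add: A.antipode_reassoc fh(5))
  have "sw3 k Q (reassoc_inv k Q) (\<lambda>x1 x2 x3. \<S>\<^sub>Q x1 \<otimes>\<^sub>Q \<alpha>\<^sub>Q \<otimes>\<^sub>Q x2 \<otimes>\<^sub>Q \<beta>\<^sub>Q \<otimes>\<^sub>Q \<S>\<^sub>Q x3)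
      = sw3 k Q (reassoc_inv k A) (\<lambda>x1 x2 x3. \<S>\<^sub>Q (f x1) \<otimes>\<^sub>Q \<alpha>\<^sub>Q \<otimes>\<^sub>Q f x2 \<otimes>\<^sub>Q \<beta>\<^sub>Q \<otimes>\<^sub>Q \<S>\<^sub>Q (f x3))"
    unfolding reassoc_Q_inverse by (intro T_sw M ql) (simp_all add: Q_closed tc)
  also have "\<dots> = f (sw3 k A (reassoc_inv k A) (\<lambda>x1 x2 x3. \<S>\<^sub>A x1 \<otimes>\<^sub>A \<alpha>\<^sub>A \<otimes>\<^sub>A x2 \<otimes>\<^sub>A \<beta>\<^sub>A \<otimes>\<^sub>A \<S>\<^sub>A x3))"
    by (simp add: fl s fh cong: A.sw3_cong)
  finally show "sw3 k Q (reassoc_inv k Q) (\<lambda>x1 x2 x3. \<S>\<^sub>Q x1 \<otimes>\<^sub>Q \<alpha>\<^sub>Q \<otimes>\<^sub>Q x2 \<otimes>\<^sub>Q \<beta>\<^sub>Q \<otimes>\<^sub>Q \<S>\<^sub>Q x3) = \<one>\<^sub>Q"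
    by (simp add: A.antipode_reassoc_inv fh(5))
qed

lemma morphism_f: "quasi_hopf_morphism k A Q f"
  unfolding quasi_hopf_morphism_def
  by (simp add: f comult_Q counit_Q antipode_Q reassoc_Q alpha_Q beta_Q fh(1) gf)

end

lemmas (in field) k_field_Units = field_Units

section \<open>Identification of the algebra of rank two\<close>

text \<open>
  A quasi-Hopf structure on the given algebra \<open>P\<close>; the algebra operations are copied from \<open>P\<close>, so that
  truncation to an algebra gives back \<open>P\<close> itself, as \<open>quasi_hopf_extension\<close> demands.
\<close>

definition transported ::
  "('k, 'm) ring_scheme \<Rightarrow> ('k, 'a, 'y) quasi_hopf_scheme \<Rightarrow> ('k, 'q) module \<Rightarrow> ('a \<Rightarrow> 'q) \<Rightarrow> ('k, 'q) quasi_hopf"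
  where "transported k A P f = (let g = inv_into (carrier A) f in \<lparr>
    carrier = carrier P, mult = mult P, one = one P, zero = zero P, add = add P, smult = smult P,
    comult = (\<lambda>q. tmap k P 2 f (comult A (g q))), counit = (\<lambda>q. counit A (g q)), reassoc = tmap k P 3 f (reassoc A),
    antipode = (\<lambda>q. f (antipode A (g q))), alpha = f (alpha A), beta = f (beta A)\<rparr>)"

lemma transported_sel:
  "carrier (transported k A P f) = carrier P" "mult (transported k A P f) = mult P"
  "one (transported k A P f) = one P" "zero (transported k A P f) = zero P"
  "add (transported k A P f) = add P" "smult (transported k A P f) = smult P"
  "comult (transported k A P f) q = tmap k P 2 f (comult A (inv_into (carrier A) f q))"
  "counit (transported k A P f) q = counit A (inv_into (carrier A) f q)"
  "reassoc (transported k A P f) = tmap k P 3 f (reassoc A)"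
  "antipode (transported k A P f) q = f (antipode A (inv_into (carrier A) f q))"
  "alpha (transported k A P f) = f (alpha A)" "beta (transported k A P f) = f (beta A)"
  "module.truncate (transported k A P f) = P"
  by (simp_all add: transported_def Let_def module.defs)

lemma tmap_transported: "tmap k (transported k A P f) n h = tmap k P n h"
proof -
  have t: "formal_tensors k (transported k A P f) m = formal_tensors k P m" for m
    by (simp add: formal_tensors_def list_monoid_def transported_sel)
  have i: "tensor_ideal k (transported k A P f) m = tensor_ideal k P m" for m
    by (simp add: tensor_ideal_def multilinear_rels_def t transported_sel)
  show ?thesis by (simp add: tmap_def[abs_def] tpow_def tens_def t i)
qed

lemma transport_along_isomorphism:
  fixes A :: "('k, 'a, 'y) quasi_hopf_scheme" and P :: "('k, 'q) module"
  assumes A: "quasi_hopf_algebra k A" and P: "unital_algebra k P"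
    and f: "f \<in> alg_hom k A P" and bij: "bij_betw f (carrier A) (carrier P)"
  shows "quasi_hopf_transport k A (transported k A P f) f (inv_into (carrier A) f)"
proof -
  let ?Q = "transported k A P f" and ?g = "inv_into (carrier A) f"
  note s = transported_sel tmap_transported
  have fQ: "f \<in> alg_hom k A ?Q" using f by (simp add: alg_hom_def ring_hom_def s)
  note fh = alg_homD[OF fQ]
  have gf: "?g (f a) = a" if "a \<in> carrier A" for a using that bij by (simp add: bij_betw_def)
  have fg: "f (?g q) = q" "?g q \<in> carrier A" if "q \<in> carrier ?Q" for q
    using that bij by (auto simp: bij_betw_def s f_inv_into_f inv_into_into)
  have ff: "?g q = a" if "a \<in> carrier A" "f a = q" for a q using that gf by blast
  interpret A: quasi_hopf_algebra k A by (rule A)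
  have g: "?g \<in> alg_hom k ?Q A"
    by (rule alg_homI; (rule ff)?) (simp_all add: fg fh)
  have "unital_algebra k ?Q"
    by (rule unital_algebra_image[OF P, where h = "\<lambda>x. x"]) (simp_all add: s)
  then show ?thesis using fQ g gf fg
    by (intro quasi_hopf_transport.intro A quasi_hopf_transport_axioms.intro) (simp_all add: s)
qed

lemma quasi_hopf_morphism_comp:
  assumes "quasi_hopf_hom k H A i" "quasi_hopf_hom k A Q f" and e: "\<And>h. h \<in> carrier H \<Longrightarrow> e h = f (i h)"
    and eh: "e \<in> alg_hom k H Q"
  shows "quasi_hopf_morphism k H Q e"
proof -
  interpret i: quasi_hopf_hom k H A i by fact
  interpret f: quasi_hopf_hom k A Q f by fact
  have "comult Q (e h) = tmap k Q 2 e (comult H h)" if h: "h \<in> carrier H" for h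
  proof -
    have "comult Q (f (i h)) = sw2 k (tpow k Q 2) (comult A (i h)) (\<lambda>a b. tens k Q [f a, f b])"
      using f.morphism h by (simp add: quasi_hopf_morphism_def f.tmap2 i.A.qh_closed i.closed)
    also have "\<dots> = sw2 k (tpow k Q 2) (comult H h) (\<lambda>a b. tens k Q [f (i a), f (i b)])"
      using h by (intro i.comult_sw bilinI f.A.tpow_module f.A.tens_lin2 f.linear) (simp_all add: f.closed)
    also have "\<dots> = tmap k Q 2 e (comult H h)"
      unfolding tmap_def sw2_def using h
      by (intro i.H.tlift_cong_closed_free[OF i.H.comult_closed]) (auto simp: i.H.length_cases e)
    finally show ?thesis by (simp add: e h)
  qed
  moreover have "tmap k Q 3 e (reassoc H) = (reassoc Q)"
  proof -
    have "reassoc Q = sw3 k (tpow k Q 3) (reassoc A) (\<lambda>a b c. tens k Q [f a, f b, f c])"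
      using f.morphism by (simp add: quasi_hopf_morphism_def f.tmap3 i.A.qh_closed)
    also have "\<dots> = sw3 k (tpow k Q 3) (reassoc H) (\<lambda>a b c. tens k Q [f (i a), f (i b), f (i c)])"
      by (intro i.reassoc_sw trilinI f.A.tpow_module f.A.tens_lin3 f.linear) (simp_all add: f.closed)
    also have "\<dots> = tmap k Q 3 e (reassoc H)"
      unfolding tmap_def sw3_def
      by (intro i.H.tlift_cong_closed_free[OF i.H.reassoc_closed]) (auto simp: i.H.length_cases e)
    finally show ?thesis by simp
  qed
  ultimately show ?thesis
    by (simp add: quasi_hopf_morphism_def eh e i.closed i.counit f.counit i.antipode f.antipode
      i.H.qh_closed i.alpha i.beta f.alpha f.beta)
qed

context quasi_hopf_projection
begin

text \<open>
  An algebra isomorphism from \<open>A\<close> to a presented algebra that takes \<open>i\<close> to the canonical map makes the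
  transported structure an extension of \<open>H\<close>: the canonical map is the composite of \<open>i\<close> with the
  isomorphism.
\<close>

lemma extension_of_isomorphism:
  assumes R: "R \<subseteq> carrier (adjoin k H)" and f: "f \<in> alg_hom k A (presented k H R)"
    and bij: "bij_betw f (carrier A) (carrier (presented k H R))"
    and fi: "\<And>h. h \<in> carrier H \<Longrightarrow> f (i h) = presented_emb k H R h"
  defines "Q \<equiv> transported k A (presented k H R) f"
  shows "quasi_hopf_extension k H R Q" "quasi_hopf_hom k A Q f" "quasi_hopf_isomorphic k A Q"
proof -
  interpret Q: quasi_hopf_transport k A Q f "inv_into (carrier A) f"
    unfolding Q_def by (rule transport_along_isomorphism[OF A.quasi_hopf_algebra_axioms H.presented_algebra[OF R] f bij])
  show hom: "quasi_hopf_hom k A Q f"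
    by (intro quasi_hopf_hom.intro quasi_hopf_hom_axioms.intro A.quasi_hopf_algebra_axioms Q.quasi_hopf_Q Q.morphism_f)
  have "inj_on (presented_emb k H R) (carrier H)"
  proof (rule inj_onI)
    fix x y assume xy: "x \<in> carrier H" "y \<in> carrier H" "presented_emb k H R x = presented_emb k H R y"
    then have "f (i x) = f (i y)" by (simp add: fi)
    then have "i x = i y" using bij xy by (simp add: bij_betw_def inj_on_def i.closed)
    then show "x = y" using proj xy by metis
  qed
  moreover have "presented_emb k H R \<in> alg_hom k H Q"
    using H.presented_emb_hom[OF R] by (simp add: alg_hom_def ring_hom_def Q_def transported_sel)
  ultimately show "quasi_hopf_extension k H R Q"
    unfolding quasi_hopf_extension_def
    using quasi_hopf_morphism_comp[OF i.quasi_hopf_hom_axioms hom fi[symmetric]] Q.quasi_hopf_Q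
    by (simp add: Q_def transported_sel)
  show "quasi_hopf_isomorphic k A Q"
    unfolding quasi_hopf_isomorphic_def using Q.morphism_f bij by (auto simp: Q_def transported_sel)
qed

end

context rank_two
begin

lemma \<theta>_direct:
  assumes h: "h1 \<in> carrier H" "h2 \<in> carrier H" and z: "i h1 \<oplus>\<^sub>A \<theta> \<star> i h2 = \<zero>\<^sub>A"
  shows "h1 = \<zero>\<^sub>H \<and> h2 = \<zero>\<^sub>H"
proof
  have "\<pi> (i h1 \<oplus>\<^sub>A \<theta> \<star> i h2) = h1"
    using h by (simp add: lin_add[OF p.linear] p.mult \<pi>_\<theta> proj)
  then show "h1 = \<zero>\<^sub>H" using z lin_zero[OF A.module_axioms H.module_axioms p.linear] by simp
  have "\<kappa> (i h1 \<oplus>\<^sub>A \<theta> \<star> i h2) = h2"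
    using h by (simp add: lin_add[OF \<kappa>_lin] \<kappa>_i \<kappa>_\<theta>_i)
  then show "h2 = \<zero>\<^sub>H" using z lin_zero[OF A.module_axioms H.module_axioms \<kappa>_lin] by simp
qed

text \<open>
  As \<open>d \<noteq> 0\<close>, the coordinates with respect to \<open>1\<close>, \<open>\<gamma>\<close> are obtained from those with respect to \<open>1\<close>, \<open>\<theta>\<close>:
  an element \<open>a\<close> with coordinates \<open>\<pi> a\<close> and \<open>\<kappa> a\<close> equals \<open>i (\<pi> a - h) + \<gamma> i h\<close>, where \<open>d h = \<kappa> a\<close>.
\<close>

lemma H_g:
  assumes c0: "c \<noteq> \<zero>" and char: "\<one> \<oplus> \<one> \<noteq> \<zero>"
  shows "\<exists>Q. is_H_g k H Q \<and> quasi_hopf_isomorphic k A Q"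
proof -
  let ?R = "g_rels k H" and ?P = "adjoin k H" and ?j = "adjoin_emb k H" and ?t = "adjoin_gen k H"
  let ?Pr = "presented k H ?R" and ?e = "presented_emb k H ?R" and ?g = "presented_gen k H ?R"
  interpret P: unital_algebra k ?P by (rule H.adjoin_algebra)
  note jh = alg_homD[OF H.adjoin_emb_hom] and tc = H.adjoin_gen_closed
  have R: "?R \<subseteq> carrier ?P" by (auto simp: g_rels_def Let_def jh tc)
  interpret Q: unital_algebra k ?Pr by (rule H.presented_algebra[OF R])
  note eh = alg_homD[OF H.presented_emb_hom[OF R]] and gc = H.presented_gen_closed[OF R]
  note ph = alg_homD[OF H.pr_hom[OF R]]
  have pm: "H.pr ?R x = H.pr ?R y" if "x \<in> carrier ?P" "y \<in> carrier ?P" "x \<ominus>\<^sub>?P y \<in> ?R" for x y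
  proof -
    have "H.pr ?R x \<ominus>\<^sub>?Pr H.pr ?R y = \<zero>\<^sub>?Pr"
      using P.alg_hom_minus[OF Q.unital_algebra_axioms H.pr_hom[OF R] that(1,2)] H.pr_rel[OF R that(3)] by simp
    moreover have "H.pr ?R x = (H.pr ?R x \<ominus>\<^sub>?Pr H.pr ?R y) \<oplus>\<^sub>?Pr H.pr ?R y"
      using that by (simp add: Q.M.minus_eq Q.M.a_assoc Q.M.l_neg ph(1))
    ultimately show ?thesis using that by (simp add: ph(1))
  qed
  have d0: "d \<noteq> \<zero>"
  proof
    assume "d = \<zero>"
    then have "\<ominus> (\<one> \<oplus> \<one>) = \<zero>" using c_d[OF c0] by simp
    then show False using char H.k_r_neg[of "\<one> \<oplus> \<one>"] by simp
  qed
  have \<gamma>h: "\<gamma> \<star> i h = i h \<oplus>\<^sub>A \<theta> \<star> i (d \<odot>\<^sub>H h)" if "h \<in> carrier H" for h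
    using that by (simp add: \<gamma>_def A.A.l_distr i.smult A.smult_mult_left A.smult_mult_right)
  have di: "inv\<^bsub>k\<^esub> d \<in> carrier k" "d \<otimes> inv\<^bsub>k\<^esub> d = \<one>" using d0 d_cl H.k_field_Units by simp_all
  obtain f where f: "f \<in> alg_hom k A ?Pr" "bij_betw f (carrier A) (carrier ?Pr)"
    "\<And>h. h \<in> carrier H \<Longrightarrow> f (i h) = ?e h" "f \<gamma> = ?g"
  proof (rule H.presented_iso[OF R A.unital_algebra_axioms i.alg_hom \<gamma>_cl])
    fix g r
    assume g: "g \<in> alg_hom k ?P A" "\<And>h. h \<in> carrier H \<Longrightarrow> g (?j h) = i h" "g ?t = \<gamma>" and r: "r \<in> ?R"
    note gm = P.alg_hom_minus[OF A.unital_algebra_axioms g(1)] alg_homD[OF g(1)]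
    show "g r = \<zero>\<^sub>A"
      using r by (auto simp: g_rels_def Let_def gm jh tc g \<gamma>_square[OF c0] \<gamma>_i[OF c0] \<gamma>_cl qc A.M.minus_eq A.M.r_neg)
  next
    fix h assume h: "h \<in> carrier H"
    have "H.pr ?R (?t \<otimes>\<^sub>?P ?j h) = H.pr ?R (?j h \<otimes>\<^sub>?P ?t)"
      using h by (intro pm) (auto simp: jh tc g_rels_def Let_def)
    then show "\<exists>h1\<in>carrier H. \<exists>h2\<in>carrier H. ?e h \<otimes>\<^sub>?Pr ?g
      = ?e h1 \<oplus>\<^sub>?Pr ?g \<otimes>\<^sub>?Pr ?e h2"
      using h eh gc lin_zero[OF H.module_axioms Q.module_axioms alg_hom_lin[OF H.presented_emb_hom[OF R]]]
      by (intro bexI[of _ h] bexI[of _ "\<zero>\<^sub>H"]) (simp_all add: ph jh tc presented_emb_def presented_gen_def)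
  next
    have "H.pr ?R (?t \<otimes>\<^sub>?P ?t) = H.pr ?R \<one>\<^sub>?P" by (intro pm) (auto simp: tc g_rels_def Let_def)
    then have "?g \<otimes>\<^sub>?Pr ?g = \<one>\<^sub>?Pr"
      by (simp add: ph tc presented_gen_def)
    then show "\<exists>h1\<in>carrier H. \<exists>h2\<in>carrier H. ?g \<otimes>\<^sub>?Pr ?g
      = ?e h1 \<oplus>\<^sub>?Pr ?g \<otimes>\<^sub>?Pr ?e h2"
      using gc lin_zero[OF H.module_axioms Q.module_axioms alg_hom_lin[OF H.presented_emb_hom[OF R]]]
      by (intro bexI[of _ "\<one>\<^sub>H"] bexI[of _ "\<zero>\<^sub>H"]) (simp_all add: eh(5))
  next
    fix a assume a: "a \<in> carrier A"
    let ?h = "inv\<^bsub>k\<^esub> d \<odot>\<^sub>H \<kappa> a"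
    have hc: "?h \<in> carrier H" using a di by simp
    have e: "d \<odot>\<^sub>H ?h = \<kappa> a" using a di d_cl by (simp flip: H.smult_assoc1)
    have "i (\<pi> a \<oplus>\<^sub>H \<ominus>\<^sub>H ?h) \<oplus>\<^sub>A \<gamma> \<star> i ?h = i (\<pi> a \<oplus>\<^sub>H \<ominus>\<^sub>H ?h) \<oplus>\<^sub>A i ?h \<oplus>\<^sub>A \<theta> \<star> i (\<kappa> a)"
      using a hc d_cl by (simp add: \<gamma>h e A.M.a_assoc)
    also have "i (\<pi> a \<oplus>\<^sub>H \<ominus>\<^sub>H ?h) \<oplus>\<^sub>A i ?h = i (\<pi> a)"
      using a hc by (simp add: H.M.a_assoc H.M.l_neg flip: lin_add[OF i.linear])
    finally show "\<exists>h1\<in>carrier H. \<exists>h2\<in>carrier H. a = i h1 \<oplus>\<^sub>A \<gamma> \<star> i h2"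
      using decomp[OF a] a hc by (intro bexI[of _ ?h] bexI[of _ "\<pi> a \<oplus>\<^sub>H \<ominus>\<^sub>H ?h"]) simp_all
  next
    fix h1 h2 assume h: "h1 \<in> carrier H" "h2 \<in> carrier H" and z: "i h1 \<oplus>\<^sub>A \<gamma> \<star> i h2 = \<zero>\<^sub>A"
    have "i (h1 \<oplus>\<^sub>H h2) \<oplus>\<^sub>A \<theta> \<star> i (d \<odot>\<^sub>H h2) = \<zero>\<^sub>A"
      using z h d_cl by (simp add: \<gamma>h lin_add[OF i.linear] A.M.a_assoc)
    from \<theta>_direct[OF _ _ this] have e: "h1 \<oplus>\<^sub>H h2 = \<zero>\<^sub>H" "d \<odot>\<^sub>H h2 = \<zero>\<^sub>H" using h d_cl by simp_all
    have "h2 = \<zero>\<^sub>H" by (rule H.smult_cancel[OF d_cl d0 h(2)]) (simp_all add: e)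
    then show "h1 = \<zero>\<^sub>H \<and> h2 = \<zero>\<^sub>H" using e h by simp
  next
    fix f
    assume "f \<in> alg_hom k A ?Pr" "bij_betw f (carrier A) (carrier ?Pr)"
      "\<And>h. h \<in> carrier H \<Longrightarrow> f (i h) = ?e h" "f \<gamma> = ?g"
    then show thesis by (rule that)
  qed
  note E = extension_of_isomorphism[OF R f(1-3)]
  let ?Q = "transported k A ?Pr f"
  interpret f: quasi_hopf_hom k A ?Q f by (rule E(2))
  have "comult ?Q (f \<gamma>) = sw2 k (tpow k ?Q 2) (\<Delta>\<^sub>A \<gamma>) (\<lambda>a b. tens k ?Q [f a, f b])"
    using f.morphism by (simp add: quasi_hopf_morphism_def f.tmap2 \<gamma>_cl)
  also have "\<dots> = tens k ?Q [f \<gamma>, f \<gamma>]"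
    by (intro comult_\<gamma>[OF c0, where f = "\<lambda>a b. tens k ?Q [f a, f b]"] bilinI f.A.tpow_module f.A.tens_lin2 f.linear f.closed)
  finally have "is_H_g k H ?Q"
    using E(1) f.counit[OF \<gamma>_cl] f.antipode[OF \<gamma>_cl]
    by (simp add: is_H_g_def f(4) counit_\<gamma> antipode_\<gamma>[OF c0])
  then show ?thesis using E(3) by blast
qed

text \<open>
  The commutation rule \<open>i_\<theta>\<close> and \<open>\<theta>_nilpotent\<close> are the relations, and the formulas for the
  coproduct and the antipode of \<open>\<theta>\<close> are those required, because \<open>d = 0\<close>.
\<close>

lemma H_theta:
  assumes c0: "c = \<zero>" and char: "\<one> \<oplus> \<one> \<noteq> \<zero>"
  shows "couple k H \<sigma> v" "\<exists>Q. is_H_theta k H \<sigma> v Q \<and> quasi_hopf_isomorphic k A Q"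
proof -
  have "\<Delta> v = sw2 k (tpow k H 2) (\<Delta> v) (\<lambda>a b. tens k H [a, b])"
    by (rule H.lin_eq_sw2[OF H.tpow_module lin_id]) simp
  also have "\<dots> = sw3 k (tpow k H 2) \<Phi> (\<lambda>X1 X2 X3. sw3 k (tpow k H 2) \<phi>i (\<lambda>x1 x2 x3. sw3 k (tpow k H 2) \<phi>i (\<lambda>y1 y2 y3.
      \<sigma> (y1 \<cdot> x3 \<cdot> X2) \<odot>\<^bsub>tpow k H 2\<^esub>
      tens k H [x1 \<cdot> X1 \<cdot> v \<cdot> y2, x2 \<cdot> v \<cdot> X3 \<cdot> y3])))"
    by (intro \<Delta>_v[where f = "\<lambda>a b. tens k H [a, b]"] bilinI H.tpow_module H.tens_lin2 lin_id)
  finally show "couple k H \<sigma> v"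
    by (simp add: couple_def \<sigma>_char v_cl \<sigma>_v[OF c0 char] counit_v v_comm)
  let ?R = "theta_rels k H \<sigma>" and ?P = "adjoin k H" and ?j = "adjoin_emb k H" and ?t = "adjoin_gen k H"
  interpret P: unital_algebra k ?P by (rule H.adjoin_algebra)
  note jh = alg_homD[OF H.adjoin_emb_hom] and tc = H.adjoin_gen_closed
  let ?s = "\<lambda>h. sw2 k ?P (\<Delta> h) (\<lambda>h1 h2. \<sigma> h1 \<odot>\<^sub>?P (?t \<otimes>\<^sub>?P ?j h2))"
  have sc: "?s h \<in> carrier ?P" if "h \<in> carrier H" for h
    using that by (intro H.sw2_closed P.module_axioms) (simp_all add: jh tc)
  have R: "?R \<subseteq> carrier ?P" by (auto simp: theta_rels_def Let_def jh tc sc)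
  let ?Pr = "presented k H ?R" and ?e = "presented_emb k H ?R" and ?g = "presented_gen k H ?R"
  interpret Q: unital_algebra k ?Pr by (rule H.presented_algebra[OF R])
  note eh = alg_homD[OF H.presented_emb_hom[OF R]] and gc = H.presented_gen_closed[OF R]
  note ez = lin_zero[OF H.module_axioms Q.module_axioms alg_hom_lin[OF H.presented_emb_hom[OF R]]]
  note ph = alg_homD[OF H.pr_hom[OF R]]
  obtain f where f: "f \<in> alg_hom k A ?Pr" "bij_betw f (carrier A) (carrier ?Pr)"
    "\<And>h. h \<in> carrier H \<Longrightarrow> f (i h) = ?e h" "f \<theta> = ?g"
  proof (rule H.presented_iso[OF R A.unital_algebra_axioms i.alg_hom \<theta>_closed])
    fix g r
    assume g: "g \<in> alg_hom k ?P A" "\<And>h. h \<in> carrier H \<Longrightarrow> g (?j h) = i h" "g ?t = \<theta>" and r: "r \<in> ?R"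
    note gm = P.alg_hom_minus[OF A.unital_algebra_axioms g(1)] alg_homD[OF g(1)]
    have "g (?s h) = i h \<star> \<theta>" if h: "h \<in> carrier H" for h
    proof -
      have "g (?s h) = sw2 k A (\<Delta> h) (\<lambda>h1 h2. g (\<sigma> h1 \<odot>\<^sub>?P (?t \<otimes>\<^sub>?P ?j h2)))"
        using h by (intro H.lin_sw2[OF P.module_axioms A.module_axioms alg_hom_lin[OF g(1)]]) (simp_all add: jh tc)
      also have "\<dots> = i h \<star> \<theta>"
      unfolding i_\<theta>[OF h] using h by (intro H.sw2_cong) (simp_all add: gm g jh tc)
      finally show ?thesis .
    qed
    then show "g r = \<zero>\<^sub>A"
      using r by (auto simp: theta_rels_def Let_def gm jh tc sc g \<theta>_nilpotent[OF c0 char] qc A.M.minus_eq A.M.r_neg)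
  next
    fix h assume h: "h \<in> carrier H"
    let ?h = "sw2 k H (\<Delta> h) (\<lambda>h1 h2. \<sigma> h1 \<odot>\<^sub>H h2)"
    have hc: "?h \<in> carrier H" using h by (intro H.sw2_closed) simp_all
    have "?j h \<otimes>\<^sub>?P ?t \<ominus>\<^sub>?P ?s h \<in> ?R" using h by (auto simp: theta_rels_def Let_def)
    then have "H.pr ?R (?j h \<otimes>\<^sub>?P ?t \<ominus>\<^sub>?P ?s h) = \<zero>\<^sub>?Pr" by (rule H.pr_rel[OF R])
    then have z: "H.pr ?R (?j h \<otimes>\<^sub>?P ?t) \<ominus>\<^sub>?Pr H.pr ?R (?s h) = \<zero>\<^sub>?Pr"
      using h by (simp add: P.alg_hom_minus[OF Q.unital_algebra_axioms H.pr_hom[OF R]] jh tc sc)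
    have "H.pr ?R (?j h \<otimes>\<^sub>?P ?t) = (H.pr ?R (?j h \<otimes>\<^sub>?P ?t) \<ominus>\<^sub>?Pr H.pr ?R (?s h)) \<oplus>\<^sub>?Pr H.pr ?R (?s h)"
      using h by (simp add: Q.M.minus_eq Q.M.a_assoc Q.M.l_neg ph(1) jh tc sc)
    then have "H.pr ?R (?j h \<otimes>\<^sub>?P ?t) = H.pr ?R (?s h)" unfolding z using h by (simp add: ph(1) sc)
    then have "?e h \<otimes>\<^sub>?Pr ?g = H.pr ?R (?s h)" using h by (simp add: ph jh tc presented_emb_def presented_gen_def)
    also have "\<dots> = sw2 k ?Pr (\<Delta> h) (\<lambda>h1 h2. H.pr ?R (\<sigma> h1 \<odot>\<^sub>?P (?t \<otimes>\<^sub>?P ?j h2)))"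
      using h by (intro H.lin_sw2[OF P.module_axioms Q.module_axioms alg_hom_lin[OF H.pr_hom[OF R]]]) (simp_all add: jh tc)
    also have "\<dots> = sw2 k ?Pr (\<Delta> h) (\<lambda>h1 h2. ?g \<otimes>\<^sub>?Pr ?e (\<sigma> h1 \<odot>\<^sub>H h2))"
      using h by (intro H.sw2_cong) (simp_all add: ph jh tc eh gc Q.smult_mult_right,
      simp_all add: presented_emb_def presented_gen_def)
    also have "\<dots> = ?g \<otimes>\<^sub>?Pr ?e ?h"
      using h by (intro H.lin_sw2[OF H.module_axioms Q.module_axioms, symmetric]
      lin_comp[OF lin_mult(2)[OF Q.unital_algebra_axioms lin_id gc] alg_hom_lin[OF H.presented_emb_hom[OF R]]]) simp_all
    finally show "\<exists>h1\<in>carrier H. \<exists>h2\<in>carrier H. ?e h \<otimes>\<^sub>?Pr ?g = ?e h1 \<oplus>\<^sub>?Pr ?g \<otimes>\<^sub>?Pr ?e h2"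
      using hc eh gc ez by (intro bexI[of _ ?h] bexI[of _ "\<zero>\<^sub>H"]) simp_all
  next
    have "H.pr ?R (?t \<otimes>\<^sub>?P ?t) = \<zero>\<^sub>?Pr" by (rule H.pr_rel[OF R]) (simp add: theta_rels_def Let_def)
    then have "?g \<otimes>\<^sub>?Pr ?g = \<zero>\<^sub>?Pr" by (simp add: ph tc presented_gen_def)
    then show "\<exists>h1\<in>carrier H. \<exists>h2\<in>carrier H. ?g \<otimes>\<^sub>?Pr ?g = ?e h1 \<oplus>\<^sub>?Pr ?g \<otimes>\<^sub>?Pr ?e h2"
      using gc ez by (intro bexI[of _ "\<zero>\<^sub>H"]) simp_all
  next
    fix a assume a: "a \<in> carrier A"
    then show "\<exists>h1\<in>carrier H. \<exists>h2\<in>carrier H. a = i h1 \<oplus>\<^sub>A \<theta> \<star> i h2"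
      using decomp[OF a] by (intro bexI[of _ "\<kappa> a"] bexI[of _ "\<pi> a"]) simp_all
  next
    show "h1 = \<zero>\<^sub>H \<and> h2 = \<zero>\<^sub>H" if "h1 \<in> carrier H" "h2 \<in> carrier H"
      "i h1 \<oplus>\<^sub>A \<theta> \<star> i h2 = \<zero>\<^sub>A" for h1 h2
      using that by (rule \<theta>_direct)
  next
    fix f
    assume "f \<in> alg_hom k A (presented k H ?R)" "bij_betw f (carrier A) (carrier (presented k H ?R))"
      "\<And>h. h \<in> carrier H \<Longrightarrow> f (i h) = presented_emb k H ?R h" "f \<theta> = presented_gen k H ?R"
    then show thesis by (rule that)
  qed
  note E = extension_of_isomorphism[OF R f(1-3)]
  let ?Q = "transported k A ?Pr f"
  interpret f: quasi_hopf_hom k A ?Q f by (rule E(2))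
  let ?T = "tpow k ?Q 2"
  note s = f.mult f.one f.smult f(3,4)
  note M = f.A.tpow_module
  interpret T: module k ?T by (rule M)
  have b: "bilin k A ?T (\<lambda>a b. tens k ?Q [f a, f b])"
    by (intro bilinI f.A.tens_lin2 f.linear f.closed)
  have "comult ?Q (f \<theta>) = sw2 k ?T (\<Delta>\<^sub>A \<theta>) (\<lambda>a b. tens k ?Q [f a, f b])"
    using f.morphism by (simp add: quasi_hopf_morphism_def f.tmap2)
  also have "\<dots> = sw3 k ?T \<Phi> (\<lambda>X1 X2 X3. sw3 k ?T \<phi>i (\<lambda>x1 x2 x3. \<sigma> (X2 \<cdot> x1) \<odot>\<^sub>?T
      tens k ?Q [f (i (X1 \<cdot> v \<cdot> x2)), f (\<theta> \<star> i (X3 \<cdot> x3))]))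
      \<oplus>\<^sub>?T sw3 k ?T \<phi>i (\<lambda>x1 x2 x3. \<sigma> x1 \<odot>\<^sub>?T tens k ?Q [f (\<theta> \<star> i x2), f (i x3)])"
    unfolding comult_\<theta>[OF M trivial_c0[OF c0 char] b]
    by (simp add: d_zero[OF c0 char] H.sw3_closed M f.A.tens_closed f.closed)
  also have "\<dots> = sw3 k ?T \<Phi> (\<lambda>X1 X2 X3. sw3 k ?T \<phi>i (\<lambda>x1 x2 x3. \<sigma> (X2 \<cdot> x1) \<odot>\<^sub>?T
      tens k ?Q [?e (X1 \<cdot> v \<cdot> x2), ?g \<otimes>\<^sub>?Q ?e (X3 \<cdot> x3)]))
      \<oplus>\<^sub>?T sw3 k ?T \<phi>i (\<lambda>x1 x2 x3. \<sigma> x1 \<odot>\<^sub>?T tens k ?Q [?g \<otimes>\<^sub>?Q ?e x2, ?e x3])"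
    by (intro arg_cong2[where f = "add ?T"] H.sw3_cong) (simp_all add: s)
  finally have \<Delta>: "comult ?Q ?g = \<dots>" by (simp add: f(4))
  have "antipode ?Q (f \<theta>) = f (\<S>\<^sub>A \<theta>)" by (rule f.antipode[OF \<theta>_closed])
  also have "\<dots> = \<ominus>\<^sub>?Q sw3 k ?Q \<Phi> (\<lambda>X1 X2 X3. sw3 k ?Q \<phi>i (\<lambda>x1 x2 x3. sw2 k ?Q (\<Delta> x1) (\<lambda>x11 x12.
      f (\<sigma> (X2 \<cdot> x12) \<odot>\<^sub>A (i (\<S> (X1 \<cdot> x11 \<cdot> v) \<cdot> \<alpha>) \<star> \<theta> \<star>
      i (X3 \<cdot> x2 \<cdot> \<beta> \<cdot> \<S> x3))))))"
  proof -
    note M = A.module_axioms f.A.module_axioms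
    have neg: "f (\<ominus>\<^sub>A x) = \<ominus>\<^sub>?Q f x" if "x \<in> carrier A" for x
      using lin_minus[OF M f.linear A.M.zero_closed that] lin_zero[OF M f.linear] that f.closed
      by (simp add: A.M.minus_eq f.A.M.minus_eq)
    show ?thesis unfolding antipode_\<theta>[OF c0 char]
      by (simp add: neg H.lin_sw3[OF M f.linear] H.lin_sw2[OF M f.linear] H.sw3_closed H.sw2_closed M cong: H.sw_cong)
  qed
  also have "\<dots> = \<ominus>\<^sub>?Q sw3 k ?Q \<Phi> (\<lambda>X1 X2 X3. sw3 k ?Q \<phi>i (\<lambda>x1 x2 x3. sw2 k ?Q (\<Delta> x1) (\<lambda>x11 x12.
      \<sigma> (X2 \<cdot> x12) \<odot>\<^sub>?Q (?e (\<S> (X1 \<cdot> x11 \<cdot> v) \<cdot> \<alpha>) \<otimes>\<^sub>?Q ?g \<otimes>\<^sub>?Q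
      ?e (X3 \<cdot> x2 \<cdot> \<beta> \<cdot> \<S> x3)))))"
    by (intro arg_cong[where f = "a_inv ?Q"] H.sw3_cong H.sw2_cong) (simp_all add: s)
  finally have S: "antipode ?Q ?g = \<dots>" by (simp add: f(4))
  have "is_H_theta k H \<sigma> v ?Q"
    unfolding is_H_theta_def Let_def using E(1) f.counit[OF \<theta>_closed] \<Delta> S by (simp add: f(4) counit_\<theta>)
  then show "\<exists>Q. is_H_theta k H \<sigma> v Q \<and> quasi_hopf_isomorphic k A Q" using E(3) by blast
qed

end

theorem proposition2p7:
  fixes k :: "('k, 'm) ring_scheme" (structure)
    and H :: "('k, 'h, 'x) quasi_hopf_scheme"
    and A :: "('k, 'a, 'y) quasi_hopf_scheme"
    and i :: "'h \<Rightarrow> 'a" and \<pi> :: "'a \<Rightarrow> 'h"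
  assumes "field k" and "\<one> \<oplus> \<one> \<noteq> \<zero>"
    and "quasi_hopf_algebra k H"
    and "bij_betw (antipode H) (carrier H) (carrier H)"
    and "quasi_hopf_algebra k A"
    and "quasi_hopf_morphism k H A i"
    and "quasi_hopf_morphism k A H \<pi>"
    and "\<forall>h\<in>carrier H. \<pi> (i h) = h"
    and "free_right_module H A i 2"
  shows "(\<exists>Q. is_H_g k H Q \<and> quasi_hopf_isomorphic k A Q) \<or>
    (\<exists>\<sigma> v. couple k H \<sigma> v \<and>
      (\<exists>Q. is_H_theta k H \<sigma> v Q \<and> quasi_hopf_isomorphic k A Q))"
proof -
  interpret H: quasi_hopf_algebra k H by fact
  interpret A: quasi_hopf_algebra k A by fact
  interpret quasi_hopf_projection k H A i \<pi>
    using assms by unfold_locales auto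
  obtain \<theta> \<phi> where "rank_two k H A i \<pi> \<theta> \<phi>"
    using rank_two_generator[OF assms(9)] rank_two.intro[OF quasi_hopf_projection_axioms rank_two_axioms.intro] by metis
  then interpret rank_two k H A i \<pi> \<theta> \<phi> .
  show ?thesis using H_g[OF _ assms(2)] H_theta[OF _ assms(2)] by blast
qed

end
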